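(* Let $a>0$ and $\gamma>0$ be constants, and consider the dissipative Timoshenko system $$w_{tt}-(w_x-\psi)_x=0,\qquad \psi_{tt}-a^2\psi_{xx}-(w_x-\psi)+\gamma\psi_t=0\qquad(t>0,\ x\in\mathbb{R}),$$ written for $u=(w_x-\psi,\,w_t,\,a\psi_x,\,\psi_t)^T$ as the first-order system $A^0u_t+Au_x+Lu=0$, $u|_{t=0}=u_0$, with $$A^0=I,\qquad A=-\begin{pmatrix}0&1&0&0\\1&0&0&0\\0&0&0&a\\0&0&a&0\end{pmatrix},\qquad L=\begin{pmatrix}0&0&0&1\\0&0&0&0\\0&0&0&0\\-1&0&0&\gamma\end{pmatrix}.$$ (1) For every $a>0$, this system satisfies conditions (A), (S), (S)$_1$ and (K) (spelled out in the context, with $n=1$, $m=4$). Consequently there are constants $C,c>0$ such that $$|\hat u(t,\xi)|\le Ce^{-c\,\eta(\xi)t}|\hat u_0(\xi)|,\qquad \eta(\xi):=\frac{|\xi|^2}{(1+|\xi|^2)^2},$$ for all $t\ge 0$, $\xi\in\mathbb{R}$, and, if $s\ge 0$ is an integer and $u_0\in H^s(\mathbb{R})\cap L^1(\mathbb{R})$, $$\|\partial_x^ku(t)\|_{L^2}\le C(1+t)^{-1/4-k/2}\|u_0\|_{L^1}+C(1+t)^{-\ell/2}\|\partial_x^{k+\ell}u_0\|_{L^2}$$ for all $t\ge 0$ and nonnegative integers $k,\ell$ with $k+\ell\le s$. (2) If $a=1$, this system satisfies conditions (A), (S), (S)$_2$ and (K). Consequently there are constants $C,c>0$ such that $$|\hat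 u(t,\xi)|\le Ce^{-c\,\rho(\xi)t}|\hat u_0(\xi)|,\qquad \rho(\xi):=\frac{|\xi|^2}{1+|\xi|^2},$$ for all $t\ge 0$, $\xi\in\mathbb{R}$, and, if $s\ge 0$ is an integer and $u_0\in H^s(\mathbb{R})\cap L^1(\mathbb{R})$, $$\|\partial_x^ku(t)\|_{L^2}\le C(1+t)^{-1/4-k/2}\|u_0\|_{L^1}+Ce^{-ct}\|\partial_x^ku_0\|_{L^2}$$ for all $t\ge 0$ and nonnegative integers $k\le s$. The constants are independent of $t,\xi,u_0$.
   Context: Notation. $\langle\cdot,\cdot\rangle$ is the standard complex inner product on $\mathbb{C}^m$. For a matrix $X$ and a subspace $V\subset\mathbb{C}^m$, "$X\ge 0$ on $V$" means $\mathrm{Re}\,\langle Xz,z\rangle\ge 0$ for all $z\in V$, and "$X>0$ on $V$" means $\mathrm{Re}\,\langle Xz,z\rangle>0$ for all $0\ne z\in V$. For a real square matrix $X$, $X_1:=(X+X^T)/2$ and $X_2:=(X-X^T)/2$ are its symmetric and skew-symmetric parts. Kernels are taken in $\mathbb{C}^m$. For a system $A^0u_t+\sum_{j=1}^nA^ju_{x_j}+Lu=0$ and $\omega\in S^{n-1}$, $A(\omega):=\sum_{j=1}^nA^j\omega_j$; here $n=1$, $m=4$, $A^1=A$, $S^{0}=\{1,-1\}$, $A(\omega)=\omega A$. $\hat u(t,\xi)$ is the Fourier transform of $u$ in $x$, and $H^s$ is the $L^2$-based Sobolev space. Condition (A): $A^0,A^1,\dots,A^n$ are real symmetric, $A^0>0$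 on $\mathbb{C}^m$, $L$ is real (not necessarily symmetric) with $L\ge 0$ on $\mathbb{C}^m$, and $\mathrm{Ker}(L)\ne\{0\}$. Condition (S): there is a real constant matrix $S$ such that $(SA^0)^T=SA^0$, $(SL)_1+L_1\ge 0$ on $\mathbb{C}^m$, and $\mathrm{Ker}((SL)_1+L_1)=\mathrm{Ker}(L)$. Condition (S)$_1$: for each $\omega\in S^{n-1}$, the matrix $S$ in condition (S) satisfies $i(SA(\omega))_2\ge 0$ on $\mathrm{Ker}(L_1)$. Condition (S)$_2$: for each $\omega\in S^{n-1}$, the matrix $S$ in condition (S) satisfies $i(SA(\omega))_2\ge 0$ on $\mathbb{C}^m$. (Conditions (S) and (S)$_1$, resp. (S) and (S)$_2$, are to hold with the same matrix $S$.) Condition (K): there is a real matrix-valued function $K(\omega)\in C^\infty(S^{n-1})$ such that for each $\omega\in S^{n-1}$: $K(-\omega)=-K(\omega)$, $(K(\omega)A^0)^T=-K(\omega)A^0$, and $(K(\omega)A(\omega))_1>0$ on $\mathrm{Ker}(L)$. *)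

theory Defs
  imports "HOL-Analysis.Analysis"
begin

section \<open>Matrices and the structural conditions\<close>

definition cinner :: "complex^'m \<Rightarrow> complex^'m \<Rightarrow> complex"
  where "cinner x y = (\<Sum>i\<in>UNIV. x $ i * cnj (y $ i))"

definition cmat :: "real^'m^'m \<Rightarrow> complex^'m^'m"
  where "cmat X = map_matrix complex_of_real X"

definition cscale :: "complex \<Rightarrow> complex^'m^'m \<Rightarrow> complex^'m^'m"
  where "cscale c X = (\<chi> i j. c * X $ i $ j)"

definition Ker :: "real^'m^'m \<Rightarrow> (complex^'m) set"
  where "Ker X = {z. cmat X *v z = 0}"

definition nonneg_on :: "complex^'m^'m \<Rightarrow> (complex^'m) set \<Rightarrow> bool"
  where "nonneg_on X V \<longleftrightarrow> (\<forall>z\<in>V. Re (cinner (X *v z) z) \<ge> 0)"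

definition pos_on :: "complex^'m^'m \<Rightarrow> (complex^'m) set \<Rightarrow> bool"
  where "pos_on X V \<longleftrightarrow> (\<forall>z\<in>V. z \<noteq> 0 \<longrightarrow> Re (cinner (X *v z) z) > 0)"

definition sym_part :: "real^'m^'m \<Rightarrow> real^'m^'m"
  where "sym_part X = (1/2) *\<^sub>R (X + transpose X)"

definition skew_part :: "real^'m^'m \<Rightarrow> real^'m^'m"
  where "skew_part X = (1/2) *\<^sub>R (X - transpose X)"

text \<open>The system \<open>A0 u\<^sub>t + (\<Sum>j. A j u\<^bsub>x j\<^esub>) + L u = 0\<close> in space dimension \<open>n = CARD('n)\<close> with
  \<open>m = CARD('m)\<close> unknowns is given by the matrices \<open>A0\<close>, \<open>A j\<close> (\<open>j :: 'n\<close>) and \<open>L\<close>.\<close>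

definition symbol :: "('n::finite \<Rightarrow> real^'m^'m) \<Rightarrow> real^'n \<Rightarrow> real^'m^'m"
  where "symbol A \<omega> = (\<Sum>j\<in>UNIV. (\<omega> $ j) *\<^sub>R A j)"

definition condition_A ::
    "real^'m^'m \<Rightarrow> ('n::finite \<Rightarrow> real^'m^'m) \<Rightarrow> real^'m^'m \<Rightarrow> bool"
  where "condition_A A0 A L \<longleftrightarrow>
    transpose A0 = A0 \<and> (\<forall>j. transpose (A j) = A j) \<and> pos_on (cmat A0) UNIV \<and>
    nonneg_on (cmat L) UNIV \<and> Ker L \<noteq> {0}"

text \<open>The matrix \<open>S\<close> is a parameter of the next three predicates, so that the same \<open>S\<close> can be
  required in several of them.\<close>

definition condition_S :: "real^'m^'m \<Rightarrow> real^'m^'m \<Rightarrow> real^'m^'m \<Rightarrow> bool"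
  where "condition_S A0 L S \<longleftrightarrow>
    transpose (S ** A0) = S ** A0 \<and>
    nonneg_on (cmat (sym_part (S ** L) + sym_part L)) UNIV \<and>
    Ker (sym_part (S ** L) + sym_part L) = Ker L"

definition condition_S1 ::
    "('n::finite \<Rightarrow> real^'m^'m) \<Rightarrow> real^'m^'m \<Rightarrow> real^'m^'m \<Rightarrow> bool"
  where "condition_S1 A L S \<longleftrightarrow>
    (\<forall>\<omega>\<in>sphere 0 1. nonneg_on (cscale \<i> (cmat (skew_part (S ** symbol A \<omega>)))) (Ker (sym_part L)))"

definition condition_S2 :: "('n::finite \<Rightarrow> real^'m^'m) \<Rightarrow> real^'m^'m \<Rightarrow> bool"
  where "condition_S2 A S \<longleftrightarrow>
    (\<forall>\<omega>\<in>sphere 0 1. nonneg_on (cscale \<i> (cmat (skew_part (S ** symbol A \<omega>)))) UNIV)"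

text \<open>\<open>C\<^sup>k\<close> on an open subset of a finite-dimensional space: all iterated directional derivatives
  of order at most \<open>k\<close> exist and are continuous.\<close>

primrec C_k_on ::
    "nat \<Rightarrow> ('a::real_normed_vector \<Rightarrow> 'b::real_normed_vector) \<Rightarrow> 'a set \<Rightarrow> bool"
  where
    "C_k_on 0 f U \<longleftrightarrow> continuous_on U f"
  | "C_k_on (Suc k) f U \<longleftrightarrow> continuous_on U f \<and>
      (\<forall>v. \<exists>g. (\<forall>x\<in>U. ((\<lambda>h. f (x + h *\<^sub>R v)) has_vector_derivative g x) (at 0)) \<and> C_k_on k g U)"

text \<open>Smoothness on the unit sphere, as restriction of a smooth function on a neighbourhood.\<close>

definition smooth_on_sphere :: "(real^'n \<Rightarrow> 'b::real_normed_vector) \<Rightarrow> bool"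
  where "smooth_on_sphere K \<longleftrightarrow>
    (\<exists>U K'. open U \<and> sphere 0 1 \<subseteq> U \<and> (\<forall>k. C_k_on k K' U) \<and> (\<forall>\<omega>\<in>sphere 0 1. K' \<omega> = K \<omega>))"

definition condition_K ::
    "real^'m^'m \<Rightarrow> ('n::finite \<Rightarrow> real^'m^'m) \<Rightarrow> real^'m^'m \<Rightarrow> bool"
  where "condition_K A0 A L \<longleftrightarrow>
    (\<exists>K :: real^'n \<Rightarrow> real^'m^'m. smooth_on_sphere K \<and>
      (\<forall>\<omega>\<in>sphere 0 1.
        K (- \<omega>) = - K \<omega> \<and>
        transpose (K \<omega> ** A0) = - (K \<omega> ** A0) \<and>
        pos_on (cmat (sym_part (K \<omega> ** symbol A \<omega>))) (Ker L)))"

section \<open>Function spaces on the real line\<close>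

text \<open>Elements of \<open>L\<^sup>2\<close> are given by Borel representatives.\<close>

definition L2 :: "(real \<Rightarrow> 'b::euclidean_space) \<Rightarrow> bool"
  where "L2 f \<longleftrightarrow> f \<in> borel_measurable lborel \<and> integrable lborel (\<lambda>x. (norm (f x))\<^sup>2)"

definition L2_norm :: "(real \<Rightarrow> 'b::euclidean_space) \<Rightarrow> real"
  where "L2_norm f = sqrt (LINT x|lborel. (norm (f x))\<^sup>2)"

definition L1_norm :: "(real \<Rightarrow> 'b::euclidean_space) \<Rightarrow> real"
  where "L1_norm f = (LINT x|lborel. norm (f x))"

definition test_function :: "(real \<Rightarrow> real) \<Rightarrow> bool"
  where "test_function \<phi> \<longleftrightarrow>
    (\<forall>k x. (deriv ^^ k) \<phi> field_differentiable (at x)) \<and> (\<exists>R. \<forall>x. \<bar>x\<bar> > R \<longrightarrow> \<phi> x = 0)"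

definition has_L2_weak_deriv ::
    "nat \<Rightarrow> (real \<Rightarrow> 'b::euclidean_space) \<Rightarrow> (real \<Rightarrow> 'b) \<Rightarrow> bool"
  where "has_L2_weak_deriv k f g \<longleftrightarrow> L2 g \<and>
    (\<forall>\<phi>. test_function \<phi> \<longrightarrow>
      (LINT x|lborel. (deriv ^^ k) \<phi> x *\<^sub>R f x) = (-1) ^ k *\<^sub>R (LINT x|lborel. \<phi> x *\<^sub>R g x))"

definition Sobolev :: "nat \<Rightarrow> (real \<Rightarrow> 'b::euclidean_space) \<Rightarrow> bool"
  where "Sobolev s f \<longleftrightarrow> L2 f \<and> (\<forall>k\<le>s. \<exists>g. has_L2_weak_deriv k f g)"

text \<open>Determined up to a null set; meaningful for \<open>f\<close> in \<open>H\<^sup>s\<close> with \<open>k \<le> s\<close>.\<close>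

definition weak_deriv :: "nat \<Rightarrow> (real \<Rightarrow> 'b::euclidean_space) \<Rightarrow> real \<Rightarrow> 'b"
  where "weak_deriv k f = (SOME g. has_L2_weak_deriv k f g)"

definition fourier :: "(real \<Rightarrow> real^'m) \<Rightarrow> real \<Rightarrow> complex^'m"
  where "fourier f \<xi> =
    (\<chi> i. LINT x|lborel. exp (- (\<i> * complex_of_real (x * \<xi>))) * complex_of_real (f x $ i))"

text \<open>The \<open>L\<^sup>2\<close> Fourier transform is the \<open>L\<^sup>2\<close> limit of the transforms of truncations; again it is
  determined up to a null set.\<close>

definition has_fourier_L2 :: "(real \<Rightarrow> real^'m) \<Rightarrow> (real \<Rightarrow> complex^'m) \<Rightarrow> bool"
  where "has_fourier_L2 f F \<longleftrightarrow> L2 f \<and> L2 F \<and>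
    ((\<lambda>R. L2_norm (\<lambda>\<xi>. F \<xi> - fourier (\<lambda>x. indicator {-R..R} x *\<^sub>R f x) \<xi>)) \<longlongrightarrow> 0) at_top"

definition fourier_L2 :: "(real \<Rightarrow> real^'m) \<Rightarrow> real \<Rightarrow> complex^'m"
  where "fourier_L2 f = (SOME F. has_fourier_L2 f F)"

section \<open>Solutions in one space dimension\<close>

text \<open>\<open>u t x\<close> solves \<open>A0 u\<^sub>t + A u\<^sub>x + L u = 0\<close>, \<open>u(0) = u0\<close>: \<open>u\<close> is continuous on \<open>[0,\<infinity>)\<close> with
  values in \<open>L\<^sup>2\<close>, and the equation holds in the sense of distributions in \<open>x\<close> for every
  \<open>t \<ge> 0\<close>.\<close>

definition cauchy_solution ::
    "real^'m^'m \<Rightarrow> real^'m^'m \<Rightarrow> real^'m^'m \<Rightarrow> (real \<Rightarrow> real^'m) \<Rightarrow> (real \<Rightarrow> real \<Rightarrow> real^'m) \<Rightarrow> bool"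
  where "cauchy_solution A0 A L u0 u \<longleftrightarrow>
    L2 u0 \<and> (\<forall>t\<ge>0. L2 (u t)) \<and>
    (\<forall>t\<ge>0. ((\<lambda>s. L2_norm (\<lambda>x. u s x - u t x)) \<longlongrightarrow> 0) (at t within {0..})) \<and>
    (AE x in lborel. u 0 x = u0 x) \<and>
    (\<forall>\<phi>. test_function \<phi> \<longrightarrow> (\<forall>t\<ge>0.
      ((\<lambda>s. LINT x|lborel. \<phi> x *\<^sub>R (A0 *v u s x)) has_vector_derivative
        (LINT x|lborel. deriv \<phi> x *\<^sub>R (A *v u t x)) - (LINT x|lborel. \<phi> x *\<^sub>R (L *v u t x)))
      (at t within {0..})))"

definition classical_solution ::
    "real^'m^'m \<Rightarrow> real^'m^'m \<Rightarrow> real^'m^'m \<Rightarrow> (real \<Rightarrow> real \<Rightarrow> real^'m) \<Rightarrow> bool"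
  where "classical_solution A0 A L u \<longleftrightarrow>
    (\<forall>t>0. \<forall>x. \<exists>ut ux.
      ((\<lambda>s. u s x) has_vector_derivative ut) (at t) \<and>
      ((\<lambda>y. u t y) has_vector_derivative ux) (at x) \<and>
      A0 *v ut + A *v ux + L *v u t x = 0)"

section \<open>The dissipative Timoshenko system\<close>

definition dt :: "(real \<Rightarrow> real \<Rightarrow> real) \<Rightarrow> real \<Rightarrow> real \<Rightarrow> real"
  where "dt f t x = deriv (\<lambda>s. f s x) t"

definition dx :: "(real \<Rightarrow> real \<Rightarrow> real) \<Rightarrow> real \<Rightarrow> real \<Rightarrow> real"
  where "dx f t x = deriv (\<lambda>y. f t y) x"

definition C2_function :: "(real \<Rightarrow> real \<Rightarrow> real) \<Rightarrow> bool"
  where "C2_function f \<longleftrightarrow> C_k_on 2 (\<lambda>(t, x). f t x) ({0<..} \<times> UNIV)"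

definition timoshenko ::
    "real \<Rightarrow> real \<Rightarrow> (real \<Rightarrow> real \<Rightarrow> real) \<Rightarrow> (real \<Rightarrow> real \<Rightarrow> real) \<Rightarrow> bool"
  where "timoshenko a \<gamma> w \<psi> \<longleftrightarrow>
    (\<forall>t>0. \<forall>x.
      dt (dt w) t x - dx (\<lambda>t x. dx w t x - \<psi> t x) t x = 0 \<and>
      dt (dt \<psi>) t x - a\<^sup>2 * dx (dx \<psi>) t x - (dx w t x - \<psi> t x) + \<gamma> * dt \<psi> t x = 0)"

definition timo_u ::
    "real \<Rightarrow> (real \<Rightarrow> real \<Rightarrow> real) \<Rightarrow> (real \<Rightarrow> real \<Rightarrow> real) \<Rightarrow> real \<Rightarrow> real \<Rightarrow> real^4"
  where "timo_u a w \<psi> t x = vector [dx w t x - \<psi> t x, dt w t x, a * dx \<psi> t x, dt \<psi> t x]"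

definition timo_A0 :: "real^4^4"
  where "timo_A0 = mat 1"

definition timo_A :: "real \<Rightarrow> real^4^4"
  where "timo_A a = - vector [vector [0, 1, 0, 0],
                              vector [1, 0, 0, 0],
                              vector [0, 0, 0, a],
                              vector [0, 0, a, 0]]"

definition timo_L :: "real \<Rightarrow> real^4^4"
  where "timo_L \<gamma> = vector [vector [ 0, 0, 0, 1],
                            vector [ 0, 0, 0, 0],
                            vector [ 0, 0, 0, 0],
                            vector [-1, 0, 0, \<gamma>]]"

definition timo_solution ::
    "real \<Rightarrow> real \<Rightarrow> (real \<Rightarrow> real^4) \<Rightarrow> (real \<Rightarrow> real \<Rightarrow> real^4) \<Rightarrow> bool"
  where "timo_solution a \<gamma> u0 u \<longleftrightarrow> cauchy_solution timo_A0 (timo_A a) (timo_L \<gamma>) u0 u"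

section \<open>Decay rates and the pointwise estimate\<close>

definition eta :: "real \<Rightarrow> real"
  where "eta \<xi> = \<bar>\<xi>\<bar>\<^sup>2 / (1 + \<bar>\<xi>\<bar>\<^sup>2)\<^sup>2"

definition rho :: "real \<Rightarrow> real"
  where "rho \<xi> = \<bar>\<xi>\<bar>\<^sup>2 / (1 + \<bar>\<xi>\<bar>\<^sup>2)"

text \<open>\<open>\<bar>\<hat>u(t,\<xi>)\<bar> \<le> C exp(-c r(\<xi>) t) \<bar>\<hat>u0(\<xi>)\<bar>\<close>.  For data that are merely in \<open>L\<^sup>2\<close> both transforms
  are defined almost everywhere only; the inequality is required at every \<open>\<xi>\<close> when they are
  defined pointwise, by absolutely convergent integrals.\<close>

definition pointwise_estimate :: "real \<Rightarrow> real \<Rightarrow> (real \<Rightarrow> real) \<Rightarrow> real \<Rightarrow> real \<Rightarrow> bool"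
  where "pointwise_estimate a \<gamma> r C c \<longleftrightarrow>
    (\<forall>u0 u. timo_solution a \<gamma> u0 u \<longrightarrow> (\<forall>t\<ge>0.
      (AE \<xi> in lborel.
        norm (fourier_L2 (u t) \<xi>) \<le> C * exp (- c * r \<xi> * t) * norm (fourier_L2 u0 \<xi>)) \<and>
      (integrable lborel u0 \<and> integrable lborel (u t) \<longrightarrow>
        (\<forall>\<xi>. norm (fourier (u t) \<xi>) \<le> C * exp (- c * r \<xi> * t) * norm (fourier u0 \<xi>)))))"

end

theory Submission
  imports Defs "HOL-Probability.Probability"
begin

text \<open>In the Fourier variable the system is the ordinary differential equation
  \<open>z' + (i \<xi> A + L) z = 0\<close> for each \<open>\<xi>\<close>. A Hermitian form built from \<open>S\<close> and \<open>K\<close> is equivalent to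
  \<open>\<bar>z\<bar>\<^sup>2\<close> and decays at the rate \<open>\<eta>\<close>, respectively \<open>\<rho>\<close>. A weak solution has no pointwise
  values in \<open>\<xi>\<close>, so Gronwall's inequality is applied to the form integrated over the bounded sets of
  frequencies on which the rate is at least \<open>q\<close> and the decay fails at time \<open>t\<close>: these sets are null.
  For the decay of \<open>u\<close> in \<open>L\<^sup>2\<close>, Plancherel's theorem turns the pointwise bound into an integral
  that is split at \<open>\<bar>\<xi>\<bar> = 1\<close>.\<close>

section \<open>Square-integrable functions\<close>

text \<open>A solution is only an \<open>L2\<close>-continuous curve satisfying the equation against
  test functions, so its transform must first be made differentiable in time. Testing with all
  translates of one \<phi> shows that, at each fixed \<open>y\<close>, the Fourier transform of
  \<open>cnj \<Phi>\<close> times the transformed solution is differentiable, where \<Phi> is the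
  transform of \<phi>. Plancherel in \<open>y\<close> turns this into an \<open>L2\<close>
  difference quotient, and \<Phi> can be divided out only where it is bounded below; hence the
  bounded bands of frequencies. Gronwall then needs a constant rate on the band.

  The corrections have sizes \<open>p = \<theta>\<^sup>2 * \<sigma>\<close> and
  \<open>q = \<theta>^3 * \<sigma> / (1 + \<xi>\<^sup>2)\<close> with one small \<theta>, so that
  what one correction spoils is dominated by the dissipation gained before it. The exception is the
  term with \<open>a\<^sup>2 - 1\<close>, which costs
  \<open>p\<^sup>2 / q = \<theta> * \<sigma> * (1 + \<xi>\<^sup>2)\<close>. The weight
  \<open>\<sigma> = 1 / (1 + \<xi>\<^sup>2)\<close> is always admissible and
  \<open>\<sigma> = 1\<close> is admissible for \<open>a = 1\<close>; the rates are multiples of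
  \<open>\<sigma> * rho\<close>, that is of \<open>eta\<close> and of \<open>rho\<close>.\<close>

lemma L2D:
  assumes "L2 f"
  shows L2_measurable: "f \<in> borel_measurable borel" "f \<in> borel_measurable lborel"
    and L2_integrable: "integrable lborel (\<lambda>x. (norm (f x))\<^sup>2)"
  using assms by (auto simp: L2_def)

lemma L2_bound:
  fixes f :: "real \<Rightarrow> 'b::euclidean_space" and g :: "real \<Rightarrow> 'c::euclidean_space"
  assumes g: "L2 g" and f: "f \<in> borel_measurable borel" and le: "AE x in lborel. norm (f x) \<le> norm (g x)"
  shows "L2 f" "L2_norm f \<le> L2_norm g"
proof -
  have le2: "AE x in lborel. (norm (f x))\<^sup>2 \<le> (norm (g x))\<^sup>2"
    using le by eventually_elim (simp add: power_mono)
  have i: "integrable lborel (\<lambda>x. (norm (f x))\<^sup>2)"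
    using L2_integrable[OF g] by (rule Bochner_Integration.integrable_bound)
      (use f le2 in \<open>auto elim: eventually_mono\<close>)
  show "L2 f" using i f by (simp add: L2_def)
  show "L2_norm f \<le> L2_norm g" unfolding L2_norm_def
    by (intro real_sqrt_le_mono integral_mono_AE i L2_integrable[OF g] le2)
qed

lemma L2_norm_nonneg [simp]: "L2_norm f \<ge> 0"
  by (simp add: L2_norm_def)

lemma L2_norm_sq: "(L2_norm f)\<^sup>2 = (LINT x|lborel. (norm (f x))\<^sup>2)"
  by (simp add: L2_norm_def)

lemma L2_zero [simp]: "L2 (\<lambda>x. 0)" "L2_norm (\<lambda>x. 0) = 0"
  by (simp_all add: L2_def L2_norm_def)

lemma L2_cong_AE:
  assumes f: "f \<in> borel_measurable borel" and g: "g \<in> borel_measurable borel" and eq: "AE x in lborel. f x = g x"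
  shows "L2 f \<longleftrightarrow> L2 g" "L2_norm f = L2_norm g"
proof -
  have e: "AE x in lborel. (norm (f x))\<^sup>2 = (norm (g x))\<^sup>2" using eq by eventually_elim simp
  show "L2 f \<longleftrightarrow> L2 g" unfolding L2_def using f g integrable_cong_AE[OF _ _ e] by simp
  show "L2_norm f = L2_norm g" unfolding L2_norm_def using f g integral_cong_AE[OF _ _ e] by simp
qed

lemma L2_eq_0_AE:
  assumes "L2 f" "L2_norm f = 0" shows "AE x in lborel. f x = 0"
proof -
  have "(LINT x|lborel. (norm (f x))\<^sup>2) = 0" using assms(2) L2_norm_sq[of f] by simp
  then have "AE x in lborel. (norm (f x))\<^sup>2 = 0"
    using integral_nonneg_eq_0_iff_AE[OF L2_integrable[OF assms(1)]] by simp
  then show ?thesis by eventually_elim simp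
qed

lemma L2_add:
  assumes f: "L2 f" and g: "L2 g" shows "L2 (\<lambda>x. f x + g x)"
proof -
  note [measurable] = L2D[OF f] L2D[OF g]
  have le: "(norm (f x + g x))\<^sup>2 \<le> 2 * (norm (f x))\<^sup>2 + 2 * (norm (g x))\<^sup>2" for x
  proof -
    have "(norm (f x + g x))\<^sup>2 \<le> (norm (f x) + norm (g x))\<^sup>2" by (simp add: norm_triangle_ineq power_mono)
    then show ?thesis using sum_squares_bound[of "norm (f x)" "norm (g x)"]
      unfolding power2_sum by simp
  qed
  have "integrable lborel (\<lambda>x. 2 * (norm (f x))\<^sup>2 + 2 * (norm (g x))\<^sup>2)"
    using L2_integrable[OF f] L2_integrable[OF g] by simp
  then have "integrable lborel (\<lambda>x. (norm (f x + g x))\<^sup>2)"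
    by (rule Bochner_Integration.integrable_bound) (use le in auto)
  then show ?thesis by (simp add: L2_def)
qed

lemma L2_scaleR:
  assumes f: "L2 f" shows "L2 (\<lambda>x. c *\<^sub>R f x)" "L2_norm (\<lambda>x. c *\<^sub>R f x) = \<bar>c\<bar> * L2_norm f"
  using f by (auto simp: L2_def L2_norm_def power_mult_distrib real_sqrt_mult)

lemma L2_cmult:
  fixes f :: "real \<Rightarrow> complex"
  assumes f: "L2 f" shows "L2 (\<lambda>x. c * f x)" "L2_norm (\<lambda>x. c * f x) = cmod c * L2_norm f"
  using f by (auto simp: L2_def L2_norm_def norm_mult power_mult_distrib real_sqrt_mult)

lemma L2_uminus:
  assumes f: "L2 f" shows "L2 (\<lambda>x. - f x)" "L2_norm (\<lambda>x. - f x) = L2_norm f"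
  using f by (auto simp: L2_def L2_norm_def)

lemma L2_diff:
  assumes f: "L2 f" and g: "L2 g" shows "L2 (\<lambda>x. f x - g x)"
  using L2_add[OF f L2_uminus(1)[OF g]] by simp

lemma L2_norm_minus_commute: "L2_norm (\<lambda>x. f x - g x) = L2_norm (\<lambda>x. g x - f x)"
  by (simp add: L2_norm_def norm_minus_commute)

lemma L2_sum:
  assumes "\<And>i. i \<in> I \<Longrightarrow> L2 (f i)" shows "L2 (\<lambda>x. \<Sum>i\<in>I. f i x)"
  using assms by (induction I rule: infinite_finite_induct) (auto intro: L2_add)

lemma borel_measurable_cnj [measurable (raw)]:
  fixes f :: "'a \<Rightarrow> complex"
  assumes "f \<in> borel_measurable M" shows "(\<lambda>x. cnj (f x)) \<in> borel_measurable M"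
  using measurable_compose[OF assms borel_measurable_continuous_onI[OF continuous_on_cnj[OF continuous_on_id]]] by simp

lemma L2_norm_cnj [simp]: "L2_norm (\<lambda>x. cnj (f x)) = L2_norm f"
  by (simp add: L2_norm_def)

lemma L2_cnj: "L2 f \<Longrightarrow> L2 (\<lambda>x. cnj (f x))"
  by (auto simp: L2_def intro: borel_measurable_cnj)

lemma L2_reflect:
  fixes f :: "real \<Rightarrow> 'b::euclidean_space"
  assumes "L2 f" shows "L2 (\<lambda>x. f (- x))" "L2_norm (\<lambda>x. f (- x)) = L2_norm f"
proof -
  note [measurable] = L2D(1)[OF assms]
  have "integrable lborel (\<lambda>x. (norm (f (- x)))\<^sup>2)"
    using lborel_integrable_real_affine[OF L2_integrable[OF assms], of "-1" 0] by simp
  then show "L2 (\<lambda>x. f (- x))" by (simp add: L2_def)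
  show "L2_norm (\<lambda>x. f (- x)) = L2_norm f"
    unfolding L2_norm_def using lborel_integral_real_affine[of "-1" "\<lambda>x. (norm (f x))\<^sup>2" 0] by simp
qed

section \<open>Products of square-integrable functions, Cauchy-Schwarz and the triangle
  inequality\<close>

lemma L2_mult_integrable:
  fixes f :: "real \<Rightarrow> 'b::euclidean_space" and g :: "real \<Rightarrow> 'c::euclidean_space"
  assumes f: "L2 f" and g: "L2 g" shows "integrable lborel (\<lambda>x. norm (f x) * norm (g x))"
proof -
  note [measurable] = L2D[OF f] L2D[OF g]
  have le: "norm (f x) * norm (g x) \<le> (norm (f x))\<^sup>2 + (norm (g x))\<^sup>2" for x
    using sum_squares_bound[of "norm (f x)" "norm (g x)"]
      mult_nonneg_nonneg[OF norm_ge_zero[of "f x"] norm_ge_zero[of "g x"]] by linarith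
  have "integrable lborel (\<lambda>x. (norm (f x))\<^sup>2 + (norm (g x))\<^sup>2)"
    using L2_integrable[OF f] L2_integrable[OF g] by simp
  then show ?thesis
    by (rule Bochner_Integration.integrable_bound) (use le in auto)
qed

text \<open>Weighted AM-GM with weights \<open>b / a\<close> and \<open>a / b\<close> integrates to
  \<open>2 * (a * b)\<close> when \<open>a\<close> and \<open>b\<close> are the two norms. Both
  norms are enlarged by \<open>d > 0\<close> so that the weights make sense for vanishing functions
  too; \<open>d\<close> then tends to 0.\<close>

lemma L2_Cauchy_Schwarz:
  fixes f :: "real \<Rightarrow> 'b::euclidean_space" and g :: "real \<Rightarrow> 'c::euclidean_space"
  assumes f: "L2 f" and g: "L2 g"
  shows "(LINT x|lborel. norm (f x) * norm (g x)) \<le> L2_norm f * L2_norm g"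
proof (rule field_le_epsilon)
  fix e :: real assume e: "e > 0"
  define A B C where "A = L2_norm f" and "B = L2_norm g" and "C = (LINT x|lborel. norm (f x) * norm (g x))"
  have key: "C \<le> (A + d) * (B + d)" if d: "d > 0" for d
  proof -
    define a b where "a = A + d" and "b = B + d"
    have ab: "a > 0" "b > 0" "A \<le> a" "B \<le> b" "0 \<le> A" "0 \<le> B"
      using d by (auto simp: a_def b_def A_def B_def intro: add_nonneg_pos)
    have le: "2 * (norm (f x) * norm (g x)) \<le> b / a * (norm (f x))\<^sup>2 + a / b * (norm (g x))\<^sup>2" for x
    proof -
      have "0 \<le> (b * norm (f x) - a * norm (g x))\<^sup>2" by simp
      then show ?thesis using ab by (simp add: field_simps power2_eq_square)
    qed
    have "2 * C \<le> (LINT x|lborel. b / a * (norm (f x))\<^sup>2 + a / b * (norm (g x))\<^sup>2)"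
      unfolding C_def integral_mult_right_zero[symmetric]
      by (intro integral_mono le) (use L2_integrable[OF f] L2_integrable[OF g] L2_mult_integrable[OF f g] in simp_all)
    also have "\<dots> = b / a * A\<^sup>2 + a / b * B\<^sup>2"
      using L2_integrable[OF f] L2_integrable[OF g] by (simp add: A_def B_def L2_norm_sq)
    also have "\<dots> \<le> b / a * a\<^sup>2 + a / b * b\<^sup>2"
      using ab by (intro add_mono mult_left_mono power_mono) auto
    also have "\<dots> = 2 * (a * b)" using ab by (simp add: power2_eq_square)
    finally show ?thesis by (simp add: a_def b_def)
  qed
  have "((\<lambda>d. (A + d) * (B + d)) \<longlongrightarrow> (A + 0) * (B + 0)) (at_right 0)"
    by (intro tendsto_intros)
  then have "C \<le> A * B"
    by (intro tendsto_lowerbound[of "\<lambda>d. (A + d) * (B + d)" _ "at_right 0"])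
       (auto simp: eventually_at_right_less intro!: eventually_mono[OF eventually_at_right_less[of 0] key])
  then show "C \<le> A * B + e" using e by simp
qed

lemma L2_mult_integrable_complex:
  fixes f g :: "real \<Rightarrow> complex"
  assumes f: "L2 f" and g: "L2 g"
  shows "integrable lborel (\<lambda>x. f x * g x)" "integrable lborel (\<lambda>x. f x * cnj (g x))"
    "cmod (LINT x|lborel. f x * g x) \<le> L2_norm f * L2_norm g"
proof -
  note [measurable] = L2D[OF f] L2D[OF g]
  have i: "integrable lborel (\<lambda>x. norm (f x * g x))"
    using L2_mult_integrable[OF f g] by (simp add: norm_mult)
  then show "integrable lborel (\<lambda>x. f x * g x)"
    by (subst integrable_norm_iff[symmetric]) simp_all
  show "integrable lborel (\<lambda>x. f x * cnj (g x))"
    by (subst integrable_norm_iff[symmetric]) (use i in \<open>simp_all add: norm_mult\<close>)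
  have "cmod (LINT x|lborel. f x * g x) \<le> (LINT x|lborel. norm (f x * g x))"
    by (rule integral_norm_bound)
  also have "\<dots> \<le> L2_norm f * L2_norm g"
    using L2_Cauchy_Schwarz[OF f g] by (simp add: norm_mult)
  finally show "cmod (LINT x|lborel. f x * g x) \<le> L2_norm f * L2_norm g" .
qed

lemma L2_norm_triangle:
  assumes f: "L2 f" and g: "L2 g"
  shows "L2_norm (\<lambda>x. f x + g x) \<le> L2_norm f + L2_norm g"
proof (rule power2_le_imp_le)
  note [measurable] = L2D[OF f] L2D[OF g]
  have le: "(norm (f x + g x))\<^sup>2 \<le> (norm (f x))\<^sup>2 + (norm (g x))\<^sup>2 + 2 * (norm (f x) * norm (g x))" for x
    using power_mono[OF norm_triangle_ineq[of "f x" "g x"], of 2] by (simp add: power2_sum)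
  note i = L2_integrable[OF f] L2_integrable[OF g] L2_mult_integrable[OF f g]
  have "(L2_norm (\<lambda>x. f x + g x))\<^sup>2
      \<le> (LINT x|lborel. (norm (f x))\<^sup>2 + (norm (g x))\<^sup>2 + 2 * (norm (f x) * norm (g x)))"
    unfolding L2_norm_sq
    by (intro integral_mono le) (use i L2_integrable[OF L2_add[OF f g]] in simp_all)
  also have "\<dots> = (L2_norm f)\<^sup>2 + (L2_norm g)\<^sup>2 + 2 * (LINT x|lborel. norm (f x) * norm (g x))"
    using i by (simp add: L2_norm_sq)
  also have "\<dots> \<le> (L2_norm f + L2_norm g)\<^sup>2"
    using L2_Cauchy_Schwarz[OF f g] by (simp add: power2_sum)
  finally show "(L2_norm (\<lambda>x. f x + g x))\<^sup>2 \<le> (L2_norm f + L2_norm g)\<^sup>2" .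
qed simp

lemma L2_norm_triangle_diff:
  assumes f: "L2 f" and g: "L2 g" and h: "L2 h"
  shows "L2_norm (\<lambda>x. f x - h x) \<le> L2_norm (\<lambda>x. f x - g x) + L2_norm (\<lambda>x. g x - h x)"
  using L2_norm_triangle[OF L2_diff[OF f g] L2_diff[OF g h]] by simp

lemma L2_norm_diff_le:
  assumes f: "L2 f" and g: "L2 g"
  shows "\<bar>L2_norm f - L2_norm g\<bar> \<le> L2_norm (\<lambda>x. f x - g x)"
  using L2_norm_triangle[OF L2_diff[OF f g] g] L2_norm_triangle[OF L2_diff[OF g f] f]
    L2_norm_minus_commute[of f g] by simp

section \<open>Dominated convergence, Fatou's lemma and completeness in L2\<close>

lemma L2_dominated_convergence:
  fixes f :: "real \<Rightarrow> 'b::euclidean_space" and g :: "real \<Rightarrow> 'c::euclidean_space"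
  assumes g: "L2 g" and f: "f \<in> borel_measurable borel" and fn: "\<And>n::nat. fn n \<in> borel_measurable borel"
    and lim: "AE x in lborel. (\<lambda>n. fn n x) \<longlonglongrightarrow> f x"
    and le: "\<And>n. AE x in lborel. norm (fn n x) \<le> norm (g x)"
  shows "(\<lambda>n. L2_norm (\<lambda>x. fn n x - f x)) \<longlonglongrightarrow> 0"
proof -
  note [measurable] = f fn
  have lef: "AE x in lborel. norm (f x) \<le> norm (g x)"
  proof -
    have "AE x in lborel. \<forall>n. norm (fn n x) \<le> norm (g x)" using le by (simp add: AE_all_countable)
    with lim show ?thesis
    proof eventually_elim
      case (elim x)
      show ?case by (rule Lim_bounded[of "\<lambda>n. norm (fn n x)" _ 0]) (use elim tendsto_norm in auto)
    qed
  qed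
  have "(\<lambda>n. LINT x|lborel. (norm (fn n x - f x))\<^sup>2) \<longlonglongrightarrow> (LINT x|(lborel::real measure). (0::real))"
  proof (rule integral_dominated_convergence[where w="\<lambda>x. 4 * (norm (g x))\<^sup>2"])
    show "integrable lborel (\<lambda>x. 4 * (norm (g x))\<^sup>2)" using L2_integrable[OF g] by simp
    show "AE x in lborel. (\<lambda>n. (norm (fn n x - f x))\<^sup>2) \<longlonglongrightarrow> 0"
      using lim
    proof eventually_elim
      case (elim x)
      have "(\<lambda>n. (norm (fn n x - f x))\<^sup>2) \<longlonglongrightarrow> (norm (f x - f x))\<^sup>2"
        by (intro tendsto_intros elim)
      then show ?case by simp
    qed
    show "AE x in lborel. norm ((norm (fn n x - f x))\<^sup>2) \<le> 4 * (norm (g x))\<^sup>2" for n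
      using le[of n] lef
    proof eventually_elim
      case (elim x)
      have "norm (fn n x - f x) \<le> 2 * norm (g x)" using norm_triangle_ineq4[of "fn n x" "f x"] elim by simp
      from power_mono[OF this, of 2] show ?case by (simp add: power_mult_distrib)
    qed
  qed simp_all
  then have "(\<lambda>n. sqrt (LINT x|lborel. (norm (fn n x - f x))\<^sup>2)) \<longlonglongrightarrow> sqrt 0"
    by (intro tendsto_real_sqrt) simp
  then show ?thesis by (simp add: L2_norm_def)
qed

lemma L2_norm_nn: 
  assumes "L2 f" shows "(\<integral>\<^sup>+x. ennreal ((norm (f x))\<^sup>2) \<partial>lborel) = ennreal ((L2_norm f)\<^sup>2)"
  using nn_integral_eq_integral[OF L2_integrable[OF assms]] by (simp add: L2_norm_sq)

lemma L2_nnI: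
  assumes [measurable]: "f \<in> borel_measurable borel"
    and le: "(\<integral>\<^sup>+x. ennreal ((norm (f x))\<^sup>2) \<partial>lborel) \<le> ennreal (C\<^sup>2)" and C: "C \<ge> 0"
  shows "L2 f" "L2_norm f \<le> C"
proof -
  show L: "L2 f" unfolding L2_def using le
    by (auto intro!: integrableI_bounded simp: order_le_less_trans)
  show "L2_norm f \<le> C"
    by (rule power2_le_imp_le) (use le C in \<open>simp_all add: L2_norm_nn[OF L]\<close>)
qed

lemma L2_Fatou:
  fixes f :: "real \<Rightarrow> 'b::euclidean_space"
  assumes f: "f \<in> borel_measurable borel" and fn: "\<And>n::nat. L2 (fn n)"
    and lim: "AE x in lborel. (\<lambda>n. fn n x) \<longlonglongrightarrow> f x"
    and le: "eventually (\<lambda>n. L2_norm (fn n) \<le> C) sequentially" and C: "C \<ge> 0"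
  shows "L2 f" "L2_norm f \<le> C"
proof -
  note [measurable] = f L2D[OF fn]
  have "(\<integral>\<^sup>+x. ennreal ((norm (f x))\<^sup>2) \<partial>lborel) = (\<integral>\<^sup>+x. liminf (\<lambda>n. ennreal ((norm (fn n x))\<^sup>2)) \<partial>lborel)"
  proof (rule nn_integral_cong_AE, use lim in eventually_elim)
    case (elim x)
    have "(\<lambda>n. ennreal ((norm (fn n x))\<^sup>2)) \<longlonglongrightarrow> ennreal ((norm (f x))\<^sup>2)"
      by (intro tendsto_intros elim)
    from lim_imp_Liminf[OF _ this] show ?case by simp
  qed
  also have "\<dots> \<le> liminf (\<lambda>n. (\<integral>\<^sup>+x. ennreal ((norm (fn n x))\<^sup>2) \<partial>lborel))"
    by (rule nn_integral_liminf) simp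
  also have "\<dots> \<le> ennreal (C\<^sup>2)"
  proof (rule Liminf_le)
    show "\<forall>\<^sub>F n in sequentially. (\<integral>\<^sup>+x. ennreal ((norm (fn n x))\<^sup>2) \<partial>lborel) \<le> ennreal (C\<^sup>2)"
      using le by eventually_elim (simp add: L2_norm_nn[OF fn] ennreal_leI power_mono)
  qed simp
  finally show "L2 f" "L2_norm f \<le> C" using L2_nnI[OF f _ C] by auto
qed

text \<open>The weights \<open>2 ^ n\<close> leave the series of squared increments integrable,
  because \<open>2 ^ n * (1/4) ^ n\<close> is summable. Hence at almost every point the weighted
  squares are bounded, so the increments are dominated by a geometric series of ratio
  \<open>sqrt (1/2)\<close> and telescope to a limit.\<close>

lemma L2_complete_fast:
  fixes f :: "nat \<Rightarrow> real \<Rightarrow> 'b::euclidean_space"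
  assumes f: "\<And>n. L2 (f n)" and fast: "\<And>n. L2_norm (\<lambda>x. f (Suc n) x - f n x) \<le> (1/2) ^ n"
  shows "\<exists>F. F \<in> borel_measurable borel \<and> (AE x in lborel. (\<lambda>n. f n x) \<longlonglongrightarrow> F x)"
proof -
  note [measurable] = L2D[OF f]
  define d where "d n x = f (Suc n) x - f n x" for n x
  have dL: "L2 (d n)" for n unfolding d_def by (intro L2_diff f)
  note [measurable] = L2D[OF dL]
  have "(\<integral>\<^sup>+x. (\<Sum>n. ennreal (2 ^ n * (norm (d n x))\<^sup>2)) \<partial>lborel) = (\<Sum>n. \<integral>\<^sup>+x. ennreal (2 ^ n * (norm (d n x))\<^sup>2) \<partial>lborel)"
    by (rule nn_integral_suminf) simp
  also have "\<dots> = (\<Sum>n. ennreal (2 ^ n * (L2_norm (d n))\<^sup>2))"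
  proof -
    have "(\<integral>\<^sup>+x. ennreal (2 ^ n * (norm (d n x))\<^sup>2) \<partial>lborel) = ennreal (2 ^ n * (L2_norm (d n))\<^sup>2)" for n
      by (simp add: ennreal_mult nn_integral_cmult L2_norm_nn[OF dL])
    then show ?thesis by simp
  qed
  also have "\<dots> \<le> (\<Sum>n. ennreal ((1/2) ^ n))"
  proof (intro suminf_le ennreal_leI)
    fix n
    have "(L2_norm (d n))\<^sup>2 \<le> ((1/2) ^ n)\<^sup>2" unfolding d_def by (intro power_mono fast) simp
    then have "2 ^ n * (L2_norm (d n))\<^sup>2 \<le> 2 ^ n * ((1/2) ^ n)\<^sup>2" by simp
    also have "\<dots> = (1/2) ^ n"
      by (simp add: power2_eq_square power_mult_distrib[symmetric])
    finally show "2 ^ n * (L2_norm (d n))\<^sup>2 \<le> (1/2) ^ n" .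
  qed auto
  also have "\<dots> = ennreal (\<Sum>n. (1/2) ^ n)"
    by (intro suminf_ennreal2 summable_geometric) auto
  also have "\<dots> < \<infinity>" by simp
  finally have "AE x in lborel. (\<Sum>n. ennreal (2 ^ n * (norm (d n x))\<^sup>2)) \<noteq> \<infinity>"
    by (intro nn_integral_PInf_AE) auto
  then have conv: "AE x in lborel. convergent (\<lambda>n. f n x)"
  proof eventually_elim
    case (elim x)
    have "summable (\<lambda>n. 2 ^ n * (norm (d n x))\<^sup>2)"
      using elim by (intro summable_suminf_not_top) auto
    then have "(\<lambda>n. 2 ^ n * (norm (d n x))\<^sup>2) \<longlonglongrightarrow> 0" by (rule summable_LIMSEQ_zero)
    then have "Bseq (\<lambda>n. 2 ^ n * (norm (d n x))\<^sup>2)" by (intro convergent_imp_Bseq convergentI)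
    then obtain K where K: "K > 0" "\<And>n. norm (2 ^ n * (norm (d n x))\<^sup>2) \<le> K" by (auto elim: BseqE)
    have le: "norm (d n x) \<le> sqrt K * (sqrt (1/2)) ^ n" for n
    proof -
      have "(norm (d n x))\<^sup>2 \<le> K * (1/2) ^ n" using K(2)[of n] by (simp add: field_simps)
      then have "sqrt ((norm (d n x))\<^sup>2) \<le> sqrt (K * (1/2) ^ n)" by (rule real_sqrt_le_mono)
      then show ?thesis by (simp add: real_sqrt_mult real_sqrt_power)
    qed
    have "summable (\<lambda>n. sqrt K * (sqrt (1/2)) ^ n)"
      by (intro summable_mult summable_geometric) simp
    then have "summable (\<lambda>n. d n x)" by (rule summable_comparison_test'[where N=0]) (use le in auto)
    then have "convergent (\<lambda>n. \<Sum>i<n. d i x)" by (simp add: summable_iff_convergent)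
    moreover have "(\<Sum>i<n. d i x) = f n x - f 0 x" for n
      unfolding d_def by (rule sum_lessThan_telescope)
    ultimately have "convergent (\<lambda>n. (f n x - f 0 x) + f 0 x)"
      by (intro convergent_add convergent_const) simp
    then show ?case by simp
  qed
  show ?thesis
  proof (intro exI conjI)
    show "(\<lambda>x. lim (\<lambda>n. f n x)) \<in> borel_measurable borel" by (rule borel_measurable_lim_metric) simp
    show "AE x in lborel. (\<lambda>n. f n x) \<longlonglongrightarrow> lim (\<lambda>n. f n x)"
      using conv by eventually_elim (simp add: convergent_LIMSEQ_iff)
  qed
qed

text \<open>A rapidly converging subsequence has a pointwise limit; Fatou applied to
  \<open>f m - f (r n)\<close> for growing \<open>n\<close> then bounds the distance of every late
  \<open>f m\<close> from that limit.\<close>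

theorem L2_complete:
  fixes f :: "nat \<Rightarrow> real \<Rightarrow> 'b::euclidean_space"
  assumes f: "\<And>n. L2 (f n)"
    and cauchy: "\<And>e. e > 0 \<Longrightarrow> \<exists>N. \<forall>m\<ge>N. \<forall>n\<ge>N. L2_norm (\<lambda>x. f m x - f n x) < e"
  obtains F where "L2 F" "(\<lambda>n. L2_norm (\<lambda>x. f n x - F x)) \<longlonglongrightarrow> 0"
proof -
  have "\<exists>N. \<forall>k. \<forall>m\<ge>N k. \<forall>n\<ge>N k. L2_norm (\<lambda>x. f m x - f n x) < (1/2) ^ k"
    by (rule choice) (use cauchy in simp)
  then obtain N where N: "\<And>k m n. m \<ge> N k \<Longrightarrow> n \<ge> N k \<Longrightarrow> L2_norm (\<lambda>x. f m x - f n x) < (1/2) ^ k"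
    by blast
  \<comment> \<open>The partial sums put both \<open>r k\<close> and \<open>r (Suc k)\<close> above
    \<open>N k\<close> although \<open>N\<close> need not be monotone; the summand \<open>k\<close>
    makes \<open>r k\<close> tend to infinity.\<close>
  define r where "r k = k + (\<Sum>i\<le>k. N i)" for k
  have "N k \<le> (\<Sum>i\<le>k. N i)" "N k \<le> (\<Sum>i\<le>Suc k. N i)" for k
    by (rule member_le_sum; simp)+
  then have rN: "r k \<ge> N k" "r (Suc k) \<ge> N k" "r k \<ge> k" for k
    unfolding r_def by (auto intro: trans_le_add2 le_SucI)
  have "\<exists>F. F \<in> borel_measurable borel \<and> (AE x in lborel. (\<lambda>n. f (r n) x) \<longlonglongrightarrow> F x)"
    by (rule L2_complete_fast) (use f N rN in \<open>auto intro!: less_imp_le\<close>)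
  then obtain F where Fm [measurable]: "F \<in> borel_measurable borel"
    and lim: "AE x in lborel. (\<lambda>n. f (r n) x) \<longlonglongrightarrow> F x" by blast
  have key: "L2 (\<lambda>x. f m x - F x) \<and> L2_norm (\<lambda>x. f m x - F x) \<le> e"
    if m: "\<forall>p\<ge>M. \<forall>n\<ge>M. L2_norm (\<lambda>x. f p x - f n x) < e" "m \<ge> M" and e: "e > 0" for m M e
  proof -
    note [measurable] = L2D[OF f]
    have lim': "AE x in lborel. (\<lambda>n. f m x - f (r n) x) \<longlonglongrightarrow> f m x - F x"
      using lim by eventually_elim (intro tendsto_intros)
    have ev: "eventually (\<lambda>n. L2_norm (\<lambda>x. f m x - f (r n) x) \<le> e) sequentially"
      using eventually_ge_at_top[of M] by eventually_elim (use m rN(3) in \<open>blast intro: less_imp_le order_trans\<close>)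
    show ?thesis
      using L2_Fatou[OF _ L2_diff[OF f f] lim' ev] e by (simp add: borel_measurable_diff)
  qed
  show ?thesis
  proof
    obtain M where M: "\<forall>p\<ge>M. \<forall>n\<ge>M. L2_norm (\<lambda>x. f p x - f n x) < 1" using cauchy[of 1] by auto
    have "L2 (\<lambda>x. f M x - F x)" using key[OF M] by simp
    from L2_diff[OF f this, of M] have "L2 (\<lambda>x. f M x - (f M x - F x))" .
    then show "L2 F" by simp
    show "(\<lambda>n. L2_norm (\<lambda>x. f n x - F x)) \<longlonglongrightarrow> 0"
    proof (rule LIMSEQ_I)
      fix e :: real assume e: "e > 0"
      obtain M where M: "\<forall>p\<ge>M. \<forall>n\<ge>M. L2_norm (\<lambda>x. f p x - f n x) < e / 2" using cauchy[of "e / 2"] e by auto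
      have "L2_norm (\<lambda>x. f n x - F x) \<le> e / 2" if "n \<ge> M" for n
        using key[OF M that] e by simp
      then show "\<exists>no. \<forall>n\<ge>no. norm (L2_norm (\<lambda>x. f n x - F x) - 0) < e"
        using e by (intro exI[of _ M]) force
    qed
  qed
qed

section \<open>Density of continuous functions with compact support\<close>

definition compact_cont :: "(real \<Rightarrow> 'b::euclidean_space) \<Rightarrow> bool"
  where "compact_cont g \<longleftrightarrow> continuous_on UNIV g \<and> (\<exists>R. \<forall>x. \<bar>x\<bar> > R \<longrightarrow> g x = 0)"

lemma L2_indicator_const:
  "L2 (\<lambda>x. indicator {-R..R} x *\<^sub>R (c::'b::euclidean_space))"
proof -
  have "(norm (indicator {-R..R} x *\<^sub>R c))\<^sup>2 = (norm c)\<^sup>2 * indicator {-R..R} x" for x :: real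
    by (simp add: indicator_def)
  moreover have "integrable lborel (\<lambda>x. (norm c)\<^sup>2 * indicator {-R..R} x :: real)"
    by (cases "R \<ge> 0") auto
  ultimately show ?thesis by (simp add: L2_def)
qed

lemma compact_cont_bounded:
  assumes "compact_cont g"
  obtains B R where "B \<ge> 0" "\<And>x. norm (g x) \<le> B * indicator {-R..R} x"
proof -
  obtain R where R: "\<And>x. \<bar>x\<bar> > R \<Longrightarrow> g x = 0" and c: "continuous_on UNIV g"
    using assms by (auto simp: compact_cont_def)
  have "bounded (g ` {-R..R})"
    by (intro compact_imp_bounded compact_continuous_image continuous_on_subset[OF c]) auto
  then obtain B where B: "B > 0" "\<And>x. \<bar>x\<bar> \<le> R \<Longrightarrow> norm (g x) \<le> B"
    unfolding bounded_pos by (metis abs_le_iff atLeastAtMost_iff imageI minus_le_iff)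
  have "norm (g x) \<le> B * indicator {-R..R} x" for x
    using R[of x] B(2)[of x] by (cases "\<bar>x\<bar> \<le> R") (auto simp: indicator_def)
  with B(1) show ?thesis using that[of B R] by simp
qed

lemma compact_cont_measurable: "compact_cont g \<Longrightarrow> g \<in> borel_measurable borel"
  by (auto simp: compact_cont_def intro: borel_measurable_continuous_onI)

lemma integrable_indicator_interval: "integrable lborel (\<lambda>x::real. B * indicator {-R..R} x :: real)"
  by (cases "R \<ge> 0") auto

lemma compact_cont_integrable:
  assumes "compact_cont g" shows "integrable lborel g"
proof -
  obtain B R where B: "B \<ge> 0" "\<And>x. norm (g x) \<le> B * indicator {-R..R} x"
    using compact_cont_bounded[OF assms] by blast
  show ?thesis
    by (rule Bochner_Integration.integrable_bound[OF integrable_indicator_interval[of B R]])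
       (use B compact_cont_measurable[OF assms] in auto)
qed

lemma compact_cont_L2:
  assumes "compact_cont g" shows "L2 g"
proof -
  obtain B R where B: "B \<ge> 0" "\<And>x. norm (g x) \<le> B * indicator {-R..R} x"
    using compact_cont_bounded[OF assms] by blast
  show ?thesis
    by (rule L2_bound[OF L2_indicator_const[of R B]])
       (use B compact_cont_measurable[OF assms] in \<open>auto simp: mult.commute\<close>)
qed

lemma L2_tendstoD:
  assumes "(\<lambda>n. L2_norm (h n)) \<longlonglongrightarrow> 0" "e > 0" shows "\<exists>n. L2_norm (h n) < e"
  using order_tendstoD(2)[OF assms] by (auto simp: eventually_sequentially)

text \<open>A measurable function is an almost everywhere limit of continuous functions
  \<open>g n\<close>. To obtain a common square-integrable majorant, these are retracted radially
  onto the ball of radius \<open>M\<close> by \<open>cl\<close> and cut off outside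
  \<open>[-R-1, R+1]\<close> by \<kappa>; neither operation disturbs the limit, since
  \<open>f\<close> is bounded by \<open>M\<close> and vanishes beyond \<open>R\<close>.\<close>

lemma L2_dense_compact_cont_bounded:
  fixes f :: "real \<Rightarrow> 'b::euclidean_space"
  assumes f: "f \<in> borel_measurable borel" and M: "\<And>x. norm (f x) \<le> M" "M > 0"
    and R: "\<And>x. \<bar>x\<bar> > R \<Longrightarrow> f x = 0" and e: "e > 0"
  shows "\<exists>g. compact_cont g \<and> L2_norm (\<lambda>x. g x - f x) < e"
proof -
  have "f \<in> borel_measurable lborel"
    using f by (simp only: measurable_lborel2)
  then have "f \<in> borel_measurable lebesgue"
    by (rule measurable_completion)
  then have "f measurable_on UNIV" by (rule lebesgue_measurable_imp_measurable_on) simp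
  then obtain N g where N: "negligible N" and g': "\<forall>n. continuous_on UNIV (g n)"
    and lim': "\<forall>x. x \<notin> N \<longrightarrow> (\<lambda>n. g n x) \<longlonglongrightarrow> f x"
    unfolding measurable_on_def by (elim exE conjE) (rule that; simp)
  note g = g'[rule_format] and lim = lim'[rule_format]
  define cl where "cl z = (M / max M (norm z)) *\<^sub>R z" for z :: 'b
  have cl_cont: "continuous_on UNIV cl" unfolding cl_def
    using M(2) by (intro continuous_intros) (auto simp: max_def)
  have cl_le: "norm (cl z) \<le> M" for z
    using M(2) by (auto simp: cl_def max_def field_simps)
  have cl_id: "cl z = z" if "norm z \<le> M" for z
    using M(2) that by (auto simp: cl_def max_def)
  define \<kappa> where "\<kappa> x = max 0 (min 1 (R + 1 - \<bar>x\<bar>))" for x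
  have \<kappa>: "0 \<le> \<kappa> x" "\<kappa> x \<le> 1" for x by (auto simp: \<kappa>_def)
  define h where "h n x = \<kappa> x *\<^sub>R cl (g n x)" for n x
  have hc: "continuous_on UNIV (h n)" for n unfolding h_def \<kappa>_def
    by (intro continuous_intros continuous_on_compose2[OF cl_cont g]) auto
  have h0: "h n x = 0" if "\<bar>x\<bar> > R + 1" for n x using that by (simp add: h_def \<kappa>_def)
  have "(\<lambda>n. L2_norm (\<lambda>x. h n x - f x)) \<longlonglongrightarrow> 0"
  proof (rule L2_dominated_convergence[OF L2_indicator_const[of "R + 1" M] f])
    show "h n \<in> borel_measurable borel" for n by (intro borel_measurable_continuous_onI hc)
    have "AE x in lborel. x \<notin> N"
      using AE_not_in[OF N[unfolded negligible_iff_null_sets]] unfolding AE_completion_iff .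
    then show "AE x in lborel. (\<lambda>n. h n x) \<longlonglongrightarrow> f x"
    proof eventually_elim
      case (elim x)
      have "(\<lambda>n. \<kappa> x *\<^sub>R cl (g n x)) \<longlonglongrightarrow> \<kappa> x *\<^sub>R cl (f x)"
        by (intro tendsto_intros continuous_on_tendsto_compose[OF cl_cont lim[OF elim]]) auto
      moreover have "\<kappa> x *\<^sub>R cl (f x) = f x"
        using R[of x] cl_id[OF M(1)] by (cases "\<bar>x\<bar> > R") (auto simp: \<kappa>_def cl_def)
      ultimately show ?case by (simp add: h_def)
    qed
    show "AE x in lborel. norm (h n x) \<le> norm (indicator {- (R + 1)..R + 1} x *\<^sub>R M)" for n
    proof (rule AE_I2)
      fix x
      show "norm (h n x) \<le> norm (indicator {- (R + 1)..R + 1} x *\<^sub>R M)"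
      proof (cases "\<bar>x\<bar> > R + 1")
        case True then show ?thesis using h0[OF True, of n] by simp
      next
        case False
        have "norm (h n x) \<le> 1 * M" unfolding h_def norm_scaleR
          by (intro mult_mono cl_le) (use \<kappa> in auto)
        then show ?thesis using False M(2) by (auto simp: indicator_def)
      qed
    qed
  qed
  from L2_tendstoD[OF this e] obtain n where "L2_norm (\<lambda>x. h n x - f x) < e" by blast
  moreover have "compact_cont (h n)" using hc h0 by (auto simp: compact_cont_def)
  ultimately show ?thesis by blast
qed

text \<open>Setting \<open>f\<close> to zero where its norm or its argument is large reduces to the
  bounded case; \<open>f\<close> itself dominates these truncations.\<close>

theorem L2_dense_compact_cont:
  fixes f :: "real \<Rightarrow> 'b::euclidean_space"
  assumes f: "L2 f" and e: "e > 0"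
  shows "\<exists>g. compact_cont g \<and> L2_norm (\<lambda>x. g x - f x) < e"
proof -
  note [measurable] = L2D[OF f]
  define h where "h n x = (if norm (f x) \<le> real (Suc n) \<and> \<bar>x\<bar> \<le> real n then f x else 0)" for n x
  have hm [measurable]: "h n \<in> borel_measurable borel" for n unfolding h_def by measurable
  have "(\<lambda>n. L2_norm (\<lambda>x. h n x - f x)) \<longlonglongrightarrow> 0"
  proof (rule L2_dominated_convergence[OF f])
    show "AE x in lborel. (\<lambda>n. h n x) \<longlonglongrightarrow> f x"
    proof (rule AE_I2, rule tendsto_eventually)
      fix x
      show "\<forall>\<^sub>F n in sequentially. h n x = f x"
        using eventually_ge_at_top[of "nat \<lceil>norm (f x)\<rceil> + nat \<lceil>\<bar>x\<bar>\<rceil>"]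
        by eventually_elim (simp add: h_def, linarith)
    qed
  qed (auto simp: h_def)
  from L2_tendstoD[OF this, of "e/2"] e obtain n where n: "L2_norm (\<lambda>x. h n x - f x) < e / 2" by auto
  have hL: "L2 (h n)" by (rule L2_bound[OF f]) (auto simp: h_def)
  obtain g where g: "compact_cont g" "L2_norm (\<lambda>x. g x - h n x) < e / 2"
  proof -
    have "norm (h n x) \<le> real (Suc n)" "\<bar>x\<bar> > real n \<Longrightarrow> h n x = 0" for x by (auto simp: h_def)
    then show ?thesis
      using L2_dense_compact_cont_bounded[of "h n" "real (Suc n)" "real n" "e / 2"] e that hm by auto
  qed
  have gL: "L2 g" using g(1) by (rule compact_cont_L2)
  have "L2_norm (\<lambda>x. g x - f x) < e"
    using L2_norm_triangle_diff[OF gL hL f] n g(2) by simp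
  with g(1) show ?thesis by blast
qed

lemma borel_measurable_cis [measurable (raw)]:
  fixes f :: "'a \<Rightarrow> real"
  assumes "f \<in> borel_measurable M" shows "(\<lambda>x. cis (f x)) \<in> borel_measurable M"
proof -
  have "cis \<in> borel_measurable borel"
    by (intro borel_measurable_continuous_onI) (simp add: cis_conv_exp[abs_def] continuous_intros)
  from measurable_compose[OF assms this] show ?thesis by simp
qed

section \<open>The Fourier transform\<close>

text \<open>The scalar transform without normalizing factor, so that the constant in Plancherel's
  identity is \<open>sqrt (2 * pi)\<close> throughout. Writing the kernel with \<open>cis\<close>
  makes its modulus 1 by simplification.\<close>

definition ft :: "(real \<Rightarrow> complex) \<Rightarrow> real \<Rightarrow> complex"
  where "ft f \<xi> = (LINT x|lborel. cis (- (x * \<xi>)) * f x)"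

lemma integrable_bounded_mult:
  fixes f k :: "'a \<Rightarrow> complex"
  assumes f: "integrable M f" and [measurable]: "k \<in> borel_measurable M" and k: "\<And>x. cmod (k x) \<le> B"
  shows "integrable M (\<lambda>x. k x * f x)"
proof -
  have B: "B \<ge> 0" using order_trans[OF norm_ge_zero k] .
  have "integrable M (\<lambda>x. B * cmod (f x))" using f by simp
  then show ?thesis
    by (rule Bochner_Integration.integrable_bound)
       (use f k B in \<open>auto simp: norm_mult intro!: mult_right_mono\<close>)
qed

lemma ft_integrable: "integrable lborel f \<Longrightarrow> integrable lborel (\<lambda>x. cis (- (x * c)) * f x)"
  by (rule integrable_bounded_mult[where B=1]) auto

lemma ft_bound: "cmod (ft f \<xi>) \<le> (LINT x|lborel. cmod (f x))"
  unfolding ft_def by (rule order_trans[OF integral_norm_bound]) (simp add: norm_mult)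

lemma ft_continuous:
  assumes f: "integrable lborel f" shows "continuous_on UNIV (ft f)"
proof (rule continuous_at_imp_continuous_on, rule ballI, subst continuous_at_sequentially, intro allI impI)
  fix \<xi> s assume s: "s \<longlonglongrightarrow> (\<xi>::real)"
  show "(ft f \<circ> s) \<longlonglongrightarrow> ft f \<xi>"
    unfolding ft_def comp_def
  proof (rule integral_dominated_convergence[where w="\<lambda>x. cmod (f x)"])
    show "AE x in lborel. (\<lambda>i. cis (- (x * s i)) * f x) \<longlonglongrightarrow> cis (- (x * \<xi>)) * f x"
      unfolding cis_conv_exp by (intro AE_I2 tendsto_intros s)
  qed (use f in \<open>auto simp: norm_mult\<close>)
qed

lemma ft_measurable [measurable]: "integrable lborel f \<Longrightarrow> ft f \<in> borel_measurable borel"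
  by (intro borel_measurable_continuous_onI ft_continuous)

lemma ft_diff:
  assumes "integrable lborel f" "integrable lborel g"
  shows "ft (\<lambda>x. f x - g x) \<xi> = ft f \<xi> - ft g \<xi>"
  using assms unfolding ft_def by (simp add: right_diff_distrib ft_integrable)

lemma ft_cnj: "ft (\<lambda>x. cnj (f x)) \<xi> = cnj (ft f (- \<xi>))"
  unfolding ft_def Bochner_Integration.integral_cnj[symmetric] by (simp add: cis_cnj)

text \<open>A kernel of modulus at most 1 keeps the double integrand below the integrable product of
  \<open>f\<close> and \<open>g\<close>. Every exchange of a Fourier integral with another integral
  rests on this.\<close>

lemma Fubini_bounded_kernel:
  fixes f g :: "real \<Rightarrow> complex" and k :: "real \<Rightarrow> real \<Rightarrow> complex"
  assumes f: "integrable lborel f" and g: "integrable lborel g"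
    and k [measurable]: "(\<lambda>(x, y). k x y) \<in> borel_measurable (borel \<Otimes>\<^sub>M borel)" and kB: "\<And>x y. cmod (k x y) \<le> 1"
  shows "(LINT x|lborel. f x * (LINT y|lborel. k x y * g y)) = (LINT y|lborel. g y * (LINT x|lborel. k x y * f x))"
proof -
  note [measurable] = borel_measurable_integrable[OF f] borel_measurable_integrable[OF g]
  have fm [measurable]: "f \<in> borel_measurable borel" "g \<in> borel_measurable borel"
    using borel_measurable_integrable[OF f] borel_measurable_integrable[OF g] by simp_all
  have i: "integrable (lborel \<Otimes>\<^sub>M lborel) (\<lambda>(x, y). f x * g y)"
  proof (rule lborel_pair.Fubini_integrable)
    show "integrable lborel (\<lambda>x. LINT y|lborel. norm (case (x, y) of (x, y) \<Rightarrow> f x * g y))"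
      using f by (simp add: norm_mult)
  qed (use g in \<open>auto\<close>)
  have "integrable (lborel \<Otimes>\<^sub>M lborel) (\<lambda>z. (case z of (x, y) \<Rightarrow> k x y) * (case z of (x, y) \<Rightarrow> f x * g y))"
    by (rule integrable_bounded_mult[OF i, where B=1]) (use kB in auto)
  then have i2: "integrable (lborel \<Otimes>\<^sub>M lborel) (\<lambda>(x, y). k x y * (f x * g y))"
    by (simp add: case_prod_unfold)
  have "(LINT x|lborel. f x * (LINT y|lborel. k x y * g y)) = (LINT x|lborel. LINT y|lborel. k x y * (f x * g y))"
    by (simp add: ac_simps flip: integral_mult_right_zero)
  also have "\<dots> = (LINT y|lborel. LINT x|lborel. k x y * (f x * g y))"
    using lborel_pair.Fubini_integral[OF i2] by simp
  also have "\<dots> = (LINT y|lborel. g y * (LINT x|lborel. k x y * f x))"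
    by (simp add: ac_simps flip: integral_mult_right_zero)
  finally show ?thesis .
qed

section \<open>Gaussian regularization and Plancherel's identity on the intersection of L1 and
  L2\<close>

lemma ft_multiplication:
  assumes f: "integrable lborel f" and g: "integrable lborel g"
  shows "(LINT x|lborel. f x * ft g x) = (LINT x|lborel. g x * ft f x)"
  unfolding ft_def using Fubini_bounded_kernel[OF f g, of "\<lambda>x y. cis (- (y * x))"]
  by (simp add: mult.commute)

text \<open>This is the characteristic function of the standard normal distribution, rescaled by
  \<open>e\<close>. Up to the factor \<open>2 * pi\<close> the transform is a probability density of
  standard deviation \<open>e\<close>, hence an approximate identity as \<open>e\<close> tends to
  0.\<close>

lemma gauss_ft:
  assumes e: "e > 0"
  shows "integrable lborel (\<lambda>\<xi>. exp (- (e * \<xi>)\<^sup>2 / 2) :: real)"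
    and "ft (\<lambda>\<xi>. complex_of_real (exp (- (e * \<xi>)\<^sup>2 / 2))) z = complex_of_real (2 * pi * normal_density 0 e z)"
proof -
  have eq: "exp (- (e * \<xi>)\<^sup>2 / 2) = sqrt (2 * pi) * std_normal_density (e * \<xi>)" for \<xi>
    by (simp add: std_normal_density_def)
  show "integrable lborel (\<lambda>\<xi>. exp (- (e * \<xi>)\<^sup>2 / 2) :: real)"
    unfolding eq using lborel_integrable_real_affine[of std_normal_density e 0] e by simp
  have ch: "(LINT x|lborel. std_normal_density x *\<^sub>R cis (t * x)) = complex_of_real (exp (- t\<^sup>2 / 2))" for t
  proof -
    have "char std_normal_distribution t = (LINT x|lborel. std_normal_density x *\<^sub>R cis (t * x))"
      unfolding char_def by (subst integral_density) (auto simp: cis_conv_exp)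
    then show ?thesis by (simp add: char_std_normal_distribution)
  qed
  have "ft (\<lambda>\<xi>. complex_of_real (exp (- (e * \<xi>)\<^sup>2 / 2))) z
      = sqrt (2 * pi) * (LINT \<xi>|lborel. std_normal_density (0 + e * \<xi>) *\<^sub>R cis ((- z / e) * (0 + e * \<xi>)))"
    unfolding ft_def eq integral_mult_right_zero[symmetric]
    by (rule Bochner_Integration.integral_cong) (use e in \<open>auto simp: scaleR_conv_of_real mult.commute\<close>)
  also have "(LINT \<xi>|lborel. std_normal_density (0 + e * \<xi>) *\<^sub>R cis ((- z / e) * (0 + e * \<xi>)))
      = (1 / e) *\<^sub>R (LINT x|lborel. std_normal_density x *\<^sub>R cis ((- z / e) * x))"
    using lborel_integral_real_affine[of e "\<lambda>x. std_normal_density x *\<^sub>R cis ((- z / e) * x)" 0] e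
    by simp
  also have "\<dots> = (1 / e) * exp (- (z / e)\<^sup>2 / 2)" unfolding ch by (simp add: scaleR_conv_of_real)
  also have "complex_of_real (sqrt (2 * pi)) * complex_of_real ((1 / e) * exp (- (z / e)\<^sup>2 / 2))
      = complex_of_real (2 * pi * normal_density 0 e z)"
    unfolding of_real_mult[symmetric] of_real_eq_iff
  proof -
    have "sqrt (2 * pi * e\<^sup>2) = sqrt (2 * pi) * e" using e by (simp add: real_sqrt_mult)
    moreover have "2 * pi = sqrt (2 * pi) * sqrt (2 * pi)" by simp
    ultimately show "sqrt (2 * pi) * ((1 / e) * exp (- (z / e)\<^sup>2 / 2)) = 2 * pi * normal_density 0 e z"
      using e by (simp add: normal_density_def power_divide field_simps)
  qed
  finally show "ft (\<lambda>\<xi>. complex_of_real (exp (- (e * \<xi>)\<^sup>2 / 2))) z = complex_of_real (2 * pi * normal_density 0 e z)" .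
qed

text \<open>The integral of the squared modulus of \<open>ft f\<close> need not converge for merely
  integrable \<open>f\<close>. The Gaussian factor makes it absolutely convergent, so one of the two
  transforms in the square can be moved over by the multiplication formula; what remains is a
  convolution with a normal density.\<close>

lemma gauss_Plancherel:
  fixes f :: "real \<Rightarrow> complex"
  assumes f: "integrable lborel f" and e: "e > 0"
  shows "complex_of_real (LINT \<xi>|lborel. exp (- (e * \<xi>)\<^sup>2 / 2) * (cmod (ft f \<xi>))\<^sup>2)
    = 2 * pi * (LINT x|lborel. f x * (LINT y|lborel. normal_density 0 e (x - y) * cnj (f y)))"
proof -
  define g where "g \<xi> = complex_of_real (exp (- (e * \<xi>)\<^sup>2 / 2))" for \<xi>
  have gi: "integrable lborel g" unfolding g_def using gauss_ft(1)[OF e] by simp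
  note [measurable] = borel_measurable_integrable[OF f] borel_measurable_integrable[OF gi] ft_measurable[OF f]
  have gm [measurable]: "g \<in> borel_measurable borel" using borel_measurable_integrable[OF gi] by simp
  have gfi: "integrable lborel (\<lambda>\<xi>. cnj (ft f \<xi>) * g \<xi>)"
    by (rule integrable_bounded_mult[OF gi]) (use ft_bound in \<open>auto intro: ft_measurable[OF f]\<close>)
  have "complex_of_real (LINT \<xi>|lborel. exp (- (e * \<xi>)\<^sup>2 / 2) * (cmod (ft f \<xi>))\<^sup>2)
     = (LINT \<xi>|lborel. (cnj (ft f \<xi>) * g \<xi>) * ft f \<xi>)"
    unfolding integral_complex_of_real[symmetric]
    by (rule Bochner_Integration.integral_cong) (simp_all add: g_def complex_norm_square[symmetric] mult.commute mult.left_commute of_real_power[symmetric] del: of_real_power)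
  also have "\<dots> = (LINT x|lborel. f x * ft (\<lambda>\<xi>. cnj (ft f \<xi>) * g \<xi>) x)"
    by (rule ft_multiplication[OF gfi f])
  also have "\<dots> = (LINT x|lborel. f x * (2 * pi * (LINT y|lborel. normal_density 0 e (x - y) * cnj (f y))))"
  proof (rule Bochner_Integration.integral_cong[OF refl], rule arg_cong[where f="\<lambda>u. f _ * u"])
    fix x
    have "ft (\<lambda>\<xi>. cnj (ft f \<xi>) * g \<xi>) x
        = (LINT \<xi>|lborel. (cis (- (\<xi> * x)) * g \<xi>) * (LINT y|lborel. cis (y * \<xi>) * cnj (f y)))"
    proof -
      have c: "cnj (ft f \<xi>) = (LINT y|lborel. cis (y * \<xi>) * cnj (f y))" for \<xi>
        unfolding ft_def Bochner_Integration.integral_cnj[symmetric] by (simp add: cis_cnj)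
      show ?thesis unfolding c[symmetric] ft_def[of "\<lambda>\<xi>. cnj (ft f \<xi>) * g \<xi>"]
        by (rule Bochner_Integration.integral_cong) (simp_all only: ac_simps)
    qed
    also have "\<dots> = (LINT y|lborel. cnj (f y) * (LINT \<xi>|lborel. cis (y * \<xi>) * (cis (- (\<xi> * x)) * g \<xi>)))"
      by (rule Fubini_bounded_kernel) (use f gi in \<open>auto intro: ft_integrable\<close>)
    also have "\<dots> = (LINT y|lborel. cnj (f y) * ft g (x - y))"
    proof -
      have "cis (y * \<xi>) * (cis (- (\<xi> * x)) * g \<xi>) = cis (- (\<xi> * (x - y))) * g \<xi>" for y \<xi>
      proof -
        have "cis (y * \<xi>) * cis (- (\<xi> * x)) = cis (- (\<xi> * (x - y)))"
          unfolding cis_mult by (rule arg_cong[where f=cis]) (simp add: algebra_simps)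
        then show ?thesis by (metis mult.assoc)
      qed
      then show ?thesis unfolding ft_def by (simp only:)
    qed
    also have "\<dots> = (LINT y|lborel. 2 * pi * (normal_density 0 e (x - y) * cnj (f y)))"
      unfolding g_def gauss_ft(2)[OF e] by (simp add: mult.commute mult.left_commute)
    finally show "ft (\<lambda>\<xi>. cnj (ft f \<xi>) * g \<xi>) x = 2 * pi * (LINT y|lborel. normal_density 0 e (x - y) * cnj (f y))"
      by simp
  qed
  also have "\<dots> = 2 * pi * (LINT x|lborel. f x * (LINT y|lborel. normal_density 0 e (x - y) * cnj (f y)))"
    by (subst mult.left_commute) (rule integral_mult_right_zero)
  finally show ?thesis .
qed

lemma nn_integral_normal_density:
  assumes "e > 0" shows "(\<integral>\<^sup>+x. ennreal (normal_density m e x) \<partial>lborel) = 1"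
  using nn_integral_eq_integral[OF integrable_normal_density[OF assms], of m] assms by simp

lemma normal_density_shift: "normal_density 0 e (x - y) = normal_density x e y" "normal_density 0 e (x - y) = normal_density y e x"
  by (simp_all add: normal_density_def power2_commute)

lemma norm_integral_le_nn: "ennreal (norm (integral\<^sup>L M f)) \<le> (\<integral>\<^sup>+x. ennreal (norm (f x)) \<partial>M)"
  by (cases "integrable M f") (auto simp: integral_norm_bound_ennreal not_integrable_integral_eq)

text \<open>Schur's test: the product of two moduli is at most the mean of their squares, and the
  kernel has mass 1 in either variable. Nonnegative integrals are used so that the order of
  integration is free. The bound is uniform in \<open>e\<close>.\<close>

lemma normal_density_form_bound:
  fixes f :: "real \<Rightarrow> complex"
  assumes f: "L2 f" and e: "e > 0"
  shows "cmod (LINT x|lborel. f x * (LINT y|lborel. normal_density 0 e (x - y) * cnj (f y))) \<le> (L2_norm f)\<^sup>2"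
proof -
  note [measurable] = L2D(1)[OF f]
  define a where "a x = ennreal ((cmod (f x))\<^sup>2 / 2)" for x
  define k where "k x y = ennreal (normal_density 0 e (x - y))" for x y
  have [measurable]: "a \<in> borel_measurable borel" "(\<lambda>(x, y). k x y) \<in> borel_measurable (borel \<Otimes>\<^sub>M borel)"
    unfolding a_def k_def by measurable
  have split: "ennreal (p * q + r * q) = ennreal p * ennreal q + ennreal r * ennreal q"
    if "p \<ge> 0" "q \<ge> 0" "r \<ge> 0" for p q r
    using that by (simp add: ennreal_mult)
  have "ennreal (cmod (LINT x|lborel. f x * (LINT y|lborel. normal_density 0 e (x - y) * cnj (f y))))
      \<le> (\<integral>\<^sup>+x. ennreal (cmod (f x)) * ennreal (cmod (LINT y|lborel. normal_density 0 e (x - y) * cnj (f y))) \<partial>lborel)"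
    using norm_integral_le_nn[of lborel "\<lambda>x. f x * (LINT y|lborel. normal_density 0 e (x - y) * cnj (f y))"]
    by (simp add: norm_mult ennreal_mult)
  also have "\<dots> \<le> (\<integral>\<^sup>+x. ennreal (cmod (f x)) * (\<integral>\<^sup>+y. ennreal (normal_density 0 e (x - y) * cmod (f y)) \<partial>lborel) \<partial>lborel)"
    by (intro nn_integral_mono mult_left_mono order_trans[OF norm_integral_le_nn])
       (auto simp: norm_mult)
  also have "\<dots> = (\<integral>\<^sup>+x. (\<integral>\<^sup>+y. ennreal (cmod (f x) * (normal_density 0 e (x - y) * cmod (f y))) \<partial>lborel) \<partial>lborel)"
    by (simp add: nn_integral_cmult[symmetric] ennreal_mult)
  also have "\<dots> \<le> (\<integral>\<^sup>+x. (\<integral>\<^sup>+y. (a x * k x y + a y * k x y) \<partial>lborel) \<partial>lborel)"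
  proof (intro nn_integral_mono)
    fix x y
    have "cmod (f x) * (normal_density 0 e (x - y) * cmod (f y)) = normal_density 0 e (x - y) * (cmod (f x) * cmod (f y))" by simp
    also have "\<dots> \<le> normal_density 0 e (x - y) * ((cmod (f x))\<^sup>2 / 2 + (cmod (f y))\<^sup>2 / 2)"
      using sum_squares_bound[of "cmod (f x)" "cmod (f y)"] by (intro mult_left_mono) auto
    also have "\<dots> = (cmod (f x))\<^sup>2 / 2 * normal_density 0 e (x - y) + (cmod (f y))\<^sup>2 / 2 * normal_density 0 e (x - y)"
      by (simp add: algebra_simps)
    finally show "ennreal (cmod (f x) * (normal_density 0 e (x - y) * cmod (f y))) \<le> a x * k x y + a y * k x y"
      unfolding a_def k_def by (subst split[symmetric]) (simp_all only: ennreal_leI normal_density_nonneg, simp_all)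
  qed
  also have "\<dots> = (\<integral>\<^sup>+x. (\<integral>\<^sup>+y. a x * k x y \<partial>lborel) + (\<integral>\<^sup>+y. a y * k x y \<partial>lborel) \<partial>lborel)"
    by (intro nn_integral_cong nn_integral_add) measurable
  also have "\<dots> = (\<integral>\<^sup>+x. (\<integral>\<^sup>+y. a x * k x y \<partial>lborel) \<partial>lborel) + (\<integral>\<^sup>+x. (\<integral>\<^sup>+y. a y * k x y \<partial>lborel) \<partial>lborel)"
    by (rule nn_integral_add) measurable
  also have "(\<integral>\<^sup>+x. (\<integral>\<^sup>+y. a y * k x y \<partial>lborel) \<partial>lborel) = (\<integral>\<^sup>+y. (\<integral>\<^sup>+x. a y * k x y \<partial>lborel) \<partial>lborel)"
    by (rule lborel_pair.Fubini') measurable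
  also have "(\<integral>\<^sup>+x. (\<integral>\<^sup>+y. a x * k x y \<partial>lborel) \<partial>lborel) = (\<integral>\<^sup>+x. a x \<partial>lborel)"
    unfolding k_def normal_density_shift(1)
    by (simp add: nn_integral_cmult nn_integral_normal_density[OF e])
  also have "(\<integral>\<^sup>+y. (\<integral>\<^sup>+x. a y * k x y \<partial>lborel) \<partial>lborel) = (\<integral>\<^sup>+x. a x \<partial>lborel)"
    unfolding k_def normal_density_shift(2)
    by (simp add: nn_integral_cmult nn_integral_normal_density[OF e])
  also have "(\<integral>\<^sup>+x. a x \<partial>lborel) + (\<integral>\<^sup>+x. a x \<partial>lborel) = (\<integral>\<^sup>+x. a x + a x \<partial>lborel)"
    by (rule nn_integral_add[symmetric]) measurable
  also have "\<dots> = ennreal ((L2_norm f)\<^sup>2)"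
    unfolding L2_norm_nn[OF f, symmetric] a_def by (simp add: ennreal_plus[symmetric] del: ennreal_plus)
  finally show ?thesis by simp
qed

lemma gauss_tendsto: "(\<lambda>n. exp (- ((1 / real (Suc n)) * \<xi>)\<^sup>2 / 2)) \<longlonglongrightarrow> (1::real)"
proof -
  have "(\<lambda>n. exp (- ((1 / real (Suc n)) * \<xi>)\<^sup>2 / 2)) \<longlonglongrightarrow> exp (- (0 * \<xi>)\<^sup>2 / 2)"
    by (intro tendsto_intros lim_1_over_n[THEN LIMSEQ_Suc]) (auto intro!: LIMSEQ_Suc lim_1_over_n)
  then show ?thesis by simp
qed

text \<open>The bound on the Gaussian-weighted integral does not depend on the width, so Fatou lets
  the weight tend to 1. The inequality already puts \<open>ft f\<close> into \<open>L2\<close> and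
  gives the continuity by which the equality is later extended from a dense class.\<close>

lemma Plancherel_le:
  fixes f :: "real \<Rightarrow> complex"
  assumes f: "integrable lborel f" and f2: "L2 f"
  shows "L2 (ft f)" "L2_norm (ft f) \<le> sqrt (2 * pi) * L2_norm f"
proof -
  note [measurable] = ft_measurable[OF f]
  \<comment> \<open>The square root of the Gaussian weight, hence the exponent over 4: the squared
    norm of \<open>w n \<xi> *\<^sub>R ft f \<xi>\<close> then carries exactly the weight of
    \<open>gauss_Plancherel\<close>.\<close>
  define w where "w n \<xi> = exp (- ((1 / real (Suc n)) * \<xi>)\<^sup>2 / 4)" for n \<xi>
  have w2: "(w n \<xi>)\<^sup>2 = exp (- ((1 / real (Suc n)) * \<xi>)\<^sup>2 / 2)" for n \<xi>
    unfolding w_def by (simp add: power2_eq_square exp_add[symmetric])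
  have wm [measurable]: "w n \<in> borel_measurable borel" for n unfolding w_def by measurable
  define B where "B = (LINT x|lborel. cmod (f x))"
  have n2: "(norm (w n \<xi> *\<^sub>R ft f \<xi>))\<^sup>2 = exp (- ((1 / real (Suc n)) * \<xi>)\<^sup>2 / 2) * (cmod (ft f \<xi>))\<^sup>2" for n \<xi>
    by (simp only: norm_scaleR power_mult_distrib power2_abs w2)
  have i: "integrable lborel (\<lambda>\<xi>. (norm (w n \<xi> *\<^sub>R ft f \<xi>))\<^sup>2)" for n
  proof (rule Bochner_Integration.integrable_bound)
    show "integrable lborel (\<lambda>\<xi>. B\<^sup>2 * exp (- ((1 / real (Suc n)) * \<xi>)\<^sup>2 / 2))"
      using gauss_ft(1)[of "1 / real (Suc n)"] by simp
    show "AE \<xi> in lborel. norm ((norm (w n \<xi> *\<^sub>R ft f \<xi>))\<^sup>2) \<le> norm (B\<^sup>2 * exp (- ((1 / real (Suc n)) * \<xi>)\<^sup>2 / 2))"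
      unfolding n2 B_def by (intro AE_I2) (auto simp: mult.commute intro!: power_mono ft_bound mult_right_mono)
  qed measurable
  have L: "L2 (\<lambda>\<xi>. w n \<xi> *\<^sub>R ft f \<xi>)" for n unfolding L2_def using i[of n] by simp
  have le: "L2_norm (\<lambda>\<xi>. w n \<xi> *\<^sub>R ft f \<xi>) \<le> sqrt (2 * pi) * L2_norm f" for n
  proof (rule power2_le_imp_le)
    have e: "1 / real (Suc n) > 0" by simp
    have "(L2_norm (\<lambda>\<xi>. w n \<xi> *\<^sub>R ft f \<xi>))\<^sup>2 = (LINT \<xi>|lborel. exp (- ((1 / real (Suc n)) * \<xi>)\<^sup>2 / 2) * (cmod (ft f \<xi>))\<^sup>2)"
      unfolding L2_norm_sq n2 ..
    also have "\<dots> \<le> \<bar>\<dots>\<bar>" by simp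
    also have "\<bar>LINT \<xi>|lborel. exp (- ((1 / real (Suc n)) * \<xi>)\<^sup>2 / 2) * (cmod (ft f \<xi>))\<^sup>2\<bar>
       = cmod (2 * pi * (LINT x|lborel. f x * (LINT y|lborel. normal_density 0 (1 / real (Suc n)) (x - y) * cnj (f y))))"
      unfolding gauss_Plancherel[OF f e, symmetric] norm_of_real ..
    also have "\<dots> \<le> 2 * pi * (L2_norm f)\<^sup>2"
      using normal_density_form_bound[OF f2 e] by (simp add: norm_mult)
    finally show "(L2_norm (\<lambda>\<xi>. w n \<xi> *\<^sub>R ft f \<xi>))\<^sup>2 \<le> (sqrt (2 * pi) * L2_norm f)\<^sup>2"
      by (simp add: power_mult_distrib)
  qed simp
  have lim: "AE \<xi> in lborel. (\<lambda>n. w n \<xi> *\<^sub>R ft f \<xi>) \<longlonglongrightarrow> ft f \<xi>"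
  proof (rule AE_I2)
    fix \<xi>
    have "(\<lambda>n. sqrt ((w n \<xi>)\<^sup>2)) \<longlonglongrightarrow> sqrt 1" unfolding w2 by (intro tendsto_real_sqrt gauss_tendsto)
    then have "(\<lambda>n. w n \<xi>) \<longlonglongrightarrow> 1" by (simp add: w_def)
    from tendsto_scaleR[OF this tendsto_const[of "ft f \<xi>"]] show "(\<lambda>n. w n \<xi> *\<^sub>R ft f \<xi>) \<longlonglongrightarrow> ft f \<xi>" by simp
  qed
  show "L2 (ft f)" "L2_norm (ft f) \<le> sqrt (2 * pi) * L2_norm f"
    using L2_Fatou[OF _ L lim, of "sqrt (2 * pi) * L2_norm f"] le by auto
qed

text \<open>Both sides of \<open>gauss_Plancherel\<close> converge as the width tends to 0: the left
  by dominated convergence, \<open>ft f\<close> being known to lie in \<open>L2\<close>, the right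
  because the normal densities form an approximate identity and \<open>f\<close> is bounded and
  continuous.\<close>

lemma Plancherel_compact_cont:
  fixes f :: "real \<Rightarrow> complex"
  assumes cc: "compact_cont f"
  shows "L2_norm (ft f) = sqrt (2 * pi) * L2_norm f"
proof -
  have f: "integrable lborel f" and f2: "L2 f" and [measurable]: "f \<in> borel_measurable borel"
    using compact_cont_integrable[OF cc] compact_cont_L2[OF cc] compact_cont_measurable[OF cc] by auto
  note F2 = Plancherel_le(1)[OF f f2]
  note [measurable] = ft_measurable[OF f]
  obtain B R where B: "B \<ge> 0" "\<And>x. norm (f x) \<le> B * indicator {-R..R} x"
    using compact_cont_bounded[OF cc] by blast
  have B': "norm (f x) \<le> B" for x
    using B(2)[of x] B(1) by (cases "x \<in> {-R..R}") (auto simp: indicator_def)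
  have fc: "isCont f x" for x using cc by (auto simp: compact_cont_def continuous_on_eq_continuous_at)
  define e where "e n = 1 / real (Suc n)" for n
  have e: "e n > 0" for n by (simp add: e_def)
  have e0: "e \<longlonglongrightarrow> 0" unfolding e_def by (rule LIMSEQ_Suc) (rule lim_1_over_n)
  have L: "(\<lambda>n. LINT \<xi>|lborel. exp (- (e n * \<xi>)\<^sup>2 / 2) * (cmod (ft f \<xi>))\<^sup>2) \<longlonglongrightarrow> (LINT \<xi>|lborel. 1 * (cmod (ft f \<xi>))\<^sup>2)"
  proof (rule integral_dominated_convergence[where w="\<lambda>\<xi>. (cmod (ft f \<xi>))\<^sup>2"])
    show "integrable lborel (\<lambda>\<xi>. (cmod (ft f \<xi>))\<^sup>2)" using L2_integrable[OF F2] .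
    show "AE x in lborel. (\<lambda>i. exp (- (e i * x)\<^sup>2 / 2) * (cmod (ft f x))\<^sup>2) \<longlonglongrightarrow> 1 * (cmod (ft f x))\<^sup>2"
      unfolding e_def by (intro AE_I2 tendsto_mult tendsto_const gauss_tendsto)
  qed (auto intro!: mult_left_le_one_le)
  \<comment> \<open>The convolution after substituting \<open>x - e n * z\<close> for
    \<open>y\<close>. The density no longer depends on \<open>n\<close>, so dominated convergence
    applies at each \<open>x\<close>.\<close>
  define I where "I n x = (LINT z|lborel. std_normal_density z * cnj (f (x - e n * z)))" for n x
  have inner: "(LINT y|lborel. normal_density 0 (e n) (x - y) * cnj (f y)) = I n x" for n x
  proof -
    have "(LINT y|lborel. normal_density 0 (e n) (x - y) * cnj (f y))
      = \<bar>- e n\<bar> *\<^sub>R (LINT z|lborel. normal_density 0 (e n) (x - (x + (- e n) * z)) * cnj (f (x + (- e n) * z)))"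
      using e[of n] by (intro lborel_integral_real_affine) simp
    also have "\<dots> = (LINT z|lborel. e n * (normal_density 0 (e n) (x - (x + (- e n) * z)) * cnj (f (x + (- e n) * z))))"
      using e[of n] by (simp add: scaleR_conv_of_real)
    also have "\<dots> = I n x" unfolding I_def
    proof (rule Bochner_Integration.integral_cong[OF refl])
      fix z
      have "e n * normal_density 0 (e n) (e n * z) = std_normal_density z"
        using e[of n] by (simp add: normal_density_def real_sqrt_mult field_simps)
      then have "complex_of_real (e n) * complex_of_real (normal_density 0 (e n) (e n * z)) = complex_of_real (std_normal_density z)"
        by (metis of_real_mult)
      then show "complex_of_real (e n) * (complex_of_real (normal_density 0 (e n) (x - (x + - e n * z))) * cnj (f (x + - e n * z)))
          = complex_of_real (std_normal_density z) * cnj (f (x - e n * z))"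
        by (simp add: mult.assoc[symmetric])
    qed
    finally show ?thesis .
  qed
  have snd_i: "integrable lborel (\<lambda>z. std_normal_density z * B)" by simp
  have Ilim: "(\<lambda>n. I n x) \<longlonglongrightarrow> (LINT z|lborel. std_normal_density z * cnj (f x))" for x
    unfolding I_def
  proof (rule integral_dominated_convergence[where w="\<lambda>z. std_normal_density z * B", OF _ _ snd_i])
    show "AE z in lborel. (\<lambda>i. std_normal_density z * cnj (f (x - e i * z))) \<longlonglongrightarrow> std_normal_density z * cnj (f x)"
    proof (rule AE_I2)
      fix z
      have "(\<lambda>i. x - e i * z) \<longlonglongrightarrow> x - 0 * z" by (intro tendsto_intros e0)
      then have "(\<lambda>i. f (x - e i * z)) \<longlonglongrightarrow> f x" using isCont_tendsto_compose[OF fc] by simp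
      then show "(\<lambda>i. std_normal_density z * cnj (f (x - e i * z))) \<longlonglongrightarrow> std_normal_density z * cnj (f x)"
        by (intro tendsto_intros)
    qed
  qed (use B' in \<open>auto simp: norm_mult intro!: mult_left_mono\<close>)
  have Ib: "cmod (I n x) \<le> B" for n x
  proof -
    have "cmod (I n x) \<le> (LINT z|lborel. cmod (std_normal_density z * cnj (f (x - e n * z))))"
      unfolding I_def by (rule integral_norm_bound)
    also have "\<dots> \<le> (LINT z|lborel. std_normal_density z * B)"
      using B B' by (intro integral_mono_AE' snd_i AE_I2) (auto simp: norm_mult intro!: mult_left_mono)
    also have "\<dots> = B" by simp
    finally show ?thesis .
  qed
  have Im [measurable]: "I n \<in> borel_measurable borel" for n unfolding I_def by measurable
  have R: "(\<lambda>n. LINT x|lborel. f x * I n x) \<longlonglongrightarrow> (LINT x|lborel. f x * cnj (f x))"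
  proof (rule integral_dominated_convergence[where w="\<lambda>x. cmod (f x) * B"])
    show "AE x in lborel. (\<lambda>i. f x * I i x) \<longlonglongrightarrow> f x * cnj (f x)"
      using Ilim by (intro AE_I2 tendsto_intros) simp
    show "integrable lborel (\<lambda>x. cmod (f x) * B)" using f by simp
  qed (use Ib in \<open>auto simp: norm_mult intro!: mult_left_mono\<close>)
  have "(\<lambda>n. complex_of_real (LINT \<xi>|lborel. exp (- (e n * \<xi>)\<^sup>2 / 2) * (cmod (ft f \<xi>))\<^sup>2)) \<longlonglongrightarrow> complex_of_real ((L2_norm (ft f))\<^sup>2)"
    using tendsto_of_real[OF L] by (simp add: L2_norm_sq)
  moreover have "(\<lambda>n. complex_of_real (LINT \<xi>|lborel. exp (- (e n * \<xi>)\<^sup>2 / 2) * (cmod (ft f \<xi>))\<^sup>2)) \<longlonglongrightarrow> 2 * pi * (LINT x|lborel. f x * cnj (f x))"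
    unfolding gauss_Plancherel[OF f e] inner by (intro tendsto_intros R)
  ultimately have "complex_of_real ((L2_norm (ft f))\<^sup>2) = 2 * pi * (LINT x|lborel. f x * cnj (f x))"
    by (rule LIMSEQ_unique)
  also have "(LINT x|lborel. f x * cnj (f x)) = complex_of_real ((L2_norm f)\<^sup>2)"
    unfolding L2_norm_sq integral_complex_of_real[symmetric]
    by (rule Bochner_Integration.integral_cong) (simp_all only: complex_norm_square)
  also have "2 * pi * complex_of_real ((L2_norm f)\<^sup>2) = complex_of_real ((sqrt (2 * pi) * L2_norm f)\<^sup>2)"
    by (simp add: power_mult_distrib)
  finally show ?thesis unfolding of_real_eq_iff by (simp add: power2_eq_iff_nonneg)
qed

text \<open>By \<open>Plancherel_le\<close> both sides are Lipschitz with respect to the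
  \<open>L2\<close> norm, and they agree on the dense class of continuous functions with compact
  support.\<close>

theorem Plancherel_L1_L2:
  fixes f :: "real \<Rightarrow> complex"
  assumes f: "integrable lborel f" and f2: "L2 f"
  shows "L2_norm (ft f) = sqrt (2 * pi) * L2_norm f"
proof (rule antisym[OF Plancherel_le(2)[OF f f2]], rule field_le_epsilon)
  fix e :: real assume e: "e > 0"
  define c where "c = sqrt (2 * pi)"
  have c: "c > 0" by (simp add: c_def)
  obtain g where g: "compact_cont g" "L2_norm (\<lambda>x. g x - f x) < e / (2 * c)"
    using L2_dense_compact_cont[OF f2, of "e / (2 * c)"] e c by auto
  note gi = compact_cont_integrable[OF g(1)] and g2 = compact_cont_L2[OF g(1)]
  have "c * L2_norm f \<le> c * L2_norm g + c * L2_norm (\<lambda>x. g x - f x)"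
    using L2_norm_diff_le[OF g2 f2] c by (simp flip: distrib_left)
  also have "c * L2_norm g = L2_norm (ft g)" unfolding c_def by (rule Plancherel_compact_cont[OF g(1), symmetric])
  also have "\<dots> \<le> L2_norm (ft f) + L2_norm (\<lambda>\<xi>. ft g \<xi> - ft f \<xi>)"
    using L2_norm_diff_le[OF Plancherel_le(1)[OF gi g2] Plancherel_le(1)[OF f f2]] by simp
  also have "L2_norm (\<lambda>\<xi>. ft g \<xi> - ft f \<xi>) \<le> c * L2_norm (\<lambda>x. g x - f x)"
    unfolding ft_diff[OF gi f, symmetric] c_def
    using Plancherel_le(2)[OF Bochner_Integration.integrable_diff[OF gi f] L2_diff[OF g2 f2]] .
  finally have "c * L2_norm f \<le> L2_norm (ft f) + 2 * (c * L2_norm (\<lambda>x. g x - f x))" by simp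
  also have "2 * (c * L2_norm (\<lambda>x. g x - f x)) \<le> e"
    using mult_left_mono[OF less_imp_le[OF g(2)], of "2 * c"] c by simp
  finally show "sqrt (2 * pi) * L2_norm f \<le> L2_norm (ft f) + e" by (simp add: c_def)
qed

section \<open>Extension of the Fourier transform to L2\<close>

abbreviation trunc :: "real \<Rightarrow> (real \<Rightarrow> 'b::real_vector) \<Rightarrow> real \<Rightarrow> 'b"
  where "trunc R f \<equiv> (\<lambda>x. indicator {-R..R} x *\<^sub>R f x)"

lemma trunc_L2: "L2 f \<Longrightarrow> L2 (trunc R f)"
  by (rule L2_bound) (auto simp: indicator_def dest: L2_measurable)

lemma trunc_integrable:
  assumes f: "L2 f" shows "integrable lborel (trunc R f)"
proof -
  note [measurable] = L2D(1)[OF f]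
  have "integrable lborel (\<lambda>x. norm (indicator {-R..R} x *\<^sub>R (1::real)) * norm (f x))"
    by (rule L2_mult_integrable[OF L2_indicator_const f])
  then show ?thesis
    by (rule Bochner_Integration.integrable_bound) auto
qed

lemma trunc_tendsto:
  assumes f: "L2 f" shows "((\<lambda>R. L2_norm (\<lambda>x. f x - trunc R f x)) \<longlongrightarrow> 0) at_top"
proof (rule tendsto_at_topI_sequentially)
  fix X :: "nat \<Rightarrow> real" assume X: "filterlim X at_top sequentially"
  note [measurable] = L2D(1)[OF f]
  have "(\<lambda>n. L2_norm (\<lambda>x. trunc (X n) f x - f x)) \<longlonglongrightarrow> 0"
  proof (rule L2_dominated_convergence[OF f])
    show "AE x in lborel. (\<lambda>n. trunc (X n) f x) \<longlonglongrightarrow> f x"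
    proof (rule AE_I2, rule tendsto_eventually)
      fix x
      have "eventually (\<lambda>n. X n \<ge> \<bar>x\<bar>) sequentially" using X by (simp add: filterlim_at_top)
      then show "eventually (\<lambda>n. trunc (X n) f x = f x) sequentially"
        by eventually_elim (auto simp: indicator_def abs_le_iff)
    qed
  qed (auto simp: indicator_def)
  then show "(\<lambda>n. L2_norm (\<lambda>x. f x - trunc (X n) f x)) \<longlonglongrightarrow> 0" by (subst L2_norm_minus_commute)
qed

lemma ft_cmult: "ft (\<lambda>x. c * f x) \<xi> = c * ft f \<xi>"
  unfolding ft_def by (subst mult.left_commute) simp

lemma ft_add:
  assumes "integrable lborel f" "integrable lborel g"
  shows "ft (\<lambda>x. f x + g x) \<xi> = ft f \<xi> + ft g \<xi>"
  using assms unfolding ft_def by (simp add: distrib_left ft_integrable)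

text \<open>A relation rather than a function, because the transform is determined only up to null
  sets. It is the scalar counterpart of \<open>has_fourier_L2\<close>; complex-valued
  \<open>f\<close> leave room for conjugation and for inverse transforms.\<close>

definition has_FT :: "(real \<Rightarrow> complex) \<Rightarrow> (real \<Rightarrow> complex) \<Rightarrow> bool"
  where "has_FT f F \<longleftrightarrow> L2 f \<and> L2 F \<and> ((\<lambda>R. L2_norm (\<lambda>\<xi>. F \<xi> - ft (trunc R f) \<xi>)) \<longlongrightarrow> 0) at_top"

lemma has_FT_L2: "has_FT f F \<Longrightarrow> L2 f" "has_FT f F \<Longrightarrow> L2 F"
  by (auto simp: has_FT_def)

lemma ft_trunc_L2: "L2 f \<Longrightarrow> L2 (ft (trunc R f))"
  by (intro Plancherel_le trunc_integrable trunc_L2)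

lemma ft_trunc_diff:
  fixes f :: "real \<Rightarrow> complex"
  assumes f: "L2 f"
  shows "L2_norm (\<lambda>\<xi>. ft (trunc R f) \<xi> - ft (trunc S f) \<xi>) = sqrt (2 * pi) * L2_norm (\<lambda>x. trunc R f x - trunc S f x)"
  unfolding ft_diff[OF trunc_integrable[OF f] trunc_integrable[OF f], symmetric]
  by (intro Plancherel_L1_L2 L2_diff trunc_L2 f Bochner_Integration.integrable_diff trunc_integrable)

text \<open>By Plancherel the transforms of the truncations form a Cauchy sequence. Completeness
  gives a limit along integer radii, and the explicit bound \<open>le\<close> carries the
  convergence over to all real radii.\<close>

lemma has_FT_exists:
  assumes f: "L2 f" shows "\<exists>F. has_FT f F"
proof -
  define c where "c = sqrt (2 * pi)"
  have c: "c > 0" by (simp add: c_def)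
  define h where "h R = L2_norm (\<lambda>x. f x - trunc R f x)" for R
  have h0: "(h \<longlongrightarrow> 0) at_top" unfolding h_def by (rule trunc_tendsto[OF f])
  have le: "L2_norm (\<lambda>\<xi>. ft (trunc R f) \<xi> - ft (trunc S f) \<xi>) \<le> c * (h R + h S)" for R S
    unfolding ft_trunc_diff[OF f] c_def[symmetric] h_def
    using L2_norm_triangle_diff[OF trunc_L2[OF f] f trunc_L2[OF f], of R S] c
      L2_norm_minus_commute[of f "trunc R f"] by simp
  have hn: "(\<lambda>n. h (real n)) \<longlonglongrightarrow> 0"
    using filterlim_compose[OF h0 filterlim_real_sequentially] .
  obtain F where F: "L2 F" "(\<lambda>n. L2_norm (\<lambda>\<xi>. ft (trunc (real n) f) \<xi> - F \<xi>)) \<longlonglongrightarrow> 0"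
  proof (rule L2_complete)
    show "L2 (ft (trunc (real n) f))" for n by (rule ft_trunc_L2[OF f])
    fix e :: real assume e: "e > 0"
    then have "eventually (\<lambda>n. h (real n) < e / (2 * c)) sequentially"
      using c by (intro order_tendstoD(2)[OF hn]) simp
    then obtain N where N: "\<And>n. n \<ge> N \<Longrightarrow> h (real n) < e / (2 * c)" by (auto simp: eventually_sequentially)
    have "L2_norm (\<lambda>x. ft (trunc (real m) f) x - ft (trunc (real n) f) x) < e" if "m \<ge> N" "n \<ge> N" for m n
    proof -
      have "c * (h (real m) + h (real n)) < c * (e / (2 * c) + e / (2 * c))"
        using N[OF that(1)] N[OF that(2)] c by (intro mult_strict_left_mono add_strict_mono) auto
      also have "\<dots> = e" using c by (simp add: field_simps)
      finally show ?thesis using le[of "real m" "real n"] by simp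
    qed
    then show "\<exists>N. \<forall>m\<ge>N. \<forall>n\<ge>N. L2_norm (\<lambda>x. ft (trunc (real m) f) x - ft (trunc (real n) f) x) < e" by blast
  qed auto
  have le2: "L2_norm (\<lambda>\<xi>. F \<xi> - ft (trunc R f) \<xi>) \<le> c * h R" for R
  proof (rule LIMSEQ_le_const)
    show "(\<lambda>n. L2_norm (\<lambda>\<xi>. ft (trunc (real n) f) \<xi> - F \<xi>) + c * (h (real n) + h R)) \<longlonglongrightarrow> c * h R"
      by (rule tendsto_eq_intros F(2) hn refl | simp)+
    have "L2_norm (\<lambda>\<xi>. F \<xi> - ft (trunc R f) \<xi>) \<le> L2_norm (\<lambda>\<xi>. ft (trunc (real n) f) \<xi> - F \<xi>) + c * (h (real n) + h R)" for n
      using L2_norm_triangle_diff[OF F(1) ft_trunc_L2[OF f] ft_trunc_L2[OF f], of R "real n"] le[of "real n" R]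
        L2_norm_minus_commute[of F "ft (trunc (real n) f)"] by simp
    then show "\<exists>N. \<forall>n\<ge>N. L2_norm (\<lambda>\<xi>. F \<xi> - ft (trunc R f) \<xi>)
        \<le> L2_norm (\<lambda>\<xi>. ft (trunc (real n) f) \<xi> - F \<xi>) + c * (h (real n) + h R)" by blast
  qed
  have "((\<lambda>R. L2_norm (\<lambda>\<xi>. F \<xi> - ft (trunc R f) \<xi>)) \<longlongrightarrow> 0) at_top"
    by (rule tendsto_sandwich[OF _ _ tendsto_const tendsto_mult_right_zero[OF h0, of c]]) (auto intro!: always_eventually le2)
  with f F(1) show ?thesis by (auto simp: has_FT_def)
qed

lemma has_FT_ft:
  assumes f: "integrable lborel f" and f2: "L2 f" shows "has_FT f (ft f)"
proof -
  have "L2_norm (\<lambda>\<xi>. ft f \<xi> - ft (trunc R f) \<xi>) = sqrt (2 * pi) * L2_norm (\<lambda>x. f x - trunc R f x)" for R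
    unfolding ft_diff[OF f trunc_integrable[OF f2], symmetric]
    by (intro Plancherel_L1_L2 L2_diff trunc_L2 f f2 Bochner_Integration.integrable_diff trunc_integrable)
  then show ?thesis unfolding has_FT_def
    using f2 Plancherel_le(1)[OF f f2] tendsto_mult_right_zero[OF trunc_tendsto[OF f2], of "sqrt (2 * pi)"] by simp
qed

lemma L2_norm_limit_le:
  assumes f: "L2 f" "\<And>R. L2 (g R)" and lim: "((\<lambda>R. L2_norm (\<lambda>x. f x - g R x)) \<longlongrightarrow> 0) A"
  shows "((\<lambda>R. L2_norm (g R)) \<longlongrightarrow> L2_norm f) A"
proof (rule LIM_zero_cancel, rule Lim_null_comparison[OF _ lim])
  show "\<forall>\<^sub>F R in A. norm (L2_norm (g R) - L2_norm f) \<le> L2_norm (\<lambda>x. f x - g R x)"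
    using L2_norm_diff_le[OF f(1) f(2)] by (intro always_eventually) (auto simp: abs_minus_commute)
qed

theorem has_FT_norm:
  assumes "has_FT f F" shows "L2_norm F = sqrt (2 * pi) * L2_norm f"
proof -
  have f: "L2 f" and F: "L2 F" and lim: "((\<lambda>R. L2_norm (\<lambda>\<xi>. F \<xi> - ft (trunc R f) \<xi>)) \<longlongrightarrow> 0) at_top"
    using assms by (auto simp: has_FT_def)
  have "((\<lambda>R. L2_norm (ft (trunc R f))) \<longlongrightarrow> L2_norm F) at_top"
    by (rule L2_norm_limit_le[OF F ft_trunc_L2[OF f] lim])
  moreover have "((\<lambda>R. L2_norm (ft (trunc R f))) \<longlongrightarrow> sqrt (2 * pi) * L2_norm f) at_top"
    unfolding Plancherel_L1_L2[OF trunc_integrable[OF f] trunc_L2[OF f]]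
    by (intro tendsto_intros L2_norm_limit_le[OF f trunc_L2[OF f] trunc_tendsto[OF f]])
  ultimately show ?thesis using tendsto_unique[OF trivial_limit_at_top_linorder] by blast
qed

lemma has_FT_add:
  assumes "has_FT f F" "has_FT g G" shows "has_FT (\<lambda>x. f x + g x) (\<lambda>\<xi>. F \<xi> + G \<xi>)"
proof -
  have f: "L2 f" and F: "L2 F" and limF: "((\<lambda>R. L2_norm (\<lambda>\<xi>. F \<xi> - ft (trunc R f) \<xi>)) \<longlongrightarrow> 0) at_top"
    using assms by (auto simp: has_FT_def)
  have g: "L2 g" and G: "L2 G" and limG: "((\<lambda>R. L2_norm (\<lambda>\<xi>. G \<xi> - ft (trunc R g) \<xi>)) \<longlongrightarrow> 0) at_top"
    using assms by (auto simp: has_FT_def)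
  have e: "ft (trunc R (\<lambda>x. f x + g x)) \<xi> = ft (trunc R f) \<xi> + ft (trunc R g) \<xi>" for R \<xi>
    unfolding ft_add[OF trunc_integrable[OF f] trunc_integrable[OF g], symmetric] by (simp only: scaleR_add_right)
  have le: "L2_norm (\<lambda>\<xi>. F \<xi> + G \<xi> - ft (trunc R (\<lambda>x. f x + g x)) \<xi>)
     \<le> L2_norm (\<lambda>\<xi>. F \<xi> - ft (trunc R f) \<xi>) + L2_norm (\<lambda>\<xi>. G \<xi> - ft (trunc R g) \<xi>)" for R
    unfolding e add_diff_add by (intro L2_norm_triangle L2_diff F G ft_trunc_L2 f g)
  have "((\<lambda>R. L2_norm (\<lambda>\<xi>. F \<xi> + G \<xi> - ft (trunc R (\<lambda>x. f x + g x)) \<xi>)) \<longlongrightarrow> 0) at_top"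
    by (rule tendsto_sandwich[OF _ _ tendsto_const tendsto_add_zero[OF limF limG]]) (auto intro!: always_eventually le)
  then show ?thesis using L2_add[OF f g] L2_add[OF F G] by (simp add: has_FT_def)
qed

lemma has_FT_cmult:
  assumes "has_FT f F" shows "has_FT (\<lambda>x. c * f x) (\<lambda>\<xi>. c * F \<xi>)"
proof -
  have f: "L2 f" and F: "L2 F" and lim: "((\<lambda>R. L2_norm (\<lambda>\<xi>. F \<xi> - ft (trunc R f) \<xi>)) \<longlongrightarrow> 0) at_top"
    using assms by (auto simp: has_FT_def)
  have "ft (trunc R (\<lambda>x. c * f x)) \<xi> = c * ft (trunc R f) \<xi>" for R \<xi>
    unfolding ft_cmult[symmetric] by (simp only: mult_scaleR_right)
  then have "L2_norm (\<lambda>\<xi>. c * F \<xi> - ft (trunc R (\<lambda>x. c * f x)) \<xi>) = cmod c * L2_norm (\<lambda>\<xi>. F \<xi> - ft (trunc R f) \<xi>)" for R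
    using L2_cmult(2)[OF L2_diff[OF F ft_trunc_L2[OF f]], of c R] by (simp add: right_diff_distrib)
  then show ?thesis using L2_cmult(1)[OF f] L2_cmult(1)[OF F] tendsto_mult_right_zero[OF lim, of "cmod c"]
    by (simp add: has_FT_def)
qed

lemma has_FT_diff:
  assumes "has_FT f F" "has_FT g G" shows "has_FT (\<lambda>x. f x - g x) (\<lambda>\<xi>. F \<xi> - G \<xi>)"
  using has_FT_add[OF assms(1) has_FT_cmult[OF assms(2), of "-1"]] by simp

lemma has_FT_cong_AE:
  assumes F: "has_FT f F" and AE: "AE \<xi> in lborel. F \<xi> = G \<xi>" and G: "G \<in> borel_measurable borel"
  shows "has_FT f G"
proof -
  have f: "L2 f" and F2: "L2 F" using F by (auto simp: has_FT_def)
  note [measurable] = L2D(1)[OF F2] G L2D(1)[OF ft_trunc_L2[OF f]]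
  have "L2_norm (\<lambda>\<xi>. F \<xi> - ft (trunc R f) \<xi>) = L2_norm (\<lambda>\<xi>. G \<xi> - ft (trunc R f) \<xi>)" for R
    by (rule L2_cong_AE(2)) (use AE in \<open>auto elim: eventually_mono\<close>)
  then show ?thesis using F L2_cong_AE(1)[OF L2D(1)[OF F2] G AE] by (simp add: has_FT_def)
qed

lemma L2_norm_diff_0_AE:
  assumes "L2 f" "L2 g" "L2_norm (\<lambda>x. f x - g x) = 0" shows "AE x in lborel. f x = g x"
  using L2_eq_0_AE[OF L2_diff[OF assms(1,2)] assms(3)] by eventually_elim simp

lemma has_FT_unique:
  assumes F: "has_FT f F" and G: "has_FT f G" shows "AE \<xi> in lborel. F \<xi> = G \<xi>"
  using has_FT_norm[OF has_FT_diff[OF F G]] by (intro L2_norm_diff_0_AE has_FT_L2(2)[OF F] has_FT_L2(2)[OF G]) simp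

lemma has_FT_inj:
  assumes F: "has_FT f F" and G: "has_FT g F" shows "AE x in lborel. f x = g x"
  using has_FT_norm[OF has_FT_diff[OF F G]] by (intro L2_norm_diff_0_AE has_FT_L2(1)[OF F] has_FT_L2(1)[OF G]) simp

lemma L2_norm_add_sq:
  fixes f g :: "real \<Rightarrow> complex"
  assumes f: "L2 f" and g: "L2 g"
  shows "(L2_norm (\<lambda>x. f x + g x))\<^sup>2 = (L2_norm f)\<^sup>2 + (L2_norm g)\<^sup>2 + 2 * Re (LINT x|lborel. f x * cnj (g x))"
proof -
  have e: "(norm (f x + g x))\<^sup>2 = (norm (f x))\<^sup>2 + (norm (g x))\<^sup>2 + 2 * Re (f x * cnj (g x))" for x
    unfolding cmod_power2 by (simp add: power2_eq_square algebra_simps)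
  note i = L2_mult_integrable_complex(2)[OF f g] L2_integrable[OF f] L2_integrable[OF g]
  show ?thesis unfolding L2_norm_sq e integral_Re[OF i(1), symmetric]
    using i(2,3) integrable_Re[OF i(1)] by (simp del: times_complex.sel)
qed

text \<open>Polarization: the norm identity for \<open>F + G\<close> yields the real part, and the
  same argument for \<open>- \<i>\<close> times the first function yields the imaginary
  part.\<close>

theorem has_FT_Parseval:
  assumes F: "has_FT f F" and G: "has_FT g G"
  shows "(LINT \<xi>|lborel. F \<xi> * cnj (G \<xi>)) = 2 * pi * (LINT x|lborel. f x * cnj (g x))"
proof (rule complex_eqI)
  have key: "Re (LINT \<xi>|lborel. F \<xi> * cnj (G \<xi>)) = 2 * pi * Re (LINT x|lborel. f x * cnj (g x))"
    if F: "has_FT f F" and G: "has_FT g G" for f F g G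
  proof -
    note l2 = has_FT_L2[OF F] has_FT_L2[OF G]
    have "(L2_norm (\<lambda>x. F x + G x))\<^sup>2 = 2 * pi * (L2_norm (\<lambda>x. f x + g x))\<^sup>2"
      "(L2_norm F)\<^sup>2 = 2 * pi * (L2_norm f)\<^sup>2" "(L2_norm G)\<^sup>2 = 2 * pi * (L2_norm g)\<^sup>2"
      by (simp_all add: has_FT_norm[OF F] has_FT_norm[OF G] has_FT_norm[OF has_FT_add[OF F G]] power_mult_distrib)
    then show ?thesis unfolding L2_norm_add_sq[OF l2(1,3)] L2_norm_add_sq[OF l2(2,4)] by (simp add: algebra_simps)
  qed
  show "Re (LINT \<xi>|lborel. F \<xi> * cnj (G \<xi>)) = Re (2 * pi * (LINT x|lborel. f x * cnj (g x)))"
    using key[OF F G] by simp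
  have "Re (- \<i> * (LINT \<xi>|lborel. F \<xi> * cnj (G \<xi>))) = 2 * pi * Re (- \<i> * (LINT x|lborel. f x * cnj (g x)))"
    using key[OF has_FT_cmult[OF F, of "- \<i>"] G] by (simp only: mult.assoc integral_mult_right_zero)
  then show "Im (LINT \<xi>|lborel. F \<xi> * cnj (G \<xi>)) = Im (2 * pi * (LINT x|lborel. f x * cnj (g x)))"
    by simp
qed

lemma L2_bilinear_tendsto:
  fixes f g :: "real \<Rightarrow> complex"
  assumes l2: "L2 f" "L2 g" "\<And>R. L2 (F R)" "\<And>R. L2 (G R)"
    and lim: "((\<lambda>R. L2_norm (\<lambda>x. f x - F R x)) \<longlongrightarrow> 0) A" "((\<lambda>R. L2_norm (\<lambda>x. g x - G R x)) \<longlongrightarrow> 0) A"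
  shows "((\<lambda>R. LINT x|lborel. F R x * G R x) \<longlongrightarrow> (LINT x|lborel. f x * g x)) A"
proof (rule LIM_zero_cancel, rule Lim_null_comparison)
  have eq: "(LINT x|lborel. F R x * G R x) - (LINT x|lborel. f x * g x)
      = - (LINT x|lborel. (f x - F R x) * G R x) - (LINT x|lborel. f x * (g x - G R x))" for R
    using L2_mult_integrable_complex(1)[OF l2(1) l2(2)] L2_mult_integrable_complex(1)[OF l2(3) l2(4), of R R]
      L2_mult_integrable_complex(1)[OF l2(1) l2(4), of R] by (simp add: left_diff_distrib right_diff_distrib)
  show "\<forall>\<^sub>F R in A. norm ((LINT x|lborel. F R x * G R x) - (LINT x|lborel. f x * g x))
     \<le> L2_norm (\<lambda>x. f x - F R x) * L2_norm (G R) + L2_norm f * L2_norm (\<lambda>x. g x - G R x)"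
  proof (intro always_eventually allI)
    fix R
    show "norm ((LINT x|lborel. F R x * G R x) - (LINT x|lborel. f x * g x))
     \<le> L2_norm (\<lambda>x. f x - F R x) * L2_norm (G R) + L2_norm f * L2_norm (\<lambda>x. g x - G R x)"
      unfolding eq
      using L2_mult_integrable_complex(3)[OF L2_diff[OF l2(1) l2(3)] l2(4), of R R]
        L2_mult_integrable_complex(3)[OF l2(1) L2_diff[OF l2(2) l2(4)], of R]
      by (intro order_trans[OF norm_triangle_ineq4]) simp
  qed
  show "((\<lambda>R. L2_norm (\<lambda>x. f x - F R x) * L2_norm (G R) + L2_norm f * L2_norm (\<lambda>x. g x - G R x)) \<longlongrightarrow> 0) A"
    by (rule tendsto_eq_intros lim L2_norm_limit_le[OF l2(2,4) lim(2)] refl | simp)+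
qed

lemma has_FT_multiplication:
  assumes F: "has_FT f F" and G: "has_FT g G"
  shows "(LINT x|lborel. F x * g x) = (LINT x|lborel. f x * G x)"
proof -
  note l2 = has_FT_L2[OF F] has_FT_L2[OF G]
  have lF: "((\<lambda>R. L2_norm (\<lambda>\<xi>. F \<xi> - ft (trunc R f) \<xi>)) \<longlongrightarrow> 0) at_top"
    and lG: "((\<lambda>R. L2_norm (\<lambda>\<xi>. G \<xi> - ft (trunc R g) \<xi>)) \<longlongrightarrow> 0) at_top"
    using F G by (auto simp: has_FT_def)
  have "((\<lambda>R. LINT x|lborel. ft (trunc R f) x * trunc R g x) \<longlongrightarrow> (LINT x|lborel. F x * g x)) at_top"
    by (intro L2_bilinear_tendsto l2 ft_trunc_L2 trunc_L2 lF trunc_tendsto)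
  moreover have "((\<lambda>R. LINT x|lborel. trunc R f x * ft (trunc R g) x) \<longlongrightarrow> (LINT x|lborel. f x * G x)) at_top"
    by (intro L2_bilinear_tendsto l2 ft_trunc_L2 trunc_L2 lG trunc_tendsto)
  moreover have "(LINT x|lborel. ft (trunc R f) x * trunc R g x) = (LINT x|lborel. trunc R f x * ft (trunc R g) x)" for R
    using ft_multiplication[OF trunc_integrable[OF l2(3)] trunc_integrable[OF l2(1)], of R R] by (simp only: mult.commute)
  ultimately show ?thesis using tendsto_unique[OF trivial_limit_at_top_linorder] by force
qed

lemma L2_self_inner: 
  fixes f :: "real \<Rightarrow> complex"
  shows "(LINT x|lborel. f x * cnj (f x)) = complex_of_real ((L2_norm f)\<^sup>2)"
  unfolding L2_norm_sq integral_complex_of_real[symmetric]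
  by (rule Bochner_Integration.integral_cong) (simp_all only: complex_norm_square)

text \<open>The inverse transform is written as the conjugate of a transform of the conjugate,
  divided by \<open>2 * pi\<close>. Its transform \<open>F\<close> is compared with \<open>G\<close>
  by duality: the inner products with every \<open>g\<close> coincide by the multiplication formula
  and Parseval, and \<open>g = F - G\<close> finishes.\<close>

theorem has_FT_surj:
  assumes G: "L2 G" shows "\<exists>f. has_FT f G"
proof -
  obtain H where H: "has_FT (\<lambda>x. cnj (G x)) H" using has_FT_exists[OF L2_cnj[OF G]] by blast
  define f where "f x = (1 / (2 * pi)) * cnj (H x)" for x
  have f: "L2 f" unfolding f_def by (intro L2_cmult L2_cnj has_FT_L2[OF H])
  obtain F where F: "has_FT f F" using has_FT_exists[OF f] by blast
  have eq: "(LINT x|lborel. F x * cnj (g x)) = (LINT x|lborel. G x * cnj (g x))" if g: "L2 g" for g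
  proof -
    obtain K where K: "has_FT (\<lambda>x. cnj (g x)) K" using has_FT_exists[OF L2_cnj[OF g]] by blast
    have "(LINT x|lborel. F x * cnj (g x)) = (LINT x|lborel. f x * K x)" by (rule has_FT_multiplication[OF F K])
    also have "\<dots> = (LINT x|lborel. (1 / (2 * pi)) * (K x * cnj (H x)))"
      unfolding f_def by (rule Bochner_Integration.integral_cong) (simp_all add: mult.commute)
    also have "\<dots> = (1 / (2 * pi)) * (LINT x|lborel. K x * cnj (H x))" by (rule integral_mult_right_zero)
    also have "\<dots> = (LINT x|lborel. cnj (g x) * cnj (cnj (G x)))"
      unfolding has_FT_Parseval[OF K H] by simp
    finally show ?thesis by (simp add: mult.commute)
  qed
  note F2 = has_FT_L2(2)[OF F]
  have D: "L2 (\<lambda>x. F x - G x)" by (rule L2_diff[OF F2 G])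
  have "(LINT x|lborel. (F x - G x) * cnj (F x - G x)) = 0"
    using eq[OF D] L2_mult_integrable_complex(2)[OF F2 D] L2_mult_integrable_complex(2)[OF G D]
    by (subst left_diff_distrib) simp
  then have "L2_norm (\<lambda>x. F x - G x) = 0" unfolding L2_self_inner by simp
  from has_FT_cong_AE[OF F L2_norm_diff_0_AE[OF F2 G this] L2D(1)[OF G]] show ?thesis by blast
qed

lemma has_FT_cnj:
  assumes F: "has_FT f F" shows "has_FT (\<lambda>x. cnj (f x)) (\<lambda>\<xi>. cnj (F (- \<xi>)))"
proof -
  have f: "L2 f" and F2: "L2 F" and lim: "((\<lambda>R. L2_norm (\<lambda>\<xi>. F \<xi> - ft (trunc R f) \<xi>)) \<longlongrightarrow> 0) at_top"
    using F by (auto simp: has_FT_def)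
  have "L2_norm (\<lambda>\<xi>. cnj (F (- \<xi>)) - ft (trunc R (\<lambda>x. cnj (f x))) \<xi>) = L2_norm (\<lambda>\<xi>. F \<xi> - ft (trunc R f) \<xi>)" for R
  proof -
    have "ft (trunc R (\<lambda>x. cnj (f x))) \<xi> = cnj (ft (trunc R f) (- \<xi>))" for \<xi>
      unfolding ft_cnj[symmetric] by simp
    then have "L2_norm (\<lambda>\<xi>. cnj (F (- \<xi>)) - ft (trunc R (\<lambda>x. cnj (f x))) \<xi>) = L2_norm (\<lambda>\<xi>. F (- \<xi>) - ft (trunc R f) (- \<xi>))"
      using L2_norm_cnj[of "\<lambda>\<xi>. F (- \<xi>) - ft (trunc R f) (- \<xi>)"] by simp
    also have "\<dots> = L2_norm (\<lambda>\<xi>. F \<xi> - ft (trunc R f) \<xi>)"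
      by (rule L2_reflect(2)[OF L2_diff[OF F2 ft_trunc_L2[OF f]]])
    finally show ?thesis .
  qed
  then show ?thesis using f F2 lim by (auto simp: has_FT_def intro: L2_cnj L2_reflect)
qed

section \<open>Test functions and weak derivatives\<close>

text \<open>The classical smooth function \<open>exp (- 1 / x)\<close>, continued by zero,
  multiplied by powers of \<open>1 / x\<close>. The powers are included because differentiation
  turns one such function into a combination of two others, at 0 as well.\<close>

definition flat :: "nat \<Rightarrow> real \<Rightarrow> real"
  where "flat k x = (if x > 0 then (1 / x) ^ k * exp (- (1 / x)) else 0)"

lemma flat_tendsto_0: "(flat k \<longlongrightarrow> 0) (at 0)"
proof (rule filterlim_split_at)
  show "(flat k \<longlongrightarrow> 0) (at_left 0)"
    by (rule tendsto_eventually) (auto simp: flat_def eventually_at_filter)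
  have "((\<lambda>x. (inverse x) ^ k / exp (inverse x)) \<longlongrightarrow> (0::real)) (at_right 0)"
    by (rule filterlim_compose[OF tendsto_power_div_exp_0 filterlim_inverse_at_top_right])
  moreover have "\<forall>\<^sub>F x in at_right 0. (inverse x) ^ k / exp (inverse x) = flat k x"
    by (auto simp: eventually_at_filter flat_def exp_minus divide_inverse)
  ultimately show "(flat k \<longlongrightarrow> 0) (at_right 0)" by (rule Lim_transform_eventually)
qed

lemma flat_deriv: "(flat k has_real_derivative flat (k + 2) x - real k * flat (k + 1) x) (at x)"
proof (cases x "0::real" rule: linorder_cases)
  case less
  have "((\<lambda>x. 0) has_real_derivative 0) (at x)" by simp
  then have "(flat k has_real_derivative 0) (at x)"
    by (rule has_field_derivative_transform_within_open[of _ _ _ "{..<0}"]) (use less in \<open>auto simp: flat_def\<close>)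
  then show ?thesis using less by (simp add: flat_def)
next
  case equal
  have "((\<lambda>h. (flat k (0 + h) - flat k 0) / h) \<longlongrightarrow> 0) (at 0)"
    by (rule Lim_transform_eventually[OF flat_tendsto_0[of "k + 1"]])
       (auto simp: flat_def eventually_at_filter)
  then show ?thesis unfolding DERIV_def equal by (simp add: flat_def)
next
  case greater
  have "((\<lambda>x. (1 / x) ^ k * exp (- (1 / x))) has_real_derivative
      (real k * (1 / x) ^ (k - 1) * (- 1 / x\<^sup>2)) * exp (- (1 / x)) + (1 / x) ^ k * (exp (- (1 / x)) * (1 / x\<^sup>2))) (at x)"
    using greater by (auto intro!: derivative_eq_intros simp: power2_eq_square)
  moreover have "(real k * (1 / x) ^ (k - 1) * (- 1 / x\<^sup>2)) * exp (- (1 / x)) + (1 / x) ^ k * (exp (- (1 / x)) * (1 / x\<^sup>2))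
     = flat (k + 2) x - real k * flat (k + 1) x"
    using greater by (cases k) (simp_all add: flat_def power2_eq_square algebra_simps add_divide_distrib)
  ultimately have "((\<lambda>x. (1 / x) ^ k * exp (- (1 / x))) has_real_derivative flat (k + 2) x - real k * flat (k + 1) x) (at x)"
    by simp
  then show ?thesis
    by (rule has_field_derivative_transform_within_open[of _ _ _ "{0<..}"]) (use greater in \<open>auto simp: flat_def\<close>)
qed

text \<open>A class of functions closed under differentiation consists of smooth functions. This
  avoids any formula for the iterated derivatives of a bump.\<close>

inductive flat_alg :: "(real \<Rightarrow> real) \<Rightarrow> bool" where
  flat: "flat_alg (\<lambda>x. flat k (1 + c * x))"
| const: "flat_alg (\<lambda>x. c)"
| add: "flat_alg f \<Longrightarrow> flat_alg g \<Longrightarrow> flat_alg (\<lambda>x. f x + g x)"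
| mult: "flat_alg f \<Longrightarrow> flat_alg g \<Longrightarrow> flat_alg (\<lambda>x. f x * g x)"

lemma flat_alg_deriv:
  assumes "flat_alg f" shows "\<exists>g. flat_alg g \<and> (\<forall>x. (f has_real_derivative g x) (at x))"
  using assms
proof induction
  case (flat k c)
  have "((\<lambda>x. flat k (1 + c * x)) has_real_derivative (c * flat (k + 2) (1 + c * x) + (- c * real k) * flat (k + 1) (1 + c * x))) (at x)" for x
  proof -
    have "((\<lambda>x. 1 + c * x) has_real_derivative c) (at x)" by (auto intro!: derivative_eq_intros)
    from DERIV_chain2[OF flat_deriv this] show ?thesis by (simp add: algebra_simps)
  qed
  moreover have "flat_alg (\<lambda>x. c * flat (k + 2) (1 + c * x) + (- c * real k) * flat (k + 1) (1 + c * x))"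
    by (intro flat_alg.intros)
  ultimately show ?case by blast
next
  case (const c)
  then show ?case by (intro exI[of _ "\<lambda>x. 0"]) (simp add: flat_alg.const)
next
  case (add f g)
  then obtain f' g' where d: "flat_alg f'" "flat_alg g'" "\<And>x. (f has_real_derivative f' x) (at x)" "\<And>x. (g has_real_derivative g' x) (at x)" by auto
  show ?case by (intro exI[of _ "\<lambda>x. f' x + g' x"] conjI flat_alg.add d allI DERIV_add)
next
  case (mult f g)
  then obtain f' g' where d: "flat_alg f'" "flat_alg g'" "\<And>x. (f has_real_derivative f' x) (at x)" "\<And>x. (g has_real_derivative g' x) (at x)" by auto
  show ?case
    by (intro exI[of _ "\<lambda>x. f' x * g x + g' x * f x"] conjI flat_alg.add flat_alg.mult d mult allI DERIV_mult)
qed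

lemma flat_alg_smooth:
  assumes "flat_alg f" shows "(deriv ^^ k) f field_differentiable (at x)"
proof -
  have "flat_alg ((deriv ^^ k) f)"
  proof (induction k)
    case (Suc k)
    then obtain g where g: "flat_alg g" "\<And>x. ((deriv ^^ k) f has_real_derivative g x) (at x)"
      using flat_alg_deriv by blast
    then have "deriv ((deriv ^^ k) f) = g" by (intro ext DERIV_imp_deriv)
    with g show ?case by simp
  qed (use assms in simp)
  from flat_alg_deriv[OF this] show ?thesis by (auto simp: field_differentiable_def)
qed

text \<open>One factor vanishes to the left of \<open>- 1 / N\<close>, the other to the right of
  \<open>1 / N\<close>.\<close>

definition bump :: "real \<Rightarrow> real \<Rightarrow> real"
  where "bump N x = flat 0 (1 + N * x) * flat 0 (1 + (- N) * x)"

lemma test_function_bump: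
  assumes N: "N > 0"
  shows "test_function (bump N)" "bump N x \<ge> 0" "\<bar>N * x\<bar> > 1 \<Longrightarrow> bump N x = 0"
    "\<bar>N * x\<bar> \<le> 1/2 \<Longrightarrow> bump N x \<ge> exp (- 4)"
proof -
  have 1: "flat_alg (bump N)" unfolding bump_def[abs_def] by (intro flat_alg.intros)
  have z: "bump N x = 0" if "\<bar>N * x\<bar> > 1" for x
    using that by (auto simp: bump_def flat_def abs_if split: if_splits)
  then show "bump N x = 0" if "\<bar>N * x\<bar> > 1" using that .
  have "bump N x = 0" if "\<bar>x\<bar> > 1 / N" for x
    using that N by (intro z) (simp add: abs_mult field_simps)
  then show "test_function (bump N)" unfolding test_function_def using flat_alg_smooth[OF 1] by blast
  show "bump N x \<ge> 0" by (simp add: bump_def flat_def)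
  have e: "flat 0 y \<ge> exp (- 2)" if "y \<ge> 1 / 2" for y using that by (simp add: flat_def field_simps)
  show "bump N x \<ge> exp (- 4)" if "\<bar>N * x\<bar> \<le> 1/2"
  proof -
    have "exp (- 2) * exp (- 2) \<le> bump N x"
      unfolding bump_def using that by (intro mult_mono e) (auto simp: abs_le_iff flat_def)
    then show ?thesis by (simp add: exp_add[symmetric])
  qed
qed

lemma test_functionD:
  assumes "test_function \<phi>"
  shows test_function_differentiable: "(deriv ^^ k) \<phi> field_differentiable (at x)"
    and test_function_deriv: "((deriv ^^ k) \<phi> has_real_derivative (deriv ^^ Suc k) \<phi> x) (at x)"
  using assms by (auto simp: test_function_def DERIV_deriv_iff_field_differentiable)

lemma test_function_deriv_test:
  assumes "test_function \<phi>" shows "test_function ((deriv ^^ k) \<phi>)"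
proof -
  obtain R where R: "\<And>x. \<bar>x\<bar> > R \<Longrightarrow> \<phi> x = 0" using assms by (auto simp: test_function_def)
  have "\<forall>x. \<bar>x\<bar> > R \<longrightarrow> (deriv ^^ k) \<phi> x = 0"
  proof (induction k)
    case (Suc k)
    show ?case
    proof (intro allI impI)
      fix x assume x: "\<bar>x\<bar> > R"
      have "((\<lambda>x. 0) has_real_derivative 0) (at x)" by simp
      then have "((deriv ^^ k) \<phi> has_real_derivative 0) (at x)"
      proof (rule has_field_derivative_transform_within_open[of _ _ _ "{x. \<bar>x\<bar> > R}"])
        show "open {x::real. \<bar>x\<bar> > R}" by (intro open_Collect_less continuous_intros)
      qed (use Suc x in auto)
      then show "(deriv ^^ Suc k) \<phi> x = 0" by (simp add: DERIV_imp_deriv)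
    qed
  qed (use R in simp)
  moreover have "(deriv ^^ j) ((deriv ^^ k) \<phi>) = (deriv ^^ (j + k)) \<phi>" for j by (simp add: funpow_add)
  ultimately show ?thesis using assms by (auto simp: test_function_def)
qed

lemma test_function_compact_cont:
  assumes "test_function \<phi>" shows "compact_cont \<phi>" "compact_cont (\<lambda>x. complex_of_real (\<phi> x))"
proof -
  have "continuous_on UNIV \<phi>"
    using test_function_differentiable[OF assms, of 0]
    by (auto intro!: continuous_at_imp_continuous_on field_differentiable_imp_continuous_at)
  with assms show "compact_cont \<phi>" "compact_cont (\<lambda>x. complex_of_real (\<phi> x))"
    by (auto simp: compact_cont_def test_function_def intro!: continuous_intros)
qed

lemma deriv_iter_shift:
  assumes "test_function \<phi>"
  shows "(deriv ^^ k) (\<lambda>x. \<phi> (x - y)) = (\<lambda>x. (deriv ^^ k) \<phi> (x - y))"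
proof (induction k)
  case (Suc k)
  have "((\<lambda>x. (deriv ^^ k) \<phi> (x - y)) has_real_derivative (deriv ^^ Suc k) \<phi> (x - y) * 1) (at x)" for x
    by (rule DERIV_chain2[OF test_function_deriv[OF assms]]) (auto intro!: derivative_eq_intros)
  then have "deriv (\<lambda>x. (deriv ^^ k) \<phi> (x - y)) = (\<lambda>x. (deriv ^^ Suc k) \<phi> (x - y))"
    by (intro ext DERIV_imp_deriv) simp
  then show ?case by (simp add: Suc)
qed simp

lemma test_function_shift:
  assumes "test_function \<phi>" shows "test_function (\<lambda>x. \<phi> (x - y))"
proof -
  obtain R where R: "\<And>x. \<bar>x\<bar> > R \<Longrightarrow> \<phi> x = 0" using assms by (auto simp: test_function_def)
  have "(deriv ^^ k) (\<lambda>x. \<phi> (x - y)) field_differentiable (at x)" for k x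
  proof -
    have "((\<lambda>x. (deriv ^^ k) \<phi> (x - y)) has_real_derivative (deriv ^^ Suc k) \<phi> (x - y) * 1) (at x)"
      by (rule DERIV_chain2[OF test_function_deriv[OF assms]]) (auto intro!: derivative_eq_intros)
    then show ?thesis unfolding deriv_iter_shift[OF assms] by (auto simp: field_differentiable_def)
  qed
  moreover have "\<phi> (x - y) = 0" if "\<bar>x\<bar> > R + \<bar>y\<bar>" for x using that by (intro R) linarith
  ultimately show ?thesis unfolding test_function_def by blast
qed

abbreviation cplx :: "(real \<Rightarrow> real) \<Rightarrow> real \<Rightarrow> complex"
  where "cplx f \<equiv> (\<lambda>x. complex_of_real (f x))"

lemma test_function_L2: "test_function \<phi> \<Longrightarrow> L2 (cplx \<phi>)" "test_function \<phi> \<Longrightarrow> integrable lborel (cplx \<phi>)"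
  by (auto intro: compact_cont_L2 compact_cont_integrable test_function_compact_cont)

lemma ft_shift:
  assumes "integrable lborel f" shows "ft (\<lambda>x. f (x - y)) \<xi> = cis (- (y * \<xi>)) * ft f \<xi>"
proof -
  have "ft (\<lambda>x. f (x - y)) \<xi> = (LINT x|lborel. cis (- ((y + x) * \<xi>)) * f x)"
    unfolding ft_def by (subst lborel_integral_real_affine[of 1 _ y]) simp_all
  also have "\<dots> = (LINT x|lborel. cis (- (y * \<xi>)) * (cis (- (x * \<xi>)) * f x))"
  proof (rule Bochner_Integration.integral_cong[OF refl])
    fix x
    have "cis (- ((y + x) * \<xi>)) = cis (- (y * \<xi>)) * cis (- (x * \<xi>))"
      unfolding cis_mult by (rule arg_cong[where f=cis]) (simp add: algebra_simps)
    then show "cis (- ((y + x) * \<xi>)) * f x = cis (- (y * \<xi>)) * (cis (- (x * \<xi>)) * f x)"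
      by (simp only: mult.assoc)
  qed
  finally show ?thesis unfolding ft_def by (simp only: integral_mult_right_zero)
qed

lemma ft_deriv:
  assumes "test_function \<phi>"
  shows "ft (cplx (deriv \<phi>)) \<xi> = \<i> * \<xi> * ft (cplx \<phi>) \<xi>"
proof -
  obtain R where R: "\<And>x. \<bar>x\<bar> > R \<Longrightarrow> \<phi> x = 0" using assms by (auto simp: test_function_def)
  obtain R' where R': "\<And>x. \<bar>x\<bar> > R' \<Longrightarrow> deriv \<phi> x = 0"
    using test_function_deriv_test[OF assms, of 1] by (auto simp: test_function_def)
  \<comment> \<open>Strictly larger than both radii, so that \<phi> vanishes at the end points
    themselves and the boundary terms of the fundamental theorem disappear.\<close>
  define b where "b = max \<bar>R\<bar> \<bar>R'\<bar> + 1"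
  have b: "\<phi> b = 0" "\<phi> (- b) = 0" "\<And>x. \<bar>x\<bar> > b \<Longrightarrow> \<phi> x = 0" "\<And>x. \<bar>x\<bar> > b \<Longrightarrow> deriv \<phi> x = 0" "b > 0"
    by (auto simp: b_def intro!: R R')
  have t1: "test_function (deriv \<phi>)" using test_function_deriv_test[OF assms, of 1] by simp
  define g where "g x = cis (- (x * \<xi>)) * cplx (deriv \<phi>) x - \<i> * \<xi> * (cis (- (x * \<xi>)) * cplx \<phi> x)" for x
  have d: "((\<lambda>x. cis (- (x * \<xi>)) * cplx \<phi> x) has_vector_derivative g x) (at x)" for x
  proof -
    have 1: "(cplx \<phi> has_vector_derivative cplx (deriv \<phi>) x) (at x)"
      using test_function_deriv[OF assms, of 0 x]
      by (intro has_vector_derivative_of_real) (simp add: has_real_derivative_iff_has_vector_derivative)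
    have 2: "((\<lambda>x. cis (- (x * \<xi>))) has_vector_derivative (- \<i> * \<xi> * cis (- (x * \<xi>)))) (at x)"
    proof -
      have "((\<lambda>x. exp (x *\<^sub>R (- \<i> * \<xi>))) has_vector_derivative exp (x *\<^sub>R (- \<i> * \<xi>)) * (- \<i> * \<xi>)) (at x)"
        by (rule exp_scaleR_has_vector_derivative_right)
      then show ?thesis by (simp add: cis_conv_exp scaleR_conv_of_real mult_ac)
    qed
    show ?thesis using has_vector_derivative_mult[OF 2 1] by (simp add: g_def algebra_simps)
  qed
  have c: "continuous_on UNIV \<phi>" "continuous_on UNIV (deriv \<phi>)"
    using test_function_compact_cont(1)[OF assms] test_function_compact_cont(1)[OF t1] by (auto simp: compact_cont_def)
  have gc: "continuous_on {-b..b} g" unfolding g_def cis_conv_exp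
    by (intro continuous_intros continuous_on_subset[OF c(1)] continuous_on_subset[OF c(2)]) auto
  have "(LINT x|lborel. indicator {-b..b} x *\<^sub>R g x) = cis (- (b * \<xi>)) * cplx \<phi> b - cis (- (- b * \<xi>)) * cplx \<phi> (- b)"
    by (rule integral_FTC_Icc[OF _ _ gc]) (use b d in \<open>auto intro: has_vector_derivative_at_within\<close>)
  also have "(\<lambda>x. indicator {-b..b} x *\<^sub>R g x) = g"
  proof
    fix x show "indicator {-b..b} x *\<^sub>R g x = g x"
      using b(3,4)[of x] by (cases "\<bar>x\<bar> > b") (auto simp: indicator_def g_def)
  qed
  finally have "(LINT x|lborel. g x) = 0" using b by simp
  moreover have "(LINT x|lborel. g x) = ft (cplx (deriv \<phi>)) \<xi> - \<i> * \<xi> * ft (cplx \<phi>) \<xi>"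
    unfolding g_def ft_def
    by (subst Bochner_Integration.integral_diff)
       (use test_function_L2(2)[OF assms] test_function_L2(2)[OF t1] in \<open>auto intro!: integrable_mult_right ft_integrable\<close>)
  ultimately show ?thesis by simp
qed

lemma ft_deriv_iter:
  assumes "test_function \<phi>"
  shows "ft (cplx ((deriv ^^ k) \<phi>)) \<xi> = (\<i> * \<xi>) ^ k * ft (cplx \<phi>) \<xi>"
proof (induction k)
  case (Suc k)
  then show ?case using ft_deriv[OF test_function_deriv_test[OF assms, of k], of \<xi>] by simp
qed simp

text \<open>The bump lives in an interval of radius \<open>1 / N\<close>, so for frequencies up to
  \<open>N\<close> the phase stays below 1, hence below \<open>pi / 3\<close>. The cosine is then at
  least 1/2 and half of the mass survives, which is \<open>c\<close>. On this band the transform can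
  be divided out of identities.\<close>

lemma ft_bump:
  assumes N: "N > 0"
  obtains \<phi> c where "test_function \<phi>" "c > 0" "\<And>\<xi>. \<bar>\<xi>\<bar> \<le> N \<Longrightarrow> c \<le> cmod (ft (cplx \<phi>) \<xi>)"
proof -
  define \<phi> where "\<phi> = bump N"
  note \<phi> = test_function_bump[OF N, folded \<phi>_def]
  note i = compact_cont_integrable[OF test_function_compact_cont(1)[OF \<phi>(1)]]
  define c where "c = (LINT x|lborel. \<phi> x) / 2"
  have "0 < exp (- 4) * (1 / N)" using N by simp
  also have "\<dots> = (LINT x|lborel. exp (- 4) * indicator {- (1 / (2 * N))..1 / (2 * N)} x)"
    using N by simp
  also have "\<dots> \<le> (LINT x|lborel. \<phi> x)"
  proof (rule integral_mono[OF integrable_indicator_interval i])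
    fix x show "exp (- 4) * indicator {- (1 / (2 * N))..1 / (2 * N)} x \<le> \<phi> x"
    proof (cases "x \<in> {- (1 / (2 * N))..1 / (2 * N)}")
      case True
      then have "\<bar>x\<bar> \<le> 1 / (2 * N)" by auto
      then have "\<bar>N * x\<bar> \<le> 1 / 2" using N by (simp add: abs_mult field_simps)
      from \<phi>(4)[OF this] True show ?thesis by simp
    qed (use \<phi>(2) in simp)
  qed
  finally have c: "c > 0" by (simp add: c_def)
  have "c \<le> cmod (ft (cplx \<phi>) \<xi>)" if \<xi>: "\<bar>\<xi>\<bar> \<le> N" for \<xi>
  proof -
    have "c = (LINT x|lborel. \<phi> x / 2)" by (simp add: c_def)
    also have "\<dots> \<le> (LINT x|lborel. Re (cis (- (x * \<xi>)) * cplx \<phi> x))"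
    proof (rule integral_mono)
      show "integrable lborel (\<lambda>x. \<phi> x / 2)" using i by simp
      show "integrable lborel (\<lambda>x. Re (cis (- (x * \<xi>)) * cplx \<phi> x))"
        by (intro integrable_Re ft_integrable test_function_L2 \<phi>)
      fix x
      have "\<phi> x / 2 \<le> cos (x * \<xi>) * \<phi> x"
      proof (cases "\<bar>N * x\<bar> > 1")
        case False
        have "\<bar>x * \<xi>\<bar> \<le> \<bar>x\<bar> * N" unfolding abs_mult using \<xi> by (intro mult_left_mono) auto
        also have "\<dots> \<le> 1" using False N by (simp add: abs_mult mult.commute)
        also have "\<dots> \<le> pi / 3" using pi_gt3 by simp
        finally have "cos (pi / 3) \<le> cos \<bar>x * \<xi>\<bar>" by (intro cos_monotone_0_pi_le) (use pi_gt3 in auto)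
        then have "1 / 2 \<le> cos (x * \<xi>)" by (simp add: cos_60)
        from mult_right_mono[OF this \<phi>(2)[of x]] show ?thesis by simp
      qed (use \<phi>(3)[of x] in simp)
      then show "\<phi> x / 2 \<le> Re (cis (- (x * \<xi>)) * cplx \<phi> x)" by simp
    qed
    also have "\<dots> = Re (ft (cplx \<phi>) \<xi>)"
      unfolding ft_def by (intro integral_Re ft_integrable test_function_L2 \<phi>)
    also have "\<dots> \<le> cmod (ft (cplx \<phi>) \<xi>)" by (rule complex_Re_le_cmod)
    finally show ?thesis .
  qed
  with \<phi>(1) c show ?thesis using that by blast
qed

lemma L2_bounded_mult:
  fixes f m :: "real \<Rightarrow> complex"
  assumes f: "L2 f" and m: "m \<in> borel_measurable borel" "\<And>x. cmod (m x) \<le> B"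
  shows "L2 (\<lambda>x. m x * f x)"
proof -
  note [measurable] = L2D(1)[OF f] m(1)
  have "B \<ge> 0" using order_trans[OF norm_ge_zero m(2)] .
  then have "norm (m x * f x) \<le> norm (B *\<^sub>R f x)" for x
    using m(2)[of x] by (simp add: norm_mult mult_right_mono)
  then show ?thesis by (intro L2_bound(1)[OF L2_scaleR(1)[OF f, of B]]) auto
qed

lemma ft_zero_imp_AE_zero:
  assumes h: "integrable lborel h" "L2 h" and z: "\<And>y. ft h y = 0"
  shows "AE x in lborel. h x = 0"
proof (rule L2_eq_0_AE[OF h(2)])
  have "ft h = (\<lambda>y. 0)" using z by auto
  then show "L2_norm h = 0" using Plancherel_L1_L2[OF h] by simp
qed

lemma test_mult_integrable:
  assumes \<phi>: "test_function \<phi>" and F: "L2 F"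
  defines "\<Phi> \<equiv> ft (cplx \<phi>)"
  shows "integrable lborel (\<lambda>\<xi>. cnj (\<Phi> \<xi>) * F \<xi>)" "L2 (\<lambda>\<xi>. cnj (\<Phi> \<xi>) * F \<xi>)"
proof -
  note t = test_function_L2[OF \<phi>]
  have P: "L2 \<Phi>" unfolding \<Phi>_def by (rule Plancherel_le(1)[OF t(2,1)])
  show "integrable lborel (\<lambda>\<xi>. cnj (\<Phi> \<xi>) * F \<xi>)"
    by (rule L2_mult_integrable_complex(1)[OF L2_cnj[OF P] F])
  show "L2 (\<lambda>\<xi>. cnj (\<Phi> \<xi>) * F \<xi>)"
    by (rule L2_bounded_mult[OF F L2D(1)[OF L2_cnj[OF P]]]) (auto simp: \<Phi>_def intro: ft_bound)
qed

text \<open>Parseval, with the translation turned into the phase \<open>cis (- (y * \<xi>))\<close>.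
  Integrals against all translates of one test function are thus the values of a single Fourier
  transform, and a statement about all of them becomes one about an integrable function of
  \<xi>.\<close>

lemma test_function_pairing:
  assumes \<phi>: "test_function \<phi>" and F: "has_FT f F"
  shows "(LINT x|lborel. cplx \<phi> (x - y) * f x) = 1 / (2 * pi) * ft (\<lambda>\<xi>. cnj (ft (cplx \<phi>) \<xi>) * F \<xi>) (- y)"
proof -
  have t: "test_function (\<lambda>x. \<phi> (x - y))" by (rule test_function_shift[OF \<phi>])
  have P: "has_FT (\<lambda>x. cplx \<phi> (x - y)) (ft (\<lambda>x. cplx \<phi> (x - y)))"
    using has_FT_ft[OF test_function_L2(2)[OF t] test_function_L2(1)[OF t]] .
  have "ft (\<lambda>\<xi>. cnj (ft (cplx \<phi>) \<xi>) * F \<xi>) (- y) = (LINT \<xi>|lborel. F \<xi> * cnj (ft (\<lambda>x. cplx \<phi> (x - y)) \<xi>))"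
    unfolding ft_shift[OF test_function_L2(2)[OF \<phi>]] unfolding ft_def[of "\<lambda>\<xi>. cnj (ft (cplx \<phi>) \<xi>) * F \<xi>"]
    by (rule Bochner_Integration.integral_cong) (simp_all add: cis_cnj mult_ac)
  also have "\<dots> = 2 * pi * (LINT x|lborel. f x * cplx \<phi> (x - y))"
    unfolding has_FT_Parseval[OF F P] by simp
  finally show ?thesis by (simp add: mult.commute)
qed

section \<open>Weak derivatives as Fourier multipliers\<close>

lemma cnj_ii_power: "cnj ((\<i> * complex_of_real \<xi>) ^ k) = (-1) ^ k * (\<i> * complex_of_real \<xi>) ^ k"
proof -
  have "cnj ((\<i> * complex_of_real \<xi>) ^ k) = ((-1) * (\<i> * complex_of_real \<xi>)) ^ k" by simp
  then show ?thesis by (simp only: power_mult_distrib)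
qed

text \<open>The hypothesis for all translates of one \<phi> says that the integrable function
  \<open>h\<close> has a vanishing Fourier transform, so \<open>h\<close> is zero almost everywhere.
  With \<phi> from \<open>ft_bump\<close> the factor \<Phi> cancels on a band; countably many bands
  exhaust the line.\<close>

lemma weak_deriv_imp_FT:
  assumes F: "has_FT f F" and G: "has_FT g G"
    and weak: "\<And>\<phi>. test_function \<phi> \<Longrightarrow> (LINT x|lborel. cplx ((deriv ^^ k) \<phi>) x * f x) = (-1) ^ k * (LINT x|lborel. cplx \<phi> x * g x)"
  shows "AE \<xi> in lborel. G \<xi> = (\<i> * \<xi>) ^ k * F \<xi>"
proof -
  have "AE \<xi> in lborel. \<bar>\<xi>\<bar> \<le> real (Suc n) \<longrightarrow> G \<xi> = (\<i> * \<xi>) ^ k * F \<xi>" for n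
  proof -
    obtain \<phi> c where \<phi>: "test_function \<phi>" and c: "c > 0" "\<And>\<xi>. \<bar>\<xi>\<bar> \<le> real (Suc n) \<Longrightarrow> c \<le> cmod (ft (cplx \<phi>) \<xi>)"
      using ft_bump[of "real (Suc n)"] by auto
    define \<Phi> \<Psi> where "\<Phi> = ft (cplx \<phi>)" and "\<Psi> = ft (cplx ((deriv ^^ k) \<phi>))"
    have \<Psi>: "\<Psi> \<xi> = (\<i> * \<xi>) ^ k * \<Phi> \<xi>" for \<xi> unfolding \<Psi>_def \<Phi>_def by (rule ft_deriv_iter[OF \<phi>])
    note t' = test_function_deriv_test[OF \<phi>, of k]
    note 1 = test_mult_integrable[OF t' has_FT_L2(2)[OF F], folded \<Psi>_def]
    note 2 = test_mult_integrable[OF \<phi> has_FT_L2(2)[OF G], folded \<Phi>_def]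
    define h where "h \<xi> = cnj (\<Psi> \<xi>) * F \<xi> - (-1) ^ k * (cnj (\<Phi> \<xi>) * G \<xi>)" for \<xi>
    have "AE \<xi> in lborel. h \<xi> = 0"
    proof (rule ft_zero_imp_AE_zero)
      show "integrable lborel h" unfolding h_def using 1(1) 2(1) by (intro Bochner_Integration.integrable_diff integrable_mult_right)
      show "L2 h" unfolding h_def using 1(2) 2(2) by (intro L2_diff L2_cmult)
      fix z
      have "(LINT x|lborel. cplx ((deriv ^^ k) \<phi>) (x - (- z)) * f x) = (-1) ^ k * (LINT x|lborel. cplx \<phi> (x - (- z)) * g x)"
        using weak[OF test_function_shift[OF \<phi>, of "- z"]] unfolding deriv_iter_shift[OF \<phi>] .
      then have "ft (\<lambda>\<xi>. cnj (\<Psi> \<xi>) * F \<xi>) z = (-1) ^ k * ft (\<lambda>\<xi>. cnj (\<Phi> \<xi>) * G \<xi>) z"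
        unfolding test_function_pairing[OF t' F] test_function_pairing[OF \<phi> G] \<Phi>_def \<Psi>_def by simp
      then show "ft h z = 0" unfolding h_def using 1(1) 2(1) by (subst ft_diff) (auto simp: ft_cmult)
    qed
    then show ?thesis
    proof eventually_elim
      case (elim \<xi>)
      show ?case
      proof
        assume "\<bar>\<xi>\<bar> \<le> real (Suc n)"
        with c have "\<Phi> \<xi> \<noteq> 0" unfolding \<Phi>_def by fastforce
        moreover have "h \<xi> = (-1) ^ k * cnj (\<Phi> \<xi>) * ((\<i> * \<xi>) ^ k * F \<xi> - G \<xi>)"
          unfolding h_def \<Psi> complex_cnj_mult[of "(\<i> * \<xi>) ^ k"] cnj_ii_power by (simp only: algebra_simps)
        ultimately show "G \<xi> = (\<i> * \<xi>) ^ k * F \<xi>" using elim by simp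
      qed
    qed
  qed
  then have "AE \<xi> in lborel. \<forall>n. \<bar>\<xi>\<bar> \<le> real (Suc n) \<longrightarrow> G \<xi> = (\<i> * \<xi>) ^ k * F \<xi>" unfolding AE_all_countable by (rule allI)
  then show ?thesis
  proof eventually_elim
    case (elim \<xi>)
    have "\<bar>\<xi>\<bar> \<le> real (Suc (nat \<lceil>\<bar>\<xi>\<bar>\<rceil>))" by linarith
    with elim show ?case by blast
  qed
qed

lemma FT_imp_weak_deriv:
  assumes F: "has_FT f F" and G: "has_FT g (\<lambda>\<xi>. (\<i> * \<xi>) ^ k * F \<xi>)" and \<phi>: "test_function \<phi>"
  shows "(LINT x|lborel. cplx ((deriv ^^ k) \<phi>) x * f x) = (-1) ^ k * (LINT x|lborel. cplx \<phi> x * g x)"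
proof -
  have e: "cnj (ft (cplx ((deriv ^^ k) \<phi>)) \<xi>) * F \<xi> = (-1) ^ k * (cnj (ft (cplx \<phi>) \<xi>) * ((\<i> * \<xi>) ^ k * F \<xi>))" for \<xi>
    unfolding ft_deriv_iter[OF \<phi>] complex_cnj_mult[of "(\<i> * \<xi>) ^ k"] cnj_ii_power by (simp only: mult_ac)
  show ?thesis
    using test_function_pairing[OF test_function_deriv_test[OF \<phi>, of k] F, of 0] test_function_pairing[OF \<phi> G, of 0]
    unfolding e ft_cmult by simp
qed

lemma has_FT_cong_AE_left:
  assumes F: "has_FT f F" and AE: "AE x in lborel. f x = g x" and g: "g \<in> borel_measurable borel"
  shows "has_FT g F"
proof -
  have f2: "L2 f" using F by (rule has_FT_L2)
  have g2: "L2 g" using L2_cong_AE(1)[OF L2D(1)[OF f2] g AE] f2 by simp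
  obtain G where G: "has_FT g G" using has_FT_exists[OF g2] by blast
  note [measurable] = L2D(1)[OF f2] g
  have "L2_norm (\<lambda>x. g x - f x) = L2_norm (\<lambda>x::real. 0::complex)"
    by (rule L2_cong_AE(2)) (use AE in \<open>auto elim: eventually_mono\<close>)
  then have "L2_norm (\<lambda>\<xi>. G \<xi> - F \<xi>) = 0" using has_FT_norm[OF has_FT_diff[OF G F]] by simp
  then have "AE \<xi> in lborel. G \<xi> = F \<xi>" by (intro L2_norm_diff_0_AE has_FT_L2(2)[OF G] has_FT_L2(2)[OF F])
  then show ?thesis using has_FT_cong_AE[OF G _ L2D(1)[OF has_FT_L2(2)[OF F]]] by simp
qed

lemma L2_cplx: "L2 (cplx f) \<longleftrightarrow> L2 f" "L2_norm (cplx f) = L2_norm f"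
proof -
  have "f \<in> borel_measurable borel" if "cplx f \<in> borel_measurable borel"
    using measurable_compose[OF that borel_measurable_Re] unfolding complex.sel Re_complex_of_real .
  moreover have "cplx f \<in> borel_measurable borel" if "f \<in> borel_measurable borel"
    using measurable_compose[OF that borel_measurable_of_real] .
  ultimately show "L2 (cplx f) \<longleftrightarrow> L2 f" unfolding L2_def norm_of_real power2_abs real_norm_def by fastforce
  show "L2_norm (cplx f) = L2_norm f" by (simp add: L2_norm_def)
qed

lemma has_FT_hermitian:
  assumes F: "has_FT (cplx f) F" shows "AE \<xi> in lborel. cnj (F (- \<xi>)) = F \<xi>"
  using has_FT_unique[OF has_FT_cnj[OF F]] F by simp

text \<open>Transforms of real functions have Hermitian symmetry, and the multiplier
  \<open>(\<i> * \<xi>) ^ k\<close> preserves it. The inverse transform is therefore real almost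
  everywhere and may be replaced by its real part, as is required of a weak derivative of a real
  function.\<close>

lemma has_FT_multiplier_real:
  assumes F: "has_FT (cplx f) F" and L: "L2 (\<lambda>\<xi>. (\<i> * \<xi>) ^ k * F \<xi>)"
  shows "\<exists>g. has_FT (cplx g) (\<lambda>\<xi>. (\<i> * \<xi>) ^ k * F \<xi>)"
proof -
  obtain g where G: "has_FT g (\<lambda>\<xi>. (\<i> * \<xi>) ^ k * F \<xi>)" using has_FT_surj[OF L] by blast
  have "AE \<xi> in lborel. cnj ((\<i> * complex_of_real (- \<xi>)) ^ k * F (- \<xi>)) = (\<i> * \<xi>) ^ k * F \<xi>"
    using has_FT_hermitian[OF F] by eventually_elim simp
  from has_FT_cong_AE[OF has_FT_cnj[OF G] this L2D(1)[OF L]]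
  have "has_FT (\<lambda>x. cnj (g x)) (\<lambda>\<xi>. (\<i> * \<xi>) ^ k * F \<xi>)" .
  from has_FT_inj[OF this G] have "AE x in lborel. g x = cplx (\<lambda>x. Re (g x)) x"
    by eventually_elim (simp add: complex_eq_iff)
  from has_FT_cong_AE_left[OF G this] L2D(1)[OF has_FT_L2(1)[OF G]] show ?thesis by auto
qed

section \<open>Transfer to vector-valued functions, component by component\<close>

lemma vec_norm_sq: "(norm (x :: ('a::real_inner) ^ 'm))\<^sup>2 = (\<Sum>i\<in>UNIV. (norm (x $ i))\<^sup>2)"
  by (simp add: power2_norm_eq_inner inner_vec_def)

lemma borel_measurable_vec_nth: 
  fixes f :: "real \<Rightarrow> ('a::euclidean_space) ^ 'm"
  assumes "f \<in> borel_measurable borel" shows "(\<lambda>x. f x $ i) \<in> borel_measurable borel"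
  using measurable_compose[OF assms borel_measurable_continuous_onI[OF linear_continuous_on[OF bounded_linear_vec_nth]]] .

lemma borel_measurable_vecI:
  fixes f :: "real \<Rightarrow> ('a::euclidean_space) ^ 'm"
  assumes "\<And>i. (\<lambda>x. f x $ i) \<in> borel_measurable borel" shows "f \<in> borel_measurable borel"
  unfolding borel_measurable_euclidean_space[of f]
proof
  fix b :: "'a ^ 'm" assume "b \<in> Basis"
  then obtain i u where "b = axis i u" by (auto simp: Basis_vec_def)
  then show "(\<lambda>x. f x \<bullet> b) \<in> borel_measurable borel" using assms[of i] by (simp add: inner_axis)
qed

lemma L2_vec:
  fixes f :: "real \<Rightarrow> ('a::euclidean_space) ^ 'm"
  shows "L2 f \<longleftrightarrow> (\<forall>i. L2 (\<lambda>x. f x $ i))"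
proof (intro iffI allI)
  fix i assume f: "L2 f"
  show "L2 (\<lambda>x. f x $ i)"
    by (rule L2_bound[OF f borel_measurable_vec_nth[OF L2D(1)[OF f]]]) (simp add: Finite_Cartesian_Product.norm_nth_le)
next
  assume f: "\<forall>i. L2 (\<lambda>x. f x $ i)"
  then show "L2 f" unfolding L2_def vec_norm_sq
    using borel_measurable_vecI[of f] by (auto simp: L2_def)
qed

lemma L2_nth: "L2 f \<Longrightarrow> L2 (\<lambda>x. f x $ i)"
  by (simp add: L2_vec[of f])

lemma L2_norm_vec:
  fixes f :: "real \<Rightarrow> ('a::euclidean_space) ^ 'm"
  assumes "L2 f" shows "(L2_norm f)\<^sup>2 = (\<Sum>i\<in>UNIV. (L2_norm (\<lambda>x. f x $ i))\<^sup>2)"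
  using assms unfolding L2_vec L2_norm_sq vec_norm_sq
  by (intro Bochner_Integration.integral_sum) (simp add: L2_def)

lemma L2_norm_nth_le:
  fixes f :: "real \<Rightarrow> ('a::euclidean_space) ^ 'm"
  assumes f: "L2 f" shows "L2_norm (\<lambda>x. f x $ i) \<le> L2_norm f"
  by (rule L2_bound(2)[OF f borel_measurable_vec_nth[OF L2D(1)[OF f]]]) (simp add: Finite_Cartesian_Product.norm_nth_le)

abbreviation comp :: "(real \<Rightarrow> real ^ 'm) \<Rightarrow> 'm \<Rightarrow> real \<Rightarrow> complex"
  where "comp f i \<equiv> cplx (\<lambda>x. f x $ i)"

definition vec_FT :: "(real \<Rightarrow> real ^ 'm) \<Rightarrow> (real \<Rightarrow> complex ^ 'm) \<Rightarrow> bool"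
  where "vec_FT f F \<longleftrightarrow> (\<forall>i. has_FT (comp f i) (\<lambda>\<xi>. F \<xi> $ i))"

lemma vec_FT_L2:
  assumes "vec_FT f F" shows "L2 f" "L2 F"
proof -
  have "L2 (comp f i)" "L2 (\<lambda>\<xi>. F \<xi> $ i)" for i using assms by (auto simp: vec_FT_def dest: has_FT_L2)
  then show "L2 f" "L2 F" by (auto simp: L2_vec[of f] L2_vec[of F] L2_cplx)
qed

lemma fourier_nth: "fourier f \<xi> $ i = ft (comp f i) \<xi>"
  by (simp add: fourier_def ft_def cis_conv_exp)

lemma trunc_nth: "comp (trunc R f) i = trunc R (comp f i)"
  by (rule ext) (simp only: vector_scaleR_component real_scaleR_def of_real_mult scaleR_conv_of_real[where 'a=complex])

text \<open>Convergence of vectors in norm is convergence of each component. This hands the scalar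
  theory over to \<open>fourier_L2\<close>, the transform in terms of which the estimates are
  stated.\<close>

lemma has_fourier_L2_iff: "has_fourier_L2 f F \<longleftrightarrow> vec_FT f F"
proof (cases "L2 f \<and> L2 F")
  case True
  then have f: "\<And>i. L2 (comp f i)" and F: "\<And>i. L2 (\<lambda>\<xi>. F \<xi> $ i)" by (auto simp: L2_vec[of f] L2_vec[of F] L2_cplx)
  define D where "D R \<xi> = F \<xi> - fourier (trunc R f) \<xi>" for R \<xi>
  have Di: "D R \<xi> $ i = F \<xi> $ i - ft (trunc R (comp f i)) \<xi>" for R \<xi> i
    unfolding D_def vector_minus_component fourier_nth trunc_nth ..
  have D2: "L2 (D R)" for R unfolding L2_vec Di by (intro allI L2_diff F ft_trunc_L2 f)
  have "((\<lambda>R. L2_norm (D R)) \<longlongrightarrow> 0) at_top \<longleftrightarrow> (\<forall>i. ((\<lambda>R. L2_norm (\<lambda>\<xi>. D R \<xi> $ i)) \<longlongrightarrow> 0) at_top)"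
  proof (intro iffI allI)
    fix i assume lim: "((\<lambda>R. L2_norm (D R)) \<longlongrightarrow> 0) at_top"
    show "((\<lambda>R. L2_norm (\<lambda>\<xi>. D R \<xi> $ i)) \<longlongrightarrow> 0) at_top"
      by (rule tendsto_sandwich[OF _ _ tendsto_const lim]) (auto intro!: always_eventually L2_norm_nth_le D2)
  next
    assume lim: "\<forall>i. ((\<lambda>R. L2_norm (\<lambda>\<xi>. D R \<xi> $ i)) \<longlongrightarrow> 0) at_top"
    have "((\<lambda>R. sqrt (\<Sum>i\<in>UNIV. (L2_norm (\<lambda>\<xi>. D R \<xi> $ i))\<^sup>2)) \<longlongrightarrow> sqrt (\<Sum>i\<in>(UNIV::'a set). 0\<^sup>2)) at_top"
      using lim by (intro tendsto_intros) auto
    then show "((\<lambda>R. L2_norm (D R)) \<longlongrightarrow> 0) at_top" unfolding L2_norm_vec[OF D2, symmetric] by simp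
  qed
  then show ?thesis unfolding has_fourier_L2_def vec_FT_def has_FT_def using True f F by (simp add: D_def[symmetric] Di)
next
  case False
  then show ?thesis using vec_FT_L2[of f F] by (auto simp: has_fourier_L2_def)
qed

lemma vec_FT_exists:
  assumes "L2 f" shows "\<exists>F. vec_FT f F"
proof -
  have "\<forall>i. \<exists>F. has_FT (comp f i) F" using assms by (auto simp: L2_vec[of f] L2_cplx intro!: has_FT_exists)
  then obtain F where "\<And>i. has_FT (comp f i) (F i)" by metis
  then show ?thesis by (intro exI[of _ "\<lambda>\<xi>. \<chi> i. F i \<xi>"]) (simp add: vec_FT_def)
qed

lemma vec_FT_fourier_L2: "L2 f \<Longrightarrow> vec_FT f (fourier_L2 f)"
  unfolding fourier_L2_def has_fourier_L2_iff by (rule someI_ex[OF vec_FT_exists])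

lemma AE_vec_eq:
  fixes F G :: "real \<Rightarrow> 'a ^ ('m::finite)"
  assumes "\<And>i. AE \<xi> in lborel. F \<xi> $ i = G \<xi> $ i" shows "AE \<xi> in lborel. F \<xi> = G \<xi>"
  using assms by (simp add: vec_eq_iff AE_all_countable)

lemma vec_FT_unique: "vec_FT f F \<Longrightarrow> vec_FT f G \<Longrightarrow> AE \<xi> in lborel. F \<xi> = G \<xi>"
  by (rule AE_vec_eq) (auto simp: vec_FT_def intro: has_FT_unique)

lemma vec_FT_norm:
  assumes F: "vec_FT f F" shows "L2_norm F = sqrt (2 * pi) * L2_norm f"
proof -
  have "(L2_norm F)\<^sup>2 = (\<Sum>i\<in>UNIV. (sqrt (2 * pi) * L2_norm (\<lambda>x. f x $ i))\<^sup>2)"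
    using F unfolding L2_norm_vec[OF vec_FT_L2(2)[OF F]] vec_FT_def
    by (intro sum.cong refl) (metis L2_cplx(2) has_FT_norm)
  also have "\<dots> = (sqrt (2 * pi) * L2_norm f)\<^sup>2"
    unfolding power_mult_distrib L2_norm_vec[OF vec_FT_L2(1)[OF F]] sum_distrib_left ..
  finally show ?thesis by (simp add: power2_eq_iff_nonneg)
qed

lemma vec_FT_fourier:
  assumes f: "integrable lborel f" "L2 f" shows "vec_FT f (fourier f)"
proof -
  have "integrable lborel (comp f i)" for i
    using integrable_bounded_linear[OF bounded_linear_vec_nth f(1)] by simp
  then show ?thesis unfolding vec_FT_def fourier_nth using f(2) by (auto simp: L2_vec[of f] L2_cplx intro!: has_FT_ft)
qed

lemma test_mult_nth:
  assumes \<phi>: "test_function \<phi>" and f: "L2 (f :: real \<Rightarrow> real ^ 'm)"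
  shows "integrable lborel (\<lambda>x. \<phi> x *\<^sub>R f x)"
    "complex_of_real ((LINT x|lborel. \<phi> x *\<^sub>R f x) $ i) = (LINT x|lborel. cplx \<phi> x * comp f i x)"
proof -
  have p: "L2 \<phi>" using compact_cont_L2[OF test_function_compact_cont(1)[OF \<phi>]] .
  note [measurable] = L2D(1)[OF p] L2D(1)[OF f]
  show i: "integrable lborel (\<lambda>x. \<phi> x *\<^sub>R f x)"
    by (rule Bochner_Integration.integrable_bound[OF L2_mult_integrable[OF p f]]) auto
  show "complex_of_real ((LINT x|lborel. \<phi> x *\<^sub>R f x) $ i) = (LINT x|lborel. cplx \<phi> x * comp f i x)"
    unfolding integral_bounded_linear[OF bounded_linear_vec_nth i, symmetric] integral_complex_of_real[symmetric]
    by simp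
qed

lemma has_L2_weak_deriv_iff:
  assumes F: "vec_FT f F" and G: "vec_FT g G"
  shows "has_L2_weak_deriv k f g \<longleftrightarrow> (AE \<xi> in lborel. \<forall>i. G \<xi> $ i = (\<i> * \<xi>) ^ k * F \<xi> $ i)"
proof -
  note Fi = F[unfolded vec_FT_def, rule_format] and Gi = G[unfolded vec_FT_def, rule_format]
  note L2 = vec_FT_L2(1)[OF F] vec_FT_L2(1)[OF G]
  have "has_L2_weak_deriv k f g \<longleftrightarrow> (\<forall>\<phi>. test_function \<phi> \<longrightarrow> (\<forall>i.
     (LINT x|lborel. cplx ((deriv ^^ k) \<phi>) x * comp f i x) = (-1) ^ k * (LINT x|lborel. cplx \<phi> x * comp g i x)))"
  proof -
    have sgn: "complex_of_real a = (-1) ^ k * complex_of_real b \<longleftrightarrow> a = (-1) ^ k * b" for a b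
    proof -
      have "(-1) ^ k * complex_of_real b = complex_of_real ((-1) ^ k * b)" by simp
      then show ?thesis by (simp only: of_real_eq_iff)
    qed
    have "(LINT x|lborel. (deriv ^^ k) \<phi> x *\<^sub>R f x) = (-1) ^ k *\<^sub>R (LINT x|lborel. \<phi> x *\<^sub>R g x) \<longleftrightarrow>
       (\<forall>i. (LINT x|lborel. cplx ((deriv ^^ k) \<phi>) x * comp f i x) = (-1) ^ k * (LINT x|lborel. cplx \<phi> x * comp g i x))"
      if \<phi>: "test_function \<phi>" for \<phi>
      unfolding test_mult_nth(2)[OF \<phi> L2(2), symmetric] test_mult_nth(2)[OF test_function_deriv_test[OF \<phi>] L2(1), symmetric]
      unfolding vec_eq_iff vector_scaleR_component real_scaleR_def sgn ..
    then show ?thesis unfolding has_L2_weak_deriv_def using L2 by auto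
  qed
  also have "\<dots> \<longleftrightarrow> (\<forall>i. AE \<xi> in lborel. G \<xi> $ i = (\<i> * \<xi>) ^ k * F \<xi> $ i)"
  proof (intro iffI allI impI)
    fix i assume "\<forall>\<phi>. test_function \<phi> \<longrightarrow> (\<forall>i. (LINT x|lborel. cplx ((deriv ^^ k) \<phi>) x * comp f i x)
        = (-1) ^ k * (LINT x|lborel. cplx \<phi> x * comp g i x))"
    then show "AE \<xi> in lborel. G \<xi> $ i = (\<i> * \<xi>) ^ k * F \<xi> $ i" by (intro weak_deriv_imp_FT[OF Fi Gi]) blast
  next
    fix \<phi> i assume AE: "\<forall>i. AE \<xi> in lborel. G \<xi> $ i = (\<i> * \<xi>) ^ k * F \<xi> $ i" and \<phi>: "test_function \<phi>"
    have m: "(\<lambda>\<xi>. (\<i> * complex_of_real \<xi>) ^ k * F \<xi> $ i) \<in> borel_measurable borel"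
      using L2D(1)[OF has_FT_L2(2)[OF Fi]] by measurable
    show "(LINT x|lborel. cplx ((deriv ^^ k) \<phi>) x * comp f i x) = (-1) ^ k * (LINT x|lborel. cplx \<phi> x * comp g i x)"
      by (rule FT_imp_weak_deriv[OF Fi has_FT_cong_AE[OF Gi AE[rule_format] m] \<phi>])
  qed
  finally show ?thesis by (simp add: AE_all_countable)
qed

lemma norm_mult_power_nth:
  fixes z w :: "complex ^ 'm"
  assumes "\<And>i. w $ i = (\<i> * complex_of_real \<xi>) ^ k * z $ i" shows "norm w = norm (\<xi> ^ k *\<^sub>R z)"
proof -
  have "(norm w)\<^sup>2 = (norm (\<xi> ^ k *\<^sub>R z))\<^sup>2"
    unfolding vec_norm_sq by (simp add: assms norm_mult norm_power power_abs)
  then show ?thesis by (simp add: power2_eq_iff_nonneg)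
qed

lemma weak_deriv_FT_norm:
  assumes F: "vec_FT f F" and g: "has_L2_weak_deriv k f g"
  shows "L2 (\<lambda>\<xi>. \<xi> ^ k *\<^sub>R F \<xi>)" "sqrt (2 * pi) * L2_norm g = L2_norm (\<lambda>\<xi>. \<xi> ^ k *\<^sub>R F \<xi>)"
proof -
  have "L2 g" using g by (simp add: has_L2_weak_deriv_def)
  then obtain G where G: "vec_FT g G" using vec_FT_exists by blast
  have "AE \<xi> in lborel. \<forall>i. G \<xi> $ i = (\<i> * \<xi>) ^ k * F \<xi> $ i" using g has_L2_weak_deriv_iff[OF F G] by simp
  then have AE: "AE \<xi> in lborel. norm (G \<xi>) = norm (\<xi> ^ k *\<^sub>R F \<xi>)"
    by eventually_elim (blast intro: norm_mult_power_nth)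
  note [measurable] = L2D(1)[OF vec_FT_L2(2)[OF F]]
  have m: "(\<lambda>\<xi>. \<xi> ^ k *\<^sub>R F \<xi>) \<in> borel_measurable borel" by measurable
  show 1: "L2 (\<lambda>\<xi>. \<xi> ^ k *\<^sub>R F \<xi>)"
    by (rule L2_bound(1)[OF vec_FT_L2(2)[OF G] m]) (use AE in \<open>auto elim: eventually_mono\<close>)
  have "L2_norm G = L2_norm (\<lambda>\<xi>. \<xi> ^ k *\<^sub>R F \<xi>)"
    by (intro antisym L2_bound(2)[OF vec_FT_L2(2)[OF G] m] L2_bound(2)[OF 1 L2D(1)[OF vec_FT_L2(2)[OF G]]])
       (use AE in \<open>auto elim: eventually_mono\<close>)
  then show "sqrt (2 * pi) * L2_norm g = L2_norm (\<lambda>\<xi>. \<xi> ^ k *\<^sub>R F \<xi>)" using vec_FT_norm[OF G] by simp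
qed

lemma weak_deriv_exists:
  assumes F: "vec_FT f F" and L: "L2 (\<lambda>\<xi>. \<xi> ^ k *\<^sub>R F \<xi>)"
  shows "\<exists>g. has_L2_weak_deriv k f g"
proof -
  note Fi = F[unfolded vec_FT_def, rule_format]
  have "L2 (\<lambda>\<xi>. (\<i> * complex_of_real \<xi>) ^ k * F \<xi> $ i)" for i
  proof (rule L2_bound(1))
    show "L2 (\<lambda>\<xi>. (\<xi> ^ k *\<^sub>R F \<xi>) $ i)" by (rule L2_nth[OF L])
    show "(\<lambda>\<xi>. (\<i> * complex_of_real \<xi>) ^ k * F \<xi> $ i) \<in> borel_measurable borel"
      using L2D(1)[OF has_FT_L2(2)[OF Fi]] by measurable
  qed (simp add: norm_mult norm_power power_abs)
  then have "\<forall>i. \<exists>g. has_FT (cplx g) (\<lambda>\<xi>. (\<i> * \<xi>) ^ k * F \<xi> $ i)"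
    by (intro allI has_FT_multiplier_real[OF Fi])
  from choice[OF this] obtain g where g: "\<forall>i. has_FT (cplx (g i)) (\<lambda>\<xi>. (\<i> * \<xi>) ^ k * F \<xi> $ i)" ..
  have G: "vec_FT (\<lambda>x. \<chi> i. g i x) (\<lambda>\<xi>. \<chi> i. (\<i> * \<xi>) ^ k * F \<xi> $ i)" using g by (simp add: vec_FT_def)
  have "has_L2_weak_deriv k f (\<lambda>x. \<chi> i. g i x)" unfolding has_L2_weak_deriv_iff[OF F G] by simp
  then show ?thesis by (intro exI[of _ "\<lambda>x. \<chi> i. g i x"])
qed

text \<open>All weak derivatives of the same order have this norm, so the representative picked by
  \<open>SOME\<close> is immaterial; integrability of the weighted transform only has to supply
  one.\<close>

lemma weak_deriv_norm:
  assumes F: "vec_FT f F" and L: "L2 (\<lambda>\<xi>. \<xi> ^ k *\<^sub>R F \<xi>)"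
  shows "sqrt (2 * pi) * L2_norm (weak_deriv k f) = L2_norm (\<lambda>\<xi>. \<xi> ^ k *\<^sub>R F \<xi>)"
  unfolding weak_deriv_def by (rule weak_deriv_FT_norm(2)[OF F someI_ex[OF weak_deriv_exists[OF F L]]])

text \<open>In this form regularity passes from the data to the solution by comparing moduli of
  transforms.\<close>

lemma Sobolev_iff:
  assumes F: "vec_FT f F" shows "Sobolev s f \<longleftrightarrow> (\<forall>k\<le>s. L2 (\<lambda>\<xi>. \<xi> ^ k *\<^sub>R F \<xi>))"
proof -
  have "(\<exists>g. has_L2_weak_deriv k f g) \<longleftrightarrow> L2 (\<lambda>\<xi>. \<xi> ^ k *\<^sub>R F \<xi>)" for k
    using weak_deriv_FT_norm(1)[OF F] weak_deriv_exists[OF F] by (intro iffI) (elim exE)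
  then show ?thesis using vec_FT_L2(1)[OF F] by (simp add: Sobolev_def)
qed

section \<open>From time derivatives at fixed points to difference quotients in L2\<close>

lemma integral_nonneg_indicator_CS:
  fixes f :: "real \<Rightarrow> complex"
  assumes c: "continuous_on {a..b} f" and ab: "a \<le> b"
  shows "(cmod (LINT s|lborel. indicator {a..b} s *\<^sub>R f s))\<^sup>2
    \<le> (b - a) * (LINT s|lborel. (cmod (indicator {a..b} s *\<^sub>R f s))\<^sup>2)"
    "L2 (\<lambda>s. indicator {a..b} s *\<^sub>R f s)"
proof -
  have m: "(\<lambda>s. indicator {a..b} s *\<^sub>R f s) \<in> borel_measurable borel"
    by (rule borel_measurable_continuous_on_indicator) (use c in auto)
  have "bounded (f ` {a..b})" by (intro compact_imp_bounded compact_continuous_image c) simp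
  then obtain B where B: "\<And>s. s \<in> {a..b} \<Longrightarrow> cmod (f s) \<le> B"
    unfolding bounded_iff by (metis imageI)
  have i1: "integrable lborel (\<lambda>s::real. (indicator {a..b} s :: real))" using ab by simp
  have e1: "(norm (indicator {a..b} s :: real))\<^sup>2 = indicator {a..b} s" for s :: real by (simp add: indicator_def)
  have I: "L2 (\<lambda>s::real. (indicator {a..b} s :: real))" unfolding L2_def e1 using i1 by auto
  show L: "L2 (\<lambda>s. indicator {a..b} s *\<^sub>R f s)"
    by (rule L2_bound(1)[OF L2_scaleR(1)[OF I, of B] m]) (use B in \<open>force simp: indicator_def\<close>)
  have "cmod (LINT s|lborel. indicator {a..b} s *\<^sub>R f s) \<le> (LINT s|lborel. cmod (indicator {a..b} s *\<^sub>R f s))"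
    by (rule integral_norm_bound)
  also have "\<dots> = (LINT s|lborel. norm (indicator {a..b} s :: real) * norm (indicator {a..b} s *\<^sub>R f s))"
    by (rule Bochner_Integration.integral_cong) (auto simp: indicator_def)
  also have "\<dots> \<le> L2_norm (\<lambda>s::real. (indicator {a..b} s :: real)) * L2_norm (\<lambda>s. indicator {a..b} s *\<^sub>R f s)"
    by (rule L2_Cauchy_Schwarz[OF I L])
  finally have "(cmod (LINT s|lborel. indicator {a..b} s *\<^sub>R f s))\<^sup>2
     \<le> (L2_norm (\<lambda>s::real. (indicator {a..b} s :: real)) * L2_norm (\<lambda>s. indicator {a..b} s *\<^sub>R f s))\<^sup>2"
    by (intro power_mono) auto
  also have "\<dots> = (b - a) * (LINT s|lborel. (cmod (indicator {a..b} s *\<^sub>R f s))\<^sup>2)"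
    unfolding power_mult_distrib L2_norm_sq e1 using ab by simp
  finally show "(cmod (LINT s|lborel. indicator {a..b} s *\<^sub>R f s))\<^sup>2
    \<le> (b - a) * (LINT s|lborel. (cmod (indicator {a..b} s *\<^sub>R f s))\<^sup>2)" .
qed

text \<open>A mean value inequality in \<open>L\<^sup>2\<close>: the derivative in \<open>s\<close> is known only after a pointwise evaluation
  of the Fourier transform, and is integrated with Cauchy-Schwarz and Tonelli.\<close>

lemma L2_mean_value:
  fixes W Z :: "real \<Rightarrow> real \<Rightarrow> complex"
  assumes ab: "a \<le> b"
    and W: "\<And>s. s \<in> {a..b} \<Longrightarrow> integrable lborel (W s)" "\<And>s. s \<in> {a..b} \<Longrightarrow> L2 (W s)"
    and Z: "\<And>s. s \<in> {a..b} \<Longrightarrow> integrable lborel (Z s)" "\<And>s. s \<in> {a..b} \<Longrightarrow> L2 (Z s)"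
    and Z0: "integrable lborel Z0" "L2 Z0"
    and der: "\<And>s y. s \<in> {a..b} \<Longrightarrow> ((\<lambda>s. ft (W s) y) has_vector_derivative ft (Z s) y) (at s within {a..b})"
    and cont: "\<And>s d. s \<in> {a..b} \<Longrightarrow> d > 0 \<Longrightarrow>
      \<exists>\<delta>>0. \<forall>r\<in>{a..b}. \<bar>r - s\<bar> < \<delta> \<longrightarrow> (LINT \<xi>|lborel. cmod (Z r \<xi> - Z s \<xi>)) < d"
    and le: "\<And>s. s \<in> {a..b} \<Longrightarrow> L2_norm (\<lambda>\<xi>. Z s \<xi> - Z0 \<xi>) \<le> e" and e: "e \<ge> 0"
  shows "L2_norm (\<lambda>\<xi>. W b \<xi> - W a \<xi> - (b - a) *\<^sub>R Z0 \<xi>) \<le> (b - a) * e"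
proof -
  define z where "z s y = ft (Z s) y - ft Z0 y" for s y
  have z_ft: "z s = ft (\<lambda>\<xi>. Z s \<xi> - Z0 \<xi>)" if "s \<in> {a..b}" for s
    unfolding z_def using ft_diff[OF Z(1)[OF that] Z0(1)] by auto
  have zL2: "L2 (z s)" and zn: "L2_norm (z s) \<le> sqrt (2 * pi) * e" if s: "s \<in> {a..b}" for s
  proof -
    note i = Bochner_Integration.integrable_diff[OF Z(1)[OF s] Z0(1)] L2_diff[OF Z(2)[OF s] Z0(2)]
    show "L2 (z s)" unfolding z_ft[OF s] by (rule Plancherel_le(1)[OF i])
    show "L2_norm (z s) \<le> sqrt (2 * pi) * e" unfolding z_ft[OF s] Plancherel_L1_L2[OF i]
      using le[OF s] by simp
  qed
  have zy: "\<bar>cmod (ft (Z r) y - ft (Z s) y)\<bar> \<le> (LINT \<xi>|lborel. cmod (Z r \<xi> - Z s \<xi>))" if "r \<in> {a..b}" "s \<in> {a..b}" for r s y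
    unfolding ft_diff[OF Z(1)[OF that(1)] Z(1)[OF that(2)], symmetric] using ft_bound by simp
  \<comment> \<open>Joint continuity provides the measurability on the product that Tonelli
    requires. Continuity in time is uniform in \<open>y\<close>, since two transforms differ by at
    most the \<open>L1\<close> distance of \<open>Z r\<close> and \<open>Z s\<close>.\<close>
  have joint: "continuous_on ({a..b} \<times> UNIV) (\<lambda>p. z (fst p) (snd p))"
    unfolding continuous_on_iff
  proof (intro ballI allI impI)
    fix p :: "real \<times> real" and d :: real assume p: "p \<in> {a..b} \<times> UNIV" and d: "d > 0"
    define s y where "s = fst p" and "y = snd p"
    have sab: "s \<in> {a..b}" using p by (auto simp: s_def)
    obtain \<delta>1 where \<delta>1: "\<delta>1 > 0" "\<And>r. r \<in> {a..b} \<Longrightarrow> \<bar>r - s\<bar> < \<delta>1 \<Longrightarrow> (LINT \<xi>|lborel. cmod (Z r \<xi> - Z s \<xi>)) < d / 2"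
      using cont[OF sab, of "d / 2"] d by auto
    have "continuous_on UNIV (z s)" unfolding z_ft[OF sab]
      by (rule ft_continuous[OF Bochner_Integration.integrable_diff[OF Z(1)[OF sab] Z0(1)]])
    then obtain \<delta>2 where \<delta>2: "\<delta>2 > 0" "\<And>x. dist x y < \<delta>2 \<Longrightarrow> dist (z s x) (z s y) < d / 2"
      unfolding continuous_on_iff using d by (meson UNIV_I half_gt_zero)
    show "\<exists>\<delta>>0. \<forall>q\<in>{a..b} \<times> UNIV. dist q p < \<delta> \<longrightarrow> dist (z (fst q) (snd q)) (z (fst p) (snd p)) < d"
    proof (intro exI[of _ "min \<delta>1 \<delta>2"] conjI ballI impI)
      fix q assume q: "q \<in> {a..b} \<times> (UNIV::real set)" and dq: "dist q p < min \<delta>1 \<delta>2"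
      have q1: "fst q \<in> {a..b}" using q by auto
      have "\<bar>fst q - s\<bar> < \<delta>1" "dist (snd q) y < \<delta>2"
        using dq dist_fst_le[of q p] dist_snd_le[of q p] by (auto simp: s_def y_def dist_real_def)
      then have "dist (z (fst q) (snd q)) (z s (snd q)) < d / 2" "dist (z s (snd q)) (z s y) < d / 2"
        using zy[OF q1 sab, of "snd q"] \<delta>1(2)[OF q1] \<delta>2(2) by (auto simp: z_def dist_norm)
      then show "dist (z (fst q) (snd q)) (z (fst p) (snd p)) < d"
        using dist_triangle[of "z (fst q) (snd q)" "z s y" "z s (snd q)"] unfolding s_def[symmetric] y_def[symmetric] by linarith
    qed (use \<delta>1 \<delta>2 in auto)
  qed
  define \<beta> where "\<beta> s y = indicator {a..b} s *\<^sub>R z s y" for s y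
  have "(\<lambda>p. indicator ({a..b} \<times> UNIV) p *\<^sub>R z (fst p) (snd p)) \<in> borel_measurable borel"
    by (rule borel_measurable_continuous_on_indicator[OF _ joint]) (simp add: closed_Times borel_closed)
  moreover have "(\<lambda>p. indicator ({a..b} \<times> UNIV) p *\<^sub>R z (fst p) (snd p)) = (\<lambda>(s, y). \<beta> s y)"
    by (auto simp: \<beta>_def indicator_def fun_eq_iff)
  ultimately have \<beta>m [measurable]: "(\<lambda>(s, y). \<beta> s y) \<in> borel_measurable (borel \<Otimes>\<^sub>M borel)"
    by (simp add: borel_prod)
  have zc: "continuous_on {a..b} (\<lambda>s. z s y)" for y
  proof -
    have "continuous_on {a..b} (\<lambda>s. (s, y))" by (intro continuous_on_Pair continuous_on_id continuous_on_const)
    from continuous_on_compose2[OF joint this] show ?thesis by auto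
  qed
  define D where "D y = ft (W b) y - ft (W a) y - (b - a) *\<^sub>R ft Z0 y" for y
  \<comment> \<open>The fundamental theorem of calculus at fixed \<open>y\<close>, after subtracting
    the linear function of slope \<open>ft Z0 y\<close>; the integrand is then the small quantity
    \<open>z s y\<close>.\<close>
  have D_int: "D y = (LINT s|lborel. \<beta> s y)" for y
  proof -
    have "((\<lambda>s. ft (W s) y - s *\<^sub>R ft Z0 y) has_vector_derivative z s y) (at s within {a..b})" if "s \<in> {a..b}" for s
      unfolding z_def using has_vector_derivative_diff[OF der[OF that, of y]
          has_vector_derivative_scaleR[OF DERIV_ident has_vector_derivative_const[of "ft Z0 y" "at s within {a..b}"]]]
      by simp
    then have "(LINT s|lborel. indicator {a..b} s *\<^sub>R z s y) = (ft (W b) y - b *\<^sub>R ft Z0 y) - (ft (W a) y - a *\<^sub>R ft Z0 y)"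
      by (intro integral_FTC_Icc[OF ab _ zc]) simp
    then show ?thesis by (simp add: D_def \<beta>_def scaleR_left_diff_distrib)
  qed
  have ia: "a \<in> {a..b}" "b \<in> {a..b}" using ab by auto
  have D_ft: "D = ft (\<lambda>\<xi>. W b \<xi> - W a \<xi> - (b - a) *\<^sub>R Z0 \<xi>)"
  proof
    fix y
    have "ft (\<lambda>\<xi>. (b - a) *\<^sub>R Z0 \<xi>) y = (b - a) *\<^sub>R ft Z0 y"
      unfolding scaleR_conv_of_real by (rule ft_cmult)
    then show "D y = ft (\<lambda>\<xi>. W b \<xi> - W a \<xi> - (b - a) *\<^sub>R Z0 \<xi>) y"
      unfolding D_def ft_diff[OF W(1)[OF ia(2)] W(1)[OF ia(1)], symmetric]
      using W(1)[OF ia(1)] W(1)[OF ia(2)] Z0(1) by (subst ft_diff) simp_all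
  qed
  have i: "integrable lborel (\<lambda>\<xi>. W b \<xi> - W a \<xi> - (b - a) *\<^sub>R Z0 \<xi>)" "L2 (\<lambda>\<xi>. W b \<xi> - W a \<xi> - (b - a) *\<^sub>R Z0 \<xi>)"
    using W(1)[OF ia(1)] W(1)[OF ia(2)] Z0(1) W(2)[OF ia(1)] W(2)[OF ia(2)] Z0(2)
    by (auto intro!: L2_diff L2_scaleR)
  have DL: "L2 D" unfolding D_ft by (rule Plancherel_le(1)[OF i])
  have D_le: "(\<integral>\<^sup>+y. ennreal ((cmod (D y))\<^sup>2) \<partial>lborel) \<le> (\<integral>\<^sup>+y. ennreal (b - a) * (\<integral>\<^sup>+s. ennreal ((cmod (\<beta> s y))\<^sup>2) \<partial>lborel) \<partial>lborel)"
  proof (intro nn_integral_mono)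
    fix y
    note CS = integral_nonneg_indicator_CS[OF zc ab, of y, folded \<beta>_def]
    have "ennreal ((cmod (D y))\<^sup>2) \<le> ennreal ((b - a) * (LINT s|lborel. (cmod (\<beta> s y))\<^sup>2))"
      unfolding D_int by (rule ennreal_leI[OF CS(1)])
    also have "\<dots> = ennreal (b - a) * (\<integral>\<^sup>+s. ennreal ((cmod (\<beta> s y))\<^sup>2) \<partial>lborel)"
      using L2_norm_nn[OF CS(2)] ab by (simp add: ennreal_mult L2_norm_sq)
    finally show "ennreal ((cmod (D y))\<^sup>2) \<le> ennreal (b - a) * (\<integral>\<^sup>+s. ennreal ((cmod (\<beta> s y))\<^sup>2) \<partial>lborel)" .
  qed
  have "(\<integral>\<^sup>+y. (\<integral>\<^sup>+s. ennreal ((cmod (\<beta> s y))\<^sup>2) \<partial>lborel) \<partial>lborel) = (\<integral>\<^sup>+s. (\<integral>\<^sup>+y. ennreal ((cmod (\<beta> s y))\<^sup>2) \<partial>lborel) \<partial>lborel)"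
    by (rule lborel_pair.Fubini') measurable
  also have "\<dots> \<le> (\<integral>\<^sup>+s. ennreal ((sqrt (2 * pi) * e)\<^sup>2) * indicator {a..b} s \<partial>lborel)"
  proof (intro nn_integral_mono)
    fix s
    show "(\<integral>\<^sup>+y. ennreal ((cmod (\<beta> s y))\<^sup>2) \<partial>lborel) \<le> ennreal ((sqrt (2 * pi) * e)\<^sup>2) * indicator {a..b} s"
    proof (cases "s \<in> {a..b}")
      case True
      have "(\<integral>\<^sup>+y. ennreal ((cmod (\<beta> s y))\<^sup>2) \<partial>lborel) = ennreal ((L2_norm (z s))\<^sup>2)"
        using True L2_norm_nn[OF zL2[OF True]] by (simp add: \<beta>_def)
      also have "\<dots> \<le> ennreal ((sqrt (2 * pi) * e)\<^sup>2)" by (intro ennreal_leI power_mono zn[OF True]) simp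
      finally show ?thesis using True by simp
    qed (simp add: \<beta>_def)
  qed
  also have "\<dots> = ennreal ((sqrt (2 * pi) * e)\<^sup>2) * ennreal (b - a)"
    using ab by (subst nn_integral_cmult_indicator) auto
  also have "\<dots> = ennreal ((sqrt (2 * pi) * e)\<^sup>2 * (b - a))"
    by (rule ennreal_mult[symmetric]) (use ab in auto)
  finally have le: "(\<integral>\<^sup>+y. (\<integral>\<^sup>+s. ennreal ((cmod (\<beta> s y))\<^sup>2) \<partial>lborel) \<partial>lborel) \<le> ennreal ((sqrt (2 * pi) * e)\<^sup>2 * (b - a))" .
  note D_le
  also have "(\<integral>\<^sup>+y. ennreal (b - a) * (\<integral>\<^sup>+s. ennreal ((cmod (\<beta> s y))\<^sup>2) \<partial>lborel) \<partial>lborel)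
      = ennreal (b - a) * (\<integral>\<^sup>+y. (\<integral>\<^sup>+s. ennreal ((cmod (\<beta> s y))\<^sup>2) \<partial>lborel) \<partial>lborel)"
    by (rule nn_integral_cmult) measurable
  also have "\<dots> \<le> ennreal (b - a) * ennreal ((sqrt (2 * pi) * e)\<^sup>2 * (b - a))"
    by (rule mult_left_mono[OF le]) simp
  also have "\<dots> = ennreal ((b - a) * ((sqrt (2 * pi) * e)\<^sup>2 * (b - a)))"
    by (rule ennreal_mult[symmetric]) (use ab in auto)
  \<comment> \<open>One factor \<open>b - a\<close> comes from Cauchy-Schwarz in \<open>s\<close>,
    the other from the length of the interval in Tonelli. The factor \<open>sqrt (2 * pi)\<close> is
    removed by Plancherel for \<open>D\<close>.\<close>
  also have "(b - a) * ((sqrt (2 * pi) * e)\<^sup>2 * (b - a)) = (sqrt (2 * pi) * ((b - a) * e))\<^sup>2"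
    by (simp add: power2_eq_square)
  finally have "(\<integral>\<^sup>+y. ennreal ((cmod (D y))\<^sup>2) \<partial>lborel) \<le> ennreal ((sqrt (2 * pi) * ((b - a) * e))\<^sup>2)" .
  from L2_nnI(2)[OF L2D(1)[OF DL] this] have "L2_norm D \<le> sqrt (2 * pi) * ((b - a) * e)"
    using ab e by simp
  then show ?thesis unfolding D_ft Plancherel_L1_L2[OF i] by simp
qed

section \<open>The evolution equation on the Fourier side\<close>

text \<open>The symbol \<open>\<i> * \<xi> * A + L\<close>; with \<open>A0 = 1\<close> the
  transformed equation is \<open>z' = - Msym A L \<xi> z\<close>.\<close>

definition Msym :: "real^'m^'m \<Rightarrow> real^'m^'m \<Rightarrow> real \<Rightarrow> complex^'m \<Rightarrow> complex^'m"
  where "Msym A L \<xi> z = (\<chi> i. \<Sum>j\<in>UNIV. (\<i> * \<xi> * A $ i $ j + L $ i $ j) * z $ j)"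

lemma ft_sum:
  assumes "\<And>j. j \<in> S \<Longrightarrow> integrable lborel (f j)"
  shows "ft (\<lambda>x. \<Sum>j\<in>S. f j x) y = (\<Sum>j\<in>S. ft (f j) y)"
  unfolding ft_def sum_distrib_left using assms by (intro Bochner_Integration.integral_sum ft_integrable)

lemma vec_FT_diff:
  assumes "vec_FT f F" "vec_FT g G" shows "vec_FT (\<lambda>x. f x - g x) (\<lambda>\<xi>. F \<xi> - G \<xi>)"
  using assms unfolding vec_FT_def vector_minus_component of_real_diff by (intro allI has_FT_diff) auto

lemma L2_matrix_mult:
  fixes f :: "real \<Rightarrow> real^'m"
  assumes "L2 f" shows "L2 (\<lambda>x. A *v f x)"
proof -
  have "L2 (\<lambda>x. \<Sum>j\<in>UNIV. A $ i $ j *\<^sub>R f x $ j)" for i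
    by (intro L2_sum L2_scaleR(1) L2_nth[OF assms])
  then show ?thesis unfolding L2_vec[of "\<lambda>x. A *v f x"] by (simp add: matrix_vector_mult_def)
qed

lemma test_matrix_nth:
  fixes f :: "real \<Rightarrow> real^'m"
  assumes \<phi>: "test_function \<phi>" and f: "L2 f"
  shows "complex_of_real ((LINT x|lborel. \<phi> x *\<^sub>R (A *v f x)) $ i) = (\<Sum>j\<in>UNIV. A $ i $ j * (LINT x|lborel. cplx \<phi> x * comp f j x))"
proof -
  have i: "integrable lborel (\<lambda>x. cplx \<phi> x * comp f j x)" for j
    by (rule L2_mult_integrable_complex(1)[OF test_function_L2(1)[OF \<phi>]]) (simp add: L2_cplx L2_nth[OF f])
  have e: "comp (\<lambda>x. A *v f x) i x = (\<Sum>j\<in>UNIV. A $ i $ j * comp f j x)" for x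
    by (simp add: matrix_vector_mult_def)
  have "complex_of_real ((LINT x|lborel. \<phi> x *\<^sub>R (A *v f x)) $ i) = (LINT x|lborel. (\<Sum>j\<in>UNIV. A $ i $ j * (cplx \<phi> x * comp f j x)))"
    unfolding test_mult_nth(2)[OF \<phi> L2_matrix_mult[OF f]] e sum_distrib_left
    by (intro Bochner_Integration.integral_cong refl sum.cong) (simp only: mult.left_commute)
  also have "\<dots> = (\<Sum>j\<in>UNIV. A $ i $ j * (LINT x|lborel. cplx \<phi> x * comp f j x))"
    using i by (subst Bochner_Integration.integral_sum) auto
  finally show ?thesis .
qed

text \<open>The distributional equation is tested with \<phi> translated by \<open>- y\<close>, and
  each integral becomes a Fourier transform at \<open>y\<close>. The derivative sitting on the test
  function turns into the factor \<open>\<i> * \<xi>\<close>, whose conjugate supplies the minus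
  sign in front of \<open>A\<close>.\<close>

lemma cauchy_solution_weak_FT:
  fixes A L :: "real^'m^'m"
  assumes sol: "cauchy_solution (mat 1) A L u0 u" and \<phi>: "test_function \<phi>" and t: "t \<ge> 0"
  defines "U \<equiv> \<lambda>s. fourier_L2 (u s)" and "\<Phi> \<equiv> ft (cplx \<phi>)"
  shows "((\<lambda>s. ft (\<lambda>\<xi>. cnj (\<Phi> \<xi>) * U s \<xi> $ i) y) has_vector_derivative
      ft (\<lambda>\<xi>. \<Sum>j\<in>UNIV. - (cnj (\<Phi> \<xi>) * (\<i> * \<xi> * A $ i $ j + L $ i $ j)) * U t \<xi> $ j) y) (at t within {0..})"
proof -
  define \<psi> where "\<psi> x = \<phi> (x - (- y))" for x
  have \<psi>: "test_function \<psi>" unfolding \<psi>_def by (rule test_function_shift[OF \<phi>])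
  have \<phi>': "test_function (deriv \<phi>)" and \<psi>': "test_function (deriv \<psi>)"
    using test_function_deriv_test[OF \<phi>, of 1] test_function_deriv_test[OF \<psi>, of 1] by simp_all
  have d\<psi>: "deriv \<psi> x = deriv \<phi> (x - (- y))" for x
    using deriv_iter_shift[OF \<phi>, of 1 "- y"] unfolding \<psi>_def[abs_def] by (simp add: fun_eq_iff)
  have u: "L2 (u s)" if "s \<ge> 0" for s using sol that by (simp add: cauchy_solution_def)
  have U: "has_FT (comp (u s) j) (\<lambda>\<xi>. U s \<xi> $ j)" if "s \<ge> 0" for s j
    using vec_FT_fourier_L2[OF u[OF that]] unfolding U_def vec_FT_def by blast
  define P Q where "P s j = (LINT x|lborel. cplx \<psi> x * comp (u s) j x)" and "Q s j = (LINT x|lborel. cplx (deriv \<psi>) x * comp (u s) j x)" for s j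
  have P: "2 * pi * P s j = ft (\<lambda>\<xi>. cnj (\<Phi> \<xi>) * U s \<xi> $ j) y" if "s \<ge> 0" for s j
    using test_function_pairing[OF \<phi> U[OF that], of "- y" j] unfolding P_def \<psi>_def \<Phi>_def by simp
  have Q: "2 * pi * Q s j = ft (\<lambda>\<xi>. cnj (ft (cplx (deriv \<phi>)) \<xi>) * U s \<xi> $ j) y" if "s \<ge> 0" for s j
    using test_function_pairing[OF \<phi>' U[OF that], of "- y" j] unfolding Q_def d\<psi> by simp
  have "((\<lambda>s. LINT x|lborel. \<psi> x *\<^sub>R (mat 1 *v u s x)) has_vector_derivative
      (LINT x|lborel. deriv \<psi> x *\<^sub>R (A *v u t x)) - (LINT x|lborel. \<psi> x *\<^sub>R (L *v u t x))) (at t within {0..})"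
    using sol \<psi> t by (simp add: cauchy_solution_def)
  from bounded_linear.has_vector_derivative[OF bounded_linear_compose[OF bounded_linear_of_real[where 'a=complex] bounded_linear_vec_nth[of i]] this]
  have "((\<lambda>s. complex_of_real ((LINT x|lborel. \<psi> x *\<^sub>R (mat 1 *v u s x)) $ i)) has_vector_derivative
      (\<Sum>j\<in>UNIV. A $ i $ j * Q t j) - (\<Sum>j\<in>UNIV. L $ i $ j * P t j)) (at t within {0..})"
    unfolding vector_minus_component of_real_diff test_matrix_nth[OF \<psi>' u[OF t]] test_matrix_nth[OF \<psi> u[OF t]] P_def Q_def .
  then have "((\<lambda>s. P s i) has_vector_derivative
      (\<Sum>j\<in>UNIV. A $ i $ j * Q t j) - (\<Sum>j\<in>UNIV. L $ i $ j * P t j)) (at t within {0..})"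
    by (rule has_vector_derivative_transform[rotated 2]) (use t in \<open>auto simp: P_def test_mult_nth(2)[OF \<psi> u]\<close>)
  from has_vector_derivative_mult_right[OF this, of "2 * pi"]
  have "((\<lambda>s. ft (\<lambda>\<xi>. cnj (\<Phi> \<xi>) * U s \<xi> $ i) y) has_vector_derivative
      2 * pi * ((\<Sum>j\<in>UNIV. A $ i $ j * Q t j) - (\<Sum>j\<in>UNIV. L $ i $ j * P t j))) (at t within {0..})"
    by (rule has_vector_derivative_transform[rotated 2]) (use t P in \<open>simp_all del: of_real_mult\<close>)
  also have "2 * pi * ((\<Sum>j\<in>UNIV. A $ i $ j * Q t j) - (\<Sum>j\<in>UNIV. L $ i $ j * P t j))
      = (\<Sum>j\<in>UNIV. A $ i $ j * (2 * pi * Q t j) - L $ i $ j * (2 * pi * P t j))"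
    unfolding sum_subtractf[symmetric] sum_distrib_left by (intro sum.cong refl) (simp add: algebra_simps)
  also have "\<dots> = (\<Sum>j\<in>UNIV. ft (\<lambda>\<xi>. - (cnj (\<Phi> \<xi>) * (\<i> * \<xi> * A $ i $ j + L $ i $ j)) * U t \<xi> $ j) y)"
  proof (intro sum.cong refl)
    fix j
    note i1 = test_mult_integrable(1)[OF \<phi>' has_FT_L2(2)[OF U[OF t, of j]]]
    note i2 = test_mult_integrable(1)[OF \<phi> has_FT_L2(2)[OF U[OF t, of j]], folded \<Phi>_def]
    have "A $ i $ j * (2 * pi * Q t j) - L $ i $ j * (2 * pi * P t j)
       = ft (\<lambda>\<xi>. A $ i $ j * (cnj (ft (cplx (deriv \<phi>)) \<xi>) * U t \<xi> $ j) - L $ i $ j * (cnj (\<Phi> \<xi>) * U t \<xi> $ j)) y"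
      unfolding P[OF t] Q[OF t] ft_cmult[symmetric] using i1 i2 by (intro ft_diff[symmetric] integrable_mult_right)
    also have "(\<lambda>\<xi>. A $ i $ j * (cnj (ft (cplx (deriv \<phi>)) \<xi>) * U t \<xi> $ j) - L $ i $ j * (cnj (\<Phi> \<xi>) * U t \<xi> $ j))
       = (\<lambda>\<xi>. - (cnj (\<Phi> \<xi>) * (\<i> * \<xi> * A $ i $ j + L $ i $ j)) * U t \<xi> $ j)"
      unfolding ft_deriv[OF \<phi>] \<Phi>_def by (rule ext) (simp add: algebra_simps)
    finally show "A $ i $ j * (2 * pi * Q t j) - L $ i $ j * (2 * pi * P t j)
       = ft (\<lambda>\<xi>. - (cnj (\<Phi> \<xi>) * (\<i> * \<xi> * A $ i $ j + L $ i $ j)) * U t \<xi> $ j) y" .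
  qed
  also have "\<dots> = ft (\<lambda>\<xi>. \<Sum>j\<in>UNIV. - (cnj (\<Phi> \<xi>) * (\<i> * \<xi> * A $ i $ j + L $ i $ j)) * U t \<xi> $ j) y"
  proof (rule ft_sum[symmetric])
    fix j
    note i1 = test_mult_integrable(1)[OF \<phi>' has_FT_L2(2)[OF U[OF t, of j]]]
    note i2 = test_mult_integrable(1)[OF \<phi> has_FT_L2(2)[OF U[OF t, of j]], folded \<Phi>_def]
    have "(\<lambda>\<xi>. - (cnj (\<Phi> \<xi>) * (\<i> * \<xi> * A $ i $ j + L $ i $ j)) * U t \<xi> $ j)
      = (\<lambda>\<xi>. A $ i $ j * (cnj (ft (cplx (deriv \<phi>)) \<xi>) * U t \<xi> $ j) - L $ i $ j * (cnj (\<Phi> \<xi>) * U t \<xi> $ j))"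
      unfolding ft_deriv[OF \<phi>] \<Phi>_def by (rule ext) (simp add: algebra_simps)
    then show "integrable lborel (\<lambda>\<xi>. - (cnj (\<Phi> \<xi>) * (\<i> * \<xi> * A $ i $ j + L $ i $ j)) * U t \<xi> $ j)"
      using i1 i2 by (simp only: Bochner_Integration.integrable_diff integrable_mult_right)
  qed
  finally show ?thesis .
qed

text \<open>Square integrability of the multipliers controls the \<open>L1\<close> norm, their
  boundedness the \<open>L2\<close> norm. The mean value inequality asks for both: \<open>L1\<close>
  continuity in time for its measurability argument, \<open>L2\<close> closeness for its
  estimate.\<close>

lemma multiplier_bounds:
  fixes V :: "real \<Rightarrow> complex^'m" and m :: "'m \<Rightarrow> real \<Rightarrow> complex"
  assumes V: "L2 V" and m: "\<And>j. L2 (m j)" and B: "\<And>j \<xi>. cmod (m j \<xi>) \<le> B"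
  defines "z \<equiv> \<lambda>\<xi>. \<Sum>j\<in>UNIV. m j \<xi> * V \<xi> $ j"
  shows "integrable lborel z" "L2 z"
    "(LINT \<xi>|lborel. cmod (z \<xi>)) \<le> (\<Sum>j\<in>UNIV. L2_norm (m j)) * L2_norm V"
    "L2_norm z \<le> real CARD('m) * B * L2_norm V"
proof -
  note Vj = L2_nth[OF V]
  have "integrable lborel (\<lambda>\<xi>. m j \<xi> * V \<xi> $ j)" for j by (rule L2_mult_integrable_complex(1)[OF m Vj])
  then show zi: "integrable lborel z" unfolding z_def by (intro Bochner_Integration.integrable_sum)
  have "L2 (\<lambda>\<xi>. m j \<xi> * V \<xi> $ j)" for j by (rule L2_bounded_mult[OF Vj L2D(1)[OF m] B])
  then show zL: "L2 z" unfolding z_def by (intro L2_sum)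
  have "(LINT \<xi>|lborel. cmod (z \<xi>)) \<le> (LINT \<xi>|lborel. (\<Sum>j\<in>UNIV. cmod (m j \<xi>) * cmod (V \<xi> $ j)))"
  proof (rule integral_mono)
    show "integrable lborel (\<lambda>\<xi>. cmod (z \<xi>))" using zi by simp
    show "integrable lborel (\<lambda>\<xi>. \<Sum>j\<in>UNIV. cmod (m j \<xi>) * cmod (V \<xi> $ j))"
      by (intro Bochner_Integration.integrable_sum L2_mult_integrable m Vj)
    show "cmod (z \<xi>) \<le> (\<Sum>j\<in>UNIV. cmod (m j \<xi>) * cmod (V \<xi> $ j))" for \<xi>
      unfolding z_def norm_mult[symmetric] by (rule norm_sum)
  qed
  also have "\<dots> = (\<Sum>j\<in>UNIV. (LINT \<xi>|lborel. cmod (m j \<xi>) * cmod (V \<xi> $ j)))"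
    by (intro Bochner_Integration.integral_sum L2_mult_integrable m Vj)
  also have "\<dots> \<le> (\<Sum>j\<in>UNIV. L2_norm (m j) * L2_norm V)"
    by (intro sum_mono order_trans[OF L2_Cauchy_Schwarz[OF m Vj]] mult_left_mono L2_norm_nth_le V) simp
  finally show "(LINT \<xi>|lborel. cmod (z \<xi>)) \<le> (\<Sum>j\<in>UNIV. L2_norm (m j)) * L2_norm V" by (simp add: sum_distrib_right)
  have B0: "B \<ge> 0" using order_trans[OF norm_ge_zero B] .
  have "cmod (z \<xi>) \<le> norm ((real CARD('m) * B) *\<^sub>R V \<xi>)" for \<xi>
  proof -
    have "cmod (z \<xi>) \<le> (\<Sum>j\<in>(UNIV::'m set). B * norm (V \<xi>))"
      unfolding z_def
      by (intro order_trans[OF norm_sum] sum_mono, unfold norm_mult)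
         (intro mult_mono B Finite_Cartesian_Product.norm_nth_le B0 norm_ge_zero)
    then show ?thesis using B0 by (simp add: abs_mult)
  qed
  then have "L2_norm z \<le> L2_norm (\<lambda>\<xi>. (real CARD('m) * B) *\<^sub>R V \<xi>)"
    by (intro L2_bound(2)[OF L2_scaleR(1)[OF V] L2D(1)[OF zL]] AE_I2)
  then show "L2_norm z \<le> real CARD('m) * B * L2_norm V" unfolding L2_scaleR(2)[OF V] using B0 by simp
qed

text \<open>The mean value inequality is applied to \<open>cnj \<Phi>\<close> times the solution,
  whose Fourier transform is differentiable in time at every point. On the band \<Phi> has modulus
  at least \<open>c\<close>, so removing it costs \<open>1 / c\<close>; this is why the tolerance
  \<open>c * e\<close> is imposed on \<open>Z\<close>.\<close>

lemma cauchy_solution_strong_deriv: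
  fixes A L :: "real^'m^'m"
  assumes sol: "cauchy_solution (mat 1) A L u0 u" and t: "t \<ge> 0" and N: "N > 0" and e: "e > 0"
  defines "U \<equiv> \<lambda>s. fourier_L2 (u s)"
  shows "\<exists>\<delta>>0. \<forall>s\<ge>0. \<bar>s - t\<bar> < \<delta> \<longrightarrow>
    L2_norm (\<lambda>\<xi>. indicator {-N..N} \<xi> *\<^sub>R (U s \<xi> $ i - U t \<xi> $ i + (s - t) *\<^sub>R (Msym A L \<xi> (U t \<xi>) $ i))) \<le> \<bar>s - t\<bar> * e"
proof -
  obtain \<phi> c where \<phi>: "test_function \<phi>" and c: "c > 0" "\<And>\<xi>. \<bar>\<xi>\<bar> \<le> N \<Longrightarrow> c \<le> cmod (ft (cplx \<phi>) \<xi>)"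
    using ft_bump[OF N] by blast
  define \<Phi> where "\<Phi> = ft (cplx \<phi>)"
  have \<phi>': "test_function (deriv \<phi>)" using test_function_deriv_test[OF \<phi>, of 1] by simp
  define m where "m j \<xi> = - (cnj (\<Phi> \<xi>) * (\<i> * \<xi> * A $ i $ j + L $ i $ j))" for j \<xi>
  \<comment> \<open>The unbounded factor \<xi> is absorbed into the transform of
    \<open>deriv \<phi>\<close>, which makes the multipliers both square integrable and
    bounded.\<close>
  have m_eq: "m j = (\<lambda>\<xi>. A $ i $ j * cnj (ft (cplx (deriv \<phi>)) \<xi>) - L $ i $ j * cnj (\<Phi> \<xi>))" for j
    unfolding m_def ft_deriv[OF \<phi>] \<Phi>_def by (rule ext) (simp add: algebra_simps)
  have P: "L2 (ft (cplx \<phi>))" if "test_function \<phi>" for \<phi>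
    by (rule Plancherel_le(1)[OF test_function_L2(2)[OF that] test_function_L2(1)[OF that]])
  have mL: "L2 (m j)" for j unfolding m_eq \<Phi>_def
    by (intro L2_diff L2_cmult L2_cnj P \<phi> \<phi>')
  define a where "a = (\<Sum>j\<in>UNIV. \<bar>A $ i $ j\<bar>)"
  define l where "l = (\<Sum>j\<in>UNIV. \<bar>L $ i $ j\<bar>)"
  have al: "\<bar>A $ i $ j\<bar> \<le> a" "\<bar>L $ i $ j\<bar> \<le> l" for j unfolding a_def l_def by (intro member_le_sum; simp)+
  then have al0: "a \<ge> 0" "l \<ge> 0" by (meson abs_ge_zero order_trans)+
  define B where "B = a * (LINT x|lborel. cmod (cplx (deriv \<phi>) x)) + l * (LINT x|lborel. cmod (cplx \<phi> x))"
  have mB: "cmod (m j \<xi>) \<le> B" for j \<xi>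
    unfolding m_eq B_def \<Phi>_def
    by (intro order_trans[OF norm_triangle_ineq4] add_mono) (auto simp: norm_mult intro!: mult_mono al al0 order_trans[OF ft_bound])
  have B0: "B \<ge> 0" using order_trans[OF norm_ge_zero mB] .
  have u: "L2 (u s)" if "s \<ge> 0" for s using sol that by (simp add: cauchy_solution_def)
  have UF: "vec_FT (u s) (U s)" if "s \<ge> 0" for s using vec_FT_fourier_L2[OF u[OF that]] unfolding U_def .
  have U: "L2 (U s)" if "s \<ge> 0" for s by (rule vec_FT_L2(2)[OF UF[OF that]])
  have Un: "L2_norm (\<lambda>\<xi>. U r \<xi> - U s \<xi>) = sqrt (2 * pi) * L2_norm (\<lambda>x. u r x - u s x)" if "r \<ge> 0" "s \<ge> 0" for r s
    by (rule vec_FT_norm[OF vec_FT_diff[OF UF[OF that(1)] UF[OF that(2)]]])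
  have Ucont: "\<exists>\<delta>>0. \<forall>r\<ge>0. \<bar>r - s\<bar> < \<delta> \<longrightarrow> L2_norm (\<lambda>\<xi>. U r \<xi> - U s \<xi>) < d" if s: "s \<ge> 0" and d: "d > 0" for s d
  proof -
    have "((\<lambda>r. L2_norm (\<lambda>x. u r x - u s x)) \<longlongrightarrow> 0) (at s within {0..})" using sol s by (simp add: cauchy_solution_def)
    then obtain \<delta> where \<delta>: "\<delta> > 0" "\<And>r. r \<ge> 0 \<Longrightarrow> r \<noteq> s \<Longrightarrow> \<bar>r - s\<bar> < \<delta> \<Longrightarrow> L2_norm (\<lambda>x. u r x - u s x) < d / sqrt (2 * pi)"
      unfolding Lim_within using d
      by (elim allE[of _ "d / sqrt (2 * pi)"]) (auto simp: dist_real_def)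
    have "L2_norm (\<lambda>\<xi>. U r \<xi> - U s \<xi>) < d" if r: "r \<ge> 0" "\<bar>r - s\<bar> < \<delta>" for r
    proof (cases "r = s")
      case False
      then show ?thesis unfolding Un[OF r(1) s] using \<delta>(2)[OF r(1) False r(2)] by (simp add: field_simps)
    qed (use d in simp)
    with \<delta>(1) show ?thesis by blast
  qed
  define Z where "Z s \<xi> = (\<Sum>j\<in>UNIV. m j \<xi> * U s \<xi> $ j)" for s \<xi>
  have Z: "integrable lborel (Z s)" "L2 (Z s)" if "s \<ge> 0" for s
    unfolding Z_def using multiplier_bounds(1,2)[OF U[OF that] mL mB] by auto
  have Zdiff: "Z r \<xi> - Z s \<xi> = (\<Sum>j\<in>UNIV. m j \<xi> * (U r \<xi> - U s \<xi>) $ j)" for r s \<xi>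
    unfolding Z_def by (simp add: right_diff_distrib sum_subtractf)
  have Z1: "(LINT \<xi>|lborel. cmod (Z r \<xi> - Z s \<xi>)) \<le> (\<Sum>j\<in>UNIV. L2_norm (m j)) * L2_norm (\<lambda>\<xi>. U r \<xi> - U s \<xi>)"
    and Z2: "L2_norm (\<lambda>\<xi>. Z r \<xi> - Z s \<xi>) \<le> real CARD('m) * B * L2_norm (\<lambda>\<xi>. U r \<xi> - U s \<xi>)" if "r \<ge> 0" "s \<ge> 0" for r s
    unfolding Zdiff using multiplier_bounds(3,4)[OF L2_diff[OF U[OF that(1)] U[OF that(2)]] mL mB] by auto
  define K where "K = (\<Sum>j\<in>UNIV. L2_norm (m j)) + real CARD('m) * B + 1"
  have K: "K > 0" "(\<Sum>j\<in>UNIV. L2_norm (m j)) \<le> K" "real CARD('m) * B \<le> K"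
    unfolding K_def using B0 by (auto intro!: add_nonneg_pos add_nonneg_nonneg sum_nonneg)
  have Zcont: "\<exists>\<delta>>0. \<forall>r\<ge>0. \<bar>r - s\<bar> < \<delta> \<longrightarrow> (LINT \<xi>|lborel. cmod (Z r \<xi> - Z s \<xi>)) < d \<and> L2_norm (\<lambda>\<xi>. Z r \<xi> - Z s \<xi>) < d"
    if s: "s \<ge> 0" and d: "d > 0" for s d
  proof -
    obtain \<delta> where \<delta>: "\<delta> > 0" "\<And>r. r \<ge> 0 \<Longrightarrow> \<bar>r - s\<bar> < \<delta> \<Longrightarrow> L2_norm (\<lambda>\<xi>. U r \<xi> - U s \<xi>) < d / K"
      using Ucont[OF s, of "d / K"] d K by auto
    have "(LINT \<xi>|lborel. cmod (Z r \<xi> - Z s \<xi>)) < d \<and> L2_norm (\<lambda>\<xi>. Z r \<xi> - Z s \<xi>) < d" if r: "r \<ge> 0" "\<bar>r - s\<bar> < \<delta>" for r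
    proof -
      have "K * L2_norm (\<lambda>\<xi>. U r \<xi> - U s \<xi>) < d" using \<delta>(2)[OF r] K by (simp add: field_simps)
      moreover have "(\<Sum>j\<in>UNIV. L2_norm (m j)) * L2_norm (\<lambda>\<xi>. U r \<xi> - U s \<xi>) \<le> K * L2_norm (\<lambda>\<xi>. U r \<xi> - U s \<xi>)"
        "real CARD('m) * B * L2_norm (\<lambda>\<xi>. U r \<xi> - U s \<xi>) \<le> K * L2_norm (\<lambda>\<xi>. U r \<xi> - U s \<xi>)"
        by (intro mult_right_mono K; simp)+
      ultimately show ?thesis using Z1[OF r(1) s] Z2[OF r(1) s] by linarith
    qed
    with \<delta>(1) show ?thesis by blast
  qed
  define W where "W s \<xi> = cnj (\<Phi> \<xi>) * U s \<xi> $ i" for s \<xi>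
  have W: "integrable lborel (W s)" "L2 (W s)" if "s \<ge> 0" for s
    unfolding W_def \<Phi>_def by (rule test_mult_integrable[OF \<phi> L2_nth[OF U[OF that]]])+
  have der: "((\<lambda>s. ft (W s) y) has_vector_derivative ft (Z s) y) (at s within {0..})" if "s \<ge> 0" for s y
    using cauchy_solution_weak_FT[OF sol \<phi> that, of i y] unfolding W_def Z_def m_def U_def \<Phi>_def .
  obtain \<delta> where \<delta>: "\<delta> > 0" "\<And>r. r \<ge> 0 \<Longrightarrow> \<bar>r - t\<bar> < \<delta> \<Longrightarrow> L2_norm (\<lambda>\<xi>. Z r \<xi> - Z t \<xi>) < c * e"
    using Zcont[OF t, of "c * e"] c e by auto
  \<comment> \<open>Formulated for intervals on either side of \<open>t\<close>, because
    \<open>s\<close> may precede or follow \<open>t\<close>.\<close>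
  have mv: "L2_norm (\<lambda>\<xi>. W b \<xi> - W a \<xi> - (b - a) *\<^sub>R Z t \<xi>) \<le> (b - a) * (c * e)"
    if ab: "0 \<le> a" "a \<le> b" and close: "\<And>r. r \<in> {a..b} \<Longrightarrow> \<bar>r - t\<bar> < \<delta>" for a b
  proof (rule L2_mean_value[OF ab(2)])
    fix s assume s: "s \<in> {a..b}"
    then have s0: "s \<ge> 0" using ab by auto
    show "integrable lborel (W s)" "L2 (W s)" "integrable lborel (Z s)" "L2 (Z s)" using W[OF s0] Z[OF s0] by auto
    show "((\<lambda>s. ft (W s) y) has_vector_derivative ft (Z s) y) (at s within {a..b})" for y
      by (rule has_vector_derivative_within_subset[OF der[OF s0]]) (use ab in auto)
    show "L2_norm (\<lambda>\<xi>. Z s \<xi> - Z t \<xi>) \<le> c * e" using \<delta>(2)[OF s0 close[OF s]] by simp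
    show "\<exists>\<delta>>0. \<forall>r\<in>{a..b}. \<bar>r - s\<bar> < \<delta> \<longrightarrow> (LINT \<xi>|lborel. cmod (Z r \<xi> - Z s \<xi>)) < d" if "d > 0" for d
      using Zcont[OF s0 that] ab by (meson atLeastAtMost_iff order_trans)
  qed (use Z[OF t] c e in auto)
  show ?thesis
  proof (intro exI[of _ \<delta>] conjI allI impI \<delta>(1))
    fix s assume s: "s \<ge> (0::real)" and st: "\<bar>s - t\<bar> < \<delta>"
    define D where "D \<xi> = U s \<xi> $ i - U t \<xi> $ i + (s - t) *\<^sub>R (Msym A L \<xi> (U t \<xi>) $ i)" for \<xi>
    have Zt: "Z t \<xi> = - (cnj (\<Phi> \<xi>) * (Msym A L \<xi> (U t \<xi>) $ i))" for \<xi>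
      unfolding Z_def Msym_def m_def by (simp add: sum_distrib_left sum_negf mult.assoc)
    have D: "cnj (\<Phi> \<xi>) * D \<xi> = W s \<xi> - W t \<xi> - (s - t) *\<^sub>R Z t \<xi>" for \<xi>
      unfolding D_def W_def Zt by (simp add: algebra_simps scaleR_conv_of_real)
    have wL: "L2 (\<lambda>\<xi>. cnj (\<Phi> \<xi>) * D \<xi>)" unfolding D by (intro L2_diff L2_scaleR W Z s t)
    have wn: "L2_norm (\<lambda>\<xi>. cnj (\<Phi> \<xi>) * D \<xi>) \<le> \<bar>s - t\<bar> * (c * e)"
    proof (cases "t \<le> s")
      case True
      show ?thesis unfolding D using mv[OF t True] st True by auto
    next
      case False
      have "L2_norm (\<lambda>\<xi>. W t \<xi> - W s \<xi> - (t - s) *\<^sub>R Z t \<xi>) \<le> (t - s) * (c * e)"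
        by (rule mv) (use False s st in auto)
      moreover have "(\<lambda>\<xi>. W t \<xi> - W s \<xi> - (t - s) *\<^sub>R Z t \<xi>) = (\<lambda>\<xi>. - (cnj (\<Phi> \<xi>) * D \<xi>))"
        unfolding D by (simp add: fun_eq_iff scaleR_left_diff_distrib)
      ultimately show ?thesis using False L2_uminus(2)[OF wL] by simp
    qed
    have Dm: "D \<in> borel_measurable borel"
    proof -
      have "(\<lambda>\<xi>. U r \<xi> $ j) \<in> borel_measurable borel" if "r \<ge> 0" for r j by (rule L2D(1)[OF L2_nth[OF U[OF that]]])
      note [measurable] = this[OF s] this[OF t]
      show ?thesis unfolding D_def Msym_def by simp
    qed
    have "L2_norm (\<lambda>\<xi>. indicator {-N..N} \<xi> *\<^sub>R D \<xi>) \<le> L2_norm (\<lambda>\<xi>. (1 / c) *\<^sub>R (cnj (\<Phi> \<xi>) * D \<xi>))"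
    proof (rule L2_bound(2)[OF L2_scaleR(1)[OF wL]])
      show "AE \<xi> in lborel. norm (indicator {-N..N} \<xi> *\<^sub>R D \<xi>) \<le> norm ((1 / c) *\<^sub>R (cnj (\<Phi> \<xi>) * D \<xi>))"
      proof (rule AE_I2)
        fix \<xi>
        show "norm (indicator {-N..N} \<xi> *\<^sub>R D \<xi>) \<le> norm ((1 / c) *\<^sub>R (cnj (\<Phi> \<xi>) * D \<xi>))"
        proof (cases "\<xi> \<in> {-N..N}")
          case True
          then have "c \<le> cmod (\<Phi> \<xi>)" unfolding \<Phi>_def by (intro c(2)) auto
          then have "c * cmod (D \<xi>) \<le> cmod (\<Phi> \<xi>) * cmod (D \<xi>)" by (rule mult_right_mono) simp
          then show ?thesis using True c(1) by (simp add: norm_mult field_simps)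
        qed simp
      qed
    qed (use Dm in simp)
    also have "\<dots> \<le> \<bar>s - t\<bar> * e" unfolding L2_scaleR(2)[OF wL] using wn c(1) by (simp add: field_simps)
    finally show "L2_norm (\<lambda>\<xi>. indicator {-N..N} \<xi> *\<^sub>R (U s \<xi> $ i - U t \<xi> $ i + (s - t) *\<^sub>R (Msym A L \<xi> (U t \<xi>) $ i))) \<le> \<bar>s - t\<bar> * e"
      unfolding D_def .
  qed
qed

section \<open>Lyapunov functions and pointwise decay\<close>

lemma L2_deriv_imp_cont:
  assumes g: "\<And>s. s \<in> S \<Longrightarrow> L2 (g s)" "t \<in> S" "L2 g'"
    and dg: "((\<lambda>s. L2_norm (\<lambda>x. g s x - g t x - (s - t) *\<^sub>R g' x) / \<bar>s - t\<bar>) \<longlongrightarrow> 0) (at t within S)"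
  shows "((\<lambda>s. L2_norm (\<lambda>x. g s x - g t x)) \<longlongrightarrow> 0) (at t within S)"
proof (rule Lim_null_comparison)
  let ?q = "\<lambda>s. L2_norm (\<lambda>x. g s x - g t x - (s - t) *\<^sub>R g' x) / \<bar>s - t\<bar>"
  have "((\<lambda>s. \<bar>s - t\<bar> * (?q s + L2_norm g')) \<longlongrightarrow> \<bar>t - t\<bar> * (0 + L2_norm g')) (at t within S)"
    by (intro tendsto_intros dg)
  then show "((\<lambda>s. \<bar>s - t\<bar> * (?q s + L2_norm g')) \<longlongrightarrow> 0) (at t within S)" by simp
  show "\<forall>\<^sub>F s in at t within S. norm (L2_norm (\<lambda>x. g s x - g t x)) \<le> \<bar>s - t\<bar> * (?q s + L2_norm g')"
    unfolding eventually_at_filter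
  proof (intro always_eventually allI impI)
    fix s assume s: "s \<noteq> t" "s \<in> S"
    have "L2_norm (\<lambda>x. (g s x - g t x - (s - t) *\<^sub>R g' x) + (s - t) *\<^sub>R g' x)
       \<le> L2_norm (\<lambda>x. g s x - g t x - (s - t) *\<^sub>R g' x) + L2_norm (\<lambda>x. (s - t) *\<^sub>R g' x)"
      by (intro L2_norm_triangle L2_diff L2_scaleR g s)
    then show "norm (L2_norm (\<lambda>x. g s x - g t x)) \<le> \<bar>s - t\<bar> * (?q s + L2_norm g')"
      using s by (simp add: L2_scaleR(2)[OF g(3)] distrib_left)
  qed
qed

text \<open>Difference quotients are measured in the \<open>L2\<close> norm because nothing is known
  about time derivatives at a fixed frequency. Cauchy-Schwarz bounds each remainder of the product
  rule.\<close>

lemma L2_inner_deriv: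
  fixes f g :: "real \<Rightarrow> real \<Rightarrow> complex"
  assumes f: "\<And>s. s \<in> S \<Longrightarrow> L2 (f s)" and f': "L2 f'" and g: "\<And>s. s \<in> S \<Longrightarrow> L2 (g s)" and g': "L2 g'" and t: "t \<in> S"
    and df: "((\<lambda>s. L2_norm (\<lambda>x. f s x - f t x - (s - t) *\<^sub>R f' x) / \<bar>s - t\<bar>) \<longlongrightarrow> 0) (at t within S)"
    and dg: "((\<lambda>s. L2_norm (\<lambda>x. g s x - g t x - (s - t) *\<^sub>R g' x) / \<bar>s - t\<bar>) \<longlongrightarrow> 0) (at t within S)"
  shows "((\<lambda>s. LINT x|lborel. f s x * cnj (g s x)) has_vector_derivative
     (LINT x|lborel. f' x * cnj (g t x)) + (LINT x|lborel. f t x * cnj (g' x))) (at t within S)"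
  unfolding has_vector_derivative_def has_derivative_within
proof (intro conjI bounded_linear_scaleR_left)
  note gc = L2_deriv_imp_cont[OF g t g' dg]
  have gn: "((\<lambda>s. L2_norm (g s)) \<longlongrightarrow> L2_norm (g t)) (at t within S)"
  proof (rule LIM_zero_cancel, rule Lim_null_comparison[OF _ gc])
    show "\<forall>\<^sub>F s in at t within S. norm (L2_norm (g s) - L2_norm (g t)) \<le> L2_norm (\<lambda>x. g s x - g t x)"
      unfolding eventually_at_filter by (intro always_eventually allI impI) (simp add: L2_norm_diff_le g t)
  qed
  let ?F = "\<lambda>s. L2_norm (\<lambda>x. f s x - f t x - (s - t) *\<^sub>R f' x) / \<bar>s - t\<bar>"
  let ?G = "\<lambda>s. L2_norm (\<lambda>x. g s x - g t x - (s - t) *\<^sub>R g' x) / \<bar>s - t\<bar>"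
  let ?I = "\<lambda>s. LINT x|lborel. f s x * cnj (g s x)"
  let ?D = "(LINT x|lborel. f' x * cnj (g t x)) + (LINT x|lborel. f t x * cnj (g' x))"
  show "((\<lambda>s. (1 / norm (s - t)) *\<^sub>R (?I s - (?I t + (s - t) *\<^sub>R ?D))) \<longlongrightarrow> 0) (at t within S)"
  proof (rule Lim_null_comparison)
    have "((\<lambda>s. ?F s * L2_norm (g s) + L2_norm f' * L2_norm (\<lambda>x. g s x - g t x) + L2_norm (f t) * ?G s)
       \<longlongrightarrow> 0 * L2_norm (g t) + L2_norm f' * 0 + L2_norm (f t) * 0) (at t within S)"
      by (intro tendsto_intros df dg gc gn)
    then show "((\<lambda>s. ?F s * L2_norm (g s) + L2_norm f' * L2_norm (\<lambda>x. g s x - g t x) + L2_norm (f t) * ?G s) \<longlongrightarrow> 0) (at t within S)"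
      by simp
    show "\<forall>\<^sub>F s in at t within S. norm ((1 / norm (s - t)) *\<^sub>R (?I s - (?I t + (s - t) *\<^sub>R ?D)))
      \<le> ?F s * L2_norm (g s) + L2_norm f' * L2_norm (\<lambda>x. g s x - g t x) + L2_norm (f t) * ?G s"
      unfolding eventually_at_filter
    proof (intro always_eventually allI impI)
      fix s assume s: "s \<noteq> t" "s \<in> S"
      define d where "d = s - t"
      have d: "d \<noteq> 0" using s by (simp add: d_def)
      define r1 r2 where "r1 x = f s x - f t x - d *\<^sub>R f' x" and "r2 x = g s x - g t x - d *\<^sub>R g' x" for x
      have r: "L2 r1" "L2 r2" unfolding r1_def r2_def by (intro L2_diff L2_scaleR f f' g g' s t)+
      have gd: "L2 (\<lambda>x. g s x - g t x)" by (intro L2_diff g s t)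
      note i = L2_mult_integrable_complex(2)
      \<comment> \<open>First-order expansion of the product. The bracket is of smaller order than
        \<open>d\<close> after integration: two of its terms contain a remainder \<open>r1\<close>
        or \<open>r2\<close>, the third is \<open>d\<close> times an increment of
        \<open>g\<close>.\<close>
      have e: "f s x * cnj (g s x) = f t x * cnj (g t x) + d * (f' x * cnj (g t x)) + d * (f t x * cnj (g' x))
          + (r1 x * cnj (g s x) + d * (f' x * cnj (g s x - g t x)) + f t x * cnj (r2 x))" for x
        unfolding r1_def r2_def by (simp add: algebra_simps scaleR_conv_of_real)
      have b1: "norm (LINT x|lborel. r1 x * cnj (g s x)) \<le> L2_norm r1 * L2_norm (g s)"
        using L2_mult_integrable_complex(3)[OF r(1) L2_cnj[OF g[OF s(2)]]] by (simp only: L2_norm_cnj)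
      have b2: "norm (LINT x|lborel. f' x * cnj (g s x - g t x)) \<le> L2_norm f' * L2_norm (\<lambda>x. g s x - g t x)"
        using L2_mult_integrable_complex(3)[OF f' L2_cnj[OF gd]] by (simp only: L2_norm_cnj)
      have b3: "norm (LINT x|lborel. f t x * cnj (r2 x)) \<le> L2_norm (f t) * L2_norm r2"
        using L2_mult_integrable_complex(3)[OF f[OF t] L2_cnj[OF r(2)]] by (simp only: L2_norm_cnj)
      have "?I s = ?I t + d * (LINT x|lborel. f' x * cnj (g t x)) + d * (LINT x|lborel. f t x * cnj (g' x))
          + ((LINT x|lborel. r1 x * cnj (g s x)) + d * (LINT x|lborel. f' x * cnj (g s x - g t x)) + (LINT x|lborel. f t x * cnj (r2 x)))"
        unfolding e
        by (intro has_bochner_integral_integral_eq has_bochner_integral_add has_bochner_integral_mult_right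
            has_bochner_integral_integrable i f g f' g' r gd t s(2))
      then have eq: "?I s - (?I t + d *\<^sub>R ?D)
         = (LINT x|lborel. r1 x * cnj (g s x)) + d * (LINT x|lborel. f' x * cnj (g s x - g t x)) + (LINT x|lborel. f t x * cnj (r2 x))"
        by (simp add: scaleR_conv_of_real distrib_left)
      have "norm (?I s - (?I t + d *\<^sub>R ?D)) \<le> norm (LINT x|lborel. r1 x * cnj (g s x)) + \<bar>d\<bar> * norm (LINT x|lborel. f' x * cnj (g s x - g t x))
          + norm (LINT x|lborel. f t x * cnj (r2 x))"
        unfolding eq by (intro order_trans[OF norm_triangle_ineq] add_mono) (auto simp: norm_mult)
      also have "\<dots> \<le> L2_norm r1 * L2_norm (g s) + \<bar>d\<bar> * (L2_norm f' * L2_norm (\<lambda>x. g s x - g t x)) + L2_norm (f t) * L2_norm r2"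
        by (rule add_mono[OF add_mono[OF b1 mult_left_mono[OF b2 abs_ge_zero]] b3])
      finally have "norm (?I s - (?I t + d *\<^sub>R ?D)) / \<bar>d\<bar>
         \<le> (L2_norm r1 * L2_norm (g s) + \<bar>d\<bar> * (L2_norm f' * L2_norm (\<lambda>x. g s x - g t x)) + L2_norm (f t) * L2_norm r2) / \<bar>d\<bar>"
        by (intro divide_right_mono) auto
      also have "\<dots> = ?F s * L2_norm (g s) + L2_norm f' * L2_norm (\<lambda>x. g s x - g t x) + L2_norm (f t) * ?G s"
        using d unfolding r1_def r2_def d_def by (simp add: add_divide_distrib)
      finally show "norm ((1 / norm (s - t)) *\<^sub>R (?I s - (?I t + (s - t) *\<^sub>R ?D)))
         \<le> ?F s * L2_norm (g s) + L2_norm f' * L2_norm (\<lambda>x. g s x - g t x) + L2_norm (f t) * ?G s"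
        unfolding d_def by simp
    qed
  qed
qed

text \<open>A bounded multiplier supported in a band tames the growth of the symbol in \<xi>, so the
  product with the solution and its formal derivative both lie in \<open>L2\<close>, and the
  difference quotient inherits the estimate on the band.\<close>

lemma cauchy_solution_mult_deriv:
  fixes A L :: "real^'m^'m" and h :: "real \<Rightarrow> complex"
  assumes sol: "cauchy_solution (mat 1) A L u0 u" and t: "t \<ge> 0" and N: "N > 0"
    and h: "h \<in> borel_measurable borel" "\<And>\<xi>. cmod (h \<xi>) \<le> K * indicator {-N..N} \<xi>"
  defines "U \<equiv> \<lambda>s. fourier_L2 (u s)"
  shows "\<And>s. s \<ge> 0 \<Longrightarrow> L2 (\<lambda>\<xi>. h \<xi> * U s \<xi> $ i)"
    and "L2 (\<lambda>\<xi>. - (h \<xi> * (Msym A L \<xi> (U t \<xi>) $ i)))"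
    and "((\<lambda>s. L2_norm (\<lambda>\<xi>. h \<xi> * U s \<xi> $ i - h \<xi> * U t \<xi> $ i - (s - t) *\<^sub>R (- (h \<xi> * (Msym A L \<xi> (U t \<xi>) $ i)))) / \<bar>s - t\<bar>) \<longlongrightarrow> 0)
      (at t within {0..})"
proof -
  have K: "K \<ge> 0" using order_trans[OF norm_ge_zero h(2)[of 0]] N by simp
  have hK: "cmod (h \<xi>) \<le> K" for \<xi> using h(2)[of \<xi>] K by (cases "\<xi> \<in> {-N..N}") (auto simp: indicator_def)
  have u: "L2 (u s)" if "s \<ge> 0" for s using sol that by (simp add: cauchy_solution_def)
  have U: "L2 (\<lambda>\<xi>. U s \<xi> $ j)" if "s \<ge> 0" for s j
    unfolding U_def by (rule L2_nth[OF vec_FT_L2(2)[OF vec_FT_fourier_L2[OF u[OF that]]]])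
  show hU: "L2 (\<lambda>\<xi>. h \<xi> * U s \<xi> $ i)" if "s \<ge> 0" for s
    by (rule L2_bounded_mult[OF U[OF that] h(1) hK])
  have "L2 (\<lambda>\<xi>. (h \<xi> * (\<i> * \<xi> * A $ i $ j + L $ i $ j)) * U t \<xi> $ j)" for j
  proof (rule L2_bounded_mult[OF U[OF t]])
    show "(\<lambda>\<xi>. h \<xi> * (\<i> * complex_of_real \<xi> * A $ i $ j + L $ i $ j)) \<in> borel_measurable borel" using h(1) by simp
    fix \<xi> :: real
    show "cmod (h \<xi> * (\<i> * complex_of_real \<xi> * A $ i $ j + L $ i $ j)) \<le> K * (N * \<bar>A $ i $ j\<bar> + \<bar>L $ i $ j\<bar>)"
    proof (cases "\<xi> \<in> {-N..N}")
      case True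
      have "cmod (\<i> * complex_of_real \<xi> * A $ i $ j + L $ i $ j) \<le> \<bar>\<xi>\<bar> * \<bar>A $ i $ j\<bar> + \<bar>L $ i $ j\<bar>"
        by (rule order_trans[OF norm_triangle_ineq]) (simp add: norm_mult)
      also have "\<dots> \<le> N * \<bar>A $ i $ j\<bar> + \<bar>L $ i $ j\<bar>" using True by (intro add_mono mult_right_mono) auto
      finally show ?thesis unfolding norm_mult by (intro mult_mono hK K) auto
    next
      case False
      then show ?thesis using h(2)[of \<xi>] K N by (auto simp: indicator_def)
    qed
  qed
  then have "L2 (\<lambda>\<xi>. \<Sum>j\<in>UNIV. (h \<xi> * (\<i> * \<xi> * A $ i $ j + L $ i $ j)) * U t \<xi> $ j)" by (intro L2_sum)
  then have "L2 (\<lambda>\<xi>. h \<xi> * (Msym A L \<xi> (U t \<xi>) $ i))"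
    by (simp add: Msym_def sum_distrib_left mult.assoc)
  then show hM: "L2 (\<lambda>\<xi>. - (h \<xi> * (Msym A L \<xi> (U t \<xi>) $ i)))" by (rule L2_uminus(1))
  show "((\<lambda>s. L2_norm (\<lambda>\<xi>. h \<xi> * U s \<xi> $ i - h \<xi> * U t \<xi> $ i - (s - t) *\<^sub>R (- (h \<xi> * (Msym A L \<xi> (U t \<xi>) $ i)))) / \<bar>s - t\<bar>) \<longlongrightarrow> 0)
      (at t within {0..})"
    unfolding Lim_within
  proof (intro allI impI)
    fix e :: real assume e: "e > 0"
    \<comment> \<open>The tolerance is divided by \<open>K + 1\<close> instead of \<open>K\<close>:
      this covers \<open>K = 0\<close> and makes the final inequality strict.\<close>
    obtain \<delta> where \<delta>: "\<delta> > 0" "\<And>s. s \<ge> 0 \<Longrightarrow> \<bar>s - t\<bar> < \<delta> \<Longrightarrow>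
        L2_norm (\<lambda>\<xi>. indicator {-N..N} \<xi> *\<^sub>R (U s \<xi> $ i - U t \<xi> $ i + (s - t) *\<^sub>R (Msym A L \<xi> (U t \<xi>) $ i))) \<le> \<bar>s - t\<bar> * (e / (K + 1))"
      unfolding U_def using cauchy_solution_strong_deriv[OF sol t N, of "e / (K + 1)" i] e K by auto
    show "\<exists>d>0. \<forall>x\<in>{0..}. 0 < dist x t \<and> dist x t < d \<longrightarrow>
       dist (L2_norm (\<lambda>\<xi>. h \<xi> * U x \<xi> $ i - h \<xi> * U t \<xi> $ i - (x - t) *\<^sub>R (- (h \<xi> * (Msym A L \<xi> (U t \<xi>) $ i)))) / \<bar>x - t\<bar>) 0 < e"
    proof (intro exI[of _ \<delta>] conjI ballI impI \<delta>(1))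
      fix s assume s: "s \<in> {0::real..}" and ds: "0 < dist s t \<and> dist s t < \<delta>"
      define D where "D \<xi> = indicator {-N..N} \<xi> *\<^sub>R (U s \<xi> $ i - U t \<xi> $ i + (s - t) *\<^sub>R (Msym A L \<xi> (U t \<xi>) $ i))" for \<xi>
      have hD: "h \<xi> * U s \<xi> $ i - h \<xi> * U t \<xi> $ i - (s - t) *\<^sub>R (- (h \<xi> * (Msym A L \<xi> (U t \<xi>) $ i))) = h \<xi> * D \<xi>" for \<xi>
        using h(2)[of \<xi>] by (cases "\<xi> \<in> {-N..N}") (auto simp: D_def algebra_simps)
      have DL: "L2 D"
      proof -
        have m: "(\<lambda>\<xi>. complex_of_real (indicator {-N..N} \<xi>)) \<in> borel_measurable borel" by simp
        have 1: "L2 (\<lambda>\<xi>. complex_of_real (indicator {-N..N} \<xi>) * U r \<xi> $ j)" if "r \<ge> 0" for r j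
          by (rule L2_bounded_mult[OF U[OF that] m, of 1]) (simp add: indicator_def)
        have 2: "L2 (\<lambda>\<xi>. complex_of_real (indicator {-N..N} \<xi>) * (Msym A L \<xi> (U t \<xi>) $ i))"
        proof -
          have "L2 (\<lambda>\<xi>. (complex_of_real (indicator {-N..N} \<xi>) * (\<i> * \<xi> * A $ i $ j + L $ i $ j)) * U t \<xi> $ j)" for j
          proof (rule L2_bounded_mult[OF U[OF t]])
            fix \<xi> :: real
            show "cmod (complex_of_real (indicator {-N..N} \<xi>) * (\<i> * \<xi> * A $ i $ j + L $ i $ j)) \<le> N * \<bar>A $ i $ j\<bar> + \<bar>L $ i $ j\<bar>"
            proof (cases "\<xi> \<in> {-N..N}")
              case True
              have "cmod (\<i> * complex_of_real \<xi> * A $ i $ j + L $ i $ j) \<le> \<bar>\<xi>\<bar> * \<bar>A $ i $ j\<bar> + \<bar>L $ i $ j\<bar>"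
                by (rule order_trans[OF norm_triangle_ineq]) (simp add: norm_mult)
              also have "\<dots> \<le> N * \<bar>A $ i $ j\<bar> + \<bar>L $ i $ j\<bar>" using True by (intro add_mono mult_right_mono) auto
              finally show ?thesis using True by simp
            qed (use N in simp)
          qed simp
          then have "L2 (\<lambda>\<xi>. \<Sum>j\<in>UNIV. (complex_of_real (indicator {-N..N} \<xi>) * (\<i> * \<xi> * A $ i $ j + L $ i $ j)) * U t \<xi> $ j)" by (intro L2_sum)
          then show ?thesis by (simp add: Msym_def sum_distrib_left mult.assoc)
        qed
        have "L2 (\<lambda>\<xi>. complex_of_real (indicator {-N..N} \<xi>) * U s \<xi> $ i - complex_of_real (indicator {-N..N} \<xi>) * U t \<xi> $ i
            + (s - t) *\<^sub>R (complex_of_real (indicator {-N..N} \<xi>) * (Msym A L \<xi> (U t \<xi>) $ i)))"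
          using s by (intro L2_add L2_diff L2_scaleR 1 2 t) simp
        then show ?thesis unfolding D_def scaleR_conv_of_real by (simp add: algebra_simps)
      qed
      have "L2_norm (\<lambda>\<xi>. h \<xi> * D \<xi>) \<le> L2_norm (\<lambda>\<xi>. K *\<^sub>R D \<xi>)"
        by (rule L2_bound(2)[OF L2_scaleR(1)[OF DL]])
           (use h(1) L2D(1)[OF DL] hK K in \<open>auto simp: norm_mult intro!: mult_right_mono\<close>)
      also have "\<dots> \<le> K * (\<bar>s - t\<bar> * (e / (K + 1)))"
      proof -
        have "L2_norm D \<le> \<bar>s - t\<bar> * (e / (K + 1))"
          unfolding D_def by (rule \<delta>(2)) (use s ds in \<open>auto simp: dist_real_def\<close>)
        then show ?thesis unfolding L2_scaleR(2)[OF DL] abs_of_nonneg[OF K] by (rule mult_left_mono) (rule K)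
      qed
      finally have "L2_norm (\<lambda>\<xi>. h \<xi> * D \<xi>) / \<bar>s - t\<bar> \<le> K * (e / (K + 1))"
        using ds by (simp add: dist_real_def field_simps)
      also have "\<dots> < e" using K e by (simp add: field_simps)
      finally show "dist (L2_norm (\<lambda>\<xi>. h \<xi> * U s \<xi> $ i - h \<xi> * U t \<xi> $ i - (s - t) *\<^sub>R (- (h \<xi> * (Msym A L \<xi> (U t \<xi>) $ i)))) / \<bar>s - t\<bar>) 0 < e"
        unfolding hD by (simp add: dist_real_def)
    qed
  qed
qed

text \<open>Since only the real part is taken, \<open>H\<close> need not be Hermitian, and each
  off-diagonal pair can be stored as one entry. Along \<open>z' = - Msym A L \<xi> z\<close> the
  derivative of \<open>qform H z z\<close> is minus the sum of
  \<open>qform H (Msym A L \<xi> z) z\<close> and \<open>qform H z (Msym A L \<xi> z)\<close>, the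
  quantity in the dissipation hypotheses.\<close>

definition qform :: "('m::finite \<Rightarrow> 'm \<Rightarrow> complex) \<Rightarrow> complex^'m \<Rightarrow> complex^'m \<Rightarrow> real"
  where "qform H z w = Re (\<Sum>i\<in>UNIV. \<Sum>j\<in>UNIV. H i j * z $ i * cnj (w $ j))"

text \<open>The integrating factor \<open>exp (c * s)\<close> makes the product nonincreasing.
  Derivatives within the half line suffice, which includes the initial time.\<close>

lemma Gronwall_exp:
  fixes E :: "real \<Rightarrow> real"
  assumes E: "\<And>s. s \<ge> 0 \<Longrightarrow> (E has_real_derivative E' s) (at s within {0..})"
    and le: "\<And>s. s \<ge> 0 \<Longrightarrow> E' s \<le> - c * E s" and t: "t \<ge> 0"
  shows "E t \<le> exp (- c * t) * E 0"
proof -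
  have "((\<lambda>s. exp (c * s) * E s) has_derivative (\<lambda>h. (exp (c * s) * (E' s + c * E s)) * h)) (at s within {0..t})" if "s \<in> {0..t}" for s
  proof -
    have "((\<lambda>s. exp (c * s) * E s) has_real_derivative exp (c * s) * (E' s + c * E s)) (at s within {0..t})"
      using DERIV_subset[OF E[of s], of "{0..t}"] that
      by (auto intro!: derivative_eq_intros simp: algebra_simps)
    then show ?thesis by (simp add: has_field_derivative_def)
  qed
  then have "\<exists>s\<in>{0..t}. exp (c * t) * E t - exp (c * 0) * E 0 = exp (c * s) * (E' s + c * E s) * (t - 0)"
    by (intro mvt_very_simple[OF t]) auto
  then obtain s where s: "s \<in> {0..t}"
    "exp (c * t) * E t - exp (c * 0) * E 0 = exp (c * s) * (E' s + c * E s) * (t - 0)" ..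
  have "exp (c * s) * (E' s + c * E s) * (t - 0) \<le> 0"
    using le[of s] s(1) t by (intro mult_nonpos_nonneg mult_nonneg_nonpos) auto
  with s(2) have "exp (c * t) * E t \<le> E 0" by simp
  then have "exp (- c * t) * (exp (c * t) * E t) \<le> exp (- c * t) * E 0" by (intro mult_left_mono) auto
  then show ?thesis by (simp add: mult.assoc[symmetric] exp_add[symmetric])
qed

lemma energy_estimate:
  fixes A L :: "real^'m^'m" and H :: "real \<Rightarrow> 'm \<Rightarrow> 'm \<Rightarrow> complex"
  assumes sol: "cauchy_solution (mat 1) A L u0 u" and t: "t \<ge> 0"
    and H: "\<And>i j. (\<lambda>\<xi>. H \<xi> i j) \<in> borel_measurable borel" "\<And>\<xi> i j. cmod (H \<xi> i j) \<le> K"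
    and B: "B \<in> sets borel" "B \<subseteq> {-N..N}" and N: "N > 0"
    and diss: "\<And>\<xi> z. \<xi> \<in> B \<Longrightarrow> 2 * c * qform (H \<xi>) z z \<le> qform (H \<xi>) (Msym A L \<xi> z) z + qform (H \<xi>) z (Msym A L \<xi> z)"
  defines "U \<equiv> \<lambda>s. fourier_L2 (u s)"
  shows "\<And>s. s \<ge> 0 \<Longrightarrow> integrable lborel (\<lambda>\<xi>. indicator B \<xi> * qform (H \<xi>) (U s \<xi>) (U s \<xi>))"
    and "(LINT \<xi>|lborel. indicator B \<xi> * qform (H \<xi>) (U t \<xi>) (U t \<xi>))
      \<le> exp (- (2 * c) * t) * (LINT \<xi>|lborel. indicator B \<xi> * qform (H \<xi>) (U 0 \<xi>) (U 0 \<xi>))"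
proof -
  note [measurable] = H(1) B(1)
  have K: "K \<ge> 0" using order_trans[OF norm_ge_zero H(2)] .
  \<comment> \<open>The indicator of \<open>B\<close> is put on both factors of the form, once in
    \<open>h\<close> and once as \<open>b\<close>, so that each factor is differentiable in
    \<open>L2\<close>. Its square is the indicator again.\<close>
  define h where "h i j \<xi> = indicator B \<xi> * H \<xi> i j" for i j \<xi>
  define b where "b \<xi> = complex_of_real (indicator B \<xi>)" for \<xi>
  have hm: "h i j \<in> borel_measurable borel" for i j unfolding h_def by measurable
  have hN: "cmod (h i j \<xi>) \<le> K * indicator {-N..N} \<xi>" for i j \<xi>
    using B(2) H(2)[of \<xi> i j] K by (cases "\<xi> \<in> B") (auto simp: h_def norm_mult indicator_def)
  have bm: "b \<in> borel_measurable borel" unfolding b_def by measurable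
  have bN: "cmod (b \<xi>) \<le> 1 * indicator {-N..N} \<xi>" for \<xi>
    using B(2) by (cases "\<xi> \<in> B") (auto simp: b_def indicator_def)
  have Us: "fourier_L2 (u s) = U s" for s by (simp add: U_def)
  note hd = cauchy_solution_mult_deriv[OF sol _ N hm hN, unfolded Us]
  note bd = cauchy_solution_mult_deriv[OF sol _ N bm bN, unfolded Us]
  define T where "T s i j \<xi> = (h i j \<xi> * U s \<xi> $ i) * cnj (b \<xi> * U s \<xi> $ j)" for s i j \<xi>
  define T1 where "T1 s i j \<xi> = (- (h i j \<xi> * (Msym A L \<xi> (U s \<xi>) $ i))) * cnj (b \<xi> * U s \<xi> $ j)" for s i j \<xi>
  define T2 where "T2 s i j \<xi> = (h i j \<xi> * U s \<xi> $ i) * cnj (- (b \<xi> * (Msym A L \<xi> (U s \<xi>) $ j)))" for s i j \<xi>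
  have Ti: "integrable lborel (T s i j)" "integrable lborel (T1 s i j)" "integrable lborel (T2 s i j)" if "s \<ge> 0" for s i j
    unfolding T_def T1_def T2_def
    using L2_mult_integrable_complex(2)[OF hd(1)[OF that that] bd(1)[OF that that]]
      L2_mult_integrable_complex(2)[OF hd(2)[OF that] bd(1)[OF that that]]
      L2_mult_integrable_complex(2)[OF hd(1)[OF that that] bd(2)[OF that]] by auto
  define E where "E s = Re (\<Sum>i\<in>UNIV. \<Sum>j\<in>UNIV. integral\<^sup>L lborel (T s i j))" for s
  define E' where "E' s = Re (\<Sum>i\<in>UNIV. \<Sum>j\<in>UNIV. integral\<^sup>L lborel (T1 s i j) + integral\<^sup>L lborel (T2 s i j))" for s
  have Re_int: "Re (\<Sum>i\<in>UNIV. \<Sum>j\<in>UNIV. integral\<^sup>L lborel (X i j)) = (LINT \<xi>|lborel. Re (\<Sum>i\<in>(UNIV::'m set). \<Sum>j\<in>(UNIV::'m set). X i j \<xi>))"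
      "integrable lborel (\<lambda>\<xi>. Re (\<Sum>i\<in>(UNIV::'m set). \<Sum>j\<in>(UNIV::'m set). X i j \<xi>))"
    if X: "\<And>i j. integrable lborel (X i j)" for X :: "'m \<Rightarrow> 'm \<Rightarrow> real \<Rightarrow> complex"
  proof -
    have i: "integrable lborel (\<lambda>\<xi>. \<Sum>i\<in>(UNIV::'m set). \<Sum>j\<in>(UNIV::'m set). X i j \<xi>)"
      by (intro Bochner_Integration.integrable_sum X)
    then show "integrable lborel (\<lambda>\<xi>. Re (\<Sum>i\<in>(UNIV::'m set). \<Sum>j\<in>(UNIV::'m set). X i j \<xi>))" by (rule integrable_Re)
    show "Re (\<Sum>i\<in>UNIV. \<Sum>j\<in>UNIV. integral\<^sup>L lborel (X i j)) = (LINT \<xi>|lborel. Re (\<Sum>i\<in>(UNIV::'m set). \<Sum>j\<in>(UNIV::'m set). X i j \<xi>))"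
      unfolding integral_Re[OF i]
      by (subst Bochner_Integration.integral_sum, intro Bochner_Integration.integrable_sum X,
          subst Bochner_Integration.integral_sum, intro X, rule refl)
  qed
  have T_q: "Re (\<Sum>i\<in>UNIV. \<Sum>j\<in>UNIV. T s i j \<xi>) = indicator B \<xi> * qform (H \<xi>) (U s \<xi>) (U s \<xi>)" for s \<xi>
    by (cases "\<xi> \<in> B") (simp_all add: T_def h_def b_def qform_def)
  have T12_q: "Re (\<Sum>i\<in>UNIV. \<Sum>j\<in>UNIV. T1 s i j \<xi> + T2 s i j \<xi>)
     = - (indicator B \<xi> * (qform (H \<xi>) (Msym A L \<xi> (U s \<xi>)) (U s \<xi>) + qform (H \<xi>) (U s \<xi>) (Msym A L \<xi> (U s \<xi>))))" for s \<xi>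
    by (cases "\<xi> \<in> B") (simp_all add: T1_def T2_def h_def b_def qform_def sum_subtractf sum_negf)
  have E_eq: "E s = (LINT \<xi>|lborel. indicator B \<xi> * qform (H \<xi>) (U s \<xi>) (U s \<xi>))"
    and E_int: "integrable lborel (\<lambda>\<xi>. indicator B \<xi> * qform (H \<xi>) (U s \<xi>) (U s \<xi>))" if "s \<ge> 0" for s
    unfolding E_def using Re_int[of "T s", OF Ti(1)[OF that]] unfolding T_q by simp_all
  have E'_le: "E' s \<le> - (2 * c) * E s" if s: "s \<ge> 0" for s
  proof -
    let ?q = "\<lambda>\<xi>. indicator B \<xi> * (qform (H \<xi>) (Msym A L \<xi> (U s \<xi>)) (U s \<xi>) + qform (H \<xi>) (U s \<xi>) (Msym A L \<xi> (U s \<xi>)))"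
    have T12: "integrable lborel (\<lambda>\<xi>. T1 s i j \<xi> + T2 s i j \<xi>)" for i j using Ti[OF s] by simp
    have "E' s = Re (\<Sum>i\<in>UNIV. \<Sum>j\<in>UNIV. LINT \<xi>|lborel. T1 s i j \<xi> + T2 s i j \<xi>)"
      unfolding E'_def using Ti[OF s] by simp
    also have "\<dots> = (LINT \<xi>|lborel. - ?q \<xi>)" unfolding Re_int(1)[of "\<lambda>i j \<xi>. T1 s i j \<xi> + T2 s i j \<xi>", OF T12] T12_q ..
    also have "\<dots> \<le> (LINT \<xi>|lborel. - (2 * c) * (indicator B \<xi> * qform (H \<xi>) (U s \<xi>) (U s \<xi>)))"
    proof (rule integral_mono)
      show "integrable lborel (\<lambda>\<xi>. - ?q \<xi>)" using Re_int(2)[of "\<lambda>i j \<xi>. T1 s i j \<xi> + T2 s i j \<xi>", OF T12] unfolding T12_q .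
      show "integrable lborel (\<lambda>\<xi>. - (2 * c) * (indicator B \<xi> * qform (H \<xi>) (U s \<xi>) (U s \<xi>)))"
        by (intro integrable_mult_right E_int s)
      show "- ?q \<xi> \<le> - (2 * c) * (indicator B \<xi> * qform (H \<xi>) (U s \<xi>) (U s \<xi>))" for \<xi>
        using diss[of \<xi> "U s \<xi>"] by (cases "\<xi> \<in> B") auto
    qed
    also have "\<dots> = - (2 * c) * E s" unfolding E_eq[OF s] by (rule integral_mult_right_zero)
    finally show ?thesis .
  qed
  have E_deriv: "(E has_real_derivative E' s) (at s within {0..})" if s: "s \<ge> 0" for s
  proof -
    have sm: "s \<in> {0..}" using s by simp
    have 1: "((\<lambda>s. integral\<^sup>L lborel (T s i j)) has_vector_derivative integral\<^sup>L lborel (T1 s i j) + integral\<^sup>L lborel (T2 s i j)) (at s within {0..})" for i j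
      unfolding T_def T1_def T2_def
      by (rule L2_inner_deriv[OF hd(1) hd(2)[OF s] bd(1) bd(2)[OF s] sm hd(3)[OF s] bd(3)[OF s]]) auto
    have "((\<lambda>s. \<Sum>i\<in>UNIV. \<Sum>j\<in>UNIV. integral\<^sup>L lborel (T s i j)) has_vector_derivative
       (\<Sum>i\<in>UNIV. \<Sum>j\<in>UNIV. integral\<^sup>L lborel (T1 s i j) + integral\<^sup>L lborel (T2 s i j))) (at s within {0..})"
      by (intro has_vector_derivative_sum 1)
    from bounded_linear.has_vector_derivative[OF bounded_linear_Re this]
    show ?thesis unfolding has_real_derivative_iff_has_vector_derivative E_def E'_def .
  qed
  show "integrable lborel (\<lambda>\<xi>. indicator B \<xi> * qform (H \<xi>) (U s \<xi>) (U s \<xi>))" if "s \<ge> 0" for s by (rule E_int[OF that])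
  have "E t \<le> exp (- (2 * c) * t) * E 0" by (rule Gronwall_exp[OF E_deriv E'_le t])
  then show "(LINT \<xi>|lborel. indicator B \<xi> * qform (H \<xi>) (U t \<xi>) (U t \<xi>))
      \<le> exp (- (2 * c) * t) * (LINT \<xi>|lborel. indicator B \<xi> * qform (H \<xi>) (U 0 \<xi>) (U 0 \<xi>))"
    unfolding E_eq[OF t] E_eq[OF order_refl] .
qed

lemma AE_all_rat:
  assumes "\<And>q. q \<in> \<rat> \<Longrightarrow> AE x in M. P q x" shows "AE x in M. \<forall>q\<in>(\<rat>::real set). P q x"
  using assms by (simp add: AE_ball_countable countable_rat)

lemma qform_measurable:
  fixes V W :: "real \<Rightarrow> complex^'m"
  assumes H: "\<And>i j. (\<lambda>\<xi>. H \<xi> i j) \<in> borel_measurable borel" and V: "V \<in> borel_measurable borel" and W: "W \<in> borel_measurable borel"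
  shows "(\<lambda>\<xi>. qform (H \<xi>) (V \<xi>) (W \<xi>)) \<in> borel_measurable borel"
proof -
  note [measurable] = H borel_measurable_vec_nth[OF V] borel_measurable_vec_nth[OF W]
  show ?thesis unfolding qform_def by measurable
qed

lemma vec_FT_cong_AE:
  assumes F: "vec_FT f F" and AE: "AE x in lborel. f x = g x" and g: "L2 g"
  shows "vec_FT g F"
  unfolding vec_FT_def
proof
  fix i
  have "comp g i \<in> borel_measurable borel" using L2D(1)[of "comp g i"] L2_nth[OF g, of i] by (simp add: L2_cplx)
  moreover have "AE x in lborel. comp f i x = comp g i x" using AE by eventually_elim simp
  ultimately show "has_FT (comp g i) (\<lambda>\<xi>. F \<xi> $ i)"
    using F has_FT_cong_AE_left[of "comp f i"] by (simp add: vec_FT_def)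
qed

text \<open>The form is comparable with the squared norm; therefore its rate \<open>2 * r\<close>
  becomes \<open>r\<close> for the norm and the constant is the square root of the ratio of the
  comparison constants.\<close>

theorem Lyapunov_decay:
  fixes A L :: "real^'m^'m" and H :: "real \<Rightarrow> 'm \<Rightarrow> 'm \<Rightarrow> complex"
  assumes sol: "cauchy_solution (mat 1) A L u0 u" and t: "t \<ge> 0"
    and H: "\<And>i j. (\<lambda>\<xi>. H \<xi> i j) \<in> borel_measurable borel" "\<And>\<xi> i j. cmod (H \<xi> i j) \<le> K"
    and lo: "\<And>\<xi> z. c1 * (norm z)\<^sup>2 \<le> qform (H \<xi>) z z" and c1: "c1 > 0"
    and up: "\<And>\<xi> z. qform (H \<xi>) z z \<le> c2 * (norm z)\<^sup>2"
    and r: "r \<in> borel_measurable borel"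
    and diss: "\<And>\<xi> z. 2 * r \<xi> * qform (H \<xi>) z z \<le> qform (H \<xi>) (Msym A L \<xi> z) z + qform (H \<xi>) z (Msym A L \<xi> z)"
  shows "AE \<xi> in lborel. norm (fourier_L2 (u t) \<xi>) \<le> sqrt (c2 / c1) * exp (- r \<xi> * t) * norm (fourier_L2 u0 \<xi>)"
proof -
  define U where "U s = fourier_L2 (u s)" for s
  define e where "e s \<xi> = qform (H \<xi>) (U s \<xi>) (U s \<xi>)" for s \<xi>
  have u: "L2 (u s)" if "s \<ge> 0" for s using sol that by (simp add: cauchy_solution_def)
  have U: "vec_FT (u s) (U s)" if "s \<ge> 0" for s unfolding U_def by (rule vec_FT_fourier_L2[OF u[OF that]])
  have em [measurable]: "e s \<in> borel_measurable borel" if "s \<ge> 0" for s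
    unfolding e_def by (intro qform_measurable H L2D(1)[OF vec_FT_L2(2)[OF U[OF that]]])
  note [measurable] = r em[OF t] em[OF order_refl]
  have step: "AE \<xi> in lborel. \<bar>\<xi>\<bar> \<le> real (Suc n) \<and> q \<le> r \<xi> \<longrightarrow> e t \<xi> \<le> exp (- (2 * q) * t) * e 0 \<xi>" for n q
  proof -
    define B where "B = {\<xi>. \<bar>\<xi>\<bar> \<le> real (Suc n) \<and> q \<le> r \<xi> \<and> \<not> e t \<xi> \<le> exp (- (2 * q) * t) * e 0 \<xi>}"
    have Bs: "B \<in> sets borel" unfolding B_def by measurable
    have BN: "B \<subseteq> {- real (Suc n)..real (Suc n)}" unfolding B_def by auto
    have d: "2 * q * qform (H \<xi>) z z \<le> qform (H \<xi>) (Msym A L \<xi> z) z + qform (H \<xi>) z (Msym A L \<xi> z)" if "\<xi> \<in> B" for \<xi> z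
    proof -
      have "0 \<le> qform (H \<xi>) z z" by (rule order_trans[OF _ lo]) (use c1 in simp)
      then have "2 * q * qform (H \<xi>) z z \<le> 2 * r \<xi> * qform (H \<xi>) z z"
        using that by (intro mult_right_mono) (auto simp: B_def)
      then show ?thesis using diss[of \<xi> z] by linarith
    qed
    note en = energy_estimate[OF sol t H Bs BN _ d, folded U_def, folded e_def]
    have i: "integrable lborel (\<lambda>\<xi>. indicator B \<xi> * e t \<xi>)" "integrable lborel (\<lambda>\<xi>. indicator B \<xi> * e 0 \<xi>)"
      using en(1)[of t] en(1)[of 0] t by simp_all
    define g where "g \<xi> = indicator B \<xi> * e t \<xi> - exp (- (2 * q) * t) * (indicator B \<xi> * e 0 \<xi>)" for \<xi>
    have gi: "integrable lborel g" unfolding g_def using i by simp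
    have g0: "g \<xi> \<ge> 0" for \<xi> unfolding g_def by (cases "\<xi> \<in> B") (auto simp: B_def)
    have "(LINT \<xi>|lborel. g \<xi>) \<le> 0" unfolding g_def using i en(2) by simp
    moreover have "(LINT \<xi>|lborel. g \<xi>) \<ge> 0" using g0 by (intro integral_nonneg_AE AE_I2)
    ultimately have "AE \<xi> in lborel. g \<xi> = 0"
      using integral_nonneg_eq_0_iff_AE[OF gi] g0 by (simp add: order_antisym)
    then show ?thesis
    proof eventually_elim
      case (elim \<xi>)
      show ?case
      proof (rule impI, rule ccontr)
        assume "\<bar>\<xi>\<bar> \<le> real (Suc n) \<and> q \<le> r \<xi>" "\<not> e t \<xi> \<le> exp (- (2 * q) * t) * e 0 \<xi>"
        then have "\<xi> \<in> B" "e t \<xi> > exp (- (2 * q) * t) * e 0 \<xi>" by (auto simp: B_def)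
        with elim show False by (simp add: g_def)
      qed
    qed
  qed
  \<comment> \<open>Rational \<open>q\<close> keep the union of the exceptional sets null. The exact
    rate \<open>r \<xi>\<close> is recovered afterwards by letting \<open>q\<close> increase to
    it.\<close>
  have "AE \<xi> in lborel. \<forall>q\<in>\<rat>. \<forall>n. \<bar>\<xi>\<bar> \<le> real (Suc n) \<and> q \<le> r \<xi> \<longrightarrow> e t \<xi> \<le> exp (- (2 * q) * t) * e 0 \<xi>"
    by (intro AE_all_rat, unfold AE_all_countable, intro allI step)
  moreover have "AE \<xi> in lborel. U 0 \<xi> = fourier_L2 u0 \<xi>"
  proof -
    have "AE x in lborel. u 0 x = u0 x" "L2 u0" using sol by (auto simp: cauchy_solution_def)
    then show ?thesis by (intro vec_FT_unique[OF vec_FT_cong_AE[OF U] vec_FT_fourier_L2]) auto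
  qed
  ultimately show ?thesis
  proof eventually_elim
    case (elim \<xi>)
    have le: "e t \<xi> \<le> exp (- (2 * q) * t) * e 0 \<xi>" if "q \<in> \<rat>" "q \<le> r \<xi>" for q
      using elim(1) that by (elim ballE[of _ _ q] allE[of _ "nat \<lceil>\<bar>\<xi>\<bar>\<rceil>"]) (linarith | simp)+
    have "e t \<xi> \<le> exp (- (2 * r \<xi>) * t) * e 0 \<xi>"
    proof (rule ccontr)
      assume n: "\<not> e t \<xi> \<le> exp (- (2 * r \<xi>) * t) * e 0 \<xi>"
      have "((\<lambda>q. exp (- (2 * q) * t) * e 0 \<xi>) \<longlongrightarrow> exp (- (2 * r \<xi>) * t) * e 0 \<xi>) (at_left (r \<xi>))"
        by (intro tendsto_intros)
      from order_tendstoD(2)[OF this, of "e t \<xi>"] n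
      have "eventually (\<lambda>q. exp (- (2 * q) * t) * e 0 \<xi> < e t \<xi>) (at_left (r \<xi>))" by simp
      then obtain b where b: "b < r \<xi>" "\<And>q. b < q \<Longrightarrow> q < r \<xi> \<Longrightarrow> exp (- (2 * q) * t) * e 0 \<xi> < e t \<xi>"
        unfolding eventually_at_left_field by blast
      obtain q where "q \<in> \<rat>" "b < q" "q < r \<xi>" using Rats_dense_in_real[OF b(1)] by blast
      with le[of q] b(2)[of q] show False by simp
    qed
    then have "c1 * (norm (U t \<xi>))\<^sup>2 \<le> exp (- (2 * r \<xi>) * t) * (c2 * (norm (U 0 \<xi>))\<^sup>2)"
      using order_trans[OF lo[of "U t \<xi>" \<xi>]] order_trans[OF _ mult_left_mono[OF up[of \<xi> "U 0 \<xi>"] exp_ge_zero]]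
      unfolding e_def by blast
    then have "(norm (U t \<xi>))\<^sup>2 \<le> (c2 / c1) * (exp (- r \<xi> * t))\<^sup>2 * (norm (U 0 \<xi>))\<^sup>2"
      using c1 by (simp add: field_simps exp_double[symmetric])
    then have "sqrt ((norm (U t \<xi>))\<^sup>2) \<le> sqrt ((c2 / c1) * (exp (- r \<xi> * t))\<^sup>2 * (norm (U 0 \<xi>))\<^sup>2)"
      by (rule real_sqrt_le_mono)
    then show ?case using elim(2) by (simp add: real_sqrt_mult real_sqrt_divide U_def)
  qed
qed

text \<open>The set where the inequality fails is open and null, hence empty.\<close>

lemma AE_le_imp_le_continuous:
  fixes f g :: "real \<Rightarrow> real"
  assumes f: "continuous_on UNIV f" and g: "continuous_on UNIV g" and AE: "AE x in lborel. f x \<le> g x"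
  shows "f x \<le> g x"
proof (rule ccontr)
  assume n: "\<not> f x \<le> g x"
  define S where "S = {x. g x < f x}"
  have op: "open S" unfolding S_def by (intro open_Collect_less f g)
  have "S \<in> null_sets lborel"
  proof (rule AE_iff_null_sets[THEN iffD2])
    show "S \<in> sets lborel" using op by simp
    show "AE x in lborel. x \<notin> S" using AE by eventually_elim (simp add: S_def)
  qed
  then have "negligible S" by (simp add: negligible_iff_null_sets null_sets_completionI)
  moreover have "x \<in> S" using n by (simp add: S_def)
  ultimately show False using open_not_negligible[OF op] by blast
qed

lemma fourier_continuous:
  assumes "integrable lborel (f :: real \<Rightarrow> real^'m)" shows "continuous_on UNIV (fourier f)"
proof -
  have "integrable lborel (comp f i)" for i
    using integrable_bounded_linear[OF bounded_linear_vec_nth assms] by simp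
  then have "continuous_on UNIV (\<lambda>\<xi>. \<chi> i. ft (comp f i) \<xi>)"
    by (intro continuous_on_vec_lambda ft_continuous)
  moreover have "fourier f = (\<lambda>\<xi>. \<chi> i. ft (comp f i) \<xi>)" by (auto simp: vec_eq_iff fourier_nth)
  ultimately show ?thesis by simp
qed

text \<open>For integrable functions the transforms are continuous and agree almost everywhere with
  the \<open>L2\<close> transforms, so a bound at almost every frequency extends to all of
  them.\<close>

lemma fourier_bound_everywhere:
  assumes f: "integrable lborel f" "L2 f" and g: "integrable lborel g" "L2 g"
    and w: "continuous_on UNIV w" and AE: "AE \<xi> in lborel. norm (fourier_L2 f \<xi>) \<le> w \<xi> * norm (fourier_L2 g \<xi>)"
  shows "norm (fourier f \<xi>) \<le> w \<xi> * norm (fourier g \<xi>)"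
proof (rule AE_le_imp_le_continuous[where f="\<lambda>\<xi>. norm (fourier f \<xi>)" and g="\<lambda>\<xi>. w \<xi> * norm (fourier g \<xi>)"])
  show "continuous_on UNIV (\<lambda>\<xi>. norm (fourier f \<xi>))" "continuous_on UNIV (\<lambda>\<xi>. w \<xi> * norm (fourier g \<xi>))"
    by (intro continuous_intros fourier_continuous f g w)+
  show "AE \<xi> in lborel. norm (fourier f \<xi>) \<le> w \<xi> * norm (fourier g \<xi>)"
    using AE vec_FT_unique[OF vec_FT_fourier_L2[OF f(2)] vec_FT_fourier[OF f]]
      vec_FT_unique[OF vec_FT_fourier_L2[OF g(2)] vec_FT_fourier[OF g]]
    by eventually_elim simp
qed

section \<open>The Timoshenko system\<close>

lemma vector_4 [simp]:
  "(vector [x, y, z, w] :: ('a::zero)^4) $ 1 = x"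
  "(vector [x, y, z, w] :: ('a::zero)^4) $ 2 = y"
  "(vector [x, y, z, w] :: ('a::zero)^4) $ 3 = z"
  "(vector [x, y, z, w] :: ('a::zero)^4) $ 4 = w"
  unfolding vector_def by simp_all

text \<open>The identity, corrected by \<open>p\<close> times the symmetrizer \<open>S\<close> and \<open>q \<xi>\<close> times the compensating matrix
  \<open>i K\<close>. The first correction dissipates \<open>z\<^sub>1\<close>, the second one \<open>z\<^sub>2\<close> and \<open>z\<^sub>3\<close>. The error
  \<open>p (a\<^sup>2 - 1) \<xi> Re (\<i> z\<^sub>4 cnj z\<^sub>2)\<close> of the first one is absorbed for \<open>p = O(1 / (1 + \<xi>\<^sup>2))\<close>, which is the
  loss of regularity when \<open>a \<noteq> 1\<close>.\<close>

definition timo_H :: "real \<Rightarrow> real \<Rightarrow> real \<Rightarrow> real \<Rightarrow> complex^4^4"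
  where "timo_H a p q \<xi> = vector
    [vector [1, 0, 0, 0],
     vector [- (\<i> * complex_of_real (q * \<xi>)), 1, 0, 0],
     vector [0, - complex_of_real (p * a), 1, - (\<i> * complex_of_real (q * \<xi>))],
     vector [- complex_of_real p, 0, 0, 1]]"

lemma timo_H_form:
  "qform (\<lambda>i j. timo_H a p q \<xi> $ i $ j) z w =
    Re (z$1 * cnj (w$1)) + Re (z$2 * cnj (w$2)) + Re (z$3 * cnj (w$3)) + Re (z$4 * cnj (w$4))
    - p * (Re (z$4 * cnj (w$1)) + a * Re (z$3 * cnj (w$2)))
    - q * \<xi> * (Re (\<i> * z$2 * cnj (w$1)) + Re (\<i> * z$3 * cnj (w$4)))"
  unfolding qform_def timo_H_def sum_4 vector_4 by (simp add: algebra_simps)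

lemma timo_Msym:
  "Msym (timo_A a) (timo_L \<gamma>) \<xi> z $ 1 = - (\<i> * \<xi> * z$2) + z$4"
  "Msym (timo_A a) (timo_L \<gamma>) \<xi> z $ 2 = - (\<i> * \<xi> * z$1)"
  "Msym (timo_A a) (timo_L \<gamma>) \<xi> z $ 3 = - (\<i> * \<xi> * a * z$4)"
  "Msym (timo_A a) (timo_L \<gamma>) \<xi> z $ 4 = - (\<i> * \<xi> * a * z$3) - z$1 + \<gamma> * z$4"
  unfolding Msym_def timo_A_def timo_L_def
  by (simp_all add: sum_4 vector_4 algebra_simps)

text \<open>The identity alone sees only the damping of the fourth component. The \<open>p\<close>
  part contributes the square of the first component, the \<open>q\<close> part those of the second
  and third with factor \<open>\<xi>\<^sup>2\<close>. Everything else is an error term to be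
  absorbed.\<close>

lemma timo_dissipation:
  fixes z :: "complex^4" and a \<gamma> \<xi> p q :: real
  defines "Mz \<equiv> Msym (timo_A a) (timo_L \<gamma>) \<xi> z"
  shows "qform (\<lambda>i j. timo_H a p q \<xi> $ i $ j) Mz z + qform (\<lambda>i j. timo_H a p q \<xi> $ i $ j) z Mz
    = 2 * \<gamma> * (cmod (z$4))\<^sup>2
    + p * ((cmod (z$1))\<^sup>2 - (cmod (z$4))\<^sup>2 - \<gamma> * Re (z$4 * cnj (z$1)) + (a\<^sup>2 - 1) * \<xi> * Re (\<i> * z$4 * cnj (z$2)))
    + q * (\<xi>\<^sup>2 * (cmod (z$2))\<^sup>2 + a * \<xi>\<^sup>2 * (cmod (z$3))\<^sup>2 - \<xi>\<^sup>2 * (cmod (z$1))\<^sup>2 - a * \<xi>\<^sup>2 * (cmod (z$4))\<^sup>2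
      - \<xi> * Re (\<i> * z$2 * cnj (z$4)) + \<xi> * Re (\<i> * z$3 * cnj (z$1)) - \<gamma> * \<xi> * Re (\<i> * z$3 * cnj (z$4)))"
  unfolding Mz_def timo_H_form timo_Msym cmod_power2
  by (simp add: algebra_simps power2_eq_square)

section \<open>Coercivity of the dissipation and choice of the constants\<close>

lemma AM_GM_weighted:
  fixes x y c :: real
  assumes "c > 0" shows "x * y \<le> c * x\<^sup>2 + y\<^sup>2 / (4 * c)"
proof -
  have "0 \<le> (2 * c * x - y)\<^sup>2" by simp
  then show ?thesis using assms by (simp add: field_simps power2_eq_square)
qed

text \<open>Cross terms are split by weighted AM-GM. The second and third components give up a
  quarter of their dissipation to each of two terms and keep half; the first gives up a quarter of
  \<open>p\<close> to a cross term and half of it to losses from \<open>q\<close>; the fourth starts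
  with \<open>2 * \<gamma>\<close> and pays the remainder. The two smallness conditions on \<theta>
  collect these costs for the fourth and the first component. The condition on \<sigma> means
  \<open>\<sigma> * (1 + \<xi>\<^sup>2) \<le> 1\<close> if \<open>a\<close> is not 1, and holds for
  every \<sigma> if \<open>a = 1\<close>.\<close>

lemma timo_dissipation_lower:
  fixes z :: "complex^4" and a \<gamma> \<theta> \<sigma> \<xi> :: real
  assumes a: "a > 0" and \<gamma>: "\<gamma> > 0" and \<theta>: "0 < \<theta>" "\<theta> \<le> 1"
    "\<theta> * (2 + \<gamma>\<^sup>2 + (a\<^sup>2 - 1)\<^sup>2 + a + \<gamma>\<^sup>2 / a) \<le> \<gamma>" "\<theta> * (1 + 1 / a) \<le> 1 / 2"
    and \<sigma>: "0 < \<sigma>" "\<sigma> \<le> 1" "(a\<^sup>2 - 1)\<^sup>2 * (\<sigma> * (1 + \<xi>\<^sup>2)) \<le> (a\<^sup>2 - 1)\<^sup>2"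
  defines "p \<equiv> \<theta>\<^sup>2 * \<sigma>" and "q \<equiv> \<theta> ^ 3 * \<sigma> / (1 + \<xi>\<^sup>2)" and "Mz \<equiv> Msym (timo_A a) (timo_L \<gamma>) \<xi> z"
  shows "\<gamma> * (cmod (z$4))\<^sup>2 + \<theta>\<^sup>2 * \<sigma> / 4 * (cmod (z$1))\<^sup>2 + q * \<xi>\<^sup>2 / 2 * ((cmod (z$2))\<^sup>2 + a * (cmod (z$3))\<^sup>2)
    \<le> qform (\<lambda>i j. timo_H a p q \<xi> $ i $ j) Mz z + qform (\<lambda>i j. timo_H a p q \<xi> $ i $ j) z Mz"
proof -
  define x1 x2 x3 x4 where "x1 = cmod (z$1)" and "x2 = cmod (z$2)" and "x3 = cmod (z$3)" and "x4 = cmod (z$4)"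
  define w where "w = 1 + \<xi>\<^sup>2"
  have w: "w \<ge> 1" "w > 0" "\<xi>\<^sup>2 \<le> w" unfolding w_def by (auto intro: add_pos_nonneg)
  have p: "p > 0" "p \<le> \<theta>" and q: "q > 0" "q \<le> \<theta> ^ 3 * \<sigma>" "q * \<xi>\<^sup>2 \<le> \<theta> ^ 3 * \<sigma>"
  proof -
    show "p > 0" "q > 0" using \<theta> \<sigma> w by (auto simp: p_def q_def w_def[symmetric])
    have "\<theta>\<^sup>2 * \<sigma> \<le> \<theta> * 1" unfolding power2_eq_square mult.assoc
      using \<theta> \<sigma> by (intro mult_left_mono mult_le_one) auto
    then show "p \<le> \<theta>" by (simp add: p_def)
    have "\<theta> ^ 3 * \<sigma> * 1 \<le> \<theta> ^ 3 * \<sigma> * w" "\<theta> ^ 3 * \<sigma> * \<xi>\<^sup>2 \<le> \<theta> ^ 3 * \<sigma> * w"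
      using \<theta> \<sigma> w by (intro mult_left_mono; simp)+
    then show "q \<le> \<theta> ^ 3 * \<sigma>" "q * \<xi>\<^sup>2 \<le> \<theta> ^ 3 * \<sigma>"
      using w unfolding q_def w_def[symmetric] by (simp_all add: field_simps)
  qed
  have t3: "\<theta> ^ 3 * \<sigma> \<le> \<theta>"
  proof -
    have "\<theta> * (\<theta> * \<theta> * \<sigma>) \<le> \<theta> * 1" using \<theta> \<sigma> by (intro mult_left_mono mult_le_one) auto
    then show ?thesis by (simp add: power3_eq_cube mult.assoc)
  qed
  have Re1: "\<bar>Re (u * cnj v)\<bar> \<le> cmod u * cmod v" for u v
    using abs_Re_le_cmod[of "u * cnj v"] by (simp add: norm_mult)
  have Re2: "\<bar>Re (\<i> * u * cnj v)\<bar> \<le> cmod u * cmod v" for u v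
    using abs_Re_le_cmod[of "\<i> * u * cnj v"] by (simp add: norm_mult)
  have b1: "p * (\<gamma> * Re (z$4 * cnj (z$1))) \<le> p * (x1\<^sup>2 / 4 + \<gamma>\<^sup>2 * x4\<^sup>2)"
  proof (intro mult_left_mono)
    have "\<gamma> * Re (z$4 * cnj (z$1)) \<le> \<gamma> * (x4 * x1)"
      using Re1[of "z$4" "z$1"] \<gamma> unfolding x1_def x4_def by (intro mult_left_mono) auto
    also have "\<dots> = x1 * (\<gamma> * x4)" by simp
    also have "\<dots> \<le> 1/4 * x1\<^sup>2 + (\<gamma> * x4)\<^sup>2 / (4 * (1/4))" by (rule AM_GM_weighted) simp
    finally show "\<gamma> * Re (z$4 * cnj (z$1)) \<le> x1\<^sup>2 / 4 + \<gamma>\<^sup>2 * x4\<^sup>2" by (simp add: power_mult_distrib)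
  qed (use p in simp)
  have b2: "- (p * ((a\<^sup>2 - 1) * \<xi> * Re (\<i> * z$4 * cnj (z$2)))) \<le> q * \<xi>\<^sup>2 / 4 * x2\<^sup>2 + \<theta> * (a\<^sup>2 - 1)\<^sup>2 * x4\<^sup>2"
  proof -
    have "- (p * ((a\<^sup>2 - 1) * \<xi> * Re (\<i> * z$4 * cnj (z$2)))) \<le> \<bar>p * ((a\<^sup>2 - 1) * \<xi> * Re (\<i> * z$4 * cnj (z$2)))\<bar>" by linarith
    also have "\<dots> = p * (\<bar>a\<^sup>2 - 1\<bar> * \<bar>\<xi>\<bar> * \<bar>Re (\<i> * z$4 * cnj (z$2))\<bar>)" using p unfolding abs_mult by simp
    also have "\<dots> \<le> p * (\<bar>a\<^sup>2 - 1\<bar> * \<bar>\<xi>\<bar> * (x4 * x2))"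
      unfolding x4_def x2_def using p by (intro mult_left_mono Re2) auto
    also have "\<dots> = (\<bar>\<xi>\<bar> * x2) * (p * \<bar>a\<^sup>2 - 1\<bar> * x4)" by simp
    also have "\<dots> \<le> q / 4 * (\<bar>\<xi>\<bar> * x2)\<^sup>2 + (p * \<bar>a\<^sup>2 - 1\<bar> * x4)\<^sup>2 / (4 * (q / 4))"
      by (rule AM_GM_weighted) (use q in simp)
    \<comment> \<open>Here the relative size of \<open>p\<close> and \<open>q\<close> enters,
      through \<open>p\<^sup>2 = q * (\<theta> * \<sigma> * w)\<close>. The hypothesis on \<sigma>
      then removes the growth in \<xi>.\<close>
    also have "(p * \<bar>a\<^sup>2 - 1\<bar> * x4)\<^sup>2 / (4 * (q / 4)) = \<theta> * ((a\<^sup>2 - 1)\<^sup>2 * (\<sigma> * w)) * x4\<^sup>2"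
    proof -
      have "q * w = \<theta> ^ 3 * \<sigma>" using w by (simp add: q_def w_def[symmetric])
      moreover have "p\<^sup>2 = \<theta> ^ 3 * \<sigma> * (\<theta> * \<sigma>)" by (simp add: p_def power2_eq_square power3_eq_cube)
      ultimately have "p\<^sup>2 = q * (\<theta> * \<sigma> * w)" by (metis mult.assoc mult.commute)
      then have "(p * \<bar>a\<^sup>2 - 1\<bar> * x4)\<^sup>2 = q * (\<theta> * ((a\<^sup>2 - 1)\<^sup>2 * (\<sigma> * w)) * x4\<^sup>2)"
        by (simp add: power_mult_distrib)
      then show ?thesis using q by simp
    qed
    also have "\<dots> \<le> \<theta> * (a\<^sup>2 - 1)\<^sup>2 * x4\<^sup>2"
      using \<theta> \<sigma>(3) unfolding w_def by (intro mult_right_mono mult_left_mono) auto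
    finally show ?thesis by (simp add: power_mult_distrib)
  qed
  have b3: "q * (\<xi> * Re (\<i> * z$2 * cnj (z$4))) \<le> q * (\<xi>\<^sup>2 * x2\<^sup>2 / 4 + x4\<^sup>2)"
  proof (intro mult_left_mono)
    have "\<xi> * Re (\<i> * z$2 * cnj (z$4)) \<le> \<bar>\<xi>\<bar> * \<bar>Re (\<i> * z$2 * cnj (z$4))\<bar>" by (metis abs_ge_self abs_mult)
    also have "\<dots> \<le> \<bar>\<xi>\<bar> * (x2 * x4)" unfolding x2_def x4_def by (intro mult_left_mono Re2) auto
    also have "\<dots> = (\<bar>\<xi>\<bar> * x2) * x4" by simp
    also have "\<dots> \<le> 1/4 * (\<bar>\<xi>\<bar> * x2)\<^sup>2 + x4\<^sup>2 / (4 * (1/4))" by (rule AM_GM_weighted) simp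
    finally show "\<xi> * Re (\<i> * z$2 * cnj (z$4)) \<le> \<xi>\<^sup>2 * x2\<^sup>2 / 4 + x4\<^sup>2" by (simp add: power_mult_distrib)
  qed (use q in simp)
  have b4: "q * (- (\<xi> * Re (\<i> * z$3 * cnj (z$1)))) \<le> q * (a * \<xi>\<^sup>2 * x3\<^sup>2 / 4 + x1\<^sup>2 / a)"
  proof (intro mult_left_mono)
    have "- (\<xi> * Re (\<i> * z$3 * cnj (z$1))) \<le> \<bar>\<xi>\<bar> * \<bar>Re (\<i> * z$3 * cnj (z$1))\<bar>" by (metis abs_ge_minus_self abs_mult)
    also have "\<dots> \<le> \<bar>\<xi>\<bar> * (x3 * x1)" unfolding x3_def x1_def by (intro mult_left_mono Re2) auto
    also have "\<dots> = (\<bar>\<xi>\<bar> * x3) * x1" by simp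
    also have "\<dots> \<le> a/4 * (\<bar>\<xi>\<bar> * x3)\<^sup>2 + x1\<^sup>2 / (4 * (a/4))" by (rule AM_GM_weighted) (use a in simp)
    finally show "- (\<xi> * Re (\<i> * z$3 * cnj (z$1))) \<le> a * \<xi>\<^sup>2 * x3\<^sup>2 / 4 + x1\<^sup>2 / a" by (simp add: power_mult_distrib mult.assoc)
  qed (use q in simp)
  have b5: "q * (\<gamma> * \<xi> * Re (\<i> * z$3 * cnj (z$4))) \<le> q * (a * \<xi>\<^sup>2 * x3\<^sup>2 / 4 + \<gamma>\<^sup>2 / a * x4\<^sup>2)"
  proof (intro mult_left_mono)
    have "\<gamma> * \<xi> * Re (\<i> * z$3 * cnj (z$4)) \<le> \<bar>\<gamma> * \<xi>\<bar> * \<bar>Re (\<i> * z$3 * cnj (z$4))\<bar>" by (metis abs_ge_self abs_mult)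
    also have "\<dots> \<le> \<bar>\<gamma> * \<xi>\<bar> * (x3 * x4)" unfolding x3_def x4_def by (intro mult_left_mono Re2) auto
    also have "\<dots> = (\<bar>\<xi>\<bar> * x3) * (\<gamma> * x4)" using \<gamma> by (simp add: abs_mult)
    also have "\<dots> \<le> a/4 * (\<bar>\<xi>\<bar> * x3)\<^sup>2 + (\<gamma> * x4)\<^sup>2 / (4 * (a/4))" by (rule AM_GM_weighted) (use a in simp)
    finally show "\<gamma> * \<xi> * Re (\<i> * z$3 * cnj (z$4)) \<le> a * \<xi>\<^sup>2 * x3\<^sup>2 / 4 + \<gamma>\<^sup>2 / a * x4\<^sup>2"
      by (simp add: power_mult_distrib mult.assoc)
  qed (use q in simp)
  have c4: "\<gamma> * x4\<^sup>2 \<le> (2 * \<gamma> - p - p * \<gamma>\<^sup>2 - \<theta> * (a\<^sup>2 - 1)\<^sup>2 - q * \<xi>\<^sup>2 * a - q - q * (\<gamma>\<^sup>2 / a)) * x4\<^sup>2"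
  proof (rule mult_right_mono)
    have "p * \<gamma>\<^sup>2 \<le> \<theta> * \<gamma>\<^sup>2" "q * \<xi>\<^sup>2 * a \<le> \<theta> * a" "q * (\<gamma>\<^sup>2 / a) \<le> \<theta> * (\<gamma>\<^sup>2 / a)" "q \<le> \<theta>"
      using mult_right_mono[of p \<theta> "\<gamma>\<^sup>2"] mult_right_mono[of "q * \<xi>\<^sup>2" \<theta> a] mult_right_mono[of q \<theta> "\<gamma>\<^sup>2 / a"] p q t3 a
      by auto
    then show "\<gamma> \<le> 2 * \<gamma> - p - p * \<gamma>\<^sup>2 - \<theta> * (a\<^sup>2 - 1)\<^sup>2 - q * \<xi>\<^sup>2 * a - q - q * (\<gamma>\<^sup>2 / a)"
      using \<theta>(3) p unfolding distrib_left by linarith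
  qed simp
  have c1: "\<theta>\<^sup>2 * \<sigma> / 4 * x1\<^sup>2 \<le> (p - p / 4 - q * \<xi>\<^sup>2 - q / a) * x1\<^sup>2"
  proof (rule mult_right_mono)
    have "q * \<xi>\<^sup>2 + q * (1 / a) \<le> \<theta> ^ 3 * \<sigma> + \<theta> ^ 3 * \<sigma> * (1 / a)"
      using q a by (intro add_mono mult_right_mono) auto
    also have "\<dots> = p * (\<theta> * (1 + 1 / a))" by (simp add: p_def power2_eq_square power3_eq_cube distrib_left)
    also have "\<dots> \<le> p * (1 / 2)" using \<theta>(4) p by (intro mult_left_mono) auto
    finally show "\<theta>\<^sup>2 * \<sigma> / 4 \<le> p - p / 4 - q * \<xi>\<^sup>2 - q / a" unfolding p_def[symmetric] by simp
  qed simp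
  \<comment> \<open>With the real parts and quotients named, the goal is the sum of the bounds
    \<open>b1\<close> to \<open>b5\<close>, \<open>c1'\<close> and \<open>c4\<close>.\<close>
  define R1 R2 R3 R4 R5 where "R1 = Re (z$4 * cnj (z$1))" and "R2 = Re (\<i> * z$4 * cnj (z$2))"
    and "R3 = Re (\<i> * z$2 * cnj (z$4))" and "R4 = Re (\<i> * z$3 * cnj (z$1))" and "R5 = Re (\<i> * z$3 * cnj (z$4))"
  define k g where "k = x1\<^sup>2 / a" and "g = \<gamma>\<^sup>2 / a"
  have c1': "\<theta>\<^sup>2 * \<sigma> / 4 * x1\<^sup>2 \<le> (p - p / 4 - q * \<xi>\<^sup>2) * x1\<^sup>2 - q * k"
    using c1 by (simp add: k_def left_diff_distrib)
  note R = k_def[symmetric] g_def[symmetric] R1_def[symmetric] R2_def[symmetric] R3_def[symmetric] R4_def[symmetric] R5_def[symmetric]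
  show ?thesis
    unfolding Mz_def timo_dissipation x1_def[symmetric] x2_def[symmetric] x3_def[symmetric] x4_def[symmetric] R
    using b1[unfolded R] b2[unfolded R] b3[unfolded R] b4[unfolded R] b5[unfolded R] c1' c4[unfolded R] by (simp add: algebra_simps)
qed

text \<open>From \<open>2 * \<bar>\<xi>\<bar> \<le> 1 + \<xi>\<^sup>2\<close>: the denominator of
  \<open>q\<close> compensates the factor \<xi> of the second correction, so that it stays a bounded
  perturbation of the identity.\<close>

lemma timo_q_bound:
  assumes \<theta>: "0 < \<theta>" "\<theta> \<le> 1" and \<sigma>: "0 < \<sigma>" "\<sigma> \<le> 1"
  shows "\<bar>\<theta> ^ 3 * \<sigma> / (1 + \<xi>\<^sup>2) * \<xi>\<bar> \<le> \<theta> / (2::real)"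
proof -
  have w: "1 + \<xi>\<^sup>2 > 0" by (simp add: add_pos_nonneg)
  have x: "2 * \<bar>\<xi>\<bar> \<le> 1 + \<xi>\<^sup>2" using sum_squares_bound[of 1 "\<bar>\<xi>\<bar>"] by simp
  have t3: "\<theta> ^ 3 * \<sigma> \<le> \<theta>"
  proof -
    have "\<theta> * (\<theta> * \<theta> * \<sigma>) \<le> \<theta> * 1" using \<theta> \<sigma> by (intro mult_left_mono mult_le_one) auto
    then show ?thesis by (simp add: power3_eq_cube mult.assoc)
  qed
  have "2 * (\<theta> ^ 3 * \<sigma> * \<bar>\<xi>\<bar>) \<le> \<theta> * (1 + \<xi>\<^sup>2)"
    using mult_mono[OF t3 x] \<theta> \<sigma> by simp
  then show ?thesis using w \<theta> \<sigma> by (simp add: abs_mult field_simps)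
qed

text \<open>The corrections have coefficients at most \<theta> and \<open>\<theta> / 2\<close>, and
  each product of components is at most a mean of squares. The condition
  \<open>\<theta> * (2 + a) \<le> 1\<close> makes the total at most half of the squared
  norm.\<close>

lemma timo_energy_equiv:
  fixes z :: "complex^4" and a \<gamma> \<theta> \<sigma> \<xi> :: real
  assumes a: "a > 0" and \<theta>: "0 < \<theta>" "\<theta> \<le> 1" "\<theta> * (2 + a) \<le> 1" and \<sigma>: "0 < \<sigma>" "\<sigma> \<le> 1"
  defines "p \<equiv> \<theta>\<^sup>2 * \<sigma>" and "q \<equiv> \<theta> ^ 3 * \<sigma> / (1 + \<xi>\<^sup>2)"
  shows "\<bar>qform (\<lambda>i j. timo_H a p q \<xi> $ i $ j) z z - (norm z)\<^sup>2\<bar> \<le> 1 / 2 * (norm z)\<^sup>2"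
proof -
  define x1 x2 x3 x4 where "x1 = cmod (z$1)" and "x2 = cmod (z$2)" and "x3 = cmod (z$3)" and "x4 = cmod (z$4)"
  have nz: "(norm z)\<^sup>2 = x1\<^sup>2 + x2\<^sup>2 + x3\<^sup>2 + x4\<^sup>2"
    unfolding vec_norm_sq sum_4 x1_def x2_def x3_def x4_def by simp
  have Re0: "Re (u * cnj u) = (cmod u)\<^sup>2" for u by (simp add: cmod_power2 power2_eq_square[symmetric])
  have Re1: "\<bar>Re (u * cnj v)\<bar> \<le> ((cmod u)\<^sup>2 + (cmod v)\<^sup>2) / 2" for u v
    using abs_Re_le_cmod[of "u * cnj v"] sum_squares_bound[of "cmod u" "cmod v"] by (simp add: norm_mult)
  have Re2: "\<bar>Re (\<i> * u * cnj v)\<bar> \<le> ((cmod u)\<^sup>2 + (cmod v)\<^sup>2) / 2" for u v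
    using abs_Re_le_cmod[of "\<i> * u * cnj v"] sum_squares_bound[of "cmod u" "cmod v"] by (simp add: norm_mult)
  have p: "0 \<le> p" "p \<le> \<theta>"
  proof -
    have "\<theta>\<^sup>2 * \<sigma> \<le> \<theta> * 1" unfolding power2_eq_square mult.assoc
      using \<theta> \<sigma> by (intro mult_left_mono mult_le_one) auto
    then show "p \<le> \<theta>" "0 \<le> p" using \<sigma> by (auto simp: p_def)
  qed
  have q: "\<bar>q * \<xi>\<bar> \<le> \<theta> / 2" unfolding q_def by (rule timo_q_bound[OF \<theta>(1,2) \<sigma>])
  have "\<bar>p * (Re (z$4 * cnj (z$1)) + a * Re (z$3 * cnj (z$2)))\<bar> \<le> \<theta> * ((x4\<^sup>2 + x1\<^sup>2) / 2 + a * ((x3\<^sup>2 + x2\<^sup>2) / 2))"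
  proof -
    have "\<bar>a * Re (z$3 * cnj (z$2))\<bar> \<le> a * ((x3\<^sup>2 + x2\<^sup>2) / 2)"
      using mult_left_mono[OF Re1[of "z$3" "z$2"], of a] a unfolding x2_def x3_def abs_mult by simp
    then have "\<bar>Re (z$4 * cnj (z$1)) + a * Re (z$3 * cnj (z$2))\<bar> \<le> (x4\<^sup>2 + x1\<^sup>2) / 2 + a * ((x3\<^sup>2 + x2\<^sup>2) / 2)"
      using Re1[of "z$4" "z$1"] unfolding x1_def x4_def by linarith
    then show ?thesis unfolding abs_mult using p \<theta> by (intro mult_mono) auto
  qed
  also have "\<dots> \<le> \<theta> * ((1 + a) * (norm z)\<^sup>2 / 2)"
  proof (rule mult_left_mono)
    have "0 \<le> a * (x1\<^sup>2 + x4\<^sup>2)" "0 \<le> x2\<^sup>2 + x3\<^sup>2" using a by auto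
    then show "(x4\<^sup>2 + x1\<^sup>2) / 2 + a * ((x3\<^sup>2 + x2\<^sup>2) / 2) \<le> (1 + a) * (norm z)\<^sup>2 / 2"
      unfolding nz by (simp add: field_simps)
  qed (use \<theta> in simp)
  finally have A: "\<bar>p * (Re (z$4 * cnj (z$1)) + a * Re (z$3 * cnj (z$2)))\<bar> \<le> \<theta> * ((1 + a) * (norm z)\<^sup>2 / 2)" .
  have "\<bar>q * \<xi> * (Re (\<i> * z$2 * cnj (z$1)) + Re (\<i> * z$3 * cnj (z$4)))\<bar> \<le> \<theta> / 2 * ((x2\<^sup>2 + x1\<^sup>2) / 2 + (x3\<^sup>2 + x4\<^sup>2) / 2)"
    unfolding abs_mult[of "q * \<xi>"] x1_def x2_def x3_def x4_def
    using \<theta> by (intro mult_mono q order_trans[OF abs_triangle_ineq] add_mono Re2) auto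
  also have "\<dots> \<le> \<theta> * (norm z)\<^sup>2 / 2" unfolding nz using \<theta> by (simp add: field_simps)
  finally have B: "\<bar>q * \<xi> * (Re (\<i> * z$2 * cnj (z$1)) + Re (\<i> * z$3 * cnj (z$4)))\<bar> \<le> \<theta> * (norm z)\<^sup>2 / 2" .
  have "\<bar>qform (\<lambda>i j. timo_H a p q \<xi> $ i $ j) z z - (norm z)\<^sup>2\<bar> \<le> \<theta> * ((1 + a) * (norm z)\<^sup>2 / 2) + \<theta> * (norm z)\<^sup>2 / 2"
    using A B unfolding timo_H_form Re0 nz x1_def[symmetric] x2_def[symmetric] x3_def[symmetric] x4_def[symmetric] by linarith
  also have "\<dots> = \<theta> * (2 + a) * ((norm z)\<^sup>2 / 2)" by (simp add: algebra_simps add_divide_distrib)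
  also have "\<dots> \<le> 1 * ((norm z)\<^sup>2 / 2)" using \<theta>(3) by (intro mult_right_mono) auto
  finally show ?thesis by simp
qed

lemma rho_bounds: "0 \<le> rho \<xi>" "rho \<xi> \<le> 1"
proof -
  have "1 + \<xi>\<^sup>2 > 0" by (simp add: add_pos_nonneg)
  then show "0 \<le> rho \<xi>" "rho \<xi> \<le> 1" by (simp_all add: rho_def)
qed

text \<open>The constants are chosen before \<sigma>, so one computation serves both weights. The
  first component is dissipated at the scale \<sigma>, the second and third with the further factor
  \<open>\<xi>\<^sup>2 / (1 + \<xi>\<^sup>2)\<close>; the smallest of these is
  \<open>\<sigma> * rho\<close>.\<close>

theorem timo_decay:
  assumes a: "a > 0" and \<gamma>: "\<gamma> > 0"
  shows "\<exists>C>0. \<exists>c>0. \<forall>\<sigma>. \<sigma> \<in> borel_measurable borel \<longrightarrow>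
    (\<forall>\<xi>. 0 < \<sigma> \<xi> \<and> \<sigma> \<xi> \<le> 1 \<and> (a\<^sup>2 - 1)\<^sup>2 * (\<sigma> \<xi> * (1 + \<xi>\<^sup>2)) \<le> (a\<^sup>2 - 1)\<^sup>2) \<longrightarrow>
    (\<forall>u0 u t. timo_solution a \<gamma> u0 u \<longrightarrow> t \<ge> 0 \<longrightarrow>
      (AE \<xi> in lborel. norm (fourier_L2 (u t) \<xi>) \<le> C * exp (- c * (\<sigma> \<xi> * rho \<xi>) * t) * norm (fourier_L2 u0 \<xi>)))"
proof -
  define K1 where "K1 = 2 + \<gamma>\<^sup>2 + (a\<^sup>2 - 1)\<^sup>2 + a + \<gamma>\<^sup>2 / a"
  have K1: "K1 > 0" unfolding K1_def using a by (intro add_pos_nonneg add_pos_nonneg) auto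
  have a1: "1 + 1 / a > 0" using a by (simp add: add_pos_pos)
  \<comment> \<open>The three quotients are the smallness conditions of
    \<open>timo_dissipation_lower\<close> and \<open>timo_energy_equiv\<close>, solved for
    \<theta>.\<close>
  define \<theta> where "\<theta> = min 1 (min (\<gamma> / K1) (min (1 / 2 / (1 + 1 / a)) (1 / (2 + a))))"
  have \<theta>: "0 < \<theta>" "\<theta> \<le> 1" unfolding \<theta>_def using \<gamma> K1 a a1 by auto
  have "\<theta> \<le> \<gamma> / K1" "\<theta> \<le> 1 / 2 / (1 + 1 / a)" "\<theta> \<le> 1 / (2 + a)" unfolding \<theta>_def by auto
  then have \<theta>K: "\<theta> * K1 \<le> \<gamma>" "\<theta> * (1 + 1 / a) \<le> 1 / 2" "\<theta> * (2 + a) \<le> 1"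
    using pos_le_divide_eq[OF K1] pos_le_divide_eq[OF a1] pos_le_divide_eq[of "2 + a"] a by (blast, blast, force)
  \<comment> \<open>The least coefficient in the lower bound for the dissipation. The rate uses
    \<open>\<kappa> / 3\<close> because of the factor 2 in front of the rate and the upper bound 3/2
    of the form.\<close>
  define \<kappa> where "\<kappa> = min \<gamma> (min (\<theta>\<^sup>2 / 4) (min (\<theta> ^ 3 / 2) (\<theta> ^ 3 / 2 * a)))"
  have \<kappa>: "\<kappa> > 0" unfolding \<kappa>_def using \<gamma> \<theta> a by auto
  have \<kappa>le: "\<kappa> \<le> \<gamma>" "\<kappa> \<le> \<theta>\<^sup>2 / 4" "\<kappa> \<le> \<theta> ^ 3 / 2" "\<kappa> \<le> \<theta> ^ 3 / 2 * a" unfolding \<kappa>_def by auto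
  show ?thesis
  proof (rule exI[of _ "sqrt 3"], rule conjI[rotated], rule exI[of _ "\<kappa> / 3"], rule conjI[rotated], intro allI impI)
    fix \<sigma> :: "real \<Rightarrow> real" and u0 u and t :: real
    assume [measurable]: "\<sigma> \<in> borel_measurable borel"
      and \<sigma>: "\<forall>\<xi>. 0 < \<sigma> \<xi> \<and> \<sigma> \<xi> \<le> 1 \<and> (a\<^sup>2 - 1)\<^sup>2 * (\<sigma> \<xi> * (1 + \<xi>\<^sup>2)) \<le> (a\<^sup>2 - 1)\<^sup>2"
      and sol: "timo_solution a \<gamma> u0 u" and t: "t \<ge> 0"
    have \<sigma>': "0 < \<sigma> \<xi>" "\<sigma> \<xi> \<le> 1" "(a\<^sup>2 - 1)\<^sup>2 * (\<sigma> \<xi> * (1 + \<xi>\<^sup>2)) \<le> (a\<^sup>2 - 1)\<^sup>2" for \<xi> using \<sigma> by auto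
    define p q where "p \<xi> = \<theta>\<^sup>2 * \<sigma> \<xi>" and "q \<xi> = \<theta> ^ 3 * \<sigma> \<xi> / (1 + \<xi>\<^sup>2)" for \<xi>
    define H where "H \<xi> i j = timo_H a (p \<xi>) (q \<xi>) \<xi> $ i $ j" for \<xi> i j
    define r where "r \<xi> = \<kappa> / 3 * (\<sigma> \<xi> * rho \<xi>)" for \<xi>
    have sol': "cauchy_solution (mat 1) (timo_A a) (timo_L \<gamma>) u0 u" using sol by (simp add: timo_solution_def timo_A0_def)
    have eq: "\<bar>qform (H \<xi>) z z - (norm z)\<^sup>2\<bar> \<le> 1 / 2 * (norm z)\<^sup>2" for \<xi> z
      using timo_energy_equiv[OF a \<theta> \<theta>K(3) \<sigma>'(1,2), of \<xi> \<xi> z] unfolding H_def p_def q_def .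
    have "AE \<xi> in lborel. norm (fourier_L2 (u t) \<xi>) \<le> sqrt ((3 / 2) / (1 / 2)) * exp (- r \<xi> * t) * norm (fourier_L2 u0 \<xi>)"
    proof (rule Lyapunov_decay[OF sol' t])
      have "\<forall>i j. (\<lambda>\<xi>. H \<xi> i j) \<in> borel_measurable borel"
        unfolding H_def timo_H_def forall_4 vector_4 p_def q_def by simp
      then show "(\<lambda>\<xi>. H \<xi> i j) \<in> borel_measurable borel" for i j by blast
      have pb: "\<bar>p \<xi>\<bar> \<le> 1" for \<xi>
        using \<theta> \<sigma>'(1,2)[of \<xi>] unfolding p_def by (simp add: abs_mult mult_le_one power_le_one)
      have qb: "\<bar>q \<xi> * \<xi>\<bar> \<le> 1" for \<xi>
        unfolding q_def by (rule order_trans[OF timo_q_bound[OF \<theta> \<sigma>'(1,2)]]) (use \<theta> in simp)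
      have pa: "\<bar>p \<xi> * a\<bar> \<le> 1 + a" for \<xi>
        using mult_right_mono[OF pb[of \<xi>], of a] a unfolding abs_mult by linarith
      have "\<forall>i j. cmod (H \<xi> i j) \<le> 1 + a" for \<xi>
        unfolding H_def timo_H_def forall_4 vector_4
        using pb[of \<xi>] qb[of \<xi>] pa[of \<xi>] a by (simp add: norm_mult abs_mult)
      then show "cmod (H \<xi> i j) \<le> 1 + a" for \<xi> i j by blast
      show "1 / 2 * (norm z)\<^sup>2 \<le> qform (H \<xi>) z z" "qform (H \<xi>) z z \<le> 3 / 2 * (norm z)\<^sup>2" for \<xi> z
        using eq[of \<xi> z] by linarith+
      show "r \<in> borel_measurable borel" unfolding r_def rho_def by simp
      fix \<xi> and z :: "complex^4"
      let ?\<mu> = "\<sigma> \<xi> * rho \<xi>"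
      have \<mu>: "0 \<le> ?\<mu>" "?\<mu> \<le> 1" "?\<mu> \<le> \<sigma> \<xi>"
        using rho_bounds[of \<xi>] \<sigma>'(1,2)[of \<xi>] by (auto intro: mult_le_one mult_left_le)
      have "2 * r \<xi> * qform (H \<xi>) z z \<le> 2 * r \<xi> * (3 / 2 * (norm z)\<^sup>2)"
      proof (rule mult_left_mono)
        show "qform (H \<xi>) z z \<le> 3 / 2 * (norm z)\<^sup>2" using eq[of \<xi> z] by linarith
      qed (use \<mu> \<kappa> in \<open>simp add: r_def\<close>)
      also have "\<dots> = \<kappa> * ?\<mu> * (cmod (z$1))\<^sup>2 + \<kappa> * ?\<mu> * (cmod (z$2))\<^sup>2 + \<kappa> * ?\<mu> * (cmod (z$3))\<^sup>2 + \<kappa> * ?\<mu> * (cmod (z$4))\<^sup>2"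
        unfolding vec_norm_sq sum_4 r_def by (simp add: algebra_simps)
      also have "\<dots> \<le> \<theta>\<^sup>2 * \<sigma> \<xi> / 4 * (cmod (z$1))\<^sup>2 + \<theta> ^ 3 / 2 * ?\<mu> * (cmod (z$2))\<^sup>2 + \<theta> ^ 3 / 2 * a * ?\<mu> * (cmod (z$3))\<^sup>2 + \<gamma> * (cmod (z$4))\<^sup>2"
      proof (intro add_mono mult_right_mono zero_le_power2 \<mu> \<kappa>le(3,4))
        have "\<kappa> * ?\<mu> \<le> \<theta>\<^sup>2 / 4 * \<sigma> \<xi>" using \<kappa>le \<kappa> \<mu> \<theta> by (intro mult_mono) auto
        then show "\<kappa> * ?\<mu> \<le> \<theta>\<^sup>2 * \<sigma> \<xi> / 4" by simp
        have "\<kappa> * ?\<mu> \<le> \<gamma> * 1" using \<kappa>le \<kappa> \<mu> \<gamma> by (intro mult_mono) auto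
        then show "\<kappa> * ?\<mu> \<le> \<gamma>" by simp
      qed
      also have "\<dots> = \<gamma> * (cmod (z$4))\<^sup>2 + \<theta>\<^sup>2 * \<sigma> \<xi> / 4 * (cmod (z$1))\<^sup>2 + q \<xi> * \<xi>\<^sup>2 / 2 * ((cmod (z$2))\<^sup>2 + a * (cmod (z$3))\<^sup>2)"
        unfolding q_def rho_def by (simp add: algebra_simps add_divide_distrib)
      also have "\<dots> \<le> qform (H \<xi>) (Msym (timo_A a) (timo_L \<gamma>) \<xi> z) z + qform (H \<xi>) z (Msym (timo_A a) (timo_L \<gamma>) \<xi> z)"
        using timo_dissipation_lower[OF a \<gamma> \<theta> \<theta>K(1)[unfolded K1_def] \<theta>K(2) \<sigma>'(1)[of \<xi>] \<sigma>'(2)[of \<xi>] \<sigma>'(3)[of \<xi>], of z] unfolding H_def p_def q_def .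
      finally show "2 * r \<xi> * qform (H \<xi>) z z
        \<le> qform (H \<xi>) (Msym (timo_A a) (timo_L \<gamma>) \<xi> z) z + qform (H \<xi>) z (Msym (timo_A a) (timo_L \<gamma>) \<xi> z)" .
    qed simp
    then show "AE \<xi> in lborel. norm (fourier_L2 (u t) \<xi>) \<le> sqrt 3 * exp (- (\<kappa> / 3) * (\<sigma> \<xi> * rho \<xi>) * t) * norm (fourier_L2 u0 \<xi>)"
      unfolding r_def by simp
  qed (use \<kappa> in simp_all)
qed

lemma eta_rho: "eta \<xi> = 1 / (1 + \<xi>\<^sup>2) * rho \<xi>"
  by (simp add: eta_def rho_def power2_eq_square)

lemma pointwise_estimateI:
  assumes AE: "\<And>u0 u t. timo_solution a \<gamma> u0 u \<Longrightarrow> t \<ge> 0 \<Longrightarrow>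
      AE \<xi> in lborel. norm (fourier_L2 (u t) \<xi>) \<le> C * exp (- c * r \<xi> * t) * norm (fourier_L2 u0 \<xi>)"
    and r: "continuous_on UNIV r"
  shows "pointwise_estimate a \<gamma> r C c"
  unfolding pointwise_estimate_def
proof (intro allI impI conjI AE)
  fix u0 u and t \<xi> :: real
  assume sol: "timo_solution a \<gamma> u0 u" and t: "t \<ge> 0" and i: "integrable lborel u0 \<and> integrable lborel (u t)"
  have l2: "L2 u0" "L2 (u t)" using sol t by (auto simp: timo_solution_def cauchy_solution_def)
  show "norm (fourier (u t) \<xi>) \<le> C * exp (- c * r \<xi> * t) * norm (fourier u0 \<xi>)"
    by (rule fourier_bound_everywhere[OF _ l2(2) _ l2(1) _ AE[OF sol t]]) (use i r in \<open>auto intro!: continuous_intros\<close>)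
qed

lemma rho_continuous: "continuous_on UNIV rho"
proof -
  have "1 + \<xi>\<^sup>2 \<noteq> 0" for \<xi> :: real using add_pos_nonneg[of 1 "\<xi>\<^sup>2"] by simp
  then show ?thesis unfolding rho_def[abs_def] by (intro continuous_intros) auto
qed

lemma eta_continuous: "continuous_on UNIV eta"
proof -
  have "1 + \<xi>\<^sup>2 \<noteq> 0" for \<xi> :: real using add_pos_nonneg[of 1 "\<xi>\<^sup>2"] by simp
  then show ?thesis unfolding eta_def[abs_def] by (intro continuous_intros) auto
qed

section \<open>Decay estimates\<close>

lemma L2_dilation:
  fixes f :: "real \<Rightarrow> 'b::euclidean_space"
  assumes f: "L2 f" and l: "l > 0"
  shows "L2 (\<lambda>x. f (l * x))" "L2_norm (\<lambda>x. f (l * x)) = L2_norm f / sqrt l"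
proof -
  note [measurable] = L2D(1)[OF f]
  have "integrable lborel (\<lambda>x. (norm (f (l * x)))\<^sup>2)"
    using lborel_integrable_real_affine[OF L2_integrable[OF f], of l 0] l by simp
  then show "L2 (\<lambda>x. f (l * x))" by (simp add: L2_def)
  have "(LINT x|lborel. (norm (f x))\<^sup>2) = l * (LINT x|lborel. (norm (f (l * x)))\<^sup>2)"
    using lborel_integral_real_affine[of l "\<lambda>x. (norm (f x))\<^sup>2" 0] l by simp
  then show "L2_norm (\<lambda>x. f (l * x)) = L2_norm f / sqrt l"
    using l unfolding L2_norm_def by (simp add: real_sqrt_mult)
qed

lemma L2_gaussian_moment: "L2 (\<lambda>x::real. \<bar>x\<bar> ^ k * exp (- x\<^sup>2 / 4))"
proof -
  have e: "(norm (\<bar>x\<bar> ^ k * exp (- x\<^sup>2 / 4)))\<^sup>2 = sqrt (2 * pi) * (std_normal_density x * x ^ (2 * k))" for x :: real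
  proof -
    have "(exp (- x\<^sup>2 / 4))\<^sup>2 = exp (- x\<^sup>2 / 2)" by (simp add: exp_double[symmetric])
    then show ?thesis
      by (simp add: power_mult_distrib std_normal_density_def power_mult[symmetric] power_even_abs mult.commute[of k])
  qed
  show ?thesis unfolding L2_def e using integrable_std_normal_moment[of "2 * k"] by simp
qed

text \<open>Dilation by \<open>l = sqrt (4 * c * (1 + t))\<close> leads to a fixed Gaussian moment:
  each power of \<xi> costs \<open>1 / l\<close> and the \<open>L2\<close> norm costs
  \<open>1 / sqrt l\<close>, whence the exponent. For frequencies of modulus at most 1, replacing
  \<open>t\<close> by \<open>1 + t\<close> costs only the factor \<open>exp c\<close>, and the bound
  holds down to \<open>t = 0\<close>.\<close>

lemma low_frequency_bound:
  assumes c: "c > (0::real)"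
  shows "\<exists>G\<ge>0. \<forall>t\<ge>0. L2 (\<lambda>\<xi>. indicator {-1..1} \<xi> * (\<bar>\<xi>\<bar> ^ k * exp (- c * \<xi>\<^sup>2 * t))) \<and>
    L2_norm (\<lambda>\<xi>. indicator {-1..1} \<xi> * (\<bar>\<xi>\<bar> ^ k * exp (- c * \<xi>\<^sup>2 * t))) \<le> G * (1 + t) powr (- 1 / 4 - real k / 2)"
proof -
  define g where "g x = \<bar>x\<bar> ^ k * exp (- x\<^sup>2 / 4)" for x :: real
  have g: "L2 g" unfolding g_def by (rule L2_gaussian_moment)
  define G where "G = exp c * L2_norm g * (4 * c) powr (- 1 / 4 - real k / 2)"
  show ?thesis
  proof (intro exI[of _ G] conjI allI impI)
    show "G \<ge> 0" by (simp add: G_def)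
    fix t :: real assume t: "t \<ge> 0"
    define l where "l = sqrt (4 * c * (1 + t))"
    have l: "l > 0" "l\<^sup>2 = 4 * c * (1 + t)" using c t by (simp_all add: l_def)
    define h where "h \<xi> = indicator {-1..1} \<xi> * (\<bar>\<xi>\<bar> ^ k * exp (- c * \<xi>\<^sup>2 * t))" for \<xi> :: real
    have hm: "h \<in> borel_measurable borel" unfolding h_def by measurable
    have h_le: "norm (h \<xi>) \<le> norm ((exp c / l ^ k) *\<^sub>R g (l * \<xi>))" for \<xi>
    proof (cases "\<xi> \<in> {-1..1}")
      case True
      have "\<xi>\<^sup>2 \<le> 1" using True by (simp add: abs_square_le_1 abs_le_iff)
      then have "- c * \<xi>\<^sup>2 * t \<le> c - (l * \<xi>)\<^sup>2 / 4"
        using mult_left_mono[of "\<xi>\<^sup>2" 1 c] c by (simp add: power_mult_distrib l(2) algebra_simps)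
      then have "exp (- c * \<xi>\<^sup>2 * t) \<le> exp c * exp (- (l * \<xi>)\<^sup>2 / 4)" by (simp flip: exp_add)
      then have "\<bar>\<xi>\<bar> ^ k * exp (- c * \<xi>\<^sup>2 * t) \<le> \<bar>\<xi>\<bar> ^ k * (exp c * exp (- (l * \<xi>)\<^sup>2 / 4))" by (rule mult_left_mono) simp
      also have "\<dots> = (exp c / l ^ k) * g (l * \<xi>)"
        using l(1) by (simp add: g_def abs_mult power_mult_distrib)
      finally show ?thesis using True l(1) by (simp add: h_def g_def abs_mult)
    qed (simp add: h_def)
    note gl = L2_dilation[OF g l(1)]
    have b: "L2 h" "L2_norm h \<le> L2_norm (\<lambda>\<xi>. (exp c / l ^ k) *\<^sub>R g (l * \<xi>))"
      by (rule L2_bound[OF L2_scaleR(1)[OF gl(1)] hm AE_I2[OF h_le]])+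
    have e1: "L2_norm (\<lambda>\<xi>. (exp c / l ^ k) *\<^sub>R g (l * \<xi>)) = exp c * L2_norm g * (1 / (l ^ k * sqrt l))"
      unfolding L2_scaleR(2)[OF gl(1)] gl(2) using l(1) by (simp add: abs_mult)
    have e2: "1 / (l ^ k * sqrt l) = (4 * c) powr (- 1 / 4 - real k / 2) * (1 + t) powr (- 1 / 4 - real k / 2)"
    proof -
      have "l = (4 * c * (1 + t)) powr (1 / 2)" unfolding l_def using c t by (simp add: powr_half_sqrt)
      then have lp: "l powr s = (4 * c * (1 + t)) powr (s / 2)" for s by (simp add: powr_powr)
      have "l ^ k * sqrt l = l powr real k * l powr (1 / 2)" using l(1) by (simp add: powr_realpow powr_half_sqrt)
      also have "\<dots> = l powr (real k + 1 / 2)" by (simp add: powr_add)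
      finally have e: "l ^ k * sqrt l = l powr (real k + 1 / 2)" .
      have "1 / (l ^ k * sqrt l) = l powr (- (real k + 1 / 2))"
        unfolding e powr_minus by (simp only: inverse_eq_divide)
      also have "\<dots> = (4 * c * (1 + t)) powr (- 1 / 4 - real k / 2)"
        unfolding lp by (rule arg_cong[where f="\<lambda>s. _ powr s"]) (simp add: field_simps)
      also have "\<dots> = (4 * c) powr (- 1 / 4 - real k / 2) * (1 + t) powr (- 1 / 4 - real k / 2)"
        by (rule powr_mult)
      finally show ?thesis .
    qed
    have "L2_norm h \<le> G * (1 + t) powr (- 1 / 4 - real k / 2)"
      using b(2) unfolding e1 e2 G_def by (simp only: mult.assoc)
    with b(1) show "L2 (\<lambda>\<xi>. indicator {-1..1} \<xi> * (\<bar>\<xi>\<bar> ^ k * exp (- c * \<xi>\<^sup>2 * t)))"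
      "L2_norm (\<lambda>\<xi>. indicator {-1..1} \<xi> * (\<bar>\<xi>\<bar> ^ k * exp (- c * \<xi>\<^sup>2 * t))) \<le> G * (1 + t) powr (- 1 / 4 - real k / 2)"
      unfolding h_def by auto
  qed
qed

text \<open>The bound for each component is summed crudely; the number of components enters only the
  constant.\<close>

lemma norm_fourier_le:
  fixes f :: "real \<Rightarrow> real^'m"
  assumes f: "integrable lborel f" shows "norm (fourier f \<xi>) \<le> real CARD('m) * L1_norm f"
proof -
  have "norm (fourier f \<xi>) \<le> (\<Sum>i\<in>(UNIV::'m set). cmod (ft (comp f i) \<xi>))"
    unfolding fourier_nth[symmetric] norm_vec_def by (rule L2_set_le_sum) simp
  also have "\<dots> \<le> (\<Sum>i\<in>(UNIV::'m set). L1_norm f)"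
  proof (rule sum_mono)
    fix i
    have "cmod (ft (comp f i) \<xi>) \<le> (LINT x|lborel. cmod (comp f i x))" by (rule ft_bound)
    also have "\<dots> \<le> (LINT x|lborel. norm (f x))"
      using integrable_bounded_linear[OF bounded_linear_vec_nth f, of i] f
      by (intro integral_mono) (auto simp: component_le_norm_cart)
    finally show "cmod (ft (comp f i) \<xi>) \<le> L1_norm f" by (simp add: L1_norm_def)
  qed
  finally show ?thesis by simp
qed

text \<open>Low frequencies are controlled by \<open>L\<^sup>1\<close>, where the rate is parabolic, and high frequencies by
  \<open>L\<^sup>2\<close> with \<open>j - k\<close> extra derivatives.\<close>

lemma frequency_splitting:
  fixes u0 v :: "real \<Rightarrow> real^'m" and c t :: real and k :: nat
  defines "g \<equiv> \<lambda>\<xi>::real. indicator {-1..1} \<xi> * (\<bar>\<xi>\<bar> ^ k * exp (- (c / 4) * \<xi>\<^sup>2 * t))"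
  assumes F0: "vec_FT u0 F0" and F: "vec_FT v F" and i: "integrable lborel u0"
    and AE: "AE \<xi> in lborel. norm (F \<xi>) \<le> C * exp (- c * r \<xi> * t) * norm (F0 \<xi>)"
    and C: "C \<ge> 0" and c: "c > 0" and t: "t \<ge> 0" and D: "D \<ge> 0"
    and low: "\<And>\<xi>. \<bar>\<xi>\<bar> \<le> 1 \<Longrightarrow> \<xi>\<^sup>2 / 4 \<le> r \<xi>"
    and high: "\<And>\<xi>. \<bar>\<xi>\<bar> > 1 \<Longrightarrow> \<bar>\<xi>\<bar> ^ k * exp (- c * r \<xi> * t) \<le> D * \<bar>\<xi>\<bar> ^ j"
    and L: "L2 (\<lambda>\<xi>. \<xi> ^ j *\<^sub>R F0 \<xi>)"
    and g: "L2 g"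
  shows "L2_norm (\<lambda>\<xi>. \<xi> ^ k *\<^sub>R F \<xi>) \<le> C * (real CARD('m) * L1_norm u0) * L2_norm g + C * D * L2_norm (\<lambda>\<xi>. \<xi> ^ j *\<^sub>R F0 \<xi>)"
proof -
  define M where "M = real CARD('m) * L1_norm u0"
  have M: "M \<ge> 0" by (simp add: M_def L1_norm_def)
  have F0_eq: "AE \<xi> in lborel. norm (F0 \<xi>) \<le> M"
    using vec_FT_unique[OF F0 vec_FT_fourier[OF i vec_FT_L2(1)[OF F0]]]
    by eventually_elim (simp add: M_def norm_fourier_le[OF i])
  \<comment> \<open>A majorant on all frequencies: the first part serves the band, the second part
    its complement. Both are nonnegative, so on each region the other part may be added
    freely.\<close>
  define G where "G \<xi> = (C * M) *\<^sub>R g \<xi> + (C * D) *\<^sub>R norm (\<xi> ^ j *\<^sub>R F0 \<xi>)" for \<xi>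
  have nL: "L2 (\<lambda>\<xi>. norm (\<xi> ^ j *\<^sub>R F0 \<xi>))" "L2_norm (\<lambda>\<xi>. norm (\<xi> ^ j *\<^sub>R F0 \<xi>)) = L2_norm (\<lambda>\<xi>. \<xi> ^ j *\<^sub>R F0 \<xi>)"
  proof -
    have "(\<lambda>\<xi>. norm (\<xi> ^ j *\<^sub>R F0 \<xi>)) \<in> borel_measurable borel"
      using measurable_compose[OF L2D(1)[OF L] borel_measurable_norm] .
    from L2_bound(1)[OF L this] show "L2 (\<lambda>\<xi>. norm (\<xi> ^ j *\<^sub>R F0 \<xi>))" by simp
    show "L2_norm (\<lambda>\<xi>. norm (\<xi> ^ j *\<^sub>R F0 \<xi>)) = L2_norm (\<lambda>\<xi>. \<xi> ^ j *\<^sub>R F0 \<xi>)" by (simp add: L2_norm_def)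
  qed
  have GL: "L2 G" unfolding G_def by (intro L2_add L2_scaleR(1) g nL)
  have "L2_norm (\<lambda>\<xi>. \<xi> ^ k *\<^sub>R F \<xi>) \<le> L2_norm G"
  proof (rule L2_bound(2)[OF GL])
    note [measurable] = L2D(1)[OF vec_FT_L2(2)[OF F]]
    show "(\<lambda>\<xi>. \<xi> ^ k *\<^sub>R F \<xi>) \<in> borel_measurable borel" by measurable
    show "AE \<xi> in lborel. norm (\<xi> ^ k *\<^sub>R F \<xi>) \<le> norm (G \<xi>)"
      using AE F0_eq
    proof eventually_elim
      case (elim \<xi>)
      have "norm (\<xi> ^ k *\<^sub>R F \<xi>) \<le> \<bar>\<xi>\<bar> ^ k * (C * exp (- c * r \<xi> * t) * norm (F0 \<xi>))"
        using mult_left_mono[OF elim(1), of "\<bar>\<xi>\<bar> ^ k"] by (simp add: power_abs)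
      also have "\<dots> \<le> G \<xi>"
      proof (cases "\<bar>\<xi>\<bar> \<le> 1")
        case True
        have "exp (- c * r \<xi> * t) \<le> exp (- (c / 4) * \<xi>\<^sup>2 * t)"
          using mult_left_mono[OF low[OF True], of "c * t"] c t by (simp add: algebra_simps)
        then have "\<bar>\<xi>\<bar> ^ k * (C * exp (- c * r \<xi> * t) * norm (F0 \<xi>)) \<le> \<bar>\<xi>\<bar> ^ k * (C * exp (- (c / 4) * \<xi>\<^sup>2 * t) * M)"
          using C elim(2) by (intro mult_left_mono mult_mono) auto
        also have "\<dots> = (C * M) * g \<xi>" using True by (simp add: g_def indicator_def abs_le_iff)
        also have "\<dots> \<le> G \<xi>" unfolding G_def using C D by simp
        finally show ?thesis .
      next
        case False
        have "\<bar>\<xi>\<bar> ^ k * (C * exp (- c * r \<xi> * t) * norm (F0 \<xi>)) = (\<bar>\<xi>\<bar> ^ k * exp (- c * r \<xi> * t)) * (C * norm (F0 \<xi>))" by simp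
        also have "\<dots> \<le> (D * \<bar>\<xi>\<bar> ^ j) * (C * norm (F0 \<xi>))"
          by (rule mult_right_mono[OF high]) (use False C in auto)
        also have "\<dots> = (C * D) * norm (\<xi> ^ j *\<^sub>R F0 \<xi>)" by (simp add: power_abs)
        also have "\<dots> \<le> G \<xi>" unfolding G_def using C M by (simp add: g_def)
        finally show ?thesis .
      qed
      finally show ?case by (rule order_trans) simp
    qed
  qed
  also have "\<dots> \<le> L2_norm (\<lambda>\<xi>. (C * M) *\<^sub>R g \<xi>) + L2_norm (\<lambda>\<xi>. (C * D) *\<^sub>R norm (\<xi> ^ j *\<^sub>R F0 \<xi>))"
    unfolding G_def by (intro L2_norm_triangle L2_scaleR(1) g nL)
  also have "\<dots> = C * M * L2_norm g + C * D * L2_norm (\<lambda>\<xi>. \<xi> ^ j *\<^sub>R F0 \<xi>)"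
    unfolding L2_scaleR(2)[OF g] L2_scaleR(2)[OF nL(1)] nL(2) using C D M by simp
  finally show ?thesis unfolding M_def .
qed

text \<open>The high-frequency bound is left open in \<open>D\<close> and \<open>j\<close>. For
  \<open>eta\<close> it is used with \<open>j = k + l\<close> and \<open>D\<close> decaying like a
  power of \<open>1 + t\<close>, which is the loss of \<open>l\<close> derivatives; for
  \<open>rho\<close> with \<open>j = k\<close> and \<open>D\<close> exponentially decaying. The
  factor 4 is the number of components.\<close>

lemma solution_decay:
  assumes sol: "timo_solution a \<gamma> u0 u" and t: "t \<ge> 0" and S: "Sobolev s u0" and i: "integrable lborel u0"
    and AE: "AE \<xi> in lborel. norm (fourier_L2 (u t) \<xi>) \<le> C * exp (- c * r \<xi> * t) * norm (fourier_L2 u0 \<xi>)"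
    and C: "C \<ge> 0" and c: "c > 0" and r: "\<And>\<xi>. r \<xi> \<ge> 0"
    and low: "\<And>\<xi>. \<bar>\<xi>\<bar> \<le> 1 \<Longrightarrow> \<xi>\<^sup>2 / 4 \<le> r \<xi>"
  shows "Sobolev s (u t)"
    and "k \<le> s \<Longrightarrow> j \<le> s \<Longrightarrow> D \<ge> 0 \<Longrightarrow> (\<And>\<xi>. \<bar>\<xi>\<bar> > 1 \<Longrightarrow> \<bar>\<xi>\<bar> ^ k * exp (- c * r \<xi> * t) \<le> D * \<bar>\<xi>\<bar> ^ j) \<Longrightarrow>
      L2 (\<lambda>\<xi>. indicator {-1..1} \<xi> * (\<bar>\<xi>\<bar> ^ k * exp (- (c / 4) * \<xi>\<^sup>2 * t))) \<Longrightarrow>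
      L2_norm (\<lambda>\<xi>. indicator {-1..1} \<xi> * (\<bar>\<xi>\<bar> ^ k * exp (- (c / 4) * \<xi>\<^sup>2 * t))) \<le> B \<Longrightarrow>
      L2_norm (weak_deriv k (u t)) \<le> 4 * C * B * L1_norm u0 + C * D * L2_norm (weak_deriv j u0)"
proof -
  have l2: "L2 u0" "L2 (u t)" using sol t by (auto simp: timo_solution_def cauchy_solution_def)
  define F0 F where "F0 = fourier_L2 u0" and "F = fourier_L2 (u t)"
  have F0: "vec_FT u0 F0" and F: "vec_FT (u t) F" unfolding F0_def F_def by (rule vec_FT_fourier_L2 l2)+
  note AE' = AE[folded F0_def F_def]
  have S0: "L2 (\<lambda>\<xi>. \<xi> ^ k *\<^sub>R F0 \<xi>)" if "k \<le> s" for k using S that unfolding Sobolev_iff[OF F0] by blast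
  have St: "L2 (\<lambda>\<xi>. \<xi> ^ k *\<^sub>R F \<xi>)" if k: "k \<le> s" for k
  proof (rule L2_bound(1)[OF L2_scaleR(1)[OF S0[OF k], of C]])
    note [measurable] = L2D(1)[OF vec_FT_L2(2)[OF F]]
    show "(\<lambda>\<xi>. \<xi> ^ k *\<^sub>R F \<xi>) \<in> borel_measurable borel" by measurable
    show "AE \<xi> in lborel. norm (\<xi> ^ k *\<^sub>R F \<xi>) \<le> norm (C *\<^sub>R \<xi> ^ k *\<^sub>R F0 \<xi>)"
      using AE'
    proof eventually_elim
      case (elim \<xi>)
      have "C * exp (- c * r \<xi> * t) * norm (F0 \<xi>) \<le> C * 1 * norm (F0 \<xi>)"
        using C c t r[of \<xi>] by (intro mult_right_mono mult_left_mono) auto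
      with elim have "norm (F \<xi>) \<le> C * norm (F0 \<xi>)" by simp
      from mult_left_mono[OF this, of "\<bar>\<xi> ^ k\<bar>"] C show ?case by (simp add: abs_mult mult_ac)
    qed
  qed
  then show "Sobolev s (u t)" unfolding Sobolev_iff[OF F] by blast
  define g where "g k = (\<lambda>\<xi>. indicator {-1..1} \<xi> * (\<bar>\<xi>\<bar> ^ k * exp (- (c / 4) * \<xi>\<^sup>2 * t)))" for k
  assume k: "k \<le> s" and j: "j \<le> s" and D: "D \<ge> 0"
    and high: "\<And>\<xi>. \<bar>\<xi>\<bar> > 1 \<Longrightarrow> \<bar>\<xi>\<bar> ^ k * exp (- c * r \<xi> * t) \<le> D * \<bar>\<xi>\<bar> ^ j"
    and g: "L2 (\<lambda>\<xi>. indicator {-1..1} \<xi> * (\<bar>\<xi>\<bar> ^ k * exp (- (c / 4) * \<xi>\<^sup>2 * t)))"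
    and B: "L2_norm (\<lambda>\<xi>. indicator {-1..1} \<xi> * (\<bar>\<xi>\<bar> ^ k * exp (- (c / 4) * \<xi>\<^sup>2 * t))) \<le> B"
  have pi1: "sqrt (2 * pi) \<ge> 1" using pi_gt3 by simp
  have N: "L1_norm u0 \<ge> 0" by (simp add: L1_norm_def)
  have B0: "B \<ge> 0" using order_trans[OF L2_norm_nonneg B] .
  have "sqrt (2 * pi) * L2_norm (weak_deriv k (u t)) = L2_norm (\<lambda>\<xi>. \<xi> ^ k *\<^sub>R F \<xi>)"
    by (rule weak_deriv_norm[OF F St[OF k]])
  also have "\<dots> \<le> C * (real CARD(4) * L1_norm u0) * L2_norm (\<lambda>\<xi>. indicator {-1..1} \<xi> * (\<bar>\<xi>\<bar> ^ k * exp (- (c / 4) * \<xi>\<^sup>2 * t)))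
      + C * D * L2_norm (\<lambda>\<xi>. \<xi> ^ j *\<^sub>R F0 \<xi>)"
    by (rule frequency_splitting[OF F0 F i AE' C c t D low high S0[OF j] g])
  also have "\<dots> \<le> C * (4 * L1_norm u0) * B + C * D * L2_norm (\<lambda>\<xi>. \<xi> ^ j *\<^sub>R F0 \<xi>)"
    using C N by (intro add_right_mono mult_mono B) auto
  also have "L2_norm (\<lambda>\<xi>. \<xi> ^ j *\<^sub>R F0 \<xi>) = sqrt (2 * pi) * L2_norm (weak_deriv j u0)"
    by (rule weak_deriv_norm[OF F0 S0[OF j], symmetric])
  \<comment> \<open>Only the \<open>L2\<close> term carries \<open>sqrt (2 * pi)\<close>. As this
    number is at least 1, it may be put in front of the \<open>L1\<close> term too and then
    cancelled.\<close>
  also have "C * (4 * L1_norm u0) * B \<le> sqrt (2 * pi) * (4 * C * B * L1_norm u0)"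
    using mult_right_mono[OF pi1, of "4 * C * B * L1_norm u0"] C B0 N by (simp add: mult_ac)
  finally have "sqrt (2 * pi) * L2_norm (weak_deriv k (u t)) \<le> sqrt (2 * pi) * (4 * C * B * L1_norm u0 + C * D * L2_norm (weak_deriv j u0))"
    by (simp add: algebra_simps)
  then show "L2_norm (weak_deriv k (u t)) \<le> 4 * C * B * L1_norm u0 + C * D * L2_norm (weak_deriv j u0)"
    by (rule mult_left_le_imp_le) simp
qed

text \<open>From \<open>y \<le> exp y\<close> at \<open>y = x / l\<close>, raised to the power
  \<open>l\<close>. For \<open>l = 0\<close> the right-hand side uses
  \<open>0 ^ 0 = 1\<close>.\<close>

lemma power_le_exp:
  assumes "x \<ge> (0::real)" shows "x ^ l \<le> real l ^ l * exp x"
proof (cases "l = 0")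
  case False
  have "x / real l \<le> exp (x / real l)" using exp_ge_add_one_self[of "x / real l"] by linarith
  then have "(x / real l) ^ l \<le> exp (x / real l) ^ l" using assms by (intro power_mono) auto
  also have "\<dots> = exp x" using False by (simp flip: exp_of_nat_mult)
  finally show ?thesis using False by (simp add: power_divide field_simps)
qed (use assms in simp)

text \<open>For high frequencies \<open>eta\<close> is at least
  \<open>1 / (4 * \<xi>\<^sup>2)\<close>, so the exponential is governed by
  \<open>v = sqrt (1 + t) / \<bar>\<xi>\<bar>\<close>, and
  \<open>v ^ l * exp (- (b * v\<^sup>2))\<close> is bounded. Dividing by \<open>v ^ l\<close> yields
  the decay in time and \<open>l\<close> powers of the frequency at once: regularity is exchanged
  for decay.\<close>

lemma high_frequency_eta:
  assumes c: "c > 0"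
  shows "\<exists>D\<ge>0. \<forall>t\<ge>0. \<forall>\<xi>. \<bar>\<xi>\<bar> > 1 \<longrightarrow> exp (- c * eta \<xi> * t) \<le> D * (1 + t) powr (- real l / 2) * \<bar>\<xi>\<bar> ^ l"
proof -
  define b where "b = c / 4"
  have b: "b > 0" using c by (simp add: b_def)
  define B where "B = 1 + real l ^ l / b ^ l"
  have B: "B \<ge> 0" using b by (simp add: B_def)
  have vb: "v ^ l * exp (- (b * v\<^sup>2)) \<le> B" if v: "v \<ge> 0" for v
  proof -
    have "2 * v ^ l \<le> 1 + (v ^ l)\<^sup>2" using sum_squares_bound[of 1 "v ^ l"] by simp
    then have "v ^ l \<le> 1 + (v ^ l)\<^sup>2" using zero_le_power[OF v, of l] by linarith
    also have "(v ^ l)\<^sup>2 = (b * v\<^sup>2) ^ l / b ^ l" using b by (simp add: power_mult_distrib power_mult[symmetric] mult.commute)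
    also have "\<dots> \<le> real l ^ l * exp (b * v\<^sup>2) / b ^ l" using b by (intro divide_right_mono power_le_exp) auto
    finally have "v ^ l * exp (- (b * v\<^sup>2)) \<le> (1 + real l ^ l * exp (b * v\<^sup>2) / b ^ l) * exp (- (b * v\<^sup>2))"
      by (intro mult_right_mono) auto
    also have "\<dots> = exp (- (b * v\<^sup>2)) + real l ^ l / b ^ l * (exp (b * v\<^sup>2) * exp (- (b * v\<^sup>2)))" by (simp add: distrib_right)
    also have "exp (b * v\<^sup>2) * exp (- (b * v\<^sup>2)) = 1" by (simp flip: exp_add)
    also have "exp (- (b * v\<^sup>2)) + real l ^ l / b ^ l * 1 \<le> B" unfolding B_def using b by simp
    finally show ?thesis .
  qed
  show ?thesis
  proof (intro exI[of _ "exp b * B"] conjI allI impI)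
    show "exp b * B \<ge> 0" using B by simp
    fix t \<xi> :: real assume t: "t \<ge> 0" and x: "\<bar>\<xi>\<bar> > 1"
    have x2: "\<xi>\<^sup>2 > 1" using x by (metis abs_1 abs_square_less_1 less_le_not_le linorder_not_le one_less_power pos2 power2_abs)
    define v where "v = sqrt (1 + t) / \<bar>\<xi>\<bar>"
    have v: "v > 0" "v\<^sup>2 = (1 + t) / \<xi>\<^sup>2" using t x by (auto simp: v_def power_divide)
    have "1 / (4 * \<xi>\<^sup>2) \<le> eta \<xi>"
    proof -
      have "(1 + \<xi>\<^sup>2)\<^sup>2 \<le> (2 * \<xi>\<^sup>2)\<^sup>2" using x2 by (intro power_mono) auto
      also have "\<dots> = 4 * \<xi>\<^sup>2 * \<xi>\<^sup>2" by (simp add: power2_eq_square)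
      finally have le: "(1 + \<xi>\<^sup>2)\<^sup>2 \<le> 4 * \<xi>\<^sup>2 * \<xi>\<^sup>2" .
      have pos: "(1 + \<xi>\<^sup>2)\<^sup>2 > 0" using add_pos_nonneg[of 1 "\<xi>\<^sup>2"] by simp
      have "1 / (4 * \<xi>\<^sup>2) = \<xi>\<^sup>2 / (4 * \<xi>\<^sup>2 * \<xi>\<^sup>2)" using x2 by simp
      also have "\<dots> \<le> \<xi>\<^sup>2 / (1 + \<xi>\<^sup>2)\<^sup>2" using le pos x2 by (intro divide_left_mono mult_pos_pos) auto
      finally show ?thesis by (simp add: eta_def)
    qed
    from mult_left_mono[OF this, of "c * t"] have "c * t * (1 / (4 * \<xi>\<^sup>2)) \<le> c * eta \<xi> * t" using c t by (simp add: mult_ac)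
    \<comment> \<open>Passing from \<open>t\<close> to \<open>1 + t\<close> leaves the remainder
      \<open>b / \<xi>\<^sup>2\<close>, which is at most \<open>b\<close> and becomes the factor
      \<open>exp b\<close>.\<close>
    moreover have "c * t * (1 / (4 * \<xi>\<^sup>2)) = b * v\<^sup>2 - b / \<xi>\<^sup>2" unfolding v(2) b_def by (simp add: add_divide_distrib algebra_simps)
    moreover have "b / \<xi>\<^sup>2 \<le> b" using b x2 by (simp add: divide_le_eq mult_left_mono[of 1 "\<xi>\<^sup>2" b, simplified])
    ultimately have "- c * eta \<xi> * t \<le> b + - (b * v\<^sup>2)" by simp
    then have "exp (- c * eta \<xi> * t) \<le> exp b * exp (- (b * v\<^sup>2))" by (simp flip: exp_add)
    also have "exp (- (b * v\<^sup>2)) \<le> B / v ^ l" using vb[of v] v(1) by (simp add: field_simps)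
    also have "B / v ^ l = B * ((1 + t) powr (- real l / 2) * \<bar>\<xi>\<bar> ^ l)"
    proof -
      have "sqrt (1 + t) ^ l = (1 + t) powr (real l / 2)"
        using t by (simp add: powr_half_sqrt[symmetric] powr_powr flip: powr_realpow)
      then have "1 / sqrt (1 + t) ^ l = (1 + t) powr (- real l / 2)" by (simp add: powr_minus_divide)
      moreover have "B / v ^ l = B * (1 / sqrt (1 + t) ^ l * \<bar>\<xi>\<bar> ^ l)" by (simp add: v_def power_divide)
      ultimately show ?thesis by simp
    qed
    finally show "exp (- c * eta \<xi> * t) \<le> exp b * B * (1 + t) powr (- real l / 2) * \<bar>\<xi>\<bar> ^ l"
      by (simp add: mult_ac)
  qed
qed

section \<open>Behaviour of the two rates, and the decay theorems\<close>

lemma eta_nonneg: "eta \<xi> \<ge> 0" by (simp add: eta_def)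

lemma eta_low: "\<bar>\<xi>\<bar> \<le> 1 \<Longrightarrow> \<xi>\<^sup>2 / 4 \<le> eta \<xi>"
proof -
  assume "\<bar>\<xi>\<bar> \<le> 1"
  then have "\<xi>\<^sup>2 \<le> 1" by (simp add: abs_square_le_1)
  then have "(1 + \<xi>\<^sup>2)\<^sup>2 \<le> 2\<^sup>2" by (intro power_mono) auto
  moreover have "(1 + \<xi>\<^sup>2)\<^sup>2 > 0" using add_pos_nonneg[of 1 "\<xi>\<^sup>2"] by simp
  ultimately show ?thesis unfolding eta_def power2_abs by (intro divide_left_mono) auto
qed

lemma rho_low: "\<bar>\<xi>\<bar> \<le> 1 \<Longrightarrow> \<xi>\<^sup>2 / 4 \<le> rho \<xi>"
proof -
  assume "\<bar>\<xi>\<bar> \<le> 1"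
  then have x: "\<xi>\<^sup>2 \<le> 1" by (simp add: abs_square_le_1)
  have "1 + \<xi>\<^sup>2 > 0" using add_pos_nonneg[of 1 "\<xi>\<^sup>2"] by simp
  with x show ?thesis unfolding rho_def power2_abs by (intro divide_left_mono) auto
qed

lemma rho_high: "\<bar>\<xi>\<bar> > 1 \<Longrightarrow> 1 / 2 \<le> rho \<xi>"
proof -
  assume "\<bar>\<xi>\<bar> > 1"
  then have "\<xi>\<^sup>2 \<ge> 1" using one_le_power[of "\<bar>\<xi>\<bar>" 2] by simp
  then show ?thesis unfolding rho_def power2_abs by (simp add: field_simps)
qed

text \<open>The weight \<open>1 / (1 + \<xi>\<^sup>2)\<close> turns the condition on \<sigma> into
  an equality, for every \<open>a\<close>; its product with \<open>rho\<close> is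
  \<open>eta\<close>.\<close>

lemma timo_pointwise_eta:
  assumes a: "a > 0" and \<gamma>: "\<gamma> > 0"
  obtains C c where "C > 0" "c > 0"
    "\<And>u0 u t. timo_solution a \<gamma> u0 u \<Longrightarrow> t \<ge> 0 \<Longrightarrow>
      AE \<xi> in lborel. norm (fourier_L2 (u t) \<xi>) \<le> C * exp (- c * eta \<xi> * t) * norm (fourier_L2 u0 \<xi>)"
proof -
  have s: "0 < 1 / (1 + \<xi>\<^sup>2) \<and> 1 / (1 + \<xi>\<^sup>2) \<le> 1 \<and> (a\<^sup>2 - 1)\<^sup>2 * (1 / (1 + \<xi>\<^sup>2) * (1 + \<xi>\<^sup>2)) \<le> (a\<^sup>2 - 1)\<^sup>2" for \<xi> :: real
    using add_pos_nonneg[of 1 "\<xi>\<^sup>2"] by simp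
  have m: "(\<lambda>\<xi>::real. 1 / (1 + \<xi>\<^sup>2)) \<in> borel_measurable borel" by measurable
  obtain C c where "C > 0" "c > 0" and *: "\<forall>\<sigma>. \<sigma> \<in> borel_measurable borel \<longrightarrow>
    (\<forall>\<xi>. 0 < \<sigma> \<xi> \<and> \<sigma> \<xi> \<le> 1 \<and> (a\<^sup>2 - 1)\<^sup>2 * (\<sigma> \<xi> * (1 + \<xi>\<^sup>2)) \<le> (a\<^sup>2 - 1)\<^sup>2) \<longrightarrow>
    (\<forall>u0 u t. timo_solution a \<gamma> u0 u \<longrightarrow> t \<ge> 0 \<longrightarrow>
      (AE \<xi> in lborel. norm (fourier_L2 (u t) \<xi>) \<le> C * exp (- c * (\<sigma> \<xi> * rho \<xi>) * t) * norm (fourier_L2 u0 \<xi>)))"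
    using timo_decay[OF a \<gamma>] by (elim exE conjE)
  have "AE \<xi> in lborel. norm (fourier_L2 (u t) \<xi>) \<le> C * exp (- c * eta \<xi> * t) * norm (fourier_L2 u0 \<xi>)"
    if "timo_solution a \<gamma> u0 u" "t \<ge> 0" for u0 u t
    unfolding eta_rho by (rule *[rule_format, OF m s that])
  with \<open>C > 0\<close> \<open>c > 0\<close> that show ?thesis by blast
qed

text \<open>The constant weight 1 is admissible because both sides of the condition on \<sigma>
  vanish for \<open>a = 1\<close>.\<close>

lemma timo_pointwise_rho:
  assumes a: "a = 1" and \<gamma>: "\<gamma> > 0"
  obtains C c where "C > 0" "c > 0"
    "\<And>u0 u t. timo_solution a \<gamma> u0 u \<Longrightarrow> t \<ge> 0 \<Longrightarrow>
      AE \<xi> in lborel. norm (fourier_L2 (u t) \<xi>) \<le> C * exp (- c * rho \<xi> * t) * norm (fourier_L2 u0 \<xi>)"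
proof -
  have a0: "a > 0" using a by simp
  obtain C c where "C > 0" "c > 0" and *: "\<forall>\<sigma>. \<sigma> \<in> borel_measurable borel \<longrightarrow>
    (\<forall>\<xi>. 0 < \<sigma> \<xi> \<and> \<sigma> \<xi> \<le> 1 \<and> (a\<^sup>2 - 1)\<^sup>2 * (\<sigma> \<xi> * (1 + \<xi>\<^sup>2)) \<le> (a\<^sup>2 - 1)\<^sup>2) \<longrightarrow>
    (\<forall>u0 u t. timo_solution a \<gamma> u0 u \<longrightarrow> t \<ge> 0 \<longrightarrow>
      (AE \<xi> in lborel. norm (fourier_L2 (u t) \<xi>) \<le> C * exp (- c * (\<sigma> \<xi> * rho \<xi>) * t) * norm (fourier_L2 u0 \<xi>)))"
    using timo_decay[OF a0 \<gamma>] by (elim exE conjE)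
  have "AE \<xi> in lborel. norm (fourier_L2 (u t) \<xi>) \<le> C * exp (- c * rho \<xi> * t) * norm (fourier_L2 u0 \<xi>)"
    if "timo_solution a \<gamma> u0 u" "t \<ge> 0" for u0 u t
    using *[rule_format, of "\<lambda>_. 1", OF _ _ that] a by simp
  with \<open>C > 0\<close> \<open>c > 0\<close> that show ?thesis by blast
qed

theorem timo_decay_eta:
  assumes a: "a > 0" and \<gamma>: "\<gamma> > 0"
  shows "\<exists>C>0. \<forall>u0 u.
        timo_solution a \<gamma> u0 u \<longrightarrow> Sobolev s u0 \<longrightarrow> integrable lborel u0 \<longrightarrow>
        (\<forall>t\<ge>0. Sobolev s (u t) \<and>
          (\<forall>k l. k + l \<le> s \<longrightarrow>
            L2_norm (weak_deriv k (u t))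
              \<le> C * (1 + t) powr (- 1 / 4 - real k / 2) * L1_norm u0
                + C * (1 + t) powr (- real l / 2) * L2_norm (weak_deriv (k + l) u0)))"
proof -
  obtain C c where C: "C > 0" and c: "c > 0" and AE: "\<And>u0 u t. timo_solution a \<gamma> u0 u \<Longrightarrow> t \<ge> 0 \<Longrightarrow>
      AE \<xi> in lborel. norm (fourier_L2 (u t) \<xi>) \<le> C * exp (- c * eta \<xi> * t) * norm (fourier_L2 u0 \<xi>)"
    by (rule timo_pointwise_eta[OF a \<gamma>], rule that)
  have c4: "c / 4 > 0" using c by simp
  from choice[OF allI[OF low_frequency_bound[OF c4]]] obtain G where
    G: "\<forall>k. G k \<ge> 0 \<and> (\<forall>t\<ge>0. L2 (\<lambda>\<xi>. indicator {-1..1} \<xi> * (\<bar>\<xi>\<bar> ^ k * exp (- (c / 4) * \<xi>\<^sup>2 * t))) \<and>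
      L2_norm (\<lambda>\<xi>. indicator {-1..1} \<xi> * (\<bar>\<xi>\<bar> ^ k * exp (- (c / 4) * \<xi>\<^sup>2 * t))) \<le> G k * (1 + t) powr (- 1 / 4 - real k / 2))" ..
  from choice[OF allI[OF high_frequency_eta[OF c]]] obtain D where
    D: "\<forall>l. D l \<ge> 0 \<and> (\<forall>t\<ge>0. \<forall>\<xi>. \<bar>\<xi>\<bar> > 1 \<longrightarrow> exp (- c * eta \<xi> * t) \<le> D l * (1 + t) powr (- real l / 2) * \<bar>\<xi>\<bar> ^ l)" ..
  \<comment> \<open>The low- and high-frequency constants depend on \<open>k\<close> and
    \<open>l\<close>. Summing them up to \<open>s\<close> gives one constant per \<open>s\<close>,
    and the summand 1 makes it positive.\<close>
  define M where "M = 1 + 4 * C * (\<Sum>k\<le>s. G k) + C * (\<Sum>l\<le>s. D l)"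
  have sums: "0 \<le> (\<Sum>k\<le>s. G k)" "0 \<le> (\<Sum>l\<le>s. D l)" using G D by (auto intro!: sum_nonneg)
  have M: "M > 0" unfolding M_def using C sums by (intro add_pos_nonneg) auto
  have MG: "4 * C * G k \<le> M" if "k \<le> s" for k
  proof -
    have "G k \<le> (\<Sum>k\<le>s. G k)" using that G by (intro member_le_sum) auto
    then have "4 * C * G k \<le> 4 * C * (\<Sum>k\<le>s. G k)" using C by (intro mult_left_mono) auto
    moreover have "0 \<le> C * (\<Sum>l\<le>s. D l)" using C sums by simp
    ultimately show ?thesis unfolding M_def by linarith
  qed
  have MD: "C * D l \<le> M" if "l \<le> s" for l
  proof -
    have "D l \<le> (\<Sum>l\<le>s. D l)" using that D by (intro member_le_sum) auto
    then have "C * D l \<le> C * (\<Sum>l\<le>s. D l)" using C by (intro mult_left_mono) auto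
    moreover have "0 \<le> 4 * C * (\<Sum>k\<le>s. G k)" using C sums by simp
    ultimately show ?thesis unfolding M_def by linarith
  qed
  show ?thesis
  proof (rule exI[of _ M], rule conjI[OF M], intro allI impI)
    fix u0 u and t :: real
    assume sol: "timo_solution a \<gamma> u0 u" and S: "Sobolev s u0" and i: "integrable lborel u0" and t: "t \<ge> 0"
    note dec = solution_decay[OF sol t S i AE[OF sol t] less_imp_le[OF C] c eta_nonneg eta_low]
    show "Sobolev s (u t) \<and> (\<forall>k l. k + l \<le> s \<longrightarrow>
            L2_norm (weak_deriv k (u t))
              \<le> M * (1 + t) powr (- 1 / 4 - real k / 2) * L1_norm u0
                + M * (1 + t) powr (- real l / 2) * L2_norm (weak_deriv (k + l) u0))"
    proof (intro conjI allI impI)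
      show "Sobolev s (u t)" by (rule dec(1))
      fix k l assume kl: "k + l \<le> s"
      define p q where "p = (1 + t) powr (- 1 / 4 - real k / 2)" and "q = (1 + t) powr (- real l / 2)"
      have pq: "p \<ge> 0" "q \<ge> 0" by (auto simp: p_def q_def)
      have N: "L1_norm u0 \<ge> 0" by (simp add: L1_norm_def)
      have "L2_norm (weak_deriv k (u t)) \<le> 4 * C * (G k * p) * L1_norm u0 + C * (D l * q) * L2_norm (weak_deriv (k + l) u0)"
      proof (rule dec(2))
        show "k \<le> s" "k + l \<le> s" using kl by auto
        show "0 \<le> D l * q" using D pq by simp
        show "\<bar>\<xi>\<bar> ^ k * exp (- c * eta \<xi> * t) \<le> D l * q * \<bar>\<xi>\<bar> ^ (k + l)" if "\<bar>\<xi>\<bar> > 1" for \<xi>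
        proof -
          have "exp (- c * eta \<xi> * t) \<le> D l * q * \<bar>\<xi>\<bar> ^ l" unfolding q_def using D t that by blast
          from mult_left_mono[OF this, of "\<bar>\<xi>\<bar> ^ k"] show ?thesis by (simp add: power_add mult_ac)
        qed
        show "L2 (\<lambda>\<xi>. indicator {-1..1} \<xi> * (\<bar>\<xi>\<bar> ^ k * exp (- (c / 4) * \<xi>\<^sup>2 * t)))"
          "L2_norm (\<lambda>\<xi>. indicator {-1..1} \<xi> * (\<bar>\<xi>\<bar> ^ k * exp (- (c / 4) * \<xi>\<^sup>2 * t))) \<le> G k * p"
          unfolding p_def using G t by blast+
      qed
      also have "\<dots> = (4 * C * G k) * (p * L1_norm u0) + (C * D l) * (q * L2_norm (weak_deriv (k + l) u0))" by (simp add: mult_ac)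
      also have "\<dots> \<le> M * (p * L1_norm u0) + M * (q * L2_norm (weak_deriv (k + l) u0))"
        using kl pq N by (intro add_mono mult_right_mono MG MD) auto
      finally show "L2_norm (weak_deriv k (u t)) \<le> M * (1 + t) powr (- 1 / 4 - real k / 2) * L1_norm u0
                + M * (1 + t) powr (- real l / 2) * L2_norm (weak_deriv (k + l) u0)"
        unfolding p_def q_def by (simp only: mult.assoc)
    qed
  qed
qed

text \<open>A single \<open>c\<close> has to serve both estimates. For high frequencies
  \<open>rho\<close> is at least 1/2, which gives the exponential rate \<open>c / 2\<close>; the
  pointwise estimate is therefore weakened from \<open>c\<close> to \<open>c / 2\<close> as
  well.\<close>

theorem timo_decay_rho:
  assumes a: "a = 1" and \<gamma>: "\<gamma> > 0"
  shows "\<exists>c>0. (\<exists>C>0. pointwise_estimate a \<gamma> rho C c) \<and>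
       (\<forall>s. \<exists>C>0. \<forall>u0 u.
          timo_solution a \<gamma> u0 u \<longrightarrow> Sobolev s u0 \<longrightarrow> integrable lborel u0 \<longrightarrow>
          (\<forall>t\<ge>0. Sobolev s (u t) \<and>
            (\<forall>k\<le>s.
              L2_norm (weak_deriv k (u t))
                \<le> C * (1 + t) powr (- 1 / 4 - real k / 2) * L1_norm u0
                  + C * exp (- c * t) * L2_norm (weak_deriv k u0))))"
proof -
  obtain C c where C: "C > 0" and c: "c > 0" and AE: "\<And>u0 u t. timo_solution a \<gamma> u0 u \<Longrightarrow> t \<ge> 0 \<Longrightarrow>
      AE \<xi> in lborel. norm (fourier_L2 (u t) \<xi>) \<le> C * exp (- c * rho \<xi> * t) * norm (fourier_L2 u0 \<xi>)"
    by (rule timo_pointwise_rho[OF a \<gamma>], rule that)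
  have c4: "c / 4 > 0" and c2: "c / 2 > 0" using c by simp_all
  have pw: "pointwise_estimate a \<gamma> rho C (c / 2)"
  proof (rule pointwise_estimateI[OF _ rho_continuous])
    fix u0 u and t :: real assume sol: "timo_solution a \<gamma> u0 u" and t: "t \<ge> 0"
    show "AE \<xi> in lborel. norm (fourier_L2 (u t) \<xi>) \<le> C * exp (- (c / 2) * rho \<xi> * t) * norm (fourier_L2 u0 \<xi>)"
      using AE[OF sol t]
    proof eventually_elim
      case (elim \<xi>)
      have "- c * rho \<xi> * t \<le> - (c / 2) * rho \<xi> * t"
        using c t rho_bounds(1)[of \<xi>] by (simp add: mult_right_mono)
      then have "C * exp (- c * rho \<xi> * t) * norm (fourier_L2 u0 \<xi>) \<le> C * exp (- (c / 2) * rho \<xi> * t) * norm (fourier_L2 u0 \<xi>)"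
        using C by (intro mult_right_mono mult_left_mono) auto
      with elim show ?case by linarith
    qed
  qed
  from choice[OF allI[OF low_frequency_bound[OF c4]]] obtain G where
    G: "\<forall>k. G k \<ge> 0 \<and> (\<forall>t\<ge>0. L2 (\<lambda>\<xi>. indicator {-1..1} \<xi> * (\<bar>\<xi>\<bar> ^ k * exp (- (c / 4) * \<xi>\<^sup>2 * t))) \<and>
      L2_norm (\<lambda>\<xi>. indicator {-1..1} \<xi> * (\<bar>\<xi>\<bar> ^ k * exp (- (c / 4) * \<xi>\<^sup>2 * t))) \<le> G k * (1 + t) powr (- 1 / 4 - real k / 2))" ..
  have "\<exists>M>0. \<forall>u0 u.
          timo_solution a \<gamma> u0 u \<longrightarrow> Sobolev s u0 \<longrightarrow> integrable lborel u0 \<longrightarrow>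
          (\<forall>t\<ge>0. Sobolev s (u t) \<and>
            (\<forall>k\<le>s.
              L2_norm (weak_deriv k (u t))
                \<le> M * (1 + t) powr (- 1 / 4 - real k / 2) * L1_norm u0
                  + M * exp (- (c / 2) * t) * L2_norm (weak_deriv k u0)))" for s
  proof -
    define M where "M = C + 4 * C * (\<Sum>k\<le>s. G k)"
    have sums: "0 \<le> (\<Sum>k\<le>s. G k)" using G by (auto intro!: sum_nonneg)
    have M: "M > 0" unfolding M_def using C sums by (intro add_pos_nonneg) auto
    have MG: "4 * C * G k \<le> M" if "k \<le> s" for k
    proof -
      have "G k \<le> (\<Sum>k\<le>s. G k)" using that G by (intro member_le_sum) auto
      then have "4 * C * G k \<le> 4 * C * (\<Sum>k\<le>s. G k)" using C by (intro mult_left_mono) auto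
      then show ?thesis unfolding M_def using C by linarith
    qed
    have MC: "C \<le> M" unfolding M_def using C sums by simp
    show ?thesis
    proof (rule exI[of _ M], rule conjI[OF M], intro allI impI)
      fix u0 u and t :: real
      assume sol: "timo_solution a \<gamma> u0 u" and S: "Sobolev s u0" and i: "integrable lborel u0" and t: "t \<ge> 0"
      note dec = solution_decay[OF sol t S i AE[OF sol t] less_imp_le[OF C] c rho_bounds(1) rho_low]
      show "Sobolev s (u t) \<and> (\<forall>k\<le>s.
              L2_norm (weak_deriv k (u t))
                \<le> M * (1 + t) powr (- 1 / 4 - real k / 2) * L1_norm u0
                  + M * exp (- (c / 2) * t) * L2_norm (weak_deriv k u0))"
      proof (intro conjI allI impI)
        show "Sobolev s (u t)" by (rule dec(1))
        fix k assume k: "k \<le> s"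
        define p q where "p = (1 + t) powr (- 1 / 4 - real k / 2)" and "q = exp (- (c / 2) * t)"
        have pq: "p \<ge> 0" "q \<ge> 0" by (auto simp: p_def q_def)
        have N: "L1_norm u0 \<ge> 0" by (simp add: L1_norm_def)
        have "L2_norm (weak_deriv k (u t)) \<le> 4 * C * (G k * p) * L1_norm u0 + C * q * L2_norm (weak_deriv k u0)"
        proof (rule dec(2))
          show "k \<le> s" "k \<le> s" "0 \<le> q" using k pq by auto
          show "\<bar>\<xi>\<bar> ^ k * exp (- c * rho \<xi> * t) \<le> q * \<bar>\<xi>\<bar> ^ k" if "\<bar>\<xi>\<bar> > 1" for \<xi>
          proof -
            have "c * t * (1 / 2) \<le> c * t * rho \<xi>" using c t by (intro mult_left_mono rho_high[OF that]) auto
            then have "exp (- c * rho \<xi> * t) \<le> q" unfolding q_def by (simp add: mult_ac)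
            from mult_left_mono[OF this, of "\<bar>\<xi>\<bar> ^ k"] show ?thesis by (simp add: mult.commute)
          qed
          show "L2 (\<lambda>\<xi>. indicator {-1..1} \<xi> * (\<bar>\<xi>\<bar> ^ k * exp (- (c / 4) * \<xi>\<^sup>2 * t)))"
            "L2_norm (\<lambda>\<xi>. indicator {-1..1} \<xi> * (\<bar>\<xi>\<bar> ^ k * exp (- (c / 4) * \<xi>\<^sup>2 * t))) \<le> G k * p"
            unfolding p_def using G t by blast+
        qed
        also have "\<dots> = (4 * C * G k) * (p * L1_norm u0) + C * (q * L2_norm (weak_deriv k u0))" by (simp add: mult_ac)
        also have "\<dots> \<le> M * (p * L1_norm u0) + M * (q * L2_norm (weak_deriv k u0))"
          using k pq N by (intro add_mono mult_right_mono MG MC) auto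
        finally show "L2_norm (weak_deriv k (u t)) \<le> M * (1 + t) powr (- 1 / 4 - real k / 2) * L1_norm u0
                  + M * exp (- (c / 2) * t) * L2_norm (weak_deriv k u0)"
          unfolding p_def q_def by (simp only: mult.assoc)
      qed
    qed
  qed
  with pw C c2 show ?thesis by (intro exI[of _ "c / 2"]) blast
qed

section \<open>The structural conditions\<close>

lemma Re_cinner_cmat_4:
  fixes X :: "real^4^4"
  shows "Re (cinner (cmat X *v z) z) = (\<Sum>i\<in>UNIV. \<Sum>j\<in>UNIV. X $ i $ j * Re (z $ j * cnj (z $ i)))"
  unfolding cinner_def cmat_def map_matrix_def matrix_vector_mult_def
  by (simp add: sum_distrib_right sum_distrib_left distrib_left mult.assoc right_diff_distrib)

lemma cmat_mult_nth: "(cmat X *v z) $ i = (\<Sum>j\<in>UNIV. complex_of_real (X $ i $ j) * z $ j)"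
  by (simp add: cmat_def map_matrix_def matrix_vector_mult_def)

lemma Ker_iff: "z \<in> Ker X \<longleftrightarrow> (\<forall>i. (\<Sum>j\<in>UNIV. complex_of_real (X $ i $ j) * z $ j) = 0)"
  by (simp add: Ker_def vec_eq_iff cmat_mult_nth)

lemma timo_A_nth:
  "timo_A a $ 1 $ 1 = 0" "timo_A a $ 1 $ 2 = -1" "timo_A a $ 1 $ 3 = 0" "timo_A a $ 1 $ 4 = 0"
  "timo_A a $ 2 $ 1 = -1" "timo_A a $ 2 $ 2 = 0" "timo_A a $ 2 $ 3 = 0" "timo_A a $ 2 $ 4 = 0"
  "timo_A a $ 3 $ 1 = 0" "timo_A a $ 3 $ 2 = 0" "timo_A a $ 3 $ 3 = 0" "timo_A a $ 3 $ 4 = - a"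
  "timo_A a $ 4 $ 1 = 0" "timo_A a $ 4 $ 2 = 0" "timo_A a $ 4 $ 3 = - a" "timo_A a $ 4 $ 4 = 0"
  by (simp_all add: timo_A_def)

lemma timo_L_nth:
  "timo_L \<gamma> $ 1 $ 1 = 0" "timo_L \<gamma> $ 1 $ 2 = 0" "timo_L \<gamma> $ 1 $ 3 = 0" "timo_L \<gamma> $ 1 $ 4 = 1"
  "timo_L \<gamma> $ 2 $ 1 = 0" "timo_L \<gamma> $ 2 $ 2 = 0" "timo_L \<gamma> $ 2 $ 3 = 0" "timo_L \<gamma> $ 2 $ 4 = 0"
  "timo_L \<gamma> $ 3 $ 1 = 0" "timo_L \<gamma> $ 3 $ 2 = 0" "timo_L \<gamma> $ 3 $ 3 = 0" "timo_L \<gamma> $ 3 $ 4 = 0"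
  "timo_L \<gamma> $ 4 $ 1 = -1" "timo_L \<gamma> $ 4 $ 2 = 0" "timo_L \<gamma> $ 4 $ 3 = 0" "timo_L \<gamma> $ 4 $ 4 = \<gamma>"
  by (simp_all add: timo_L_def)

lemma Re_mult_cnj_self: "Re (u * cnj u) = (cmod u)\<^sup>2"
  by (simp add: cmod_power2 power2_eq_square[symmetric])

lemma Ker_timo_L: "z \<in> Ker (timo_L \<gamma>) \<longleftrightarrow> z $ 1 = 0 \<and> z $ 4 = 0"
  unfolding Ker_iff forall_4 sum_4 timo_L_nth by auto

lemma timo_condition_A:
  assumes "\<gamma> > 0" shows "condition_A timo_A0 (\<lambda>_::1. timo_A a) (timo_L \<gamma>)"
  unfolding condition_A_def
proof (intro conjI allI)
  show "transpose timo_A0 = timo_A0" by (simp add: timo_A0_def transpose_mat)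
  show "transpose (timo_A a) = timo_A a"
    unfolding vec_eq_iff forall_4 by (simp add: transpose_def timo_A_nth)
  show "pos_on (cmat timo_A0) UNIV"
    unfolding pos_on_def
  proof (intro ballI impI)
    fix z :: "complex^4" assume z: "z \<noteq> 0"
    have "Re (cinner (cmat timo_A0 *v z) z) = (norm z)\<^sup>2"
      unfolding Re_cinner_cmat_4 vec_norm_sq sum_4 timo_A0_def mat_def Re_mult_cnj_self[symmetric] by simp
    then show "0 < Re (cinner (cmat timo_A0 *v z) z)" using z by simp
  qed
  show "nonneg_on (cmat (timo_L \<gamma>)) UNIV"
    unfolding nonneg_on_def
  proof
    fix z :: "complex^4"
    have "Re (cinner (cmat (timo_L \<gamma>) *v z) z) = \<gamma> * (cmod (z $ 4))\<^sup>2"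
      unfolding Re_cinner_cmat_4 sum_4 timo_L_nth Re_mult_cnj_self[symmetric] by simp
    then show "0 \<le> Re (cinner (cmat (timo_L \<gamma>) *v z) z)" using assms by simp
  qed
  have "(vector [0, 1, 0, 0] :: complex^4) \<in> Ker (timo_L \<gamma>)" by (simp add: Ker_timo_L)
  moreover have "(vector [0, 1, 0, 0] :: complex^4) \<noteq> 0" unfolding vec_eq_iff forall_4 by simp
  ultimately show "Ker (timo_L \<gamma>) \<noteq> {0}" by blast
qed

text \<open>The corner entries let the symmetric part of \<open>S ** L\<close> see the first
  component. The entries \<open>a\<close> make the product with \<open>timo_A a\<close> symmetric at
  the positions (1,3) and (3,1) and leave a multiple of \<open>a\<^sup>2 - 1\<close> at (2,4) as the
  only skew entry up to sign. The scalar \<open>s = \<gamma> / (2 + \<gamma>\<^sup>2)\<close> solves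
  \<open>s + s * \<gamma>\<^sup>2 / 2 = \<gamma> / 2\<close>.\<close>

definition timo_S :: "real \<Rightarrow> real \<Rightarrow> real^4^4"
  where "timo_S a \<gamma> = - (\<gamma> / (2 + \<gamma>\<^sup>2)) *\<^sub>R vector
    [vector [0, 0, 0, 1],
     vector [0, 0, a, 0],
     vector [0, a, 0, 0],
     vector [1, 0, 0, 0]]"

text \<open>AM-GM spends half of the square of the first component on the cross term, and the choice
  of \<open>s\<close> leaves exactly half of the damping of the fourth. This lower bound also
  identifies the kernel: a kernel vector annihilates the form, hence has vanishing first and fourth
  components.\<close>

lemma timo_condition_S:
  assumes \<gamma>: "\<gamma> > 0" shows "condition_S timo_A0 (timo_L \<gamma>) (timo_S a \<gamma>)"
proof -
  define s where "s = \<gamma> / (2 + \<gamma>\<^sup>2)"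
  have w: "2 + \<gamma>\<^sup>2 > 0" by (simp add: add_pos_nonneg)
  have s: "s > 0" "s * (2 + \<gamma>\<^sup>2) = \<gamma>" using \<gamma> w by (auto simp: s_def)
  define T where "T = sym_part (timo_S a \<gamma> ** timo_L \<gamma>) + sym_part (timo_L \<gamma>)"
  have T: "T $ 1 $ 1 = s" "T $ 1 $ 2 = 0" "T $ 1 $ 3 = 0" "T $ 1 $ 4 = - (s * \<gamma> / 2)"
    "T $ 2 $ 1 = 0" "T $ 2 $ 2 = 0" "T $ 2 $ 3 = 0" "T $ 2 $ 4 = 0"
    "T $ 3 $ 1 = 0" "T $ 3 $ 2 = 0" "T $ 3 $ 3 = 0" "T $ 3 $ 4 = 0"
    "T $ 4 $ 1 = - (s * \<gamma> / 2)" "T $ 4 $ 2 = 0" "T $ 4 $ 3 = 0" "T $ 4 $ 4 = \<gamma> - s"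
    unfolding T_def sym_part_def timo_S_def s_def[symmetric]
    by (simp_all add: matrix_matrix_mult_def transpose_def sum_4 timo_L_nth)
  have form: "s / 2 * (cmod (z $ 1))\<^sup>2 + \<gamma> / 2 * (cmod (z $ 4))\<^sup>2 \<le> Re (cinner (cmat T *v z) z)" for z
  proof -
    define R where "R = Re (z $ 4 * cnj (z $ 1))"
    have R': "Re (z $ 1 * cnj (z $ 4)) = R" by (simp add: R_def)
    have "R \<le> cmod (z $ 4) * cmod (z $ 1)" unfolding R_def using complex_Re_le_cmod[of "z $ 4 * cnj (z $ 1)"] by (simp add: norm_mult)
    then have "s * \<gamma> * R \<le> s * \<gamma> * (cmod (z $ 4) * cmod (z $ 1))" using s \<gamma> by (intro mult_left_mono) auto
    also have "\<dots> = s * (cmod (z $ 1) * (\<gamma> * cmod (z $ 4)))" by simp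
    also have "\<dots> \<le> s * (1 / 2 * (cmod (z $ 1))\<^sup>2 + (\<gamma> * cmod (z $ 4))\<^sup>2 / (4 * (1 / 2)))"
      using s by (intro mult_left_mono AM_GM_weighted) auto
    finally have 1: "s * \<gamma> * R \<le> s / 2 * (cmod (z $ 1))\<^sup>2 + s * \<gamma>\<^sup>2 / 2 * (cmod (z $ 4))\<^sup>2"
      by (simp add: power_mult_distrib algebra_simps)
    have 2: "s * (cmod (z $ 4))\<^sup>2 + s * \<gamma>\<^sup>2 / 2 * (cmod (z $ 4))\<^sup>2 = \<gamma> / 2 * (cmod (z $ 4))\<^sup>2"
      using arg_cong[OF s(2), of "\<lambda>u. u / 2 * (cmod (z $ 4))\<^sup>2"] by (simp add: algebra_simps add_divide_distrib)
    have "Re (cinner (cmat T *v z) z) = s * (cmod (z $ 1))\<^sup>2 - s * \<gamma> * R + (\<gamma> - s) * (cmod (z $ 4))\<^sup>2"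
      unfolding Re_cinner_cmat_4 sum_4 T Re_mult_cnj_self R' R_def[symmetric] by simp
    then show ?thesis using 1 2 by (simp add: left_diff_distrib)
  qed
  show ?thesis
    unfolding condition_S_def T_def[symmetric]
  proof (intro conjI)
    have "transpose (timo_S a \<gamma>) = timo_S a \<gamma>"
      unfolding vec_eq_iff forall_4 by (simp add: transpose_def timo_S_def)
    then show "transpose (timo_S a \<gamma> ** timo_A0) = timo_S a \<gamma> ** timo_A0" by (simp add: timo_A0_def)
    show "nonneg_on (cmat T) UNIV" unfolding nonneg_on_def
      using form s \<gamma> by (intro ballI order_trans[OF _ form]) simp
    show "Ker T = Ker (timo_L \<gamma>)"
    proof (intro set_eqI iffI)
      fix z assume "z \<in> Ker T"
      then have "Re (cinner (cmat T *v z) z) = 0" by (simp add: Ker_def cinner_def)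
      then have le: "s / 2 * (cmod (z $ 1))\<^sup>2 + \<gamma> / 2 * (cmod (z $ 4))\<^sup>2 \<le> 0" using form[of z] by simp
      have "0 \<le> s / 2 * (cmod (z $ 1))\<^sup>2" "0 \<le> \<gamma> / 2 * (cmod (z $ 4))\<^sup>2" using s \<gamma> by auto
      with le have "s / 2 * (cmod (z $ 1))\<^sup>2 = 0" "\<gamma> / 2 * (cmod (z $ 4))\<^sup>2 = 0" by linarith+
      then show "z \<in> Ker (timo_L \<gamma>)" using s \<gamma> by (simp add: Ker_timo_L)
    next
      fix z assume "z \<in> Ker (timo_L \<gamma>)"
      then have "z $ 1 = 0" "z $ 4 = 0" by (simp_all add: Ker_timo_L)
      then show "z \<in> Ker T" unfolding Ker_iff forall_4 sum_4 T by simp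
    qed
  qed
qed

lemma symbol_1: "symbol (\<lambda>_::1. A) \<omega> = (\<omega> $ 1) *\<^sub>R A"
  by (simp add: symbol_def sum_1)

text \<open>Only the pair of the second and fourth components survives, with a factor
  \<open>a\<^sup>2 - 1\<close>. Both (S)_1 and (S)_2 can be read off: the form vanishes where
  \<open>z $ 4 = 0\<close>, and identically when \<open>a = 1\<close>.\<close>

lemma timo_skew_form:
  fixes \<omega> :: "real^1"
  shows "Re (cinner (cscale \<i> (cmat (skew_part (timo_S a \<gamma> ** symbol (\<lambda>_. timo_A a) \<omega>))) *v z) z)
    = \<gamma> / (2 + \<gamma>\<^sup>2) * \<omega> $ 1 * (a\<^sup>2 - 1) * Re (\<i> * z $ 4 * cnj (z $ 2))"
proof -
  define s where "s = \<gamma> / (2 + \<gamma>\<^sup>2)"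
  define T where "T = skew_part (timo_S a \<gamma> ** symbol (\<lambda>_. timo_A a) \<omega>)"
  define m where "m = s * \<omega> $ 1 * (a\<^sup>2 - 1) / 2"
  have T: "T $ 1 $ 1 = 0" "T $ 1 $ 2 = 0" "T $ 1 $ 3 = 0" "T $ 1 $ 4 = 0"
    "T $ 2 $ 1 = 0" "T $ 2 $ 2 = 0" "T $ 2 $ 3 = 0" "T $ 2 $ 4 = m"
    "T $ 3 $ 1 = 0" "T $ 3 $ 2 = 0" "T $ 3 $ 3 = 0" "T $ 3 $ 4 = 0"
    "T $ 4 $ 1 = 0" "T $ 4 $ 2 = - m" "T $ 4 $ 3 = 0" "T $ 4 $ 4 = 0"
    unfolding T_def skew_part_def timo_S_def s_def[symmetric] symbol_1 m_def
    by (simp_all add: matrix_matrix_mult_def transpose_def sum_4 timo_A_nth power2_eq_square field_simps)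
  have form: "cinner (cscale \<i> (cmat T) *v z) z = \<i> * m * z $ 4 * cnj (z $ 2) - \<i> * m * z $ 2 * cnj (z $ 4)"
    unfolding cinner_def cscale_def cmat_def map_matrix_def matrix_vector_mult_def
    by (simp add: sum_4 T)
  have m: "\<gamma> / (2 + \<gamma>\<^sup>2) * \<omega> $ 1 * (a\<^sup>2 - 1) = 2 * m" unfolding s_def[symmetric] m_def by simp
  show ?thesis
    unfolding T_def[symmetric] form m by (simp add: algebra_simps)
qed

lemma timo_condition_S1:
  assumes \<gamma>: "\<gamma> > 0" shows "condition_S1 (\<lambda>_::1. timo_A a) (timo_L \<gamma>) (timo_S a \<gamma>)"
  unfolding condition_S1_def nonneg_on_def timo_skew_form
proof (intro ballI)
  fix z :: "complex^4" and \<omega> :: "real^1" assume "z \<in> Ker (sym_part (timo_L \<gamma>))"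
  then have "z $ 4 = 0"
    using \<gamma> unfolding Ker_iff forall_4 sum_4 sym_part_def by (simp add: transpose_def timo_L_nth)
  then show "0 \<le> \<gamma> / (2 + \<gamma>\<^sup>2) * \<omega> $ 1 * (a\<^sup>2 - 1) * Re (\<i> * z $ 4 * cnj (z $ 2))" by simp
qed

lemma timo_condition_S2:
  assumes "a = 1" shows "condition_S2 (\<lambda>_::1. timo_A a) (timo_S a \<gamma>)"
  unfolding condition_S2_def nonneg_on_def timo_skew_form using assms by simp

section \<open>Smoothness of linear maps and condition (K)\<close>

lemma C_k_on_const: "C_k_on k (\<lambda>x. c) U"
proof (induction k arbitrary: c)
  case (Suc k)
  have "((\<lambda>h::real. c) has_vector_derivative 0) (at 0)" by simp
  with Suc[of 0] show ?case by (auto intro!: exI[of _ "\<lambda>x. 0"])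
qed simp

text \<open>The derivative in direction \<open>v\<close> is the constant \<open>f v\<close>, so
  constants take care of all higher orders.\<close>

lemma C_k_on_bounded_linear:
  assumes f: "bounded_linear f" shows "C_k_on k f U"
proof (cases k)
  case 0
  then show ?thesis using linear_continuous_on[OF f] by simp
next
  case (Suc n)
  have "((\<lambda>h. f (x + h *\<^sub>R v)) has_vector_derivative f v) (at 0)" for x v
  proof -
    have "((\<lambda>h. x + h *\<^sub>R v) has_vector_derivative v) (at 0)"
      by (auto intro!: derivative_eq_intros)
    from bounded_linear.has_vector_derivative[OF f this] show ?thesis .
  qed
  then show ?thesis using linear_continuous_on[OF f] C_k_on_const Suc
    by (auto intro!: exI[of _ "\<lambda>x. f v" for v])
qed

text \<open>Its product with \<open>timo_A a\<close> is the diagonal matrix with entries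
  \<open>-1, 1, a, -a\<close>, positive on the second and third components, that is on the kernel of
  \<open>timo_L\<close>.\<close>

definition timo_K :: "real^4^4"
  where "timo_K = vector
    [vector [0, 1, 0, 0],
     vector [-1, 0, 0, 0],
     vector [0, 0, 0, -1],
     vector [0, 0, 1, 0]]"

text \<open>The sphere consists of two points, and \<open>\<omega> $ 1\<close> times
  \<open>timo_K\<close> is the restriction of a linear map, whence oddness and smoothness. Since the
  square of \<open>\<omega> $ 1\<close> is 1, the product with the symbol is the same at both
  points.\<close>

lemma timo_condition_K:
  assumes a: "a > 0" shows "condition_K timo_A0 (\<lambda>_::1. timo_A a) (timo_L \<gamma>)"
  unfolding condition_K_def
proof (intro exI[of _ "\<lambda>\<omega>::real^1. (\<omega> $ 1) *\<^sub>R timo_K"] conjI ballI)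
  have bl: "bounded_linear (\<lambda>\<omega>::real^1. (\<omega> $ 1) *\<^sub>R timo_K)"
    by (intro bounded_linear_scaleR_const bounded_linear_vec_nth)
  show "smooth_on_sphere (\<lambda>\<omega>::real^1. (\<omega> $ 1) *\<^sub>R timo_K)"
    unfolding smooth_on_sphere_def
    by (intro exI[of _ UNIV] exI[of _ "\<lambda>\<omega>::real^1. (\<omega> $ 1) *\<^sub>R timo_K"] conjI allI ballI C_k_on_bounded_linear bl) auto
  fix \<omega> :: "real^1" assume "\<omega> \<in> sphere 0 1"
  then have \<omega>: "(\<omega> $ 1)\<^sup>2 = 1" by (simp add: norm_real abs_square_eq_1)
  show "(- \<omega>) $ 1 *\<^sub>R timo_K = - (\<omega> $ 1 *\<^sub>R timo_K)" by simp
  show "transpose (\<omega> $ 1 *\<^sub>R timo_K ** timo_A0) = - (\<omega> $ 1 *\<^sub>R timo_K ** timo_A0)"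
    unfolding timo_A0_def matrix_mul_rid vec_eq_iff forall_4 by (simp add: transpose_def timo_K_def)
  show "pos_on (cmat (sym_part (\<omega> $ 1 *\<^sub>R timo_K ** symbol (\<lambda>_. timo_A a) \<omega>))) (Ker (timo_L \<gamma>))"
    unfolding pos_on_def
  proof (intro ballI impI)
    fix z assume zK: "z \<in> Ker (timo_L \<gamma>)" and z: "z \<noteq> 0"
    have z14: "z $ 1 = 0" "z $ 4 = 0" using zK by (simp_all add: Ker_timo_L)
    define T where "T = sym_part (\<omega> $ 1 *\<^sub>R timo_K ** symbol (\<lambda>_. timo_A a) \<omega>)"
    have \<omega>': "\<omega> $ 1 * \<omega> $ 1 = 1" using \<omega> by (simp add: power2_eq_square)
    have T: "T $ 2 $ 2 = 1" "T $ 2 $ 3 = 0" "T $ 3 $ 2 = 0" "T $ 3 $ 3 = a"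
      unfolding T_def sym_part_def symbol_1
      using \<omega>' by (simp_all add: matrix_matrix_mult_def transpose_def sum_4 timo_A_nth timo_K_def)
    have form: "Re (cinner (cmat T *v z) z) = (cmod (z $ 2))\<^sup>2 + a * (cmod (z $ 3))\<^sup>2"
      unfolding Re_cinner_cmat_4 sum_4 z14 T Re_mult_cnj_self by simp
    have "z $ 2 \<noteq> 0 \<or> z $ 3 \<noteq> 0" using z z14 unfolding vec_eq_iff forall_4 by auto
    then have "0 < (cmod (z $ 2))\<^sup>2 + a * (cmod (z $ 3))\<^sup>2"
      using a by (auto intro: add_pos_nonneg add_nonneg_pos)
    then show "0 < Re (cinner (cmat (sym_part (\<omega> $ 1 *\<^sub>R timo_K ** symbol (\<lambda>_. timo_A a) \<omega>)) *v z) z)"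
      using form unfolding T_def by simp
  qed
qed

section \<open>First-order form of the Timoshenko system\<close>

text \<open>Schwarz's theorem: two applications of the mean value theorem, in either order, write
  the second difference over a small square as \<open>h * h\<close> times one or the other mixed
  derivative at an interior point. Continuity at \<open>(t, x)\<close> brings the two points
  together. The square extends to later times only, so it stays in the domain.\<close>

lemma mixed_partials_eq:
  fixes f f1 f2 f12 f21 :: "real \<Rightarrow> real \<Rightarrow> real"
  assumes f1: "\<And>s y. s > 0 \<Longrightarrow> ((\<lambda>s. f s y) has_real_derivative f1 s y) (at s)"
    and f2: "\<And>s y. s > 0 \<Longrightarrow> ((\<lambda>y. f s y) has_real_derivative f2 s y) (at y)"
    and f12: "\<And>s y. s > 0 \<Longrightarrow> ((\<lambda>y. f1 s y) has_real_derivative f12 s y) (at y)"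
    and f21: "\<And>s y. s > 0 \<Longrightarrow> ((\<lambda>s. f2 s y) has_real_derivative f21 s y) (at s)"
    and c12: "continuous_on ({0<..} \<times> UNIV) (\<lambda>(s, y). f12 s y)"
    and c21: "continuous_on ({0<..} \<times> UNIV) (\<lambda>(s, y). f21 s y)"
    and t: "t > 0"
  shows "f12 t x = f21 t x"
proof (rule ccontr)
  assume ne: "f12 t x \<noteq> f21 t x"
  define e where "e = dist (f12 t x) (f21 t x) / 2"
  have e: "e > 0" using ne by (simp add: e_def)
  have p: "(t, x) \<in> {0<..} \<times> UNIV" using t by simp
  obtain d1 where d1: "d1 > 0"
    "\<And>q. q \<in> {0<..} \<times> UNIV \<Longrightarrow> dist q (t, x) < d1 \<Longrightarrow> dist (case q of (s, y) \<Rightarrow> f12 s y) (f12 t x) < e"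
    using bspec[OF c12[unfolded continuous_on_iff] p, rule_format, OF e] by auto
  obtain d2 where d2: "d2 > 0"
    "\<And>q. q \<in> {0<..} \<times> UNIV \<Longrightarrow> dist q (t, x) < d2 \<Longrightarrow> dist (case q of (s, y) \<Rightarrow> f21 s y) (f21 t x) < e"
    using bspec[OF c21[unfolded continuous_on_iff] p, rule_format, OF e] by auto
  define h where "h = min d1 d2 / 2"
  have h: "h > 0" using d1 d2 by (simp add: h_def)
  have near: "dist (s, y) (t, x) < min d1 d2" if "t < s" "s < t + h" "x < y" "y < x + h" for s y
  proof -
    have "dist (s, y) (t, x) \<le> \<bar>s - t\<bar> + \<bar>y - x\<bar>"
      unfolding dist_Pair_Pair dist_real_def using sqrt_sum_squares_le_sum_abs[of "\<bar>s - t\<bar>" "\<bar>y - x\<bar>"] by simp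
    also have "\<dots> < 2 * h" using that by linarith
    finally show ?thesis by (simp add: h_def)
  qed
  let ?D = "f (t + h) (x + h) - f (t + h) x - (f t (x + h) - f t x)"
  obtain s where s: "t < s" "s < t + h" "?D = (t + h - t) * (f1 s (x + h) - f1 s x)"
  proof -
    have "((\<lambda>s. f s (x + h) - f s x) has_real_derivative f1 s (x + h) - f1 s x) (at s)" if "t \<le> s" for s
      using that t by (intro DERIV_diff f1) auto
    then show thesis using MVT2[of t "t + h" "\<lambda>s. f s (x + h) - f s x" "\<lambda>s. f1 s (x + h) - f1 s x"] h that by auto
  qed
  obtain y where y: "x < y" "y < x + h" "f1 s (x + h) - f1 s x = (x + h - x) * f12 s y"
    using MVT2[OF _ f12, of x "x + h" s] h s(1) t by auto
  obtain y' where y': "x < y'" "y' < x + h"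
    "f (t + h) (x + h) - f t (x + h) - (f (t + h) x - f t x) = (x + h - x) * (f2 (t + h) y' - f2 t y')"
  proof -
    have "((\<lambda>y. f (t + h) y - f t y) has_real_derivative f2 (t + h) y - f2 t y) (at y)" for y
      using h t by (intro DERIV_diff f2) auto
    then show thesis using MVT2[of x "x + h" "\<lambda>y. f (t + h) y - f t y" "\<lambda>y. f2 (t + h) y - f2 t y"] h that by auto
  qed
  obtain s' where s': "t < s'" "s' < t + h" "f2 (t + h) y' - f2 t y' = (t + h - t) * f21 s' y'"
    using MVT2[OF _ f21, of t "t + h" y'] h t by auto
  have "h * (h * f12 s y) = h * (h * f21 s' y')" using s(3) y(3) y'(3) s'(3) by (simp add: algebra_simps)
  then have eq: "f12 s y = f21 s' y'" using h by simp
  have "dist (f12 s y) (f12 t x) < e" using d1(2)[of "(s, y)"] near[OF s(1,2) y(1,2)] s t by simp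
  moreover have "dist (f21 s' y') (f21 t x) < e" using d2(2)[of "(s', y')"] near[OF s'(1,2) y'(1,2)] s' t by simp
  ultimately have "dist (f12 t x) (f21 t x) < e + e"
    unfolding eq by (intro dist_triangle_less_add[of "f12 t x" "f21 s' y'"]) (simp_all add: dist_commute)
  then show False by (simp add: e_def)
qed

lemma C_k_on_Suc_partials:
  fixes F :: "real \<times> real \<Rightarrow> real"
  assumes "C_k_on (Suc k) F ({0<..} \<times> UNIV)"
  obtains g1 g2 where "C_k_on k g1 ({0<..} \<times> UNIV)" "C_k_on k g2 ({0<..} \<times> UNIV)"
    "\<And>t x. t > 0 \<Longrightarrow> ((\<lambda>s. F (s, x)) has_real_derivative g1 (t, x)) (at t)"
    "\<And>t x. t > 0 \<Longrightarrow> ((\<lambda>y. F (t, y)) has_real_derivative g2 (t, x)) (at x)"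
proof -
  have dir: "\<exists>g. (\<forall>p\<in>{0<..} \<times> UNIV. ((\<lambda>h. F (p + h *\<^sub>R v)) has_vector_derivative g p) (at 0))
      \<and> C_k_on k g ({0<..} \<times> UNIV)" for v
    using assms unfolding C_k_on.simps by (elim conjE allE)
  obtain g1 where g1: "\<forall>p\<in>{0<..} \<times> UNIV. ((\<lambda>h. F (p + h *\<^sub>R (1, 0))) has_vector_derivative g1 p) (at 0)"
    "C_k_on k g1 ({0<..} \<times> UNIV)" using dir by blast
  obtain g2 where g2: "\<forall>p\<in>{0<..} \<times> UNIV. ((\<lambda>h. F (p + h *\<^sub>R (0, 1))) has_vector_derivative g2 p) (at 0)"
    "C_k_on k g2 ({0<..} \<times> UNIV)" using dir by blast
  show thesis
  proof (rule that[OF g1(2) g2(2)])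
    fix t x :: real assume t: "t > 0"
    have "((\<lambda>h. F (t + h, x)) has_real_derivative g1 (t, x)) (at 0)"
      using bspec[OF g1(1), of "(t, x)"] t by (simp add: has_real_derivative_iff_has_vector_derivative)
    then show "((\<lambda>s. F (s, x)) has_real_derivative g1 (t, x)) (at t)"
      using DERIV_shift[of "\<lambda>s. F (s, x)" "g1 (t, x)" 0 t] by (simp add: add.commute)
    have "((\<lambda>h. F (t, x + h)) has_real_derivative g2 (t, x)) (at 0)"
      using bspec[OF g2(1), of "(t, x)"] t by (simp add: has_real_derivative_iff_has_vector_derivative)
    then show "((\<lambda>y. F (t, y)) has_real_derivative g2 (t, x)) (at x)"
      using DERIV_shift[of "\<lambda>y. F (t, y)" "g2 (t, x)" 0 x] by (simp add: add.commute)
  qed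
qed

text \<open>\<open>dt\<close> and \<open>dx\<close> are identified with the derivatives supplied by
  \<open>C_k_on\<close> for positive times only, so a further time derivative has to be transferred
  on the open half line.\<close>

lemma has_real_derivative_cong_pos:
  assumes "(f has_real_derivative D) (at t)" "t > 0" "\<And>s. s > 0 \<Longrightarrow> f s = g s"
  shows "(g has_real_derivative D) (at t)"
  by (rule has_field_derivative_transform_within_open[OF assms(1), of "{0<..}"]) (use assms in auto)

text \<open>A single \<open>m\<close> serves as both mixed derivatives. This is what makes the
  compatibility rows of the first-order system hold identically.\<close>

lemma C2_function_derivs:
  assumes "C2_function f"
  obtains m where
    "\<And>t x. t > 0 \<Longrightarrow> ((\<lambda>s. f s x) has_real_derivative dt f t x) (at t)"
    "\<And>t x. t > 0 \<Longrightarrow> ((\<lambda>y. f t y) has_real_derivative dx f t x) (at x)"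
    "\<And>t x. t > 0 \<Longrightarrow> ((\<lambda>s. dt f s x) has_real_derivative dt (dt f) t x) (at t)"
    "\<And>t x. t > 0 \<Longrightarrow> ((\<lambda>y. dt f t y) has_real_derivative m t x) (at x)"
    "\<And>t x. t > 0 \<Longrightarrow> ((\<lambda>s. dx f s x) has_real_derivative m t x) (at t)"
    "\<And>t x. t > 0 \<Longrightarrow> ((\<lambda>y. dx f t y) has_real_derivative dx (dx f) t x) (at x)"
proof -
  have C: "C_k_on (Suc (Suc 0)) (\<lambda>(t, x). f t x) ({0<..} \<times> UNIV)"
    using assms by (simp add: C2_function_def numeral_2_eq_2)
  obtain g1 g2 where g: "C_k_on (Suc 0) g1 ({0<..} \<times> UNIV)" "C_k_on (Suc 0) g2 ({0<..} \<times> UNIV)"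
    and f1: "\<And>t x. t > 0 \<Longrightarrow> ((\<lambda>s. f s x) has_real_derivative g1 (t, x)) (at t)"
    and f2: "\<And>t x. t > 0 \<Longrightarrow> ((\<lambda>y. f t y) has_real_derivative g2 (t, x)) (at x)"
    by (rule C_k_on_Suc_partials[OF C]) auto
  obtain g11 g12 where c12: "C_k_on 0 g12 ({0<..} \<times> UNIV)"
    and g11: "\<And>t x. t > 0 \<Longrightarrow> ((\<lambda>s. g1 (s, x)) has_real_derivative g11 (t, x)) (at t)"
    and g12: "\<And>t x. t > 0 \<Longrightarrow> ((\<lambda>y. g1 (t, y)) has_real_derivative g12 (t, x)) (at x)"
    by (rule C_k_on_Suc_partials[OF g(1)]) (rule that)
  obtain g21 g22 where c21: "C_k_on 0 g21 ({0<..} \<times> UNIV)"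
    and g21: "\<And>t x. t > 0 \<Longrightarrow> ((\<lambda>s. g2 (s, x)) has_real_derivative g21 (t, x)) (at t)"
    and g22: "\<And>t x. t > 0 \<Longrightarrow> ((\<lambda>y. g2 (t, y)) has_real_derivative g22 (t, x)) (at x)"
    by (rule C_k_on_Suc_partials[OF g(2)]) (rule that)
  have mixed: "g12 (t, x) = g21 (t, x)" if "t > 0" for t x
    by (rule mixed_partials_eq[where ?f = f and ?f1.0 = "\<lambda>t x. g1 (t, x)" and ?f2.0 = "\<lambda>t x. g2 (t, x)"
          and ?f12.0 = "\<lambda>t x. g12 (t, x)" and ?f21.0 = "\<lambda>t x. g21 (t, x)"])
      (use f1 f2 g12 g21 c12 c21 that in auto)
  have dtf: "dt f t x = g1 (t, x)" and dxf: "dx f t x = g2 (t, x)" if "t > 0" for t x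
    using f1[OF that] f2[OF that] by (auto simp: dt_def dx_def intro: DERIV_imp_deriv)
  have dtt: "((\<lambda>s. dt f s x) has_real_derivative g11 (t, x)) (at t)" if "t > 0" for t x
    by (rule has_real_derivative_cong_pos[OF g11[OF that] that]) (simp add: dtf)
  have dxx: "((\<lambda>y. dx f t y) has_real_derivative g22 (t, x)) (at x)" if "t > 0" for t x
    using g22[OF that] by (simp add: dxf[OF that])
  show thesis
  proof (rule that[of "\<lambda>t x. g12 (t, x)"])
    fix t x :: real assume t: "t > 0"
    show "((\<lambda>s. f s x) has_real_derivative dt f t x) (at t)" using f1 t by (simp add: dtf)
    show "((\<lambda>y. f t y) has_real_derivative dx f t x) (at x)" using f2 t by (simp add: dxf)
    show "((\<lambda>s. dt f s x) has_real_derivative dt (dt f) t x) (at t)"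
      using dtt[OF t, of x] by (simp add: dt_def[of "dt f"] DERIV_imp_deriv)
    show "((\<lambda>y. dt f t y) has_real_derivative g12 (t, x)) (at x)" using g12[OF t] by (simp add: dtf[OF t])
    show "((\<lambda>s. dx f s x) has_real_derivative g12 (t, x)) (at t)"
      unfolding mixed[OF t] by (rule has_real_derivative_cong_pos[OF g21[OF t] t]) (simp add: dxf)
    show "((\<lambda>y. dx f t y) has_real_derivative dx (dx f) t x) (at x)"
      using dxx[OF t, of x] by (simp add: dx_def[of "dx f"] DERIV_imp_deriv)
  qed
qed

lemma has_vector_derivative_vector_4:
  assumes "(f1 has_real_derivative d1) (at t)" "(f2 has_real_derivative d2) (at t)"
    "(f3 has_real_derivative d3) (at t)" "(f4 has_real_derivative d4) (at t)"
  shows "((\<lambda>s. vector [f1 s, f2 s, f3 s, f4 s] :: real^4) has_vector_derivative vector [d1, d2, d3, d4]) (at t)"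
proof -
  have v: "(vector [a, b, c, d] :: real^4) = a *\<^sub>R axis 1 1 + b *\<^sub>R axis 2 1 + c *\<^sub>R axis 3 1 + d *\<^sub>R axis 4 1"
    for a b c d :: real
    unfolding vec_eq_iff forall_4 by (simp add: axis_def)
  show ?thesis
    unfolding v using assms by (auto intro!: derivative_eq_intros)
qed

text \<open>The first and third rows of the system only say that mixed derivatives commute, and so
  hold for every pair of C2 functions; the second and fourth rows are the two Timoshenko
  equations.\<close>

lemma timoshenko_iff_classical_solution:
  assumes w: "C2_function w" and \<psi>: "C2_function \<psi>"
  shows "timoshenko a \<gamma> w \<psi> \<longleftrightarrow> classical_solution timo_A0 (timo_A a) (timo_L \<gamma>) (timo_u a w \<psi>)"
proof -
  obtain m where w: 
    "\<And>t x. t > 0 \<Longrightarrow> ((\<lambda>s. dt w s x) has_real_derivative dt (dt w) t x) (at t)"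
    "\<And>t x. t > 0 \<Longrightarrow> ((\<lambda>y. dt w t y) has_real_derivative m t x) (at x)"
    "\<And>t x. t > 0 \<Longrightarrow> ((\<lambda>s. dx w s x) has_real_derivative m t x) (at t)"
    "\<And>t x. t > 0 \<Longrightarrow> ((\<lambda>y. dx w t y) has_real_derivative dx (dx w) t x) (at x)"
    by (rule C2_function_derivs[OF w], rule that)
  obtain n where \<psi>: 
    "\<And>t x. t > 0 \<Longrightarrow> ((\<lambda>s. \<psi> s x) has_real_derivative dt \<psi> t x) (at t)"
    "\<And>t x. t > 0 \<Longrightarrow> ((\<lambda>y. \<psi> t y) has_real_derivative dx \<psi> t x) (at x)"
    "\<And>t x. t > 0 \<Longrightarrow> ((\<lambda>s. dt \<psi> s x) has_real_derivative dt (dt \<psi>) t x) (at t)"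
    "\<And>t x. t > 0 \<Longrightarrow> ((\<lambda>y. dt \<psi> t y) has_real_derivative n t x) (at x)"
    "\<And>t x. t > 0 \<Longrightarrow> ((\<lambda>s. dx \<psi> s x) has_real_derivative n t x) (at t)"
    "\<And>t x. t > 0 \<Longrightarrow> ((\<lambda>y. dx \<psi> t y) has_real_derivative dx (dx \<psi>) t x) (at x)"
    by (rule C2_function_derivs[OF \<psi>], rule that)
  have "(dt (dt w) t x - dx (\<lambda>t x. dx w t x - \<psi> t x) t x = 0 \<and>
      dt (dt \<psi>) t x - a\<^sup>2 * dx (dx \<psi>) t x - (dx w t x - \<psi> t x) + \<gamma> * dt \<psi> t x = 0) \<longleftrightarrow>
    (\<exists>ut ux. ((\<lambda>s. timo_u a w \<psi> s x) has_vector_derivative ut) (at t) \<and>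
      ((\<lambda>y. timo_u a w \<psi> t y) has_vector_derivative ux) (at x) \<and>
      timo_A0 *v ut + timo_A a *v ux + timo_L \<gamma> *v timo_u a w \<psi> t x = 0)"
    (is "?T \<longleftrightarrow> (\<exists>ut ux. ?P ut \<and> ?Q ux \<and> ?R ut ux)") if t: "t > 0" for t x
  proof -
    define Ut Ux :: "real^4"
      where "Ut = vector [m t x - dt \<psi> t x, dt (dt w) t x, a * n t x, dt (dt \<psi>) t x]"
        and "Ux = vector [dx (dx w) t x - dx \<psi> t x, m t x, a * dx (dx \<psi>) t x, n t x]"
    have Ut: "?P Ut" unfolding timo_u_def Ut_def
      by (intro has_vector_derivative_vector_4 DERIV_diff DERIV_cmult w \<psi> t)
    have Ux: "?Q Ux" unfolding timo_u_def Ux_def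
      by (intro has_vector_derivative_vector_4 DERIV_diff DERIV_cmult w \<psi> t)
    \<comment> \<open>Derivatives are unique, so the existential quantifiers collapse to the
      explicit vectors \<open>Ut\<close> and \<open>Ux\<close>.\<close>
    have "(\<exists>ut ux. ?P ut \<and> ?Q ux \<and> ?R ut ux) \<longleftrightarrow> ?R Ut Ux"
    proof
      assume "\<exists>ut ux. ?P ut \<and> ?Q ux \<and> ?R ut ux"
      then obtain ut ux where P: "?P ut" and Q: "?Q ux" and R: "?R ut ux" by (elim exE conjE)
      have "ut = Ut" "ux = Ux" by (rule vector_derivative_unique_at[OF P Ut] vector_derivative_unique_at[OF Q Ux])+
      with R show "?R Ut Ux" by (simp only:)
    next
      assume "?R Ut Ux"
      with Ut Ux show "\<exists>ut ux. ?P ut \<and> ?Q ux \<and> ?R ut ux" by (intro exI conjI)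
    qed
    also have "\<dots> \<longleftrightarrow> ?T"
    proof -
      have dxd: "dx (\<lambda>t x. dx w t x - \<psi> t x) t x = dx (dx w) t x - dx \<psi> t x"
        unfolding dx_def[of "\<lambda>t x. dx w t x - \<psi> t x"] by (intro DERIV_imp_deriv DERIV_diff w \<psi> t)
      show ?thesis
        unfolding vec_eq_iff forall_4 dxd
        by (auto simp: matrix_vector_mult_def sum_4 timo_A_nth timo_L_nth timo_A0_def mat_def
            timo_u_def Ut_def Ux_def power2_eq_square algebra_simps)
    qed
    finally show ?thesis by simp
  qed
  then show ?thesis unfolding timoshenko_def classical_solution_def by simp
qed

theorem theorem6p1:
  fixes a \<gamma> :: real
  assumes "a > 0" and "\<gamma> > 0"
  shows
    "(\<forall>w \<psi>. C2_function w \<longrightarrow> C2_function \<psi> \<longrightarrow>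
        (timoshenko a \<gamma> w \<psi> \<longleftrightarrow>
         classical_solution timo_A0 (timo_A a) (timo_L \<gamma>) (timo_u a w \<psi>)))
    \<and>
    (condition_A timo_A0 (\<lambda>_::1. timo_A a) (timo_L \<gamma>) \<and>
     (\<exists>S. condition_S timo_A0 (timo_L \<gamma>) S \<and>
          condition_S1 (\<lambda>_::1. timo_A a) (timo_L \<gamma>) S) \<and>
     condition_K timo_A0 (\<lambda>_::1. timo_A a) (timo_L \<gamma>) \<and>
     (\<exists>C c. C > 0 \<and> c > 0 \<and> pointwise_estimate a \<gamma> eta C c) \<and>
     (\<forall>s. \<exists>C>0. \<forall>u0 u.
        timo_solution a \<gamma> u0 u \<longrightarrow> Sobolev s u0 \<longrightarrow> integrable lborel u0 \<longrightarrow>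
        (\<forall>t\<ge>0. Sobolev s (u t) \<and>
          (\<forall>k l. k + l \<le> s \<longrightarrow>
            L2_norm (weak_deriv k (u t))
              \<le> C * (1 + t) powr (- 1 / 4 - real k / 2) * L1_norm u0
                + C * (1 + t) powr (- real l / 2) * L2_norm (weak_deriv (k + l) u0)))))
    \<and>
    (a = 1 \<longrightarrow>
     condition_A timo_A0 (\<lambda>_::1. timo_A a) (timo_L \<gamma>) \<and>
     (\<exists>S. condition_S timo_A0 (timo_L \<gamma>) S \<and> condition_S2 (\<lambda>_::1. timo_A a) S) \<and>
     condition_K timo_A0 (\<lambda>_::1. timo_A a) (timo_L \<gamma>) \<and>
     (\<exists>c>0. (\<exists>C>0. pointwise_estimate a \<gamma> rho C c) \<and>
       (\<forall>s. \<exists>C>0. \<forall>u0 u.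
          timo_solution a \<gamma> u0 u \<longrightarrow> Sobolev s u0 \<longrightarrow> integrable lborel u0 \<longrightarrow>
          (\<forall>t\<ge>0. Sobolev s (u t) \<and>
            (\<forall>k\<le>s.
              L2_norm (weak_deriv k (u t))
                \<le> C * (1 + t) powr (- 1 / 4 - real k / 2) * L1_norm u0
                  + C * exp (- c * t) * L2_norm (weak_deriv k u0))))))"
proof (intro conjI impI)
  have K: "condition_K timo_A0 (\<lambda>_::1. timo_A a) (timo_L \<gamma>)" by (rule timo_condition_K[OF assms(1)])
  have A: "condition_A timo_A0 (\<lambda>_::1. timo_A a) (timo_L \<gamma>)" by (rule timo_condition_A[OF assms(2)])
  have S: "condition_S timo_A0 (timo_L \<gamma>) (timo_S a \<gamma>)" by (rule timo_condition_S[OF assms(2)])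
  show "condition_A timo_A0 (\<lambda>_::1. timo_A a) (timo_L \<gamma>)"
    "condition_K timo_A0 (\<lambda>_::1. timo_A a) (timo_L \<gamma>)"
    "condition_A timo_A0 (\<lambda>_::1. timo_A a) (timo_L \<gamma>)"
    "condition_K timo_A0 (\<lambda>_::1. timo_A a) (timo_L \<gamma>)"
    by (rule A K)+
  show "\<forall>w \<psi>. C2_function w \<longrightarrow> C2_function \<psi> \<longrightarrow>
        (timoshenko a \<gamma> w \<psi> \<longleftrightarrow> classical_solution timo_A0 (timo_A a) (timo_L \<gamma>) (timo_u a w \<psi>))"
    by (intro allI impI timoshenko_iff_classical_solution)
  show "\<exists>S. condition_S timo_A0 (timo_L \<gamma>) S \<and> condition_S1 (\<lambda>_::1. timo_A a) (timo_L \<gamma>) S"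
    by (rule exI, rule conjI[OF S timo_condition_S1[OF assms(2)]])
  show "\<exists>C c. C > 0 \<and> c > 0 \<and> pointwise_estimate a \<gamma> eta C c"
  proof (rule timo_pointwise_eta[OF assms])
    fix C c :: real
    assume "C > 0" "c > 0" and AE: "\<And>u0 u t. timo_solution a \<gamma> u0 u \<Longrightarrow> t \<ge> 0 \<Longrightarrow>
      AE \<xi> in lborel. norm (fourier_L2 (u t) \<xi>) \<le> C * exp (- c * eta \<xi> * t) * norm (fourier_L2 u0 \<xi>)"
    have "pointwise_estimate a \<gamma> eta C c" by (rule pointwise_estimateI[OF _ eta_continuous]) (rule AE)
    then show ?thesis using \<open>C > 0\<close> \<open>c > 0\<close> by (intro exI conjI)
  qed
  show "\<forall>s. \<exists>C>0. \<forall>u0 u.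
        timo_solution a \<gamma> u0 u \<longrightarrow> Sobolev s u0 \<longrightarrow> integrable lborel u0 \<longrightarrow>
        (\<forall>t\<ge>0. Sobolev s (u t) \<and>
          (\<forall>k l. k + l \<le> s \<longrightarrow>
            L2_norm (weak_deriv k (u t))
              \<le> C * (1 + t) powr (- 1 / 4 - real k / 2) * L1_norm u0
                + C * (1 + t) powr (- real l / 2) * L2_norm (weak_deriv (k + l) u0)))"
    by (intro allI timo_decay_eta assms)
  assume a: "a = 1"
  show "\<exists>S. condition_S timo_A0 (timo_L \<gamma>) S \<and> condition_S2 (\<lambda>_::1. timo_A a) S"
    by (rule exI, rule conjI[OF S timo_condition_S2[OF a]])
  show "\<exists>c>0. (\<exists>C>0. pointwise_estimate a \<gamma> rho C c) \<and>
       (\<forall>s. \<exists>C>0. \<forall>u0 u.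
          timo_solution a \<gamma> u0 u \<longrightarrow> Sobolev s u0 \<longrightarrow> integrable lborel u0 \<longrightarrow>
          (\<forall>t\<ge>0. Sobolev s (u t) \<and>
            (\<forall>k\<le>s.
              L2_norm (weak_deriv k (u t))
                \<le> C * (1 + t) powr (- 1 / 4 - real k / 2) * L1_norm u0
                  + C * exp (- c * t) * L2_norm (weak_deriv k u0))))"
    by (rule timo_decay_rho[OF a assms(2)])
qed

end
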